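(* Let $X=V(F,G)$ be a curve in standard form over $\mathbb{F}_3$ with $a$-number $3$. Then $X$ has no Type $2$ Cartier points, and: (1) if $F=F_d=2yw+z^2$, then $X$ has exactly one Type $1$ Cartier point, of multiplicity $6$; (2) if $F=F_1=2xw+2yz$, then $X$ has exactly two Type $1$ Cartier points, of multiplicity $3$, each defined over $\mathbb{F}_3$; (3) if $F=F_2=2xw+y^2+z^2$, then $X$ has exactly two Type $1$ Cartier points, of multiplicity $3$, each defined over $\mathbb{F}_9$.
   Context: Let $k=\mathbb{F}_3$, $p=3$, and let $\epsilon=2=-1$ be the non-square in $k^\times$. Put $F_1=2xw+2yz$, $F_2=2xw+y^2-\epsilon z^2=2xw+y^2+z^2$, $F_d=2yw+z^2$ in $k[x,y,z,w]$; $V(F,G)\subset\mathbb{P}^3_k$ denotes the common zero locus. Below, $k^\times/(k^\times)^2$ stands for a fixed set of representatives of the square classes. A curve $X$ of genus $4$ over $k$ is in standard form if it is non-hyperelliptic, irreducible, smooth, and $X=V(F,G)$ with one of the following. (Case D) $F=F_d$ and $G=a_0x^3+(a_1y^2+a_2z^2+a_3w^2+a_4yz+a_5zw)x+a_6y^3+a_7z^3+a_8w^3+a_9yz^2+b_1z^2w+b_2zw^2$, with $a_i\in k$, $a_0,a_6\in k^\times$, $b_1,b_2\in\{0,1\}$, and $r=a_1y^2+a_2z^2+a_3w^2+a_4yz+a_5zw$ is either $0$ or has leading coefficient $1$ (graded lexicographic order with $x>y>z>w$). (Case N1i) $F=F_1$ and $G=(a_1y+a_2z)x^2+a_3yzx+y^3+a_4z^3+b_1y^2z+a_5yz^2+(a_6y^2+a_7yz+b_2z^2)w+(a_8y+a_9z)w^2+a_{10}w^3$,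 with $a_i\in k$, $a_1\ne0$, $a_2\neq 0$, $b_1\in\{0\}\cup k^\times/(k^\times)^2$, $b_2\in\{0,1\}$. (Case N1ii) $F=F_1$ and $G=(a_1y+a_2z)x^2+a_3yzx+b_1y^2z+b_2yz^2+(a_4y^2+a_5yz+b_3z^2)w+(a_6y+a_7z)w^2+a_8w^3$, with $a_i\in k$, $a_1a_2\neq0$, $b_1,b_3\in\{0,1\}$, $b_2\in\{0\}\cup k^\times/(k^\times)^2$. (Case N2) $F=F_2$ and $G=(a_1y+a_2z)x^2+a_3(y^2-\epsilon z^2)x+b_1y(y^2-\epsilon z^2)+a_4y(y^2+3\epsilon z^2)+a_5z(3y^2+\epsilon z^2)+(a_6y^2+a_7yz+b_2z^2)w+(a_8y+a_9z)w^2+a_{10}w^3$, with $a_i\in k$, $(a_1,a_2)\ne(0,0)$, $b_1,b_2\in\{0,1\}$. The embedding $X\subset\mathbb{P}^3$ is the canonical one, so $x,y,z,w$ correspond to a basis of $H^0(X,\Omega_X^1)$; let $\{\xi_1,\dots,\xi_4\}$ be the dual basis of $H^1(X,\mathcal{O}_X)$. The Hasse--Witt matrix $H=(a_{ij})$ is given by $\mathcal{F}_X(\xi_j)=\sum_i a_{ij}\xi_i$, with $\mathcal{F}_X$ the $p$-linear map induced by the absolute Frobenius. The $a$-number is $4-\operatorname{rank}(H)$. A point $P\in X(\overline{k})$ is a Cartier point if the hyperplane of regular differentials (over $\overline{k}$) vanishing at $P$ is stable under the Cartier operator; equivalently, with $\mathbf{v}_P$ the column vector of homogeneous coordinates of $P$,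 $H\mathbf{v}_P^{(p)}=c\mathbf{v}_P$ for some $c\in\overline{k}$, where $(p)$ means raising entries to the $p$-th power. It is of Type $1$ if $c=0$ and of Type $2$ otherwise. When $a=3$, the Type $1$ points are the points of $X\cap S$, where $S\subset\mathbb{P}^3$ is the plane defined by the kernel of $H^{(1/p)}$ (entrywise $p$-th roots; equal to $H$ over $\mathbb{F}_p$), and the multiplicity of a Type $1$ point is its intersection multiplicity in $X\cap S$ (these multiplicities sum to $6$). *)

theory Defs
  imports
    "HOL-Analysis.Analysis"
    "HOL-Library.Poly_Mapping"
    "HOL-Computational_Algebra.Polynomial"
    "HOL-Computational_Algebra.Fraction_Field"
    "HOL-Algebra.Algebraic_Closure_Type"
begin

section \<open>Polynomials in four variables\<close>

text \<open>
  The index type 4 has the elements 0, 1, 2, 3, and the variables are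
  x = X_0, y = X_1, z = X_2, w = X_3.
\<close>

type_synonym 'a poly4 = "(4 \<Rightarrow>\<^sub>0 nat) \<Rightarrow>\<^sub>0 'a"
type_synonym 'a laurent4 = "(4 \<Rightarrow>\<^sub>0 int) \<Rightarrow>\<^sub>0 'a"

definition cst :: "'a::field \<Rightarrow> 'a poly4" where
  "cst c = Poly_Mapping.single 0 c"

definition var :: "4 \<Rightarrow> 'a::field poly4" where
  "var i = Poly_Mapping.single (Poly_Mapping.single i 1) 1"

abbreviation vx :: "'a::field poly4" where "vx \<equiv> var 0"
abbreviation vy :: "'a::field poly4" where "vy \<equiv> var 1"
abbreviation vz :: "'a::field poly4" where "vz \<equiv> var 2"
abbreviation vw :: "'a::field poly4" where "vw \<equiv> var 3"

definition eval4 :: "'a::field ^ 4 \<Rightarrow> 'a poly4 \<Rightarrow> 'a" where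
  "eval4 v A = (\<Sum>m\<in>Poly_Mapping.keys A.
     Poly_Mapping.lookup A m * (\<Prod>i\<in>UNIV. (v $ i) ^ Poly_Mapping.lookup m i))"

definition mdeg :: "(4 \<Rightarrow>\<^sub>0 'n::comm_monoid_add) \<Rightarrow> 'n" where
  "mdeg m = (\<Sum>i\<in>UNIV. Poly_Mapping.lookup m i)"

definition homog :: "nat \<Rightarrow> 'a::field poly4 \<Rightarrow> bool" where
  "homog d A \<longleftrightarrow> (\<forall>m\<in>Poly_Mapping.keys A. mdeg m = d)"

definition partial_deriv :: "4 \<Rightarrow> 'a::field poly4 \<Rightarrow> 'a poly4" where
  "partial_deriv i A = (\<Sum>m\<in>Poly_Mapping.keys A.
     Poly_Mapping.single (m - Poly_Mapping.single i 1)
       (of_nat (Poly_Mapping.lookup m i) * Poly_Mapping.lookup A m))"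

definition base_change :: "'k::field poly4 \<Rightarrow> 'k alg_closure poly4" where
  "base_change A = Poly_Mapping.map to_ac A"

definition to_laurent :: "'a::field poly4 \<Rightarrow> 'a laurent4" where
  "to_laurent A = (\<Sum>m\<in>Poly_Mapping.keys A.
     Poly_Mapping.single (Poly_Mapping.map int m) (Poly_Mapping.lookup A m))"

text \<open>
  The order of the type of exponents compares at the smallest index where the exponents
  differ, so it is the lexicographic order with x > y > z > w.
\<close>

definition grlex_less :: "(4 \<Rightarrow>\<^sub>0 nat) \<Rightarrow> (4 \<Rightarrow>\<^sub>0 nat) \<Rightarrow> bool" where
  "grlex_less m n \<longleftrightarrow> mdeg m < mdeg n \<or> mdeg m = mdeg n \<and> m < n"

definition has_leading_coeff :: "'a::field poly4 \<Rightarrow> 'a \<Rightarrow> bool" where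
  "has_leading_coeff A c \<longleftrightarrow>
     (\<exists>m\<in>Poly_Mapping.keys A. (\<forall>n\<in>Poly_Mapping.keys A. n \<noteq> m \<longrightarrow> grlex_less n m) \<and>
        Poly_Mapping.lookup A m = c)"

text \<open>
  The quotient of \<open>V\<close> by \<open>W\<close> has dimension \<open>n\<close> over the field \<open>C\<close> that acts through \<open>sc\<close>.
\<close>

definition has_quot_dim ::
  "'c set \<Rightarrow> ('c \<Rightarrow> 'v \<Rightarrow> 'v) \<Rightarrow> 'v::ab_group_add set \<Rightarrow> 'v set \<Rightarrow> nat \<Rightarrow> bool" where
  "has_quot_dim C sc V W n \<longleftrightarrow>
     (\<exists>b. (\<forall>i<n. b i \<in> V) \<and>
        (\<forall>v\<in>V. \<exists>!c. c \<in> {..<n} \<rightarrow>\<^sub>E C \<and> v - (\<Sum>i<n. sc (c i) (b i)) \<in> W))"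


section \<open>The locus of geometric points\<close>

text \<open>
  Subsets of projective space are represented by their cones without the origin; a point is
  the set of its homogeneous coordinate vectors.
\<close>

definition zero_locus :: "'a::field poly4 set \<Rightarrow> ('a ^ 4) set" where
  "zero_locus T = {v. v \<noteq> 0 \<and> (\<forall>A\<in>T. eval4 v A = 0)}"

definition proj_closed :: "('a::field ^ 4) set \<Rightarrow> bool" where
  "proj_closed Z \<longleftrightarrow> (\<exists>T. (\<forall>A\<in>T. \<exists>d. homog d A) \<and> Z = zero_locus T)"

definition proj_point :: "'a::field ^ 4 \<Rightarrow> ('a ^ 4) set" where
  "proj_point v = {c *s v | c. c \<noteq> 0}"

text \<open>For a subfield with \<open>q\<close> elements of an algebraically closed field.\<close>

definition defined_over :: "nat \<Rightarrow> ('a::field ^ 4) set \<Rightarrow> bool" where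
  "defined_over q P \<longleftrightarrow> (\<exists>v\<in>P. \<forall>i. (v $ i) ^ q = v $ i)"

definition geom_locus :: "'k::field poly4 \<Rightarrow> 'k poly4 \<Rightarrow> ('k alg_closure ^ 4) set" where
  "geom_locus F G = zero_locus {base_change F, base_change G}"

definition irreducible_curve :: "'k::field poly4 \<Rightarrow> 'k poly4 \<Rightarrow> bool" where
  "irreducible_curve F G \<longleftrightarrow> geom_locus F G \<noteq> {} \<and>
     (\<forall>Z1 Z2. proj_closed Z1 \<longrightarrow> proj_closed Z2 \<longrightarrow> geom_locus F G = Z1 \<union> Z2 \<longrightarrow>
        geom_locus F G = Z1 \<or> geom_locus F G = Z2)"

definition gradient :: "'a::field poly4 \<Rightarrow> 'a ^ 4 \<Rightarrow> 'a ^ 4" where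
  "gradient A v = (\<chi> i. eval4 v (partial_deriv i A))"

definition smooth_curve :: "'k::field poly4 \<Rightarrow> 'k poly4 \<Rightarrow> bool" where
  "smooth_curve F G \<longleftrightarrow> (\<forall>v\<in>geom_locus F G.
     rank (vector [gradient (base_change F) v, gradient (base_change G) v]
       :: 'k alg_closure ^ 4 ^ 2) = 2)"

text \<open>Fractions of homogeneous polynomials of the same degree.\<close>

definition deg0_fractions :: "'a::field poly4 set \<Rightarrow> 'a poly4 set \<Rightarrow> 'a poly4 fract set" where
  "deg0_fractions N D = {Fract A B | A B d. homog d A \<and> homog d B \<and> A \<in> N \<and> B \<in> D}"

definition fract_cst :: "'a::field \<Rightarrow> 'a poly4 fract" where
  "fract_cst c = Fract (cst c) 1"

definition vanishing_ideal :: "('a::field ^ 4) set \<Rightarrow> 'a poly4 set" where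
  "vanishing_ideal Z = {A. \<forall>v\<in>Z. eval4 v A = 0}"

text \<open>
  The function field of an irreducible curve \<open>X\<close> over the algebraic closure \<open>K\<close> is the residue
  field of the local ring at the generic point of \<open>X\<close>. The curve is hyperelliptic if it has a map
  of degree 2 to the projective line, that is, if the function field has degree 2 over \<open>K(t)\<close>
  for a nonconstant function \<open>t\<close>.
\<close>

definition generic_local_ring :: "'k::field poly4 \<Rightarrow> 'k poly4 \<Rightarrow> 'k alg_closure poly4 fract set" where
  "generic_local_ring F G = deg0_fractions UNIV (- vanishing_ideal (geom_locus F G))"

definition generic_max_ideal :: "'k::field poly4 \<Rightarrow> 'k poly4 \<Rightarrow> 'k alg_closure poly4 fract set" where
  "generic_max_ideal F G =
     deg0_fractions (vanishing_ideal (geom_locus F G)) (- vanishing_ideal (geom_locus F G))"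

definition rational_functions_in :: "'a::field poly4 fract \<Rightarrow> 'a poly4 fract set" where
  "rational_functions_in t =
     {poly (map_poly fract_cst p) t / poly (map_poly fract_cst q) t | p q. q \<noteq> 0}"

definition hyperelliptic :: "'k::field poly4 \<Rightarrow> 'k poly4 \<Rightarrow> bool" where
  "hyperelliptic F G \<longleftrightarrow>
     (\<exists>t\<in>generic_local_ring F G. (\<forall>c. t - fract_cst c \<notin> generic_max_ideal F G) \<and>
        has_quot_dim (rational_functions_in t) (*)
          (generic_local_ring F G) (generic_max_ideal F G) 2)"


section \<open>Cohomology of the structure sheaf\<close>

text \<open>
  Cech cohomology of \<open>X = V(F,G)\<close>, where F is a quadric and G a cubic, for the cover by the four
  open sets \<open>X_i \<noteq> 0\<close>. With \<open>S\<close> the polynomial ring, \<open>sections T d\<close> is the degree d part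
  of \<open>S\<close> localized at the variables in \<open>T\<close>, and \<open>ideal_sections F G T\<close> is the degree 0 part of
  the ideal that F and G generate there. Cochains are indexed by all tuples of indices
  (not only increasing ones) and stand for their classes modulo \<open>ideal_sections\<close>.
\<close>

definition sections :: "4 set \<Rightarrow> int \<Rightarrow> 'a::field laurent4 set" where
  "sections T d = {f. \<forall>m\<in>Poly_Mapping.keys f.
     mdeg m = d \<and> (\<forall>i. i \<notin> T \<longrightarrow> 0 \<le> Poly_Mapping.lookup m i)}"

definition ideal_sections :: "'a::field poly4 \<Rightarrow> 'a poly4 \<Rightarrow> 4 set \<Rightarrow> 'a laurent4 set" where
  "ideal_sections F G T = {to_laurent F * a + to_laurent G * b | a b.
     a \<in> sections T (-2) \<and> b \<in> sections T (-3)}"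

definition cocycles :: "'a::field poly4 \<Rightarrow> 'a poly4 \<Rightarrow> ('a laurent4 ^ 4 ^ 4) set" where
  "cocycles F G = {f. (\<forall>i j. f $ i $ j \<in> sections {i, j} 0) \<and>
     (\<forall>i j k. f $ j $ k - f $ i $ k + f $ i $ j \<in> ideal_sections F G {i, j, k})}"

definition coboundaries :: "'a::field poly4 \<Rightarrow> 'a poly4 \<Rightarrow> ('a laurent4 ^ 4 ^ 4) set" where
  "coboundaries F G = {f. (\<forall>i j. f $ i $ j \<in> sections {i, j} 0) \<and>
     (\<exists>h. (\<forall>i. h i \<in> sections {i} 0) \<and>
        (\<forall>i j. f $ i $ j - (h j - h i) \<in> ideal_sections F G {i, j}))}"

definition scale_cochain :: "'a::field \<Rightarrow> 'a laurent4 ^ 4 ^ 4 \<Rightarrow> 'a laurent4 ^ 4 ^ 4" where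
  "scale_cochain c f = (\<chi> i j. Poly_Mapping.single 0 c * f $ i $ j)"

definition has_genus :: "'k::field poly4 \<Rightarrow> 'k poly4 \<Rightarrow> nat \<Rightarrow> bool" where
  "has_genus F G g \<longleftrightarrow> has_quot_dim UNIV scale_cochain (cocycles F G) (coboundaries F G) g"

text \<open>
  Serre duality for the complete intersection \<open>X\<close>. The adjunction isomorphism of the canonical
  sheaf of \<open>X\<close> with \<open>O_X(1)\<close> identifies regular differentials with linear forms. The connecting
  maps of the Koszul resolution

    \<open>0 \<rightarrow> O(-5) \<rightarrow> O(-2) \<oplus> O(-3) \<rightarrow> O \<rightarrow> O_X \<rightarrow> 0\<close>,

  with maps \<open>c \<mapsto> (G c, - F c)\<close> and \<open>(a, b) \<mapsto> F a + G b\<close>, take a class in \<open>H^1(X, O_X)\<close> to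
  one in \<open>H^3(P^3, O(-5))\<close>. The product with a linear form is a class in \<open>H^3(P^3, O(-4))\<close>, and its
  trace is the coefficient of \<open>1/(xyzw)\<close>. In the definition, \<open>\<alpha>\<close>, \<open>\<beta>\<close> and \<open>\<gamma>\<close> are
  the cochains in this zig-zag.
\<close>

definition serre_pairing ::
  "'a::field poly4 \<Rightarrow> 'a poly4 \<Rightarrow> 'a poly4 \<Rightarrow> 'a laurent4 ^ 4 ^ 4 \<Rightarrow> 'a \<Rightarrow> bool" where
  "serre_pairing F G l f t \<longleftrightarrow>
     (\<exists>\<alpha> \<beta> :: 4 \<Rightarrow> 4 \<Rightarrow> 4 \<Rightarrow> 'a laurent4. \<exists>\<gamma> :: 4 \<Rightarrow> 4 \<Rightarrow> 4 \<Rightarrow> 4 \<Rightarrow> 'a laurent4.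
        (\<forall>i j k. \<alpha> i j k \<in> sections {i, j, k} (-2) \<and> \<beta> i j k \<in> sections {i, j, k} (-3) \<and>
           f $ j $ k - f $ i $ k + f $ i $ j = to_laurent F * \<alpha> i j k + to_laurent G * \<beta> i j k) \<and>
        (\<forall>h i j k. \<gamma> h i j k \<in> sections {h, i, j, k} (-5) \<and>
           \<alpha> i j k - \<alpha> h j k + \<alpha> h i k - \<alpha> h i j = to_laurent G * \<gamma> h i j k \<and>
           \<beta> i j k - \<beta> h j k + \<beta> h i k - \<beta> h i j = - (to_laurent F * \<gamma> h i j k)) \<and>
        t = Poly_Mapping.lookup (to_laurent l * \<gamma> 0 1 2 3)
              (\<Sum>i\<in>UNIV. Poly_Mapping.single i (-1)))"

definition dual_basis ::
  "'a::field poly4 \<Rightarrow> 'a poly4 \<Rightarrow> (4 \<Rightarrow> 'a laurent4 ^ 4 ^ 4) \<Rightarrow> bool" where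
  "dual_basis F G \<xi> \<longleftrightarrow> (\<forall>j. \<xi> j \<in> cocycles F G \<and>
     (\<forall>i. serre_pairing F G (var i) (\<xi> j) (if i = j then 1 else 0)))"

text \<open>In characteristic 3; the map that the absolute Frobenius induces on cochains.\<close>

definition frobenius_cochain :: "'a::field laurent4 ^ 4 ^ 4 \<Rightarrow> 'a laurent4 ^ 4 ^ 4" where
  "frobenius_cochain f = (\<chi> i j. (f $ i $ j) ^ 3)"

text \<open>
  The residue trace is normalized only up to a scalar, but over the field with 3 elements
  a common scalar factor of the dual basis does not change the matrix.
\<close>

definition is_hasse_witt_matrix :: "'k::field poly4 \<Rightarrow> 'k poly4 \<Rightarrow> 'k ^ 4 ^ 4 \<Rightarrow> bool" where
  "is_hasse_witt_matrix F G H \<longleftrightarrow> (\<exists>\<xi>. dual_basis F G \<xi> \<and>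
     (\<forall>j. frobenius_cochain (\<xi> j) - (\<Sum>i\<in>UNIV. scale_cochain (H $ i $ j) (\<xi> i))
        \<in> coboundaries F G))"

definition a_number :: "'k::field ^ 4 ^ 4 \<Rightarrow> nat" where
  "a_number H = 4 - rank H"


section \<open>Cartier points\<close>

definition cartier_eigen :: "'k::field ^ 4 ^ 4 \<Rightarrow> 'k alg_closure ^ 4 \<Rightarrow> 'k alg_closure \<Rightarrow> bool" where
  "cartier_eigen H v c \<longleftrightarrow> (\<chi> i j. to_ac (H $ i $ j)) *v (\<chi> i. (v $ i) ^ 3) = c *s v"

definition cartier_points ::
  "'k::field poly4 \<Rightarrow> 'k poly4 \<Rightarrow> 'k ^ 4 ^ 4 \<Rightarrow> ('k alg_closure ^ 4) set set" where
  "cartier_points F G H = proj_point ` {v \<in> geom_locus F G. \<exists>c. cartier_eigen H v c}"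

definition type1_points ::
  "'k::field poly4 \<Rightarrow> 'k poly4 \<Rightarrow> 'k ^ 4 ^ 4 \<Rightarrow> ('k alg_closure ^ 4) set set" where
  "type1_points F G H = {P \<in> cartier_points F G H. \<forall>v\<in>P. cartier_eigen H v 0}"

definition type2_points ::
  "'k::field poly4 \<Rightarrow> 'k poly4 \<Rightarrow> 'k ^ 4 ^ 4 \<Rightarrow> ('k alg_closure ^ 4) set set" where
  "type2_points F G H = cartier_points F G H - type1_points F G H"

text \<open>
  The multiplicity of a point P in the intersection of \<open>X\<close> with \<open>S\<close> is the dimension of the local
  ring of projective space at P modulo the ideal of this intersection. The linear forms
  \<open>kernel_form H i\<close> cut out the kernel \<open>S\<close> of \<open>H\<close>; over the field with 3 elements the entrywise cube
  root of \<open>H\<close> is \<open>H\<close> itself.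
\<close>

definition kernel_form :: "'k::field ^ 4 ^ 4 \<Rightarrow> 4 \<Rightarrow> 'k alg_closure poly4" where
  "kernel_form H i = (\<Sum>j\<in>UNIV. cst (to_ac (H $ i $ j)) * var j)"

definition section_ideal ::
  "'k::field poly4 \<Rightarrow> 'k poly4 \<Rightarrow> 'k ^ 4 ^ 4 \<Rightarrow> 'k alg_closure poly4 set" where
  "section_ideal F G H =
     {base_change F * a + base_change G * b + (\<Sum>i\<in>UNIV. kernel_form H i * l i) | a b l. True}"

definition has_multiplicity ::
  "'k::field poly4 \<Rightarrow> 'k poly4 \<Rightarrow> 'k ^ 4 ^ 4 \<Rightarrow> ('k alg_closure ^ 4) set \<Rightarrow> nat \<Rightarrow> bool" where
  "has_multiplicity F G H P n \<longleftrightarrow>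
     has_quot_dim UNIV (\<lambda>c f. fract_cst c * f)
       (deg0_fractions UNIV {B. \<forall>v\<in>P. eval4 v B \<noteq> 0})
       (deg0_fractions (section_ideal F G H) {B. \<forall>v\<in>P. eval4 v B \<noteq> 0}) n"


section \<open>Standard forms\<close>

definition eps :: "'k::field" where "eps = 2"

definition F1 :: "'k::field poly4" where "F1 = 2 * vx * vw + 2 * vy * vz"
definition F2 :: "'k::field poly4" where "F2 = 2 * vx * vw + vy^2 - cst eps * vz^2"
definition Fd :: "'k::field poly4" where "Fd = 2 * vy * vw + vz^2"

text \<open>Representatives of the square classes of the nonzero elements when there are 3 elements.\<close>

definition square_class_reps :: "'k::field set" where
  "square_class_reps = {1, eps}"

definition case_D :: "'k::field poly4 \<Rightarrow> 'k poly4 \<Rightarrow> bool" where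
  "case_D F G \<longleftrightarrow> F = Fd \<and>
     (\<exists>a0 a1 a2 a3 a4 a5 a6 a7 a8 a9 b1 b2. \<exists>r.
        a0 \<noteq> 0 \<and> a6 \<noteq> 0 \<and> b1 \<in> {0, 1} \<and> b2 \<in> {0, 1} \<and>
        r = cst a1 * vy^2 + cst a2 * vz^2 + cst a3 * vw^2 + cst a4 * vy * vz + cst a5 * vz * vw \<and>
        (r = 0 \<or> has_leading_coeff r 1) \<and>
        G = cst a0 * vx^3 + r * vx
          + cst a6 * vy^3 + cst a7 * vz^3 + cst a8 * vw^3 + cst a9 * vy * vz^2
          + cst b1 * vz^2 * vw + cst b2 * vz * vw^2)"

definition case_N1i :: "'k::field poly4 \<Rightarrow> 'k poly4 \<Rightarrow> bool" where
  "case_N1i F G \<longleftrightarrow> F = F1 \<and>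
     (\<exists>a1 a2 a3 a4 a5 a6 a7 a8 a9 a10 b1 b2.
        a1 \<noteq> 0 \<and> a2 \<noteq> 0 \<and> b1 \<in> {0} \<union> square_class_reps \<and> b2 \<in> {0, 1} \<and>
        G = (cst a1 * vy + cst a2 * vz) * vx^2 + cst a3 * vy * vz * vx
          + vy^3 + cst a4 * vz^3 + cst b1 * vy^2 * vz + cst a5 * vy * vz^2
          + (cst a6 * vy^2 + cst a7 * vy * vz + cst b2 * vz^2) * vw
          + (cst a8 * vy + cst a9 * vz) * vw^2 + cst a10 * vw^3)"

definition case_N1ii :: "'k::field poly4 \<Rightarrow> 'k poly4 \<Rightarrow> bool" where
  "case_N1ii F G \<longleftrightarrow> F = F1 \<and>
     (\<exists>a1 a2 a3 a4 a5 a6 a7 a8 b1 b2 b3.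
        a1 * a2 \<noteq> 0 \<and> b1 \<in> {0, 1} \<and> b3 \<in> {0, 1} \<and> b2 \<in> {0} \<union> square_class_reps \<and>
        G = (cst a1 * vy + cst a2 * vz) * vx^2 + cst a3 * vy * vz * vx
          + cst b1 * vy^2 * vz + cst b2 * vy * vz^2
          + (cst a4 * vy^2 + cst a5 * vy * vz + cst b3 * vz^2) * vw
          + (cst a6 * vy + cst a7 * vz) * vw^2 + cst a8 * vw^3)"

definition case_N2 :: "'k::field poly4 \<Rightarrow> 'k poly4 \<Rightarrow> bool" where
  "case_N2 F G \<longleftrightarrow> F = F2 \<and>
     (\<exists>a1 a2 a3 a4 a5 a6 a7 a8 a9 a10 b1 b2.
        (a1, a2) \<noteq> (0, 0) \<and> b1 \<in> {0, 1} \<and> b2 \<in> {0, 1} \<and>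
        G = (cst a1 * vy + cst a2 * vz) * vx^2 + cst a3 * (vy^2 - cst eps * vz^2) * vx
          + cst b1 * vy * (vy^2 - cst eps * vz^2)
          + cst a4 * vy * (vy^2 + 3 * cst eps * vz^2)
          + cst a5 * vz * (3 * vy^2 + cst eps * vz^2)
          + (cst a6 * vy^2 + cst a7 * vy * vz + cst b2 * vz^2) * vw
          + (cst a8 * vy + cst a9 * vz) * vw^2 + cst a10 * vw^3)"

definition standard_form :: "'k::field poly4 \<Rightarrow> 'k poly4 \<Rightarrow> bool" where
  "standard_form F G \<longleftrightarrow>
     has_genus F G 4 \<and> \<not> hyperelliptic F G \<and> irreducible_curve F G \<and> smooth_curve F G \<and>
     (case_D F G \<or> case_N1i F G \<or> case_N1ii F G \<or> case_N2 F G)"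

end

theory Submission
  imports Defs
begin

text \<open>
  Frobenius on \<open>H^1(X, O_X)\<close> is computed from the coefficients of \<open>(F G)^2\<close>. On the quadric surface
  \<open>F = 0\<close> with its two rulings, G becomes a form f of bidegree (3, 3); in characteristic 3 the matrix H
  has rank one exactly when \<open>f f_12 + f_1 f_2\<close> is the cube of a bilinear form times a bilinear form, where
  \<open>f_1\<close>, \<open>f_2\<close>, \<open>f_12\<close> are the derivatives along the rulings. Smoothness then forces the plane of
  the kernel to be tangent to the quadric, so that it cuts out two lines, on each of which f is the cube of a
  linear form. On the quadric cone the kernel plane is tangent along a line and all intersections collapse
  to one point. A Type 2 point would have to be the point in the image of H, which is off the curve or singular.
\<close>

text \<open>Up to sign, \<open>f f_12 + f_1 f_2\<close> is the mixed derivative of f^2 freed of the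
  factors that derivatives have in characteristic 3. Its exponents in each ruling are 3a + b with a,
  b in {0, 1}; a comes from the column index of H and b from the row index, so its 16 coefficients
  are, up to a linear change of coordinates, the entries of H, and a rank one matrix becomes a cube
  times a bilinear form. The cube is that of the kernel plane; the other factor is the polar plane
  of the image point with respect to the quadric. Two obstacles shape the proof. H is given by Cech
  cochains and an abstract dual basis, so the coefficient formula rests on the trace being
  independent of the zig-zag, and for this F and G must form a regular sequence on every open set of
  the cover. Tangency of the kernel plane is reduced to one point of the curve in that plane, moved
  to (0:1, 0:1), where the coefficient equations are solved by hand and an explicit singular point
  excludes the unwanted solutions. The intersection points come from cube roots, under which finite
  fields of characteristic 3 are closed; this gives their fields of definition.\<close>

section \<open>Forms of bidegree (3, 3) in characteristic 3\<close>

definition row :: "(nat \<Rightarrow> nat \<Rightarrow> 'a::field) \<Rightarrow> nat \<Rightarrow> 'a \<Rightarrow> 'a \<Rightarrow> 'a" where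
  "row c i u v = c i 0 * v^3 + c i 1 * v^2 * u + c i 2 * v * u^2 + c i 3 * u^3"

text \<open>In characteristic 3 the derivative of the binary cubic \<open>row c i\<close> by u is v
  times this linear form, and the derivative by v is -u times it. One linear form thus encodes both
  partial derivatives; the two cubes contribute nothing. \<open>deriv1\<close>,
  \<open>deriv2\<close> and \<open>deriv12\<close> are reduced derivatives in the same
  sense.\<close>

definition drow :: "(nat \<Rightarrow> nat \<Rightarrow> 'a::field) \<Rightarrow> nat \<Rightarrow> 'a \<Rightarrow> 'a \<Rightarrow> 'a" where
  "drow c i u v = c i 1 * v - c i 2 * u"

definition bicubic :: "(nat \<Rightarrow> nat \<Rightarrow> 'a::field) \<Rightarrow> 'a \<Rightarrow> 'a \<Rightarrow> 'a \<Rightarrow> 'a \<Rightarrow> 'a" where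
  "bicubic c s t u v = row c 0 u v * t^3 + row c 1 u v * t^2 * s + row c 2 u v * t * s^2 + row c 3 u v * s^3"

definition deriv1 :: "(nat \<Rightarrow> nat \<Rightarrow> 'a::field) \<Rightarrow> 'a \<Rightarrow> 'a \<Rightarrow> 'a \<Rightarrow> 'a \<Rightarrow> 'a" where
  "deriv1 c s t u v = row c 1 u v * t - row c 2 u v * s"

definition deriv2 :: "(nat \<Rightarrow> nat \<Rightarrow> 'a::field) \<Rightarrow> 'a \<Rightarrow> 'a \<Rightarrow> 'a \<Rightarrow> 'a \<Rightarrow> 'a" where
  "deriv2 c s t u v = drow c 0 u v * t^3 + drow c 1 u v * t^2 * s + drow c 2 u v * t * s^2 + drow c 3 u v * s^3"

definition deriv12 :: "(nat \<Rightarrow> nat \<Rightarrow> 'a::field) \<Rightarrow> 'a \<Rightarrow> 'a \<Rightarrow> 'a \<Rightarrow> 'a \<Rightarrow> 'a" where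
  "deriv12 c s t u v = drow c 1 u v * t - drow c 2 u v * s"

definition bilin :: "(nat \<Rightarrow> nat \<Rightarrow> 'a::field) \<Rightarrow> 'a \<Rightarrow> 'a \<Rightarrow> 'a \<Rightarrow> 'a \<Rightarrow> 'a" where
  "bilin l s t u v = l 0 0 * t * v + l 0 1 * t * u + l 1 0 * s * v + l 1 1 * s * u"

text \<open>Both sides have bidegree (4, 4). The factor \<open>l\<close> enters as a cube because
  Frobenius cubes the coordinates; it describes the kernel of H, while \<open>r\<close> describes
  the image.\<close>

definition hw_rank1 :: "(nat \<Rightarrow> nat \<Rightarrow> 'a::field) \<Rightarrow> (nat \<Rightarrow> nat \<Rightarrow> 'a) \<Rightarrow> (nat \<Rightarrow> nat \<Rightarrow> 'a) \<Rightarrow> bool" where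
  "hw_rank1 c l r \<longleftrightarrow> (\<forall>s t u v. bicubic c s t u v * deriv12 c s t u v + deriv1 c s t u v * deriv2 c s t u v
     = bilin l s t u v ^ 3 * bilin r s t u v)"

text \<open>Euler's relation is void because 3 = 0, so the vanishing of the form does not follow
  from that of its derivatives and is listed separately.\<close>

definition smooth_bicubic :: "(nat \<Rightarrow> nat \<Rightarrow> 'a::field) \<Rightarrow> bool" where
  "smooth_bicubic c \<longleftrightarrow> (\<forall>s t u v. (s, t) \<noteq> (0, 0) \<longrightarrow> (u, v) \<noteq> (0, 0) \<longrightarrow>
     \<not> (bicubic c s t u v = 0 \<and> deriv1 c s t u v = 0 \<and> deriv2 c s t u v = 0))"

lemmas bicubic_defs = row_def drow_def bicubic_def deriv1_def deriv2_def deriv12_def bilin_def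

text \<open>The exchange of the two rulings; it carries each result on one ruling over to the
  other.\<close>

definition transp :: "(nat \<Rightarrow> nat \<Rightarrow> 'a) \<Rightarrow> nat \<Rightarrow> nat \<Rightarrow> 'a" where
  "transp c = (\<lambda>i j. c j i)"

lemma transp_simps:
  "bicubic (transp c) s t u v = bicubic c u v s t"
  "deriv1 (transp c) s t u v = deriv2 c u v s t"
  "deriv2 (transp c) s t u v = deriv1 c u v s t"
  "deriv12 (transp c) s t u v = deriv12 c u v s t"
  "bilin (transp c) s t u v = bilin c u v s t"
  unfolding bicubic_defs transp_def by (simp_all del: One_nat_def add: algebra_simps)

lemma hw_rank1_transp: "hw_rank1 c l r \<Longrightarrow> hw_rank1 (transp c) (transp l) (transp r)"
  unfolding hw_rank1_def transp_simps by (metis mult.commute)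

lemma smooth_transp: "smooth_bicubic c \<Longrightarrow> smooth_bicubic (transp c)"
  unfolding smooth_bicubic_def transp_simps by blast

lemma numerals_char3:
  assumes "(3::'a::comm_ring_1) = 0"
  shows "(2::'a) = -1" "(4::'a) = 1" "(5::'a) = -1" "(6::'a) = 0" "(7::'a) = 1" "(8::'a) = -1" "(9::'a) = 0"
    "(10::'a) = 1" "(11::'a) = -1" "(12::'a) = 0"
proof -
  have "(2::'a) = 3 - 1" "(4::'a) = 3 + 1" "(5::'a) = 3 * 2 - 1" "(6::'a) = 3 * 2" "(7::'a) = 3 * 2 + 1"
    "(8::'a) = 3 * 3 - 1" "(9::'a) = 3 * 3" "(10::'a) = 3 * 3 + 1" "(11::'a) = 3 * 4 - 1" "(12::'a) = 3 * 4"
    by simp_all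
  then show "(2::'a) = -1" "(4::'a) = 1" "(5::'a) = -1" "(6::'a) = 0" "(7::'a) = 1" "(8::'a) = -1" "(9::'a) = 0"
    "(10::'a) = 1" "(11::'a) = -1" "(12::'a) = 0"
    by (simp_all only: assms mult_zero_left diff_0 add_0_left)
qed

lemma add_cube_char3:
  assumes "(3::'a::comm_ring_1) = 0"
  shows "(x + y)^3 = x^3 + (y::'a)^3"
proof -
  have "(x + y)^3 = x^3 + y^3 + 3 * (x^2*y + x*y^2)"
    by (simp add: algebra_simps power2_eq_square power3_eq_cube)
  then show ?thesis using assms by simp
qed

text \<open>The coefficients after s -> m s + n t, t -> p s + q t in the first pair of variables.
  The middle coefficients are those of the reduced derivative \<open>deriv1\<close>, which
  transforms linearly with the determinant as a factor; they agree with the expanded ones only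
  modulo 3.\<close>

definition subst1 :: "'a \<Rightarrow> 'a \<Rightarrow> 'a \<Rightarrow> 'a \<Rightarrow> (nat \<Rightarrow> nat \<Rightarrow> 'a::field) \<Rightarrow> nat \<Rightarrow> nat \<Rightarrow> 'a" where
  "subst1 m n p q c = (\<lambda>i j.
     if i = 0 then c 0 j * q^3 + c 1 j * q^2 * n + c 2 j * q * n^2 + c 3 j * n^3
     else if i = 1 then (q * m - p * n) * (c 1 j * q - c 2 j * n)
     else if i = 2 then (q * m - p * n) * (c 2 j * m - c 1 j * p)
     else c 0 j * p^3 + c 1 j * p^2 * m + c 2 j * p * m^2 + c 3 j * m^3)"

definition lsubst1 :: "'a \<Rightarrow> 'a \<Rightarrow> 'a \<Rightarrow> 'a \<Rightarrow> (nat \<Rightarrow> nat \<Rightarrow> 'a::field) \<Rightarrow> nat \<Rightarrow> nat \<Rightarrow> 'a" where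
  "lsubst1 m n p q l = (\<lambda>i j. if i = 0 then n * l 1 j + q * l 0 j else m * l 1 j + p * l 0 j)"

lemma row_subst1:
  "row (subst1 m n p q c) 0 u v = row c 0 u v * q^3 + row c 1 u v * q^2 * n + row c 2 u v * q * n^2 + row c 3 u v * n^3"
  "row (subst1 m n p q c) 1 u v = (q * m - p * n) * (row c 1 u v * q - row c 2 u v * n)"
  "row (subst1 m n p q c) 2 u v = (q * m - p * n) * (row c 2 u v * m - row c 1 u v * p)"
  "row (subst1 m n p q c) 3 u v = row c 0 u v * p^3 + row c 1 u v * p^2 * m + row c 2 u v * p * m^2 + row c 3 u v * m^3"
  unfolding row_def subst1_def by (simp_all del: One_nat_def add: algebra_simps)

lemma drow_subst1:
  "drow (subst1 m n p q c) 0 u v = drow c 0 u v * q^3 + drow c 1 u v * q^2 * n + drow c 2 u v * q * n^2 + drow c 3 u v * n^3"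
  "drow (subst1 m n p q c) 1 u v = (q * m - p * n) * (drow c 1 u v * q - drow c 2 u v * n)"
  "drow (subst1 m n p q c) 2 u v = (q * m - p * n) * (drow c 2 u v * m - drow c 1 u v * p)"
  "drow (subst1 m n p q c) 3 u v = drow c 0 u v * p^3 + drow c 1 u v * p^2 * m + drow c 2 u v * p * m^2 + drow c 3 u v * m^3"
  unfolding drow_def subst1_def by (simp_all del: One_nat_def add: algebra_simps)

lemma cubic_subst:
  assumes "(3::'a::field) = 0"
  shows "((a::'a) * q^3 + b * q^2 * n + c * q * n^2 + d * n^3) * t^3 + (q * m - p * n) * (b * q - c * n) * t^2 * s
    + (q * m - p * n) * (c * m - b * p) * t * s^2 + (a * p^3 + b * p^2 * m + c * p * m^2 + d * m^3) * s^3
    = a * (p * s + q * t)^3 + b * (p * s + q * t)^2 * (m * s + n * t) + c * (p * s + q * t) * (m * s + n * t)^2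
      + d * (m * s + n * t)^3" (is "?l = ?r")
proof -
  have "?r = ?l + 3 * (a * (p^2* s^2*q*t + p* s*q^2*t^2) + d * (m^2* s^2*n*t + m* s*n^2*t^2)
     + b * (t^2* s*p*q*n + t * s^2*p*m*q) + c * (t^2* s*q*m*n + t * s^2*p*m*n))"
    by (simp add: algebra_simps power2_eq_square power3_eq_cube)
  also have "\<dots> = ?l" by (simp only: assms mult_zero_left add_0_right)
  finally show ?thesis by (rule sym)
qed

lemma subst1_simps:
  assumes "(3::'a::field) = 0"
  shows "bicubic (subst1 m n p q c) s t u (v::'a) = bicubic c (m * s + n * t) (p * s + q * t) u v"
  "deriv1 (subst1 m n p q c) s t u v = (q * m - p * n) * deriv1 c (m * s + n * t) (p * s + q * t) u v"
  "deriv2 (subst1 m n p q c) s t u v = deriv2 c (m * s + n * t) (p * s + q * t) u v"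
  "deriv12 (subst1 m n p q c) s t u v = (q * m - p * n) * deriv12 c (m * s + n * t) (p * s + q * t) u v"
  unfolding bicubic_def deriv1_def deriv2_def deriv12_def row_subst1 drow_subst1
  by (simp_all only: cubic_subst[OF assms]) (simp_all add: algebra_simps)

lemma bilin_lsubst1: "bilin (lsubst1 m n p q l) s t u v = bilin l (m * s + n * t) (p * s + q * t) u v"
  unfolding bilin_def lsubst1_def by (simp del: One_nat_def add: algebra_simps)

text \<open>Each product on the left contains exactly one of \<open>deriv1\<close> and
  \<open>deriv12\<close>, so the whole left side picks up the determinant D once. It is absorbed
  into \<open>r\<close>, and \<open>l\<close>, whose cube occurs, is merely substituted.\<close>

lemma hw_rank1_subst1:
  assumes "(3::'a::field) = 0" "hw_rank1 c l r" "(q * m - p * n :: 'a) = D"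
  shows "hw_rank1 (subst1 m n p q c) (lsubst1 m n p q l) (\<lambda>i j. D * lsubst1 m n p q r i j)"
proof -
  have "bilin (\<lambda>i j. D * lsubst1 m n p q r i j) s t u v = D * bilin (lsubst1 m n p q r) s t u v" for s t u v
    unfolding bilin_def by (simp add: algebra_simps)
  moreover have "f * (D * e) + D * a * b = D * (f * e + a * b)" for f e a b :: 'a by (simp add: algebra_simps)
  ultimately show ?thesis
    using assms(2) unfolding hw_rank1_def subst1_simps[OF assms(1)] bilin_lsubst1 assms(3)
    by (simp only: mult.left_commute[of _ D] simp_thms)
qed

lemma subst1_nonzero:
  assumes "(q * m - p * n :: 'a::field) \<noteq> 0" "(s, t) \<noteq> (0, 0)"
  shows "(m * s + n * t, p * s + q * t) \<noteq> (0, 0)"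
proof
  assume *: "(m * s + n * t, p * s + q * t) = (0, 0)"
  have "(q * m - p * n) * s = q * (m * s + n * t) - n * (p * s + q * t)"
    "(q * m - p * n) * t = m * (p * s + q * t) - p * (m * s + n * t)" by (simp_all add: algebra_simps)
  with * have "(q * m - p * n) * s = 0" "(q * m - p * n) * t = 0" by simp_all
  with assms show False by auto
qed

lemma smooth_subst1:
  assumes "(3::'a::field) = 0" "smooth_bicubic c" "(q * m - p * n :: 'a) \<noteq> 0"
  shows "smooth_bicubic (subst1 m n p q c)"
  using assms(2) subst1_nonzero[OF assms(3)] assms(3)
  unfolding smooth_bicubic_def subst1_simps[OF assms(1)] by (metis mult_eq_0_iff)

text \<open>Over a finite field the product of all X - a, increased by 1, takes the value 1
  everywhere and has no root.\<close>

lemma infinite_alg_closed_field: "infinite (UNIV :: 'a::alg_closed_field set)"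
proof
  assume fin: "finite (UNIV :: 'a set)"
  define p :: "'a poly" where "p = (\<Prod>a\<in>UNIV. [:- a, 1:])"
  have deg: "Polynomial.degree p = card (UNIV :: 'a set)"
    unfolding p_def using fin by (subst degree_prod_eq_sum_degree) auto
  then have "Polynomial.degree p > 0" using fin by (simp add: card_gt_0_iff)
  then have "Polynomial.degree (p + 1) > 0" by (simp add: degree_add_eq_left)
  then obtain x where "poly (p + 1) x = 0" using alg_closed_imp_poly_has_root by blast
  moreover have "poly p x = 0" unfolding p_def poly_prod using fin by (intro prod_zero) auto
  ultimately show False by simp
qed

text \<open>The square is missing because the exponents 3a + b with a, b in {0, 1} are 0, 1, 3, 4,
  and only these occur in \<open>hw_rank1\<close>.\<close>

lemma quartic_zero:
  assumes "infinite (UNIV :: 'a::field set)" "\<And>x::'a. a + b * x + c * x^3 + d * x^4 = 0"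
  shows "a = 0 \<and> b = 0 \<and> c = 0 \<and> d = 0"
proof -
  let ?p = "[:a, b, 0, c, d:]"
  have "poly ?p x = 0" for x
    using assms(2)[of x] by (simp add: algebra_simps power2_eq_square power3_eq_cube power4_eq_xxxx)
  then have "?p = 0" using assms(1) poly_roots_finite[of ?p] by auto
  then show ?thesis by simp
qed

text \<open>Comparison of coefficients in the identity at t = v = 1, in s and then in u. The field
  is infinite, so a polynomial identity in values is one in coefficients; 2 is replaced by -1
  throughout.\<close>

lemma hw_rank1_coeffs:
  assumes char3: "(3::'a::alg_closed_field) = 0" and hw: "hw_rank1 c l (r :: nat \<Rightarrow> nat \<Rightarrow> 'a)"
  shows "c 0 0 * c 1 1 + c 1 0 * c 0 1 = l 0 0 ^ 3 * r 0 0"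
  "c 0 1 * c 1 1 + c 0 0 * c 1 2 + c 0 2 * c 1 0 = - (l 0 0 ^ 3 * r 0 1)"
  "c 0 3 * c 1 1 + c 0 1 * c 1 3 + c 0 2 * c 1 2 = l 0 1 ^ 3 * r 0 0"
  "c 0 3 * c 1 2 + c 0 2 * c 1 3 = - (l 0 1 ^ 3 * r 0 1)"
  "c 1 0 * c 1 1 + c 0 0 * c 2 1 + c 0 1 * c 2 0 = - (l 0 0 ^ 3 * r 1 0)"
  "c 1 0 * c 1 2 - c 1 1 ^ 2 + c 0 1 * c 2 1 + c 0 0 * c 2 2 + c 0 2 * c 2 0 = l 0 0 ^ 3 * r 1 1"
  "c 1 2 ^ 2 - c 1 1 * c 1 3 - c 0 3 * c 2 1 - c 0 1 * c 2 3 - c 0 2 * c 2 2 = l 0 1 ^ 3 * r 1 0"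
  "c 1 2 * c 1 3 + c 0 3 * c 2 2 + c 0 2 * c 2 3 = l 0 1 ^ 3 * r 1 1"
  "c 3 0 * c 1 1 + c 1 0 * c 3 1 + c 2 0 * c 2 1 = l 1 0 ^ 3 * r 0 0"
  "c 2 1 ^ 2 - c 2 0 * c 2 2 - c 1 1 * c 3 1 - c 1 0 * c 3 2 - c 1 2 * c 3 0 = l 1 0 ^ 3 * r 0 1"
  "c 1 3 * c 3 1 + c 1 1 * c 3 3 + c 1 2 * c 3 2 + c 2 1 * c 2 3 - c 2 2 ^ 2 = l 1 1 ^ 3 * r 0 0"
  "c 1 3 * c 3 2 + c 1 2 * c 3 3 + c 2 2 * c 2 3 = - (l 1 1 ^ 3 * r 0 1)"
  "c 2 0 * c 3 1 + c 2 1 * c 3 0 = - (l 1 0 ^ 3 * r 1 0)"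
  "c 2 1 * c 3 1 + c 2 0 * c 3 2 + c 2 2 * c 3 0 = l 1 0 ^ 3 * r 1 1"
  "c 2 3 * c 3 1 + c 2 1 * c 3 3 + c 2 2 * c 3 2 = - (l 1 1 ^ 3 * r 1 0)"
  "c 2 3 * c 3 2 + c 2 2 * c 3 3 = l 1 1 ^ 3 * r 1 1"
proof -
  note inf = infinite_alg_closed_field[where 'a = 'a]
  \<comment> \<open>\<open>e\<close>, \<open>e1\<close>, \<open>e3\<close>, \<open>e4\<close> are
    the differences of the two sides at s^0, s^1, s^3, s^4, as functions of u. The terms with s^2
    cancel.\<close>
  define e where "e = (\<lambda>u. (drow c 1 u 1 * row c 0 u 1 + row c 1 u 1 * drow c 0 u 1 - (l 0 0 ^ 3 + l 0 1 ^ 3 * u^3) * (r 0 0 + r 0 1 * u))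
    :: 'a)"
  define e1 where "e1 = (\<lambda>u. (2 * drow c 1 u 1 * row c 1 u 1 - row c 0 u 1 * drow c 2 u 1 - row c 2 u 1 * drow c 0 u 1
    - (l 0 0 ^ 3 + l 0 1 ^ 3 * u^3) * (r 1 0 + r 1 1 * u)) :: 'a)"
  define e3 where "e3 = (\<lambda>u. (drow c 1 u 1 * row c 3 u 1 + row c 1 u 1 * drow c 3 u 1 - 2 * row c 2 u 1 * drow c 2 u 1
    - (l 1 0 ^ 3 + l 1 1 ^ 3 * u^3) * (r 0 0 + r 0 1 * u)) :: 'a)"
  define e4 where "e4 = (\<lambda>u. (- (drow c 2 u 1 * row c 3 u 1 + row c 2 u 1 * drow c 3 u 1)
    - (l 1 0 ^ 3 + l 1 1 ^ 3 * u^3) * (r 1 0 + r 1 1 * u)) :: 'a)"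
  have lam: "bilin l s 1 u 1 ^ 3 = l 0 0 ^ 3 + l 0 1 ^ 3 * u^3 + (l 1 0 ^ 3 + l 1 1 ^ 3 * u^3) * s^3" for s u :: 'a
    unfolding bilin_def by (simp only: add_cube_char3[OF char3] power_mult_distrib) (simp add: algebra_simps)
  have "e u + e1 u * s + e3 u * s^3 + e4 u * s^4 = 0" for s u :: 'a
  proof -
    have rho: "bilin r s 1 u 1 = r 0 0 + r 0 1 * u + (r 1 0 + r 1 1 * u) * s" unfolding bilin_def by (simp add: algebra_simps)
    have "(B' * A + B * A' - L0 * R0) + (2 * B' * B - A * C' - C * A' - L0 * R1) * s
        + (B' * D + B * D' - 2 * C * C' - L1 * R0) * s^3 + (- (C' * D + C * D') - L1 * R1) * s^4 = 0"
      if "(A * 1^3 + B * 1^2 * s + C * 1 * s^2 + D * s^3) * (B' * 1 - C' * s)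
        + (B * 1 - C * s) * (A' * 1^3 + B' * 1^2 * s + C' * 1 * s^2 + D' * s^3)
        = (L0 + L1 * s^3) * (R0 + R1 * s)" for A B C D A' B' C' D' L0 L1 R0 R1 :: 'a
    proof -
      have "(B' * A + B * A' - L0 * R0) + (2 * B' * B - A * C' - C * A' - L0 * R1) * s
        + (B' * D + B * D' - 2 * C * C' - L1 * R0) * s^3 + (- (C' * D + C * D') - L1 * R1) * s^4
        = ((A * 1^3 + B * 1^2 * s + C * 1 * s^2 + D * s^3) * (B' * 1 - C' * s)
          + (B * 1 - C * s) * (A' * 1^3 + B' * 1^2 * s + C' * 1 * s^2 + D' * s^3)) - (L0 + L1 * s^3) * (R0 + R1 * s)"
        by (simp add: algebra_simps power2_eq_square power3_eq_cube power4_eq_xxxx)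
      then show ?thesis using that by simp
    qed
    note combine = this
    have "bicubic c s 1 u 1 * deriv12 c s 1 u 1 + deriv1 c s 1 u 1 * deriv2 c s 1 u 1 = bilin l s 1 u 1 ^ 3 * bilin r s 1 u 1"
      using hw unfolding hw_rank1_def by blast
    from combine[OF this[unfolded bicubic_def deriv1_def deriv2_def deriv12_def lam rho]]
    show ?thesis unfolding e_def e1_def e3_def e4_def .
  qed
  then have e: "e u = 0" "e1 u = 0" "e3 u = 0" "e4 u = 0" for u
    using quartic_zero[OF inf, of "e u" "e1 u" "e3 u" "e4 u"] by auto
  note two = numerals_char3(1)[OF char3]
  have "(c 0 0 * c 1 1 + c 1 0 * c 0 1 - l 0 0 ^ 3 * r 0 0) + (2 * c 0 1 * c 1 1 - c 0 0 * c 1 2 - c 0 2 * c 1 0 - l 0 0 ^ 3 * r 0 1) * u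
    + (c 0 3 * c 1 1 + c 0 1 * c 1 3 - 2 * c 0 2 * c 1 2 - l 0 1 ^ 3 * r 0 0) * u^3
    + (- c 0 3 * c 1 2 - c 0 2 * c 1 3 - l 0 1 ^ 3 * r 0 1) * u^4 = e u" for u
    unfolding e_def row_def drow_def by (simp add: algebra_simps power2_eq_square power3_eq_cube power4_eq_xxxx)
  note q0 = quartic_zero[OF inf this[unfolded e]]
  have "(2 * c 1 0 * c 1 1 - c 0 0 * c 2 1 - c 0 1 * c 2 0 - l 0 0 ^ 3 * r 1 0)
    + (2 * (c 1 1 ^ 2 - c 1 0 * c 1 2) - 2 * c 0 1 * c 2 1 + c 0 0 * c 2 2 + c 0 2 * c 2 0 - l 0 0 ^ 3 * r 1 1) * u
    + (2 * (c 1 3 * c 1 1 - c 1 2 ^ 2) - c 0 3 * c 2 1 - c 0 1 * c 2 3 + 2 * c 0 2 * c 2 2 - l 0 1 ^ 3 * r 1 0) * u^3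
    + (- 2 * c 1 2 * c 1 3 + c 0 3 * c 2 2 + c 0 2 * c 2 3 - l 0 1 ^ 3 * r 1 1) * u^4 = e1 u" for u
    unfolding e1_def row_def drow_def by (simp add: algebra_simps power2_eq_square power3_eq_cube power4_eq_xxxx)
  note q1 = quartic_zero[OF inf this[unfolded e]]
  have "(c 3 0 * c 1 1 + c 1 0 * c 3 1 - 2 * c 2 0 * c 2 1 - l 1 0 ^ 3 * r 0 0)
    + (2 * c 1 1 * c 3 1 - c 1 0 * c 3 2 - c 1 2 * c 3 0 - 2 * (c 2 1 ^ 2 - c 2 0 * c 2 2) - l 1 0 ^ 3 * r 0 1) * u
    + (c 1 3 * c 3 1 + c 1 1 * c 3 3 - 2 * c 1 2 * c 3 2 - 2 * (c 2 1 * c 2 3 - c 2 2 ^ 2) - l 1 1 ^ 3 * r 0 0) * u^3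
    + (- c 1 3 * c 3 2 - c 1 2 * c 3 3 + 2 * c 2 2 * c 2 3 - l 1 1 ^ 3 * r 0 1) * u^4 = e3 u" for u
    unfolding e3_def row_def drow_def by (simp add: algebra_simps power2_eq_square power3_eq_cube power4_eq_xxxx)
  note q3 = quartic_zero[OF inf this[unfolded e]]
  have "(- c 2 0 * c 3 1 - c 2 1 * c 3 0 - l 1 0 ^ 3 * r 1 0)
    + (- 2 * c 2 1 * c 3 1 + c 2 0 * c 3 2 + c 2 2 * c 3 0 - l 1 0 ^ 3 * r 1 1) * u
    + (- c 2 3 * c 3 1 - c 2 1 * c 3 3 + 2 * c 2 2 * c 3 2 - l 1 1 ^ 3 * r 1 0) * u^3
    + (c 2 3 * c 3 2 + c 2 2 * c 3 3 - l 1 1 ^ 3 * r 1 1) * u^4 = e4 u" for u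
    unfolding e4_def row_def drow_def by (simp add: algebra_simps power2_eq_square power3_eq_cube power4_eq_xxxx)
  note q4 = quartic_zero[OF inf this[unfolded e]]
  note q = q0 q1 q3 q4
  show "c 0 0 * c 1 1 + c 1 0 * c 0 1 = l 0 0 ^ 3 * r 0 0"
  "c 0 1 * c 1 1 + c 0 0 * c 1 2 + c 0 2 * c 1 0 = - (l 0 0 ^ 3 * r 0 1)"
  "c 0 3 * c 1 1 + c 0 1 * c 1 3 + c 0 2 * c 1 2 = l 0 1 ^ 3 * r 0 0"
  "c 0 3 * c 1 2 + c 0 2 * c 1 3 = - (l 0 1 ^ 3 * r 0 1)"
    using q0 unfolding two by (simp_all add: algebra_simps eq_neg_iff_add_eq_0 neg_eq_iff_add_eq_0)
  show "c 1 0 * c 1 1 + c 0 0 * c 2 1 + c 0 1 * c 2 0 = - (l 0 0 ^ 3 * r 1 0)"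
  "c 1 0 * c 1 2 - c 1 1 ^ 2 + c 0 1 * c 2 1 + c 0 0 * c 2 2 + c 0 2 * c 2 0 = l 0 0 ^ 3 * r 1 1"
  "c 1 2 ^ 2 - c 1 1 * c 1 3 - c 0 3 * c 2 1 - c 0 1 * c 2 3 - c 0 2 * c 2 2 = l 0 1 ^ 3 * r 1 0"
  "c 1 2 * c 1 3 + c 0 3 * c 2 2 + c 0 2 * c 2 3 = l 0 1 ^ 3 * r 1 1"
    using q1 unfolding two by (simp_all add: algebra_simps eq_neg_iff_add_eq_0 neg_eq_iff_add_eq_0)
  show "c 3 0 * c 1 1 + c 1 0 * c 3 1 + c 2 0 * c 2 1 = l 1 0 ^ 3 * r 0 0"
  "c 2 1 ^ 2 - c 2 0 * c 2 2 - c 1 1 * c 3 1 - c 1 0 * c 3 2 - c 1 2 * c 3 0 = l 1 0 ^ 3 * r 0 1"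
  "c 1 3 * c 3 1 + c 1 1 * c 3 3 + c 1 2 * c 3 2 + c 2 1 * c 2 3 - c 2 2 ^ 2 = l 1 1 ^ 3 * r 0 0"
  "c 1 3 * c 3 2 + c 1 2 * c 3 3 + c 2 2 * c 2 3 = - (l 1 1 ^ 3 * r 0 1)"
    using q3 unfolding two by (simp_all add: algebra_simps eq_neg_iff_add_eq_0 neg_eq_iff_add_eq_0)
  show "c 2 0 * c 3 1 + c 2 1 * c 3 0 = - (l 1 0 ^ 3 * r 1 0)"
  "c 2 1 * c 3 1 + c 2 0 * c 3 2 + c 2 2 * c 3 0 = l 1 0 ^ 3 * r 1 1"
  "c 2 3 * c 3 1 + c 2 1 * c 3 3 + c 2 2 * c 3 2 = - (l 1 1 ^ 3 * r 1 0)"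
  "c 2 3 * c 3 2 + c 2 2 * c 3 3 = l 1 1 ^ 3 * r 1 1"
    using q4 unfolding two by (simp_all add: algebra_simps eq_neg_iff_add_eq_0 neg_eq_iff_add_eq_0)
qed

section \<open>Additive extension of maps from monomials to polynomials\<close>

abbreviation "lookup \<equiv> Poly_Mapping.lookup"
abbreviation "keys \<equiv> Poly_Mapping.keys"
abbreviation "single \<equiv> Poly_Mapping.single"

lemma UNIV_4': "(UNIV :: 4 set) = {0, 1, 2, 3}"
proof -
  have "(4 :: 4) = 0" by simp
  then show ?thesis unfolding UNIV_4 by (simp only: insert_commute)
qed

lemma distinct_4: "(0 :: 4) \<noteq> 1" "(0 :: 4) \<noteq> 2" "(0 :: 4) \<noteq> 3" "(1 :: 4) \<noteq> 2" "(1 :: 4) \<noteq> 3" "(2 :: 4) \<noteq> 3"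
  by simp_all

lemma sum_UNIV_4: "sum f (UNIV :: 4 set) = f 0 + f 1 + f 2 + f 3"
  unfolding UNIV_4' by (simp add: distinct_4 add.assoc)

lemma prod_UNIV_4: "prod f (UNIV :: 4 set) = f 0 * f 1 * f 2 * f 3"
  unfolding UNIV_4' by (simp add: distinct_4 mult.assoc)

lemma all_4: "(\<forall>i::4. P i) \<longleftrightarrow> P 0 \<and> P 1 \<and> P 2 \<and> P 3"
  using UNIV_4' by (metis UNIV_I insertE singletonD)

lemma sum_single_lookup: "(\<Sum>m\<in>keys A. single m (lookup A m)) = (A :: 'a \<Rightarrow>\<^sub>0 'b::comm_monoid_add)"
proof (rule poly_mapping_eqI)
  fix k
  have "lookup (\<Sum>m\<in>keys A. single m (lookup A m)) k = (\<Sum>m\<in>keys A. lookup A m when m = k)"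
    by (simp add: lookup_sum lookup_single)
  also have "\<dots> = (\<Sum>m\<in>keys A. if m = k then lookup A m else 0)" by (simp add: when_def)
  also have "\<dots> = lookup A k" by (simp add: sum.delta' in_keys_iff)
  finally show "lookup (\<Sum>m\<in>keys A. single m (lookup A m)) k = lookup A k" .
qed

lemma poly_mapping_add_induct [case_names zero single add]:
  fixes A :: "'a \<Rightarrow>\<^sub>0 'b::comm_monoid_add"
  assumes "P 0" "\<And>m c. P (single m c)" "\<And>A B. P A \<Longrightarrow> P B \<Longrightarrow> P (A + B)"
  shows "P A"
proof -
  have "P (\<Sum>m\<in>M. single m (lookup A m))" if "finite M" for M
    using that by (induction M) (simp_all add: assms)
  from this[OF finite_keys, of A] show ?thesis by (simp add: sum_single_lookup)
qed

text \<open>Evaluation, partial derivatives, passage to Laurent polynomials and homogeneous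
  components are all sums over the support of a term that is additive in the coefficient. Treated as
  one construction, they inherit additivity from one argument about enlarging the support.\<close>

definition linext :: "('m \<Rightarrow> 'a \<Rightarrow> 'b) \<Rightarrow> ('m \<Rightarrow>\<^sub>0 'a::ab_group_add) \<Rightarrow> 'b::ab_group_add" where
  "linext \<phi> A = (\<Sum>m\<in>keys A. \<phi> m (lookup A m))"

context
  fixes \<phi> :: "'m \<Rightarrow> 'a::ab_group_add \<Rightarrow> 'b::ab_group_add"
  assumes add: "\<And>m a b. \<phi> m (a + b) = \<phi> m a + \<phi> m b"
begin

lemma linext_zero_coeff: "\<phi> m 0 = 0"
  using add[of m 0 0] by simp

lemma linext_zero: "linext \<phi> 0 = 0"
  by (simp add: linext_def)

lemma linext_superset: "finite M \<Longrightarrow> keys A \<subseteq> M \<Longrightarrow> linext \<phi> A = (\<Sum>m\<in>M. \<phi> m (lookup A m))"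
  unfolding linext_def
  by (rule sum.mono_neutral_left) (auto simp: linext_zero_coeff in_keys_iff)

lemma linext_single: "linext \<phi> (single m c) = \<phi> m c"
  by (simp add: linext_def linext_zero_coeff)

lemma linext_add: "linext \<phi> (A + B) = linext \<phi> A + linext \<phi> B"
proof -
  let ?M = "keys A \<union> keys B"
  have M: "finite ?M" "keys A \<subseteq> ?M" "keys B \<subseteq> ?M" "keys (A + B) \<subseteq> ?M"
    using keys_add[of A B] by auto
  show ?thesis
    unfolding linext_superset[OF M(1,2)] linext_superset[OF M(1,3)] linext_superset[OF M(1,4)]
    by (simp add: lookup_add add sum.distrib)
qed

lemma linext_uminus: "linext \<phi> (- A) = - linext \<phi> A"
  using linext_add[of "- A" A] by (simp only: eq_neg_iff_add_eq_0 left_minus linext_zero)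

lemma linext_diff: "linext \<phi> (A - B) = linext \<phi> A - linext \<phi> B"
  using linext_add[of A "- B"] unfolding linext_uminus by simp

lemma linext_sum: "linext \<phi> (\<Sum>i\<in>I. f i) = (\<Sum>i\<in>I. linext \<phi> (f i))"
  by (induction I rule: infinite_finite_induct) (simp_all add: linext_zero linext_add)

end

section \<open>Substitution homomorphisms\<close>

definition ring_map :: "('a::comm_ring_1 \<Rightarrow> 'b::comm_ring_1) \<Rightarrow> bool" where
  "ring_map h \<longleftrightarrow> h 1 = 1 \<and> (\<forall>a b. h (a + b) = h a + h b) \<and> (\<forall>a b. h (a * b) = h a * h b)"

definition insertion :: "('a \<Rightarrow> 'b) \<Rightarrow> (4 \<Rightarrow> 'b::comm_ring_1) \<Rightarrow> 'a::comm_ring_1 poly4 \<Rightarrow> 'b" where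
  "insertion h g = linext (\<lambda>m c. h c * (\<Prod>i\<in>UNIV. g i ^ lookup m i))"

context
  fixes h :: "'a::comm_ring_1 \<Rightarrow> 'b::comm_ring_1"
  assumes h: "ring_map h"
begin

lemma insertion_coeff_add:
  "h (a + b) * x = h a * x + h b * x"
  using h by (simp add: ring_map_def algebra_simps)

lemma insertion_linear:
  "insertion h g 0 = 0" "insertion h g (A + B) = insertion h g A + insertion h g B"
  "insertion h g (- A) = - insertion h g A" "insertion h g (A - B) = insertion h g A - insertion h g B"
  "insertion h g (\<Sum>i\<in>I. f i) = (\<Sum>i\<in>I. insertion h g (f i))"
  unfolding insertion_def
  by (rule linext_zero linext_add linext_uminus linext_diff linext_sum, rule insertion_coeff_add)+

lemma insertion_single: "insertion h g (single m c) = h c * (\<Prod>i\<in>UNIV. g i ^ lookup m i)"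
  unfolding insertion_def by (rule linext_single) (rule insertion_coeff_add)

lemma insertion_mult: "insertion h g (A * B) = insertion h g A * insertion h g B"
proof (induction A rule: poly_mapping_add_induct)
  case (single m c)
  show ?case
  proof (induction B rule: poly_mapping_add_induct)
    case (single n d)
    have "h (c * d) = h c * h d" using h by (simp add: ring_map_def)
    then show ?case
      by (simp add: mult_single insertion_single lookup_add power_add prod.distrib algebra_simps)
  qed (simp_all add: insertion_linear algebra_simps)
qed (simp_all add: insertion_linear algebra_simps)

lemma insertion_one: "insertion h g 1 = 1"
  using insertion_single[of g 0 1] h by (simp add: ring_map_def)

lemma insertion_power: "insertion h g (A ^ n) = insertion h g A ^ n"
  by (induction n) (simp_all add: insertion_one insertion_mult)

lemma insertion_numeral: "insertion h g (numeral n) = numeral n"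
  by (induction n) (simp_all only: numeral.simps insertion_one insertion_linear)

lemma insertion_cst: "insertion h g (single 0 c) = h c"
  by (simp add: insertion_single)

lemma insertion_var: "insertion h g (single (single i 1) 1) = g i"
proof -
  have "(\<Prod>j\<in>UNIV. g j ^ lookup (single i 1) j) = (\<Prod>j\<in>UNIV. if j = i then g j else 1)"
    by (intro prod.cong) (auto simp: lookup_single when_def)
  then show ?thesis using h by (simp add: insertion_single ring_map_def)
qed

lemmas insertion_simps = insertion_linear insertion_mult insertion_one insertion_power insertion_numeral

end

section \<open>Evaluation, base change and Laurent polynomials\<close>

text \<open>The universal property of the polynomial ring: a monomial is a constant times powers of
  the variables, so an additive and multiplicative map is determined by constants and
  variables.\<close>

lemma insertion_unique:
  assumes h: "ring_map h" and k: "\<And>A B. k (A + B) = k A + k B" "\<And>A B. k (A * B) = k A * k B" "\<And>c. k (single 0 c) = h c"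
    and g: "\<And>i. k (single (single i 1) 1) = g i"
  shows "k A = insertion h g A"
proof -
  have k1: "k 1 = 1" using k(3)[of 1] h by (simp add: ring_map_def)
  have pow: "k (A ^ n) = k A ^ n" for A n by (induction n) (simp_all add: k1 k(2))
  have monom: "single (single i n) 1 = (single (single i 1) 1 :: 'a poly4) ^ n" for i :: 4 and n
  proof (induction n)
    case (Suc n)
    have "single i (Suc n) = single i 1 + single i n" using single_add[of i 1 n] unfolding plus_1_eq_Suc .
    then have "single (single i (Suc n)) 1 = (single (single i 1) 1 :: 'a poly4) * single (single i n) 1"
      by (simp only: mult_single mult_1)
    then show ?case using Suc by (simp only: power_Suc)
  qed (simp only: single_zero single_one power_0)
  have exps: "single m c = single 0 c * (\<Prod>i\<in>UNIV. single (single i (lookup m i)) 1)" for m :: "4 \<Rightarrow>\<^sub>0 nat" and c :: 'a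
  proof -
    have "(\<Sum>i\<in>UNIV. single i (lookup m i)) = m"
    proof (rule poly_mapping_eqI)
      fix k
      have "lookup (\<Sum>i\<in>UNIV. single i (lookup m i)) k = (\<Sum>i\<in>UNIV. if i = k then lookup m i else 0)"
        by (simp add: lookup_sum lookup_single when_def)
      then show "lookup (\<Sum>i\<in>UNIV. single i (lookup m i)) k = lookup m k" by (simp only: sum.delta finite UNIV_I if_True)
    qed
    then have m: "0 + (single 0 (lookup m 0) + single 1 (lookup m 1) + single 2 (lookup m 2) + single 3 (lookup m 3)) = m"
      unfolding sum_UNIV_4 by (simp only: add_0_left)
    show ?thesis unfolding prod_UNIV_4 mult_single m by (simp only: mult_1_right)
  qed
  show ?thesis
  proof (induction A rule: poly_mapping_add_induct)
    case zero
    have "k 0 = 0" using k(1)[of 0 0] by simp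
    then show ?case by (simp only: insertion_linear[OF h])
  next
    case (single m c)
    have kmonom: "k (single (single i (lookup m i)) 1) = g i ^ lookup m i" for i
      by (subst monom) (simp only: pow g)
    have "k (\<Prod>i\<in>UNIV. single (single i (lookup m i)) 1) = (\<Prod>i\<in>UNIV. g i ^ lookup m i)"
      unfolding prod_UNIV_4 k(2) by (simp only: kmonom)
    then show ?case using insertion_single[OF h, of g m c] exps[of m c] by (simp only: k)
  next
    case (add A B)
    then show ?case by (simp only: k insertion_linear[OF h])
  qed
qed

lemma cst_mult: "cst (a * b) = cst a * cst b"
  by (simp add: cst_def mult_single)

lemma cst_add: "cst (a + b) = cst a + cst b"
  and cst_uminus: "cst (- a) = - cst a"
  and cst_diff: "cst (a - b) = cst a - cst b"
  by (simp_all add: cst_def single_add single_uminus single_diff)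

lemma cst_0 [simp]: "cst 0 = 0" and cst_1 [simp]: "cst 1 = 1"
  by (simp_all add: cst_def)

lemma ring_map_id: "ring_map id" and ring_map_cst: "ring_map (cst :: 'a::field \<Rightarrow> _)"
  and ring_map_to_ac: "ring_map (to_ac :: 'a \<Rightarrow> _)" and ring_map_cst_to_ac: "ring_map (cst \<circ> (to_ac :: 'a \<Rightarrow> _))"
  by (simp_all add: ring_map_def cst_add cst_mult)

lemma eval4_insertion: "eval4 v = insertion id (vec_nth v)"
  by (simp add: fun_eq_iff eval4_def insertion_def linext_def)

lemma eval4_simps:
  "eval4 v 0 = 0" "eval4 v (A + B) = eval4 v A + eval4 v B"
  "eval4 v (- A) = - eval4 v A" "eval4 v (A - B) = eval4 v A - eval4 v B"
  "eval4 v (A * B) = eval4 v A * eval4 v B" "eval4 v 1 = 1"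
  "eval4 v (A ^ n) = eval4 v A ^ n" "eval4 v (numeral k) = numeral k" "eval4 v (\<Sum>i\<in>I. f i) = (\<Sum>i\<in>I. eval4 v (f i))"
  unfolding eval4_insertion by (simp_all only: insertion_simps[OF ring_map_id])

lemma eval4_cst [simp]: "eval4 v (cst c) = c" and eval4_var [simp]: "eval4 v (var i) = v $ i"
  unfolding eval4_insertion cst_def var_def by (simp_all only: insertion_cst[OF ring_map_id] insertion_var[OF ring_map_id] id_apply)

lemma base_change_insertion: "base_change A = insertion (cst \<circ> to_ac) var A"
proof (rule insertion_unique[OF ring_map_cst_to_ac])
  have lookup_bc: "lookup (base_change A) m = to_ac (lookup A m)" for A :: "'a poly4" and m
    by (simp add: base_change_def map.rep_eq when_def)
  show add: "base_change (A + B) = base_change A + base_change B" for A B :: "'a poly4"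
    by (rule poly_mapping_eqI) (simp add: lookup_bc lookup_add)
  have single: "base_change (single m c) = single m (to_ac c)" for m and c :: 'a
    by (rule poly_mapping_eqI) (simp add: lookup_bc lookup_single when_def)
  show "base_change (single 0 c) = (cst \<circ> to_ac) c" for c :: 'a by (simp add: single cst_def)
  show "base_change (single (single i 1) 1 :: 'a poly4) = var i" for i by (simp add: single var_def)
  have zero: "base_change (0 :: 'a poly4) = 0" by (rule poly_mapping_eqI) (simp add: lookup_bc)
  show "base_change (A * B) = base_change A * base_change B" for A B :: "'a poly4"
  proof (induction A rule: poly_mapping_add_induct)
    case (single m c)
    show ?case
      by (induction B rule: poly_mapping_add_induct)
        (simp_all add: \<open>\<And>m c. base_change (single m c) = _\<close> add zero mult_single algebra_simps)
  qed (simp_all add: add zero algebra_simps)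
qed

lemma base_change_simps:
  fixes A B :: "'a::field poly4"
  shows "base_change (0 :: 'a poly4) = 0" "base_change (A + B) = base_change A + base_change B"
  "base_change (- A) = - base_change A" "base_change (A - B) = base_change A - base_change B"
  "base_change (A * B) = base_change A * base_change B" "base_change (1 :: 'a poly4) = 1"
  "base_change (A ^ n) = base_change A ^ n" "base_change (numeral k :: 'a poly4) = numeral k"
  unfolding base_change_insertion by (simp_all only: insertion_simps[OF ring_map_cst_to_ac])

lemma base_change_cst [simp]: "base_change (cst c) = cst (to_ac c)"
  unfolding base_change_insertion cst_def[of c] insertion_cst[OF ring_map_cst_to_ac] by simp

lemma base_change_var [simp]: "base_change (var i :: 'a::field poly4) = var i"
  unfolding base_change_insertion var_def[where 'a = 'a] insertion_var[OF ring_map_cst_to_ac] ..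

lemma lookup_map_int: "lookup (Poly_Mapping.map int m) i = int (lookup m i)"
  by (simp add: map.rep_eq when_def)

lemma lookup_map_nat: "lookup (Poly_Mapping.map nat m) i = nat (lookup m i)"
  by (simp add: map.rep_eq when_def)

lemma to_laurent_linext: "to_laurent = linext (\<lambda>m. single (Poly_Mapping.map int m))"
  by (simp add: fun_eq_iff to_laurent_def linext_def)

lemma to_laurent_linear:
  "to_laurent 0 = 0" "to_laurent (A + B) = to_laurent A + to_laurent B" "to_laurent (- A) = - to_laurent A"
  "to_laurent (A - B) = to_laurent A - to_laurent B" "to_laurent (sum f I) = (\<Sum>i\<in>I. to_laurent (f i))"
  unfolding to_laurent_linext by (rule linext_zero linext_add linext_uminus linext_diff linext_sum, rule single_add)+

lemma to_laurent_single: "to_laurent (single m c) = single (Poly_Mapping.map int m) c"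
  unfolding to_laurent_linext by (rule linext_single) (rule single_add)

lemma to_laurent_mult: "to_laurent (A * B) = to_laurent A * to_laurent B"
proof (induction A rule: poly_mapping_add_induct)
  case (single m c)
  show ?case
  proof (induction B rule: poly_mapping_add_induct)
    case (single n d)
    have "Poly_Mapping.map int (m + n) = Poly_Mapping.map int m + Poly_Mapping.map int n"
      by (rule poly_mapping_eqI) (simp add: lookup_map_int lookup_add)
    then show ?case by (simp add: mult_single to_laurent_single)
  qed (simp_all add: to_laurent_linear algebra_simps)
qed (simp_all add: to_laurent_linear algebra_simps)

lemma lookup_to_laurent: "lookup (to_laurent A) (Poly_Mapping.map int m) = lookup A m"
proof (induction A rule: poly_mapping_add_induct)
  case (single n c)
  have "n = m" if "Poly_Mapping.map int n = Poly_Mapping.map int m"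
    by (rule poly_mapping_eqI) (metis that lookup_map_int of_nat_eq_iff)
  then show ?case by (auto simp: to_laurent_single lookup_single when_def)
qed (simp_all add: to_laurent_linear lookup_add)

lemma to_laurent_inject: "to_laurent A = to_laurent B \<longleftrightarrow> A = B"
  by (metis lookup_to_laurent poly_mapping_eqI)

lemma to_laurent_one: "to_laurent 1 = 1"
proof -
  have "Poly_Mapping.map int (0 :: 4 \<Rightarrow>\<^sub>0 nat) = 0" by (rule poly_mapping_eqI) (simp add: lookup_map_int)
  then show ?thesis using to_laurent_single[of 0 1] by simp
qed

lemma to_laurent_power: "to_laurent (A ^ n) = to_laurent A ^ n"
  by (induction n) (simp_all add: to_laurent_one to_laurent_mult)

section \<open>Coefficients\<close>

lemma lookup_monomial_mult:
  fixes A :: "(4 \<Rightarrow>\<^sub>0 nat) \<Rightarrow>\<^sub>0 'a::comm_ring_1"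
  shows "lookup (single m c * A) n = (if \<forall>i. lookup m i \<le> lookup n i then c * lookup A (n - m) else 0)"
proof (induction A rule: poly_mapping_add_induct)
  case (single l d)
  have "m + l = n \<longleftrightarrow> (\<forall>i. lookup m i \<le> lookup n i) \<and> l = n - m"
    unfolding poly_mapping_eq_iff fun_eq_iff lookup_add lookup_minus by (metis add_diff_cancel_left' le_add1 le_add_diff_inverse)
  then show ?case by (auto simp: mult_single lookup_single when_def)
qed (simp_all add: lookup_add algebra_simps)

text \<open>A normal form for exponents in which addition, equality and divisibility become
  arithmetic on four numerals, so that single coefficients of explicit products can be computed by
  rewriting.\<close>

definition mon :: "nat \<Rightarrow> nat \<Rightarrow> nat \<Rightarrow> nat \<Rightarrow> 4 \<Rightarrow>\<^sub>0 nat" where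
  "mon a b c d = single 0 a + single 1 b + single 2 c + single 3 d"

lemma lookup_mon: "lookup (mon a b c d) 0 = a" "lookup (mon a b c d) 1 = b" "lookup (mon a b c d) 2 = c" "lookup (mon a b c d) 3 = d"
  unfolding mon_def lookup_add lookup_single when_def using distinct_4 by simp_all

lemma mon_eqI:
  assumes "lookup m 0 = a" "lookup m 1 = b" "lookup m 2 = c" "lookup m 3 = d"
  shows "m = mon a b c d"
proof -
  have "\<forall>i. lookup m i = lookup (mon a b c d) i" unfolding all_4 lookup_mon using assms by simp
  then show ?thesis by (intro poly_mapping_eqI) simp
qed

lemma mon_eq_iff: "mon a b c d = mon a' b' c' d' \<longleftrightarrow> a = a' \<and> b = b' \<and> c = c' \<and> d = d'"
  by (metis lookup_mon)

lemma mon_add: "mon a b c d + mon a' b' c' d' = mon (a + a') (b + b') (c + c') (d + d')"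
  by (rule mon_eqI) (simp_all add: lookup_add lookup_mon)

lemma lookup_mon_mult:
  fixes A :: "(4 \<Rightarrow>\<^sub>0 nat) \<Rightarrow>\<^sub>0 'a::comm_ring_1"
  shows "lookup (single (mon a b c d) k * A) (mon e f g h)
    = (if a \<le> e \<and> b \<le> f \<and> c \<le> g \<and> d \<le> h then k * lookup A (mon (e - a) (f - b) (g - c) (h - d)) else 0)"
proof -
  have "mon e f g h - mon a b c d = mon (e - a) (f - b) (g - c) (h - d)"
    by (rule mon_eqI) (simp_all add: lookup_minus lookup_mon)
  then show ?thesis unfolding lookup_monomial_mult all_4 lookup_mon by simp
qed

lemma var_mon: "vx = single (mon 1 0 0 0) 1" "vy = single (mon 0 1 0 0) 1" "vz = single (mon 0 0 1 0) 1" "vw = single (mon 0 0 0 1) 1"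
  unfolding var_def by (rule arg_cong2[where f = single, OF mon_eqI refl]; simp add: lookup_single when_def distinct_4 distinct_4[symmetric])+

lemma cst_mon: "cst c = single (mon 0 0 0 0) c"
  unfolding cst_def by (rule arg_cong2[where f = single, OF mon_eqI refl]; simp)

section \<open>Partial derivatives\<close>

lemma partial_deriv_linext:
  "partial_deriv i = linext (\<lambda>m c. single (m - single i 1) (of_nat (lookup m i) * c))"
  by (simp add: fun_eq_iff partial_deriv_def linext_def)

lemma partial_deriv_coeff_add:
  "single (m - single i 1) (of_nat (lookup m i) * (a + b)) = single (m - single i 1) (of_nat (lookup m i) * a)
    + single (m - single i 1) (of_nat (lookup m i) * (b :: 'a::field))"
  by (simp add: single_add[symmetric] distrib_left)

lemma partial_deriv_linear:
  "partial_deriv i 0 = 0" "partial_deriv i (A + B) = partial_deriv i A + partial_deriv i B"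
  "partial_deriv i (- A) = - partial_deriv i A" "partial_deriv i (A - B) = partial_deriv i A - partial_deriv i B"
  unfolding partial_deriv_linext
  by (rule linext_zero linext_add linext_uminus linext_diff, rule partial_deriv_coeff_add)+

lemma partial_deriv_single:
  "partial_deriv i (single m c) = single (m - single i 1) (of_nat (lookup m i) * c)"
  unfolding partial_deriv_linext by (rule linext_single) (rule partial_deriv_coeff_add)

lemma partial_deriv_mult: "partial_deriv i (A * B) = partial_deriv i A * B + A * partial_deriv i B"
proof (induction A rule: poly_mapping_add_induct)
  case (single m c)
  show ?case
  proof (induction B rule: poly_mapping_add_induct)
    case (single n d)
    \<comment> \<open>Subtraction of exponents is truncated, so the shift can fail to commute with
      adding n only if the variable is absent from m; in that case the coefficient is 0.\<close>
    have *: "single (m + n - single i 1) (of_nat (lookup m i) * x) = single (m - single i 1 + n) (of_nat (lookup m i) * x)"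
      for m n :: "4 \<Rightarrow>\<^sub>0 nat" and x :: 'a
    proof (cases "lookup m i = 0")
      case False
      have "m + n - single i 1 = m - single i 1 + n"
      proof (rule poly_mapping_eqI)
        fix k
        show "lookup (m + n - single i 1) k = lookup (m - single i 1 + n) k"
          using False by (cases "k = i") (auto simp: lookup_minus lookup_add lookup_single when_def)
      qed
      then show ?thesis by simp
    qed simp
    have "partial_deriv i (single m c * single n d) = single (m + n - single i 1) (of_nat (lookup m i) * (c * d))
      + single (n + m - single i 1) (of_nat (lookup n i) * (c * d))"
      unfolding mult_single partial_deriv_single single_add[symmetric] add.commute[of n m] by (simp add: lookup_add algebra_simps)
    also have "\<dots> = partial_deriv i (single m c) * single n d + single m c * partial_deriv i (single n d)"
      unfolding * partial_deriv_single mult_single by (simp add: ac_simps)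
    finally show ?case .
  qed (simp_all add: partial_deriv_linear algebra_simps)
qed (simp_all add: partial_deriv_linear algebra_simps)

lemma partial_deriv_cst: "partial_deriv i (cst c) = 0"
  by (simp add: cst_def partial_deriv_single)

lemma partial_deriv_numeral: "partial_deriv i (numeral n) = 0"
  using partial_deriv_cst[of i "numeral n"] by (simp add: cst_def)

lemma partial_deriv_var: "partial_deriv i (var j) = (if i = j then 1 else 0)"
  by (simp add: var_def partial_deriv_single lookup_single when_def)

lemma partial_deriv_power: "partial_deriv i (A ^ n) = of_nat n * A ^ (n - 1) * partial_deriv i A"
proof (induction n)
  case 0
  then show ?case using partial_deriv_cst[of i 1] by simp
next
  case (Suc n)
  then show ?case by (cases n) (simp_all add: partial_deriv_mult algebra_simps)
qed

section \<open>The Hasse-Witt matrix in terms of coefficients\<close>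

definition ring_ideal :: "'r::comm_ring_1 set \<Rightarrow> bool" where
  "ring_ideal I \<longleftrightarrow> 0 \<in> I \<and> (\<forall>x\<in>I. \<forall>y\<in>I. x + y \<in> I) \<and> (\<forall>r. \<forall>x\<in>I. r * x \<in> I)"

lemma ring_ideal_diff: "ring_ideal I \<Longrightarrow> x \<in> I \<Longrightarrow> y \<in> I \<Longrightarrow> x - y \<in> I"
proof -
  assume I: "ring_ideal I" and "x \<in> I" "y \<in> I"
  then have "x + (-1) * y \<in> I" unfolding ring_ideal_def by blast
  then show "x - y \<in> I" by simp
qed

lemma ring_ideal_mult_cong:
  assumes I: "ring_ideal I" and "a - a' \<in> I" "b - b' \<in> I"
  shows "a * b - a' * b' \<in> I"
proof -
  have "a * (b - b') + b' * (a - a') \<in> I" using assms unfolding ring_ideal_def by blast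
  then show ?thesis by (simp add: algebra_simps)
qed

lemma ring_ideal_power_cong:
  assumes I: "ring_ideal I" and "a - a' \<in> I"
  shows "a ^ n - a' ^ n \<in> I"
proof (induction n)
  case 0
  then show ?case using I by (simp add: ring_ideal_def)
next
  case (Suc n)
  then show ?case using ring_ideal_mult_cong[OF I assms(2) Suc] by simp
qed

text \<open>A polynomial is built from its arguments by sums and products, so it respects
  congruences modulo an ideal. All reductions modulo F, a variable, a point or a line go through
  this fact.\<close>

lemma insertion_cong_mod:
  assumes h: "ring_map h" and I: "ring_ideal I" and g: "\<And>i. g i - g' i \<in> I"
  shows "insertion h g A - insertion h g' A \<in> I"
proof (induction A rule: poly_mapping_add_induct)
  case zero
  then show ?case using I by (simp add: insertion_linear[OF h] ring_ideal_def)
next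
  case (single m c)
  have "(\<Prod>i\<in>UNIV. g i ^ lookup m i) - (\<Prod>i\<in>UNIV. g' i ^ lookup m i) \<in> I"
    unfolding prod_UNIV_4 by (intro ring_ideal_mult_cong[OF I] ring_ideal_power_cong[OF I] g)
  then have "h c * ((\<Prod>i\<in>UNIV. g i ^ lookup m i) - (\<Prod>i\<in>UNIV. g' i ^ lookup m i)) \<in> I"
    using I unfolding ring_ideal_def by blast
  then show ?case unfolding insertion_single[OF h] by (simp add: right_diff_distrib)
next
  case (add A B)
  then have "(insertion h g A - insertion h g' A) + (insertion h g B - insertion h g' B) \<in> I"
    using I unfolding ring_ideal_def by blast
  then show ?case unfolding insertion_linear[OF h] by (simp add: algebra_simps)
qed

lemma insertion_at_var: "ring_map h \<Longrightarrow> insertion h g (var i) = g i"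
  unfolding var_def by (rule insertion_var)

lemma insertion_at_cst: "ring_map h \<Longrightarrow> insertion h g (cst c) = h c"
  unfolding cst_def by (rule insertion_cst)

lemma insertion_cst_var: "insertion cst var A = A"
  by (rule insertion_unique[OF ring_map_cst, of "\<lambda>x. x", symmetric]) (simp_all add: cst_def var_def)

lemma insertion_homog:
  assumes "homog d A"
  shows "insertion h (\<lambda>i. x * g i) A = x ^ d * insertion h g A"
proof -
  have "h (lookup A m) * (\<Prod>i\<in>UNIV. (x * g i) ^ lookup m i) = x ^ d * (h (lookup A m) * (\<Prod>i\<in>UNIV. g i ^ lookup m i))"
    if "m \<in> keys A" for m
  proof -
    have "(\<Prod>i\<in>UNIV. (x * g i) ^ lookup m i) = x ^ mdeg m * (\<Prod>i\<in>UNIV. g i ^ lookup m i)"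
      by (simp add: power_mult_distrib prod.distrib mdeg_def power_sum)
    then show ?thesis using assms that by (simp add: homog_def mult.left_commute)
  qed
  then show ?thesis unfolding insertion_def linext_def sum_distrib_left by (intro sum.cong refl) simp
qed

lemma ring_ideal_dvd: "ring_ideal {x. F dvd x}"
  by (auto simp: ring_ideal_def)

lemma var_nonzero: "(var i :: 'a::field poly4) \<noteq> 0"
proof
  assume "var i = (0 :: 'a poly4)"
  then have "eval4 (\<chi> j. 1) (var i :: 'a poly4) = eval4 (\<chi> j. 1) 0" by simp
  then show False unfolding eval4_simps eval4_var by simp
qed

section \<open>Divisibility by a quadric that is linear in w\<close>

context
  fixes F q :: "'a::field poly4" and c :: 'a and a :: 4
  assumes F: "F = cst c * (var a * vw + q)" and c: "c \<noteq> 0" and a: "a \<noteq> 3" and q: "q \<noteq> 0"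
    and q_subst: "insertion cst (\<lambda>i. if i = 3 then - q else var a * var i) q = var a ^ 2 * q"
    and q_zero: "insertion cst (\<lambda>i. if i = a then 0 else var i) q = q"
begin

text \<open>At x_a = 0 the quadric becomes c q, which is nonzero. If x_a B = F C, then C vanishes at
  x_a = 0, so x_a divides C and can be cancelled.\<close>

lemma quadric_cancel_var:
  assumes "F dvd var a * B" shows "F dvd B"
proof -
  let ?\<chi> = "insertion cst (\<lambda>i. if i = a then 0 else var i)"
  note simps = insertion_simps[OF ring_map_cst]
  have var: "?\<chi> (var i) = (if i = a then 0 else var i)" for i
    by (rule insertion_at_var[OF ring_map_cst])
  obtain C where C: "var a * B = F * C" using assms by (elim dvdE)
  have "?\<chi> (var a * B) = ?\<chi> F * ?\<chi> C" unfolding C simps ..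
  moreover have "?\<chi> F = cst c * q"
    unfolding F simps var insertion_at_cst[OF ring_map_cst] q_zero by simp
  moreover have "cst c * q \<noteq> 0"
  proof
    assume "cst c * q = 0"
    then have "cst (inverse c) * (cst c * q) = 0" by simp
    then show False using c q by (simp add: mult.assoc[symmetric] cst_mult[symmetric])
  qed
  ultimately have "?\<chi> C = 0" unfolding simps var by simp
  have "var a dvd insertion cst var C - ?\<chi> C"
    using insertion_cong_mod[OF ring_map_cst ring_ideal_dvd[of "var a"], of var "\<lambda>i. if i = a then 0 else var i" C] by simp
  then obtain C' where "C = var a * C'" unfolding insertion_cst_var \<open>?\<chi> C = 0\<close> by (auto elim: dvdE)
  with C have "var a * B = var a * (F * C')" by (simp add: algebra_simps)
  then show ?thesis using var_nonzero[of a] by auto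
qed

text \<open>On the quadric w = - q / x_a. Cleared of the denominator this is a substitution that
  kills F, hence G B, hence B, as G survives. Modulo F it agrees with multiplying every variable by
  x_a, since - q is congruent to x_a w; so F divides x_a^d B, and the powers of x_a are
  cancelled.\<close>

lemma quadric_prime:
  assumes G: "insertion cst (\<lambda>i. if i = 3 then - q else var a * var i) G \<noteq> 0"
    and B: "homog d B" and dvd: "F dvd G * B"
  shows "F dvd B"
proof -
  let ?g = "\<lambda>i. if i = 3 then - q else var a * var i"
  note simps = insertion_simps[OF ring_map_cst]
  have var: "insertion cst ?g (var i) = ?g i" for i
    by (rule insertion_at_var[OF ring_map_cst])
  have "insertion cst ?g F = insertion cst ?g (cst c) * (?g a * ?g 3 + insertion cst ?g q)"
    unfolding F by (simp only: simps var)
  also have "?g a * ?g 3 + insertion cst ?g q = 0"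
    unfolding q_subst using a by (simp add: power2_eq_square)
  finally have "insertion cst ?g F = 0" by simp
  moreover obtain D where "G * B = F * D" using dvd by (elim dvdE)
  then have "insertion cst ?g G * insertion cst ?g B = insertion cst ?g F * insertion cst ?g D"
    unfolding insertion_mult[OF ring_map_cst, symmetric] by (rule arg_cong)
  ultimately have "insertion cst ?g G * insertion cst ?g B = 0" by simp
  with G have B0: "insertion cst ?g B = 0" by simp
  have "F dvd ?g i - var a * var i" for i
  proof (cases "i = 3")
    case True
    have "- q - var a * vw = F * cst (- inverse c)"
    proof -
      have "F * cst (- inverse c) = cst (c * - inverse c) * (var a * vw + q)" unfolding F cst_mult by (simp only: mult.assoc mult.commute mult.left_commute)
      also have "c * - inverse c = - 1" using c by simp
      finally show ?thesis by (simp add: cst_uminus)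
    qed
    then show ?thesis using True by simp
  qed simp
  then have "F dvd insertion cst ?g B - insertion cst (\<lambda>i. var a * var i) B"
    using insertion_cong_mod[OF ring_map_cst ring_ideal_dvd[of F], of ?g "\<lambda>i. var a * var i" B] by simp
  then have "F dvd var a ^ d * B" unfolding B0 insertion_homog[OF B] insertion_cst_var by simp
  then show ?thesis
  proof (induction d)
    case 0
    then show ?case by simp
  next
    case (Suc n)
    from Suc.prems have "F dvd var a * (var a ^ n * B)" by (simp only: power_Suc mult.assoc)
    then show ?case by (rule Suc.IH[OF quadric_cancel_var])
  qed
qed

end

section \<open>Sections over the open sets of the cover and Koszul exactness\<close>

definition nonneg_outside :: "4 set \<Rightarrow> 'a::field laurent4 \<Rightarrow> bool" where
  "nonneg_outside T f \<longleftrightarrow> (\<forall>m\<in>keys f. \<forall>i. i \<notin> T \<longrightarrow> 0 \<le> lookup m i)"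

text \<open>The sum of the absolute values of all exponents is a crude bound for the pole orders.
  The last conclusion holds for every larger exponent k, so that two sections can be cleared by a
  common monomial.\<close>

lemma clear_denominators:
  assumes "f \<in> sections T d"
  obtains n A where "to_laurent A = single (\<Sum>i\<in>T. single i (int n)) 1 * f" "\<exists>e. homog e A"
    "\<And>k. k \<ge> n \<Longrightarrow> \<exists>A. to_laurent A = single (\<Sum>i\<in>T. single i (int k)) 1 * f \<and> (\<exists>e. homog e A)"
proof -
  define n where "n = (\<Sum>m\<in>keys f. \<Sum>i\<in>UNIV. nat \<bar>lookup m i\<bar>)"
  have n: "- int n \<le> lookup m i" if "m \<in> keys f" for m i
  proof -
    have "nat \<bar>lookup m i\<bar> \<le> (\<Sum>i\<in>UNIV. nat \<bar>lookup m i\<bar>)" by (rule member_le_sum) simp_all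
    also have "\<dots> \<le> n" unfolding n_def by (rule member_le_sum[OF that]) simp_all
    finally show ?thesis by linarith
  qed
  have main: "\<exists>A. to_laurent A = single (\<Sum>i\<in>T. single i (int k)) 1 * f \<and> (\<exists>e. homog e A)" if k: "k \<ge> n" for k
  proof -
    define e where "e = (\<Sum>i\<in>T. single i (int k) :: 4 \<Rightarrow>\<^sub>0 int)"
    have e: "lookup e i = (if i \<in> T then int k else 0)" for i
      unfolding e_def by (simp add: lookup_sum lookup_single when_def)
    have pos: "0 \<le> lookup (e + m) i" if "m \<in> keys f" for m i
      using n[OF that, of i] k assms that unfolding lookup_add e sections_def by auto
    have mapnat: "Poly_Mapping.map int (Poly_Mapping.map nat (e + m)) = e + m" if "m \<in> keys f" for m
      by (rule poly_mapping_eqI) (simp add: lookup_map_int lookup_map_nat pos[OF that])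
    define A where "A = (\<Sum>m\<in>keys f. single (Poly_Mapping.map nat (e + m)) (lookup f m))"
    have "to_laurent A = (\<Sum>m\<in>keys f. single e 1 * single m (lookup f m))"
      unfolding A_def to_laurent_linear to_laurent_single mult_single
      by (intro sum.cong refl) (simp add: mapnat)
    then have "to_laurent A = single e 1 * f" unfolding sum_distrib_left[symmetric] sum_single_lookup .
    moreover have "homog (nat (int k * int (card T) + d)) A"
      unfolding homog_def
    proof
      fix l assume "l \<in> keys A"
      then obtain m where m: "m \<in> keys f" "l = Poly_Mapping.map nat (e + m)"
        unfolding A_def by (auto dest!: subsetD[OF keys_sum] split: if_splits)
      have "int (mdeg l) = (\<Sum>i\<in>UNIV. lookup (e + m) i)"
        unfolding mdeg_def m(2) lookup_map_nat of_nat_sum using pos[OF m(1)] by (intro sum.cong refl) simp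
      also have "\<dots> = int k * int (card T) + d"
        using assms m(1) unfolding lookup_add sum.distrib e sections_def mdeg_def by (simp add: sum.If_cases mult.commute)
      finally show "mdeg l = nat (int k * int (card T) + d)" by linarith
    qed
    ultimately show ?thesis unfolding e_def by blast
  qed
  obtain A where "to_laurent A = single (\<Sum>i\<in>T. single i (int n)) 1 * f" "\<exists>e. homog e A" using main[of n] by blast
  then show thesis using that main by blast
qed

text \<open>Exactness of the Koszul complex of F and G at its middle term, over every open set of
  the cover. What is recorded about c is where its poles lie; a missing pole makes its contribution
  to the trace vanish.\<close>

definition regular_pair :: "'a::field poly4 \<Rightarrow> 'a poly4 \<Rightarrow> bool" where
  "regular_pair F G \<longleftrightarrow> G \<noteq> 0 \<and> (\<forall>T a b. a \<in> sections T (-2) \<longrightarrow> b \<in> sections T (-3) \<longrightarrow>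
     to_laurent F * a + to_laurent G * b = 0 \<longrightarrow>
     (\<exists>c. nonneg_outside T c \<and> a = to_laurent G * c \<and> b = - (to_laurent F * c)))"

text \<open>A common monomial e clears the denominators of a and b. The resulting relation between
  polynomials gives F | B by hypothesis, and division by e returns c, whose poles involve only the
  variables in T.\<close>

lemma regular_pairI:
  assumes F: "F \<noteq> 0" and G: "G \<noteq> 0" and prime: "\<And>d B. homog d B \<Longrightarrow> F dvd G * B \<Longrightarrow> F dvd B"
  shows "regular_pair F G"
  unfolding regular_pair_def
proof (intro conjI allI impI)
  show "G \<noteq> 0" by (rule G)
  fix T and a b :: "'a laurent4"
  assume a: "a \<in> sections T (-2)" and b: "b \<in> sections T (-3)" and eq: "to_laurent F * a + to_laurent G * b = 0"
  obtain n1 where n1: "\<And>k. k \<ge> n1 \<Longrightarrow> \<exists>A. to_laurent A = single (\<Sum>i\<in>T. single i (int k)) 1 * a \<and> (\<exists>e. homog e A)"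
    by (rule clear_denominators[OF a]) blast
  obtain n2 where n2: "\<And>k. k \<ge> n2 \<Longrightarrow> \<exists>A. to_laurent A = single (\<Sum>i\<in>T. single i (int k)) 1 * b \<and> (\<exists>e. homog e A)"
    by (rule clear_denominators[OF b]) blast
  define e where "e = (\<Sum>i\<in>T. single i (int (max n1 n2)) :: 4 \<Rightarrow>\<^sub>0 int)"
  have e: "lookup e i = (if i \<in> T then int (max n1 n2) else 0)" for i
    unfolding e_def by (simp add: lookup_sum lookup_single when_def)
  obtain A B where A: "to_laurent A = single e 1 * a" and B: "to_laurent B = single e 1 * b" "\<exists>d. homog d B"
    using n1[of "max n1 n2"] n2[of "max n1 n2"] unfolding e_def by auto
  have "to_laurent (F * A + G * B) = single e 1 * (to_laurent F * a + to_laurent G * b)"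
    unfolding to_laurent_linear to_laurent_mult A B by (simp add: algebra_simps)
  also have "\<dots> = to_laurent 0" unfolding eq to_laurent_linear by simp
  finally have FG: "F * A + G * B = 0" unfolding to_laurent_inject .
  then have "G * B = F * (- A)" by (simp add: eq_neg_iff_add_eq_0 add.commute)
  then have "F dvd B" using prime B(2) by (metis dvd_triv_left)
  then obtain C where C: "B = F * C" by (elim dvdE)
  with FG have "F * (A + G * C) = 0" by (simp add: algebra_simps)
  then have AC: "A = - (G * C)" using F by (simp add: eq_neg_iff_add_eq_0)
  define c where "c = - (single (- e) 1 * to_laurent C)"
  have inv: "single (- e) 1 * (single e 1 * x) = x" for x :: "'a laurent4"
    by (simp add: mult.assoc[symmetric] mult_single)
  have "a = single (- e) 1 * to_laurent A" "b = single (- e) 1 * to_laurent B" unfolding A B inv by simp_all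
  then have "a = to_laurent G * c" "b = - (to_laurent F * c)"
    unfolding AC C c_def to_laurent_linear to_laurent_mult by (simp_all add: algebra_simps)
  moreover have "nonneg_outside T c"
    unfolding nonneg_outside_def
  proof (intro ballI allI impI)
    fix m i assume m: "m \<in> keys c" and i: "i \<notin> T"
    then obtain l where l: "l \<in> keys (to_laurent C)" "m = - e + l"
      unfolding c_def using keys_mult[of "single (- e) (1 :: 'a)" "to_laurent C"] by auto
    obtain l' where "l = Poly_Mapping.map int l'"
      using l(1) unfolding to_laurent_def by (auto dest!: subsetD[OF keys_sum] split: if_splits)
    then show "0 \<le> lookup m i" using i unfolding l(2) lookup_add lookup_uminus e by (simp add: lookup_map_int)
  qed
  ultimately show "\<exists>c. nonneg_outside T c \<and> a = to_laurent G * c \<and> b = - (to_laurent F * c)" by blast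
qed

lemma keys_uminus_laurent: "keys (- f :: 'a::field laurent4) = keys f"
  by (auto simp: in_keys_iff)

lemma sections_add: "f \<in> sections T d \<Longrightarrow> g \<in> sections T d \<Longrightarrow> f + g \<in> sections T d"
  unfolding sections_def using keys_add[of f g] by blast

lemma sections_uminus: "f \<in> sections T d \<Longrightarrow> - f \<in> sections T d"
  by (simp add: sections_def keys_uminus_laurent)

lemma sections_diff: "f \<in> sections T d \<Longrightarrow> g \<in> sections T d \<Longrightarrow> f - g \<in> sections T d"
  using sections_add[OF _ sections_uminus, of f T d g] by simp

lemma sections_zero: "0 \<in> sections T d"
  by (simp add: sections_def)

lemma sections_mono: "f \<in> sections T d \<Longrightarrow> T \<subseteq> T' \<Longrightarrow> f \<in> sections T' d"
  unfolding sections_def by blast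

lemma mdeg_add: "mdeg (m + n) = mdeg m + mdeg n"
  by (simp add: mdeg_def lookup_add sum.distrib)

lemma sections_mult: "f \<in> sections T d \<Longrightarrow> g \<in> sections T e \<Longrightarrow> f * g \<in> sections T (d + e)"
proof -
  assume f: "f \<in> sections T d" and g: "g \<in> sections T e"
  show ?thesis
    unfolding sections_def
  proof (intro CollectI ballI)
    fix m assume "m \<in> keys (f * g)"
    then obtain a b where "a \<in> keys f" "b \<in> keys g" "m = a + b" using keys_mult[of f g] by blast
    then show "mdeg m = d + e \<and> (\<forall>i. i \<notin> T \<longrightarrow> 0 \<le> lookup m i)"
      using f g unfolding sections_def by (auto simp: mdeg_add lookup_add)
  qed
qed

lemma sections_const: "single 0 c \<in> sections T 0"
  by (auto simp: sections_def mdeg_def)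

lemma sections_to_laurent: "homog d A \<Longrightarrow> to_laurent A \<in> sections T (int d)"
  unfolding sections_def
proof (intro CollectI ballI)
  fix k assume A: "homog d A" and "k \<in> keys (to_laurent A)"
  then obtain m where m: "m \<in> keys A" "k = Poly_Mapping.map int m"
    unfolding to_laurent_def by (auto dest!: subsetD[OF keys_sum] split: if_splits)
  then show "mdeg k = int d \<and> (\<forall>i. i \<notin> T \<longrightarrow> 0 \<le> lookup k i)"
    using A by (auto simp: mdeg_def lookup_map_int homog_def of_nat_sum[symmetric])
qed

section \<open>Zig-zags through the Koszul resolution and the trace\<close>

text \<open>The cochains of \<open>serre_pairing\<close> detached from the linear form and the
  trace, so that differences, multiples and Frobenius images of zig-zags can be formed.\<close>

definition zigzag :: "'a::field poly4 \<Rightarrow> 'a poly4 \<Rightarrow> 'a laurent4 ^ 4 ^ 4 \<Rightarrow> (4 \<Rightarrow> 4 \<Rightarrow> 4 \<Rightarrow> 'a laurent4) \<Rightarrow>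
    (4 \<Rightarrow> 4 \<Rightarrow> 4 \<Rightarrow> 'a laurent4) \<Rightarrow> (4 \<Rightarrow> 4 \<Rightarrow> 4 \<Rightarrow> 4 \<Rightarrow> 'a laurent4) \<Rightarrow> bool" where
  "zigzag F G f \<alpha> \<beta> \<gamma> \<longleftrightarrow>
     (\<forall>i j k. \<alpha> i j k \<in> sections {i, j, k} (-2) \<and> \<beta> i j k \<in> sections {i, j, k} (-3) \<and>
       f $ j $ k - f $ i $ k + f $ i $ j = to_laurent F * \<alpha> i j k + to_laurent G * \<beta> i j k) \<and>
     (\<forall>h i j k. \<gamma> h i j k \<in> sections {h, i, j, k} (-5) \<and>
       \<alpha> i j k - \<alpha> h j k + \<alpha> h i k - \<alpha> h i j = to_laurent G * \<gamma> h i j k \<and>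
       \<beta> i j k - \<beta> h j k + \<beta> h i k - \<beta> h i j = - (to_laurent F * \<gamma> h i j k))"

lemma serre_pairing_zigzag:
  "serre_pairing F G l f t \<longleftrightarrow> (\<exists>\<alpha> \<beta> \<gamma>. zigzag F G f \<alpha> \<beta> \<gamma> \<and>
     t = lookup (to_laurent l * \<gamma> 0 1 2 3) (\<Sum>i\<in>UNIV. single i (-1)))"
  unfolding serre_pairing_def zigzag_def by (simp only: conj_assoc)

lemma zigzag_diff:
  assumes "zigzag F G f \<alpha> \<beta> \<gamma>" "zigzag F G f' \<alpha>' \<beta>' \<gamma>'"
  shows "zigzag F G (f - f') (\<lambda>i j k. \<alpha> i j k - \<alpha>' i j k) (\<lambda>i j k. \<beta> i j k - \<beta>' i j k)
    (\<lambda>h i j k. \<gamma> h i j k - \<gamma>' h i j k)"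
proof -
  have 1: "(a - a') - (b - b') + (c - c') = x * (p - p') + y * (q - q')"
    if "a - b + c = x * p + y * q" "a' - b' + c' = x * p' + y * q'" for a b c a' b' c' x y p q p' q' :: "'a laurent4"
  proof -
    have "(a - a') - (b - b') + (c - c') = (a - b + c) - (a' - b' + c')" by (simp add: algebra_simps)
    then show ?thesis unfolding that by (simp add: algebra_simps)
  qed
  have 2: "(a - a') - (b - b') + (c - c') - (d - d') = x * (p - p')"
    if "a - b + c - d = x * p" "a' - b' + c' - d' = x * p'" for a b c d a' b' c' d' x p p' :: "'a laurent4"
  proof -
    have "(a - a') - (b - b') + (c - c') - (d - d') = (a - b + c - d) - (a' - b' + c' - d')" by (simp add: algebra_simps)
    then show ?thesis unfolding that by (simp add: algebra_simps)
  qed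
  have 3: "(a - a') - (b - b') + (c - c') - (d - d') = - (x * (p - p'))"
    if "a - b + c - d = - (x * p)" "a' - b' + c' - d' = - (x * p')" for a b c d a' b' c' d' x p p' :: "'a laurent4"
    using 2[of a b c d "- x" p a' b' c' d' p'] that by simp
  show ?thesis
    using assms unfolding zigzag_def vector_minus_component by (intro conjI allI sections_diff 1 2 3) blast+
qed

lemma zigzag_add:
  assumes "zigzag F G f \<alpha> \<beta> \<gamma>" "zigzag F G f' \<alpha>' \<beta>' \<gamma>'"
  shows "zigzag F G (f + f') (\<lambda>i j k. \<alpha> i j k + \<alpha>' i j k) (\<lambda>i j k. \<beta> i j k + \<beta>' i j k)
    (\<lambda>h i j k. \<gamma> h i j k + \<gamma>' h i j k)"
proof -
  have "zigzag F G (0 - f') (\<lambda>i j k. 0 - \<alpha>' i j k) (\<lambda>i j k. 0 - \<beta>' i j k) (\<lambda>h i j k. 0 - \<gamma>' h i j k)"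
    by (rule zigzag_diff[OF _ assms(2)]) (simp add: zigzag_def sections_zero)
  from zigzag_diff[OF assms(1) this] show ?thesis by simp
qed

lemma zigzag_scale:
  assumes "zigzag F G f \<alpha> \<beta> \<gamma>"
  shows "zigzag F G (scale_cochain c f) (\<lambda>i j k. single 0 c * \<alpha> i j k) (\<lambda>i j k. single 0 c * \<beta> i j k)
    (\<lambda>h i j k. single 0 c * \<gamma> h i j k)"
proof -
  have s: "single 0 c * x \<in> sections T d" if "x \<in> sections T d" for x T d
    using sections_mult[OF sections_const that] by simp
  have 1: "s * a - s * b + s * e = x * (s * p) + y * (s * q)" if "a - b + e = x * p + y * q" for s a b e x y p q :: "'a laurent4"
  proof -
    have "s * a - s * b + s * e = s * (a - b + e)" by (simp add: algebra_simps)
    then show ?thesis unfolding that by (simp add: algebra_simps)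
  qed
  have 2: "s * a - s * b + s * e - s * d = x * (s * p)" if "a - b + e - d = x * p" for s a b e d x p :: "'a laurent4"
  proof -
    have "s * a - s * b + s * e - s * d = s * (a - b + e - d)" by (simp add: algebra_simps)
    then show ?thesis unfolding that by (simp add: algebra_simps)
  qed
  have 3: "s * a - s * b + s * e - s * d = - (x * (s * p))" if "a - b + e - d = - (x * p)" for s a b e d x p :: "'a laurent4"
    using 2[of a b e d "- x" p s] that by simp
  have "scale_cochain c f $ i $ j = single 0 c * f $ i $ j" for i j by (simp add: scale_cochain_def)
  then show ?thesis
    using assms unfolding zigzag_def by (intro conjI allI) (simp_all only: s 1 2 3)
qed

lemma cube_add_laurent:
  assumes "(3 :: 'a::field) = 0"
  shows "(x + y) ^ 3 = x ^ 3 + (y :: 'a laurent4) ^ 3" "(x - y) ^ 3 = x ^ 3 - (y :: 'a laurent4) ^ 3"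
proof -
  have "(3 :: 'a laurent4) = single 0 3" by simp
  then have 3: "(3 :: 'a laurent4) = 0" using assms by simp
  show "(x + y) ^ 3 = x ^ 3 + y ^ 3" by (rule add_cube_char3[OF 3])
  show "(x - y) ^ 3 = x ^ 3 - y ^ 3" using add_cube_char3[OF 3, of x "- y"] by (simp add: power3_eq_cube)
qed

text \<open>Cubing is additive here. Splitting F^3 \<alpha>^3 as F times F^2 \<alpha>^3, and
  likewise for G, restores the shape of a zig-zag, and at the last stage F^2 G^2 appears in front of
  \<gamma>^3. This is where the coefficients of (F G)^2 come from. The degrees fit: 4 - 6 = -2, 6 -
  9 = -3, 4 + 6 - 15 = -5.\<close>

lemma zigzag_frobenius:
  assumes char3: "(3 :: 'a::field) = 0" and F: "homog 2 F" and G: "homog 3 (G :: 'a poly4)"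
    and z: "zigzag F G f \<alpha> \<beta> \<gamma>"
  shows "zigzag F G (frobenius_cochain f) (\<lambda>i j k. to_laurent F ^ 2 * \<alpha> i j k ^ 3)
    (\<lambda>i j k. to_laurent G ^ 2 * \<beta> i j k ^ 3) (\<lambda>h i j k. to_laurent (F ^ 2 * G ^ 2) * \<gamma> h i j k ^ 3)"
proof -
  note cube = cube_add_laurent[OF char3]
  have s2: "x ^ 2 \<in> sections T (d + d)" if "x \<in> sections T d" for x :: "'a laurent4" and T d
    using sections_mult[OF that that] by (simp add: power2_eq_square)
  have s3: "x ^ 3 \<in> sections T (d + d + d)" if "x \<in> sections T d" for x :: "'a laurent4" and T d
    using sections_mult[OF sections_mult[OF that that] that] by (simp add: power3_eq_cube)
  note F2 = s2[OF sections_to_laurent[OF F]] and G2 = s2[OF sections_to_laurent[OF G]]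
  have 1: "a ^ 3 - b ^ 3 + c ^ 3 = x * (x ^ 2 * p ^ 3) + y * (y ^ 2 * q ^ 3)"
    if "a - b + c = x * p + y * q" for a b c x y p q :: "'a laurent4"
  proof -
    have "a ^ 3 - b ^ 3 + c ^ 3 = (a - b + c) ^ 3" by (simp only: cube)
    then show ?thesis unfolding that cube by (simp add: power_mult_distrib power2_eq_square power3_eq_cube mult.assoc)
  qed
  have 2: "z * a ^ 3 - z * b ^ 3 + z * c ^ 3 - z * d ^ 3 = z * (x * p) ^ 3"
    if "a - b + c - d = x * p" for a b c d x p z :: "'a laurent4"
  proof -
    have "z * a ^ 3 - z * b ^ 3 + z * c ^ 3 - z * d ^ 3 = z * (a - b + c - d) ^ 3" by (simp only: cube) (simp add: algebra_simps)
    then show ?thesis unfolding that .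
  qed
  show ?thesis
    unfolding zigzag_def
  proof (intro conjI allI)
    fix h i j k
    show "to_laurent F ^ 2 * \<alpha> i j k ^ 3 \<in> sections {i, j, k} (-2)"
      using sections_mult[OF F2 s3, of "\<alpha> i j k" "{i, j, k}" "-2"] z unfolding zigzag_def by simp
    show "to_laurent G ^ 2 * \<beta> i j k ^ 3 \<in> sections {i, j, k} (-3)"
      using sections_mult[OF G2 s3, of "\<beta> i j k" "{i, j, k}" "-3"] z unfolding zigzag_def by simp
    show "to_laurent (F ^ 2 * G ^ 2) * \<gamma> h i j k ^ 3 \<in> sections {h, i, j, k} (-5)"
      using sections_mult[OF sections_mult[OF F2 G2] s3, of "\<gamma> h i j k" "{h, i, j, k}" "-5"] z
      unfolding zigzag_def to_laurent_mult to_laurent_power by simp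
    show "frobenius_cochain f $ j $ k - frobenius_cochain f $ i $ k + frobenius_cochain f $ i $ j
      = to_laurent F * (to_laurent F ^ 2 * \<alpha> i j k ^ 3) + to_laurent G * (to_laurent G ^ 2 * \<beta> i j k ^ 3)"
      using z unfolding zigzag_def frobenius_cochain_def vec_lambda_beta by (intro 1) blast
    have "to_laurent F ^ 2 * \<alpha> i j k ^ 3 - to_laurent F ^ 2 * \<alpha> h j k ^ 3 + to_laurent F ^ 2 * \<alpha> h i k ^ 3 - to_laurent F ^ 2 * \<alpha> h i j ^ 3
      = to_laurent F ^ 2 * (to_laurent G * \<gamma> h i j k) ^ 3"
      using z unfolding zigzag_def by (intro 2) blast
    then show "to_laurent F ^ 2 * \<alpha> i j k ^ 3 - to_laurent F ^ 2 * \<alpha> h j k ^ 3 + to_laurent F ^ 2 * \<alpha> h i k ^ 3 - to_laurent F ^ 2 * \<alpha> h i j ^ 3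
      = to_laurent G * (to_laurent (F ^ 2 * G ^ 2) * \<gamma> h i j k ^ 3)"
      by (simp add: to_laurent_mult to_laurent_power power_mult_distrib power2_eq_square power3_eq_cube ac_simps)
    have "to_laurent G ^ 2 * \<beta> i j k ^ 3 - to_laurent G ^ 2 * \<beta> h j k ^ 3 + to_laurent G ^ 2 * \<beta> h i k ^ 3 - to_laurent G ^ 2 * \<beta> h i j ^ 3
      = to_laurent G ^ 2 * ((- to_laurent F) * \<gamma> h i j k) ^ 3"
      using z unfolding zigzag_def by (intro 2) auto
    then show "to_laurent G ^ 2 * \<beta> i j k ^ 3 - to_laurent G ^ 2 * \<beta> h j k ^ 3 + to_laurent G ^ 2 * \<beta> h i k ^ 3 - to_laurent G ^ 2 * \<beta> h i j ^ 3
      = - (to_laurent F * (to_laurent (F ^ 2 * G ^ 2) * \<gamma> h i j k ^ 3))"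
      by (simp add: to_laurent_mult to_laurent_power power_mult_distrib power2_eq_square power3_eq_cube ac_simps)
  qed
qed

text \<open>For a coboundary, exactness shows that \<alpha> differs from a Cech coboundary by G c,
  where c i j k has poles in three variables only. Hence \<gamma> is an alternating sum of terms
  each of which lacks a pole in one variable, and no monomial with four negative exponents occurs in
  it.\<close>

lemma zigzag_coboundary:
  assumes reg: "regular_pair F G" and f: "f \<in> coboundaries F G" and z: "zigzag F G f \<alpha> \<beta> \<gamma>"
    and n: "\<And>i. lookup n i < 0"
  shows "lookup (\<gamma> 0 1 2 3) n = 0"
proof -
  obtain p where p: "\<And>i j. f $ i $ j - (p j - p i) \<in> ideal_sections F G {i, j}"
    using f unfolding coboundaries_def by blast
  have "\<exists>a b. a \<in> sections {i, j} (-2) \<and> b \<in> sections {i, j} (-3) \<and>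
      f $ i $ j = p j - p i + (to_laurent F * a + to_laurent G * b)" for i j
    using p[of i j] unfolding ideal_sections_def by (auto simp: algebra_simps)
  then obtain a b where a: "\<And>i j. a i j \<in> sections {i, j} (-2)" and b: "\<And>i j. b i j \<in> sections {i, j} (-3)"
    and fab: "\<And>i j. f $ i $ j = p j - p i + (to_laurent F * a i j + to_laurent G * b i j)"
    by metis
  have "\<exists>c. nonneg_outside {i, j, k} c \<and> \<alpha> i j k - (a j k - a i k + a i j) = to_laurent G * c \<and>
      \<beta> i j k - (b j k - b i k + b i j) = - (to_laurent F * c)" for i j k
  proof -
    have "\<alpha> i j k \<in> sections {i, j, k} (-2)" "\<beta> i j k \<in> sections {i, j, k} (-3)" using z unfolding zigzag_def by blast+
    moreover have "a j k - a i k + a i j \<in> sections {i, j, k} (-2)" "b j k - b i k + b i j \<in> sections {i, j, k} (-3)"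
      by (intro sections_add sections_diff sections_mono[OF a] sections_mono[OF b]; blast)+
    ultimately have s: "\<alpha> i j k - (a j k - a i k + a i j) \<in> sections {i, j, k} (-2)"
      "\<beta> i j k - (b j k - b i k + b i j) \<in> sections {i, j, k} (-3)"
      by (simp_all add: sections_diff)
    have "f $ j $ k - f $ i $ k + f $ i $ j = to_laurent F * \<alpha> i j k + to_laurent G * \<beta> i j k"
      using z unfolding zigzag_def by blast
    then have "to_laurent F * (\<alpha> i j k - (a j k - a i k + a i j)) + to_laurent G * (\<beta> i j k - (b j k - b i k + b i j)) = 0"
      unfolding fab by (simp add: algebra_simps)
    then show ?thesis using reg s unfolding regular_pair_def by blast
  qed
  then obtain c where c: "\<And>i j k. nonneg_outside {i, j, k} (c i j k)"
    and \<alpha>: "\<And>i j k. \<alpha> i j k - (a j k - a i k + a i j) = to_laurent G * c i j k" by metis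
  have "to_laurent G * \<gamma> 0 1 2 3 = \<alpha> 1 2 3 - \<alpha> 0 2 3 + \<alpha> 0 1 3 - \<alpha> 0 1 2"
    using z unfolding zigzag_def by metis
  also have "\<dots> = to_laurent G * (c 1 2 3 - c 0 2 3 + c 0 1 3 - c 0 1 2)"
    unfolding right_diff_distrib distrib_left \<alpha>[symmetric] by (simp add: algebra_simps)
  finally have \<gamma>: "\<gamma> 0 1 2 3 = c 1 2 3 - c 0 2 3 + c 0 1 3 - c 0 1 2"
    using reg to_laurent_inject[of G 0] unfolding regular_pair_def by (auto simp: to_laurent_linear)
  have "lookup (c i j k) n = 0" if "l \<notin> {i, j, k}" for i j k l
    using c[of i j k] n[of l] that unfolding nonneg_outside_def by (metis in_keys_iff not_le)
  from this[of 0 1 2 3] this[of 1 0 2 3] this[of 2 0 1 3] this[of 3 0 1 2] show ?thesis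
    unfolding \<gamma> by (simp add: lookup_add lookup_minus)
qed

lemma lookup_laurent_monomial_mult:
  fixes A :: "'a::comm_ring_1 laurent4"
  shows "lookup (single k c * A) n = c * lookup A (n - k)"
proof (induction A rule: poly_mapping_add_induct)
  case (single l d)
  have "k + l = n \<longleftrightarrow> l = n - k" by (metis add_diff_cancel_left' diff_add_cancel add.commute)
  then show ?case by (auto simp: mult_single lookup_single when_def)
qed (simp_all add: lookup_add algebra_simps)

text \<open>The exponent of 1 / (x y z w x_i). These are the only exponents of degree -5 with four
  negative entries, so they give the basis of H^3(P^3, O(-5)) dual to the variables.\<close>

definition dual_exp :: "4 \<Rightarrow> 4 \<Rightarrow>\<^sub>0 int" where
  "dual_exp i = (\<Sum>k\<in>UNIV. single k (-1)) - single i 1"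

lemma lookup_minus_ones: "lookup (\<Sum>k\<in>UNIV. single k (-1) :: 4 \<Rightarrow>\<^sub>0 int) l = -1"
  by (simp add: lookup_sum lookup_single when_def)

lemma lookup_dual_exp: "lookup (dual_exp i) k = (if k = i then -2 else -1)"
  unfolding dual_exp_def lookup_minus lookup_minus_ones by (simp add: lookup_single when_def)

lemma dual_exp_unique:
  assumes "mdeg k = -5" "\<And>i. lookup k i < 0"
  shows "\<exists>j. k = dual_exp j"
proof -
  have "lookup k 0 + lookup k 1 + lookup k 2 + lookup k 3 = -5" using assms(1) unfolding mdeg_def sum_UNIV_4 .
  then have "(lookup k 0 = -2 \<and> lookup k 1 = -1 \<and> lookup k 2 = -1 \<and> lookup k 3 = -1) \<or>
    (lookup k 0 = -1 \<and> lookup k 1 = -2 \<and> lookup k 2 = -1 \<and> lookup k 3 = -1) \<or>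
    (lookup k 0 = -1 \<and> lookup k 1 = -1 \<and> lookup k 2 = -2 \<and> lookup k 3 = -1) \<or>
    (lookup k 0 = -1 \<and> lookup k 1 = -1 \<and> lookup k 2 = -1 \<and> lookup k 3 = -2)"
    using assms(2)[of 0] assms(2)[of 1] assms(2)[of 2] assms(2)[of 3] by presburger
  then have "\<exists>j. \<forall>i. lookup k i = lookup (dual_exp j) i"
    unfolding all_4 lookup_dual_exp by (elim disjE) (rule exI[of _ 0], simp, rule exI[of _ 1], simp, rule exI[of _ 2], simp, rule exI[of _ 3], simp)
  then show ?thesis by (metis poly_mapping_eqI)
qed

lemma to_laurent_var: "to_laurent (var i) = single (single i 1) 1"
proof -
  have "Poly_Mapping.map int (single i 1) = single i 1" by (rule poly_mapping_eqI) (simp add: lookup_map_int lookup_single when_def)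
  then show ?thesis by (simp add: var_def to_laurent_single)
qed

lemma zero_in_coboundaries: "0 \<in> coboundaries F G"
proof -
  have "0 \<in> ideal_sections F G T" for T
    unfolding ideal_sections_def using sections_zero by force
  then show ?thesis unfolding coboundaries_def using sections_zero by (auto intro!: exI[of _ "\<lambda>i. 0"])
qed

text \<open>Monomials of g with a nonnegative exponent keep one after cubing, and multiplication by
  a polynomial cannot make it negative, so they do not reach \<open>dual_exp m\<close>. The
  surviving monomial is \<open>dual_exp j\<close> with coefficient 1, and e is
  \<open>dual_exp m\<close> - 3 \<open>dual_exp j\<close>; its entries are at least 1, so truncated
  subtraction is exact.\<close>

lemma lookup_cube:
  assumes char3: "(3 :: 'a::field) = 0" and g: "g \<in> sections T (-5)" "\<And>i. lookup g (dual_exp i) = (if i = j then 1 else 0)"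
    and e: "\<And>k. lookup e k = 2 + (if k = j then 3 else 0) - (if k = m then 1 else 0)"
  shows "lookup (to_laurent P * g ^ 3) (dual_exp m) = lookup (P :: 'a poly4) e"
proof -
  define L where "L = (\<lambda>f :: 'a laurent4. lookup (to_laurent P * f ^ 3) (dual_exp m))"
  have add: "L (x + y) = L x + L y" for x y
    unfolding L_def cube_add_laurent[OF char3] by (simp add: distrib_left lookup_add)
  have zero: "L 0 = 0" by (simp add: L_def)
  have single: "L (single k c) = c ^ 3 * lookup (to_laurent P) (dual_exp m - (k + k + k))" for k c
  proof -
    have "to_laurent P * single k c ^ 3 = single (k + k + k) (c ^ 3) * to_laurent P"
      by (simp only: power3_eq_cube mult_single mult.commute[of "to_laurent P"])
    then show ?thesis unfolding L_def by (simp only: lookup_laurent_monomial_mult)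
  qed
  have "L (\<Sum>k\<in>M. single k (lookup g k)) = (\<Sum>k\<in>M. L (single k (lookup g k)))" if "finite M" for M
    using that by (induction M) (simp_all add: zero add)
  from this[OF finite_keys[of g]] have "L g = (\<Sum>k\<in>keys g. L (single k (lookup g k)))"
    unfolding sum_single_lookup .
  also have "\<dots> = (\<Sum>k\<in>{dual_exp j}. L (single k (lookup g k)))"
  proof (rule sum.mono_neutral_right)
    show "{dual_exp j} \<subseteq> keys g" using g(2)[of j] by (simp add: in_keys_iff)
    show "\<forall>k\<in>keys g - {dual_exp j}. L (single k (lookup g k)) = 0"
    proof
      fix k assume k: "k \<in> keys g - {dual_exp j}"
      have "\<exists>i. \<not> lookup k i < 0"
      proof (rule ccontr)
        assume "\<nexists>i. \<not> lookup k i < 0"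
        then obtain i where "k = dual_exp i" using dual_exp_unique[of k] g(1) k unfolding sections_def by blast
        then show False using k g(2)[of i] by (auto simp: in_keys_iff split: if_splits)
      qed
      then obtain i where "\<not> lookup k i < 0" by blast
      then have "lookup (dual_exp m - (k + k + k)) i < 0"
        unfolding lookup_minus lookup_add lookup_dual_exp by (cases "i = m") auto
      moreover have "0 \<le> lookup l i" if "l \<in> keys (to_laurent P)" for l
        using that unfolding to_laurent_def by (auto dest!: subsetD[OF keys_sum] simp: lookup_map_int split: if_splits)
      ultimately have "lookup (to_laurent P) (dual_exp m - (k + k + k)) = 0" by (metis in_keys_iff not_le)
      then show "L (single k (lookup g k)) = 0" by (simp add: single)
    qed
  qed simp
  also have "\<dots> = lookup (to_laurent P) (dual_exp m - (dual_exp j + dual_exp j + dual_exp j))"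
    using g(2)[of j] by (simp add: single)
  also have "dual_exp m - (dual_exp j + dual_exp j + dual_exp j) = Poly_Mapping.map int e"
  proof (rule poly_mapping_eqI)
    fix k
    show "lookup (dual_exp m - (dual_exp j + dual_exp j + dual_exp j)) k = lookup (Poly_Mapping.map int e) k"
      unfolding lookup_map_int e lookup_minus lookup_add lookup_dual_exp by (cases "k = j"; cases "k = m") simp_all
  qed
  finally show ?thesis unfolding L_def lookup_to_laurent .
qed

text \<open>Frobenius of \<open>\<xi> j\<close> minus its expansion in the dual basis is a
  coboundary, so the coefficient at \<open>dual_exp i\<close> of its zig-zag vanishes. The expansion
  contributes H i j, the Frobenius zig-zag a coefficient of (F G)^2.\<close>

theorem hasse_witt_coeff:
  fixes F G :: "'a::field poly4" and H :: "'a ^ 4 ^ 4"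
  assumes char3: "(3 :: 'a) = 0" and F: "homog 2 F" and G: "homog 3 G" and reg: "regular_pair F G"
    and H: "is_hasse_witt_matrix F G H"
    and e: "\<And>k. lookup e k = 2 + (if k = j then 3 else 0) - (if k = i then 1 else 0)"
  shows "H $ i $ j = lookup (F ^ 2 * G ^ 2) e"
proof -
  obtain \<xi> where dual: "dual_basis F G \<xi>"
    and frob: "\<And>j. frobenius_cochain (\<xi> j) - (\<Sum>i\<in>UNIV. scale_cochain (H $ i $ j) (\<xi> i)) \<in> coboundaries F G"
    using H unfolding is_hasse_witt_matrix_def by blast
  have pair: "\<exists>\<alpha> \<beta> \<gamma>. zigzag F G (\<xi> j) \<alpha> \<beta> \<gamma> \<and> lookup (\<gamma> 0 1 2 3) (dual_exp i) = (if i = j then 1 else 0)" for i j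
  proof -
    have "serre_pairing F G (var i) (\<xi> j) (if i = j then 1 else 0)" using dual unfolding dual_basis_def by blast
    then obtain \<alpha> \<beta> \<gamma> where z: "zigzag F G (\<xi> j) \<alpha> \<beta> \<gamma>"
      and l: "(if i = j then 1 else 0) = lookup (to_laurent (var i) * \<gamma> 0 1 2 3) (\<Sum>i\<in>UNIV. single i (-1))"
      unfolding serre_pairing_zigzag by blast
    from l have "lookup (\<gamma> 0 1 2 3) (dual_exp i) = (if i = j then 1 else 0)"
      unfolding to_laurent_var lookup_laurent_monomial_mult dual_exp_def mult_1 by (rule sym)
    with z show ?thesis by blast
  qed
  then have "\<forall>j. \<exists>\<alpha> \<beta> \<gamma>. zigzag F G (\<xi> j) \<alpha> \<beta> \<gamma>" by blast
  then obtain \<alpha> \<beta> \<gamma> where z: "\<And>j. zigzag F G (\<xi> j) (\<alpha> j) (\<beta> j) (\<gamma> j)" by metis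
  have neg: "lookup (dual_exp i) k < 0" for i k by (simp add: lookup_dual_exp)
  \<comment> \<open>The pairings with different variables may come with different zig-zags. Their
    difference is a zig-zag of the zero cochain, so one fixed choice computes all four
    traces.\<close>
  have \<gamma>: "lookup (\<gamma> j 0 1 2 3) (dual_exp i) = (if i = j then 1 else 0)" for i j
  proof -
    obtain a b c where abc: "zigzag F G (\<xi> j) a b c" "lookup (c 0 1 2 3) (dual_exp i) = (if i = j then 1 else 0)"
      using pair[of j i] by blast
    have "\<xi> j - \<xi> j \<in> coboundaries F G" using zero_in_coboundaries by simp
    from zigzag_coboundary[OF reg this zigzag_diff[OF z abc(1)] neg, of i] abc(2) show ?thesis
      by (simp add: lookup_minus)
  qed
  note S = zigzag_scale[OF z[of 0], of "H $ 0 $ j"] zigzag_scale[OF z[of 1], of "H $ 1 $ j"]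
    zigzag_scale[OF z[of 2], of "H $ 2 $ j"] zigzag_scale[OF z[of 3], of "H $ 3 $ j"]
  note Z = zigzag_diff[OF zigzag_frobenius[OF char3 F G z[of j]] zigzag_add[OF zigzag_add[OF zigzag_add[OF S(1,2)] S(3)] S(4)]]
  have *: "x = (\<Sum>k\<in>UNIV. H $ k $ j * d k)"
    if "x - (H $ 0 $ j * d 0 + H $ 1 $ j * d 1 + H $ 2 $ j * d 2 + H $ 3 $ j * d 3) = 0" for x d
    using that unfolding sum_UNIV_4 by simp
  note zigzag_coboundary[OF reg frob[of j, unfolded sum_UNIV_4] Z neg, of i,
    unfolded lookup_minus lookup_add lookup_laurent_monomial_mult diff_zero \<gamma>]
  from *[OF this]
  have "lookup (to_laurent (F ^ 2 * G ^ 2) * \<gamma> j 0 1 2 3 ^ 3) (dual_exp i) = (\<Sum>k\<in>UNIV. H $ k $ j * (if i = k then 1 else 0))"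
    .
  moreover have "\<gamma> j 0 1 2 3 \<in> sections {0, 1, 2, 3} (-5)" using z[of j] unfolding zigzag_def by blast
  from lookup_cube[OF char3 this \<gamma> e]
  have "lookup (to_laurent (F ^ 2 * G ^ 2) * \<gamma> j 0 1 2 3 ^ 3) (dual_exp i) = lookup (F ^ 2 * G ^ 2) e" .
  moreover have "(\<Sum>k\<in>UNIV. H $ k $ j * (if i = k then 1 else 0)) = (\<Sum>k\<in>UNIV. if i = k then H $ k $ j else 0)"
    by (intro sum.cong refl) simp
  ultimately show ?thesis by (simp only: sum.delta' sum.delta finite UNIV_I if_True)
qed

declare One_nat_def [simp del]

section \<open>Curve points in the kernel plane\<close>

text \<open>The point is (s:t, u:v) = (0:1, 0:1), on the curve and in the plane, with vanishing
  first derivative; \<open>c 0 2 = 0\<close> is arranged beforehand. Smoothness makes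
  \<open>c 0 1\<close> invertible, which lets the 16 equations be solved one after the
  other.\<close>

lemma local_structure_normalized:
  fixes c l r :: "nat \<Rightarrow> nat \<Rightarrow> 'a::alg_closed_field"
  assumes char3: "(3::'a) = 0" and hw: "hw_rank1 c l r" and smooth: "smooth_bicubic c"
    and l: "bilin l ls lt lu lv \<noteq> 0" and r: "bilin r rs rt ru rv \<noteq> 0"
    and c0: "c 0 0 = 0" "c 1 0 = 0" "c 0 2 = 0" "l 0 0 = 0"
  shows "l 1 0 = 0 \<and> l 0 1 \<noteq> 0 \<and> c 2 0 = 0"
proof -
  note E = hw_rank1_coeffs[OF char3 hw, unfolded c0]
  have sing: "(s, t) \<noteq> (0, 0) \<Longrightarrow> (u, v) \<noteq> (0, 0) \<Longrightarrow> bicubic c s t u v = 0 \<Longrightarrow> deriv1 c s t u v = 0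
    \<Longrightarrow> deriv2 c s t u v \<noteq> 0" for s t u v
    using smooth unfolding smooth_bicubic_def by blast
  have a1: "c 0 1 \<noteq> 0"
    using sing[of 0 1 0 1] c0 unfolding bicubic_defs by simp
  have c11: "c 1 1 = 0" using E(2) a1 by simp
  have c20: "c 2 0 = 0" using E(5) a1 by simp
  have c21: "c 2 1 = 0" using E(6) a1 c11 by simp
  note E = E[unfolded c11 c20 c21]
  have "\<not> (r 0 0 = 0 \<and> r 0 1 = 0 \<and> r 1 0 = 0 \<and> r 1 1 = 0)" using r unfolding bilin_def by auto
  then have r': "r 0 0 \<noteq> 0 \<or> r 0 1 \<noteq> 0 \<or> r 1 0 \<noteq> 0 \<or> r 1 1 \<noteq> 0" by blast
  have l': "l 0 1 \<noteq> 0 \<or> l 1 0 \<noteq> 0 \<or> l 1 1 \<noteq> 0" using l c0(4) unfolding bilin_def by auto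
  \<comment> \<open>If \<open>l 0 1\<close> were 0, smoothness at (0:1, 1:0) would give
    \<open>c 0 3\<close> \<noteq> 0; the equations then annihilate every product of a cubed entry of
    \<open>l\<close> with an entry of \<open>r\<close>, so one of the two forms would be
    zero.\<close>
  have gamma: "l 0 1 \<noteq> 0"
  proof
    assume g: "l 0 1 = 0"
    have c13: "c 1 3 = 0" using E(3) a1 g by simp
    have "c 0 3 \<noteq> 0" using sing[of 0 1 1 0] c0 c13 unfolding bicubic_defs by auto
    then have "c 1 2 = 0" "c 2 2 = 0" using E(4,8) g c13 by simp_all
    moreover from this have "c 2 3 = 0" using E(7) g a1 by simp
    ultimately have "l 1 0 ^ 3 * r i j = 0 \<and> l 1 1 ^ 3 * r i j = 0" if "i \<in> {0, 1}" "j \<in> {0, 1}" for i j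
      using E(9-16) c13 that by auto
    from this[of 0 0] this[of 0 1] this[of 1 0] this[of 1 1] r' l' g show False by auto
  qed
  \<comment> \<open>If this entry is nonzero, the equations express the form through few parameters.
    It is then singular at a point that can be written down.\<close>
  moreover have "l 1 0 = 0"
  proof (rule ccontr)
    assume b: "l 1 0 \<noteq> 0"
    have r0: "r 0 0 = 0" "r 1 0 = 0" using E(9,13) b by simp_all
    have c13: "c 1 3 = 0" using E(3) a1 r0 by simp
    have b2: "c 1 2 \<noteq> 0"
    proof
      assume z: "c 1 2 = 0"
      then have "c 2 3 = 0" using E(7) a1 r0 by simp
      moreover have "c 2 2 = 0" using E(11) z r0 c13 by simp
      ultimately show False using E(4,8) z gamma r' r0 by simp
    qed
    \<comment> \<open>The parameters of the solution: z compares the third row with the second, and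
      k is the common factor of the cubed entries of \<open>l\<close> inside \<open>c 0 3\<close>,
      \<open>c 3 0\<close> and \<open>c 3 3\<close>.\<close>
    define z where "z = c 2 2 / c 1 2"
    define k where "k = - (r 0 1 / c 1 2)"
    have c22: "c 2 2 = z * c 1 2" using b2 by (simp add: z_def)
    have r01: "r 0 1 = - (k * c 1 2)" using b2 by (simp add: k_def)
    have c03: "c 0 3 = k * l 0 1 ^ 3" using E(4) b2 by (simp add: c13 r01)
    have c30: "c 3 0 = k * l 1 0 ^ 3" using E(10) b2 by (simp add: r01)
    have c23: "c 2 3 = c 1 2 ^ 2 / c 0 1" using E(7) a1 by (simp add: r0 c22 c13 divide_simps mult.commute)
    have c32: "c 3 2 = z^2 * c 1 2" using E(11) b2 by (simp add: r0 c22 c13 power2_eq_square)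
    have c31: "c 3 1 = - (z^3 * c 0 1)"
    proof -
      have "c 1 2 ^ 2 * (c 3 1 + z^3 * c 0 1) = 0"
        using E(15) a1 by (simp add: r0 c22 c32 c23 divide_simps power2_eq_square power3_eq_cube algebra_simps)
      then show ?thesis using b2 by (simp add: eq_neg_iff_add_eq_0)
    qed
    have c33: "c 3 3 = k * l 1 1 ^ 3 - z * c 2 3"
    proof -
      have "c 1 2 * (c 3 3 - (k * l 1 1 ^ 3 - z * c 2 3)) = 0"
        using E(12) by (simp add: c13 c22 r01 algebra_simps)
      then show ?thesis using b2 by simp
    qed
    define w where "w = c 0 1 / c 1 2"
    have w: "w \<noteq> 0" "c 1 2 * w = c 0 1" using a1 b2 by (simp_all add: w_def)
    \<comment> \<open>The singular point has t = 1 + z s, v = 1 and u = w / s, so that t - z s = 1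
      and s u = w make both derivatives vanish. It must also lie in the plane of \<open>l\<close>;
      that condition, multiplied by s, is this quadratic. Its constant term is nonzero, hence so is
      s.\<close>
    obtain s where s: "poly [:l 0 1 * w, (l 1 1 + l 0 1 * z) * w, l 1 0:] s = 0"
      using alg_closed_imp_poly_has_root[of "[:l 0 1 * w, (l 1 1 + l 0 1 * z) * w, l 1 0:]"] b by auto
    then have s0: "s \<noteq> 0" using w gamma by auto
    define u where "u = w / s"
    define t where "t = 1 + z * s"
    have su: "s * u = w" using s0 by (simp add: u_def)
    have bsu: "c 1 2 * (s * u) = c 0 1" using su w by simp
    have "c 2 3 * (s * u) = c 1 2 * (c 1 2 * (s * u)) / c 0 1" by (simp add: c23 power2_eq_square)
    then have c23su: "c 2 3 * (s * u) = c 1 2" using a1 unfolding bsu by simp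
    have lam: "l 1 1 * (s * u) + l 1 0 * s + l 0 1 * (t * u) = 0"
    proof -
      have "s * (l 1 1 * w + l 1 0 * s + l 0 1 * (t * u)) = l 0 1 * (s * u) + l 0 1 * z * s * (s * u) + l 1 1 * w * s + l 1 0 * s * s"
        unfolding t_def by (simp add: algebra_simps)
      also have "\<dots> = 0" unfolding su using s by (simp add: algebra_simps)
      finally show ?thesis using s0 su by simp
    qed
    have d1: "deriv1 c s t u 1 = 0"
    proof -
      have "deriv1 c s t u 1 = u^2 * (c 1 2 * (t - z * s) - c 2 3 * (s * u))"
        unfolding bicubic_defs by (simp add: c0 c11 c13 c20 c21 c22 algebra_simps power2_eq_square power3_eq_cube)
      also have "c 2 3 * (s * u) = c 1 2" unfolding c23su ..
      finally show ?thesis by (simp add: t_def)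
    qed
    have d2: "deriv2 c s t u 1 = 0"
    proof -
      have "deriv2 c s t u 1 = c 0 1 * (t^3 - z^3 * s^3) - c 1 2 * (s * u) * (t^2 + z * s * t + z^2 * s^2)"
        unfolding bicubic_defs by (simp add: c0 c11 c21 c22 c31 c32 algebra_simps power2_eq_square power3_eq_cube)
      also have "\<dots> = c 0 1 * (t - z * s - 1) * (t^2 + z * s * t + z^2 * s^2)"
        unfolding bsu by (simp add: algebra_simps power2_eq_square power3_eq_cube)
      finally show ?thesis by (simp add: t_def)
    qed
    have f: "bicubic c s t u 1 = 0"
    proof -
      have "bicubic c s t u 1 = k * ((l 1 1 * (s * u))^3 + (l 1 0 * s)^3 + (l 0 1 * (t * u))^3)
        + c 0 1 * u * (t^3 - z^3 * s^3) + c 1 2 * (s * u) * u * (t^2 + z * s * t + z^2 * s^2)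
        + c 2 3 * (s * u) * (s * u) * u * (t - z * s)"
        unfolding bicubic_defs
        by (simp add: c0 c11 c13 c20 c21 c22 c31 c32 c33 c03 c30 algebra_simps power2_eq_square power3_eq_cube)
      also have "(l 1 1 * (s * u))^3 + (l 1 0 * s)^3 + (l 0 1 * (t * u))^3 = 0"
        using arg_cong[OF lam, of "\<lambda>x. x^3"] by (simp add: add_cube_char3[OF char3])
      also have "c 2 3 * (s * u) * (s * u) = c 0 1" unfolding c23su bsu ..
      \<comment> \<open>Since t = 1 + z s, each of the three remaining terms equals
        \<open>c 0 1 * u\<close> in characteristic 3, so their sum is zero.\<close>
      also have "k * 0
        + c 0 1 * u * (t^3 - z^3 * s^3) + c 1 2 * (s * u) * u * (t^2 + z * s * t + z^2 * s^2) + c 0 1 * u * (t - z * s)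
        = c 0 1 * u * (3 + 6 * z * s + 6 * (z * s)^2)"
        unfolding bsu t_def by (simp add: algebra_simps power2_eq_square power3_eq_cube)
      finally show ?thesis by (simp add: numerals_char3[OF char3] char3)
    qed
    from sing[OF _ _ f d1] d2 s0 show False by simp
  qed
  ultimately show ?thesis using c20 by simp
qed

lemma subst1_surj:
  assumes "(q * m - p * n :: 'a::field) \<noteq> 0"
  obtains s' t' where "s = m * s' + n * t'" "t = p * s' + q * t'"
proof
  show "s = m * ((q * s - n * t) / (q * m - p * n)) + n * ((m * t - p * s) / (q * m - p * n))"
    "t = p * ((q * s - n * t) / (q * m - p * n)) + q * ((m * t - p * s) / (q * m - p * n))"
    using assms by (simp_all add: divide_simps) (simp_all add: algebra_simps)
qed

lemma complete_basis:
  assumes "(n, q) \<noteq> (0::'a::field, 0)"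
  obtains m p where "q * m - p * n \<noteq> 0"
  using assms by (cases "q = 0") (auto intro: that[of 1 0] that[of 0 1])

lemma bilin_scale: "bilin (\<lambda>i j. d * x i j) s t u v = d * bilin x s t u v"
  unfolding bilin_def by (simp add: algebra_simps)

text \<open>The given point serves as second column of an invertible matrix in each factor, so that
  it becomes (0:1, 0:1).\<close>

lemma change_coordinates:
  fixes c l r :: "nat \<Rightarrow> nat \<Rightarrow> 'a::field"
  assumes char3: "(3::'a) = 0" and hw: "hw_rank1 c l r" and smooth: "smooth_bicubic c"
    and nz: "(s0, t0) \<noteq> (0, 0)" "(u0, v0) \<noteq> (0, 0)"
  obtains c1 l1 r1 m p m' p' where "t0 * m - p * s0 \<noteq> 0" "v0 * m' - p' * u0 \<noteq> 0" "hw_rank1 c1 l1 r1" "smooth_bicubic c1"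
    "\<And>s t u v. bicubic c1 s t u v = bicubic c (m * s + s0 * t) (p * s + t0 * t) (m' * u + u0 * v) (p' * u + v0 * v)"
    "\<And>s t u v. deriv1 c1 s t u v = (t0 * m - p * s0) * deriv1 c (m * s + s0 * t) (p * s + t0 * t) (m' * u + u0 * v) (p' * u + v0 * v)"
    "\<And>s t u v. deriv2 c1 s t u v = (v0 * m' - p' * u0) * deriv2 c (m * s + s0 * t) (p * s + t0 * t) (m' * u + u0 * v) (p' * u + v0 * v)"
    "\<And>s t u v. bilin l1 s t u v = bilin l (m * s + s0 * t) (p * s + t0 * t) (m' * u + u0 * v) (p' * u + v0 * v)"
    "\<And>s t u v. bilin r1 s t u v = (v0 * m' - p' * u0) * ((t0 * m - p * s0)
      * bilin r (m * s + s0 * t) (p * s + t0 * t) (m' * u + u0 * v) (p' * u + v0 * v))"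
proof -
  obtain m p where D: "t0 * m - p * s0 \<noteq> 0" using complete_basis[OF nz(1)] by metis
  obtain m' p' where D': "v0 * m' - p' * u0 \<noteq> 0" using complete_basis[OF nz(2)] by metis
  let ?D = "t0 * m - p * s0" and ?D' = "v0 * m' - p' * u0"
  define c1 where "c1 = transp (subst1 m' u0 p' v0 (transp (subst1 m s0 p t0 c)))"
  define l1 where "l1 = transp (lsubst1 m' u0 p' v0 (transp (lsubst1 m s0 p t0 l)))"
  define r1 where "r1 = transp (\<lambda>i j. ?D' * lsubst1 m' u0 p' v0 (transp (\<lambda>i j. ?D * lsubst1 m s0 p t0 r i j)) i j)"
  have "hw_rank1 (transp (subst1 m s0 p t0 c)) (transp (lsubst1 m s0 p t0 l)) (transp (\<lambda>i j. ?D * lsubst1 m s0 p t0 r i j))"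
    by (rule hw_rank1_transp, rule hw_rank1_subst1[OF char3 hw]) simp
  from hw_rank1_transp[OF hw_rank1_subst1[OF char3 this, of v0 m' p' u0, OF refl]]
  have hw1: "hw_rank1 c1 l1 r1" unfolding c1_def l1_def r1_def .
  have smooth1: "smooth_bicubic c1"
    unfolding c1_def by (intro smooth_transp smooth_subst1 char3 smooth D D')
  show thesis
    by (rule that[OF D D' hw1 smooth1])
      (simp_all only: c1_def l1_def r1_def transp_simps subst1_simps[OF char3] bilin_scale bilin_lsubst1)
qed

text \<open>If the derivative along the first ruling vanishes at a curve point of the kernel plane,
  the plane contains the line of that ruling through the point but not the other line. The
  derivative vanishes on all of this line, so the form restricts to it as a sum of two
  cubes.\<close>

lemma local_structure:
  fixes c l r :: "nat \<Rightarrow> nat \<Rightarrow> 'a::alg_closed_field"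
  assumes char3: "(3::'a) = 0" and hw: "hw_rank1 c l r" and smooth: "smooth_bicubic c"
    and l: "bilin l ls lt lu lv \<noteq> 0" and r: "bilin r rs rt ru rv \<noteq> 0"
    and nz: "(s0, t0) \<noteq> (0, 0)" "(u0, v0) \<noteq> (0, 0)"
    and P: "bicubic c s0 t0 u0 v0 = 0" "bilin l s0 t0 u0 v0 = 0" "deriv1 c s0 t0 u0 v0 = 0"
  shows "bilin l s t u0 v0 = 0" "\<exists>u v. bilin l s0 t0 u v \<noteq> 0" "deriv1 c s t u0 v0 = 0"
proof -
  obtain c1 l1 r1 m p m' p' where D: "t0 * m - p * s0 \<noteq> 0" and D': "v0 * m' - p' * u0 \<noteq> 0"
    and hw1: "hw_rank1 c1 l1 r1" and smooth1: "smooth_bicubic c1"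
    and c1: "\<And>s t u v. bicubic c1 s t u v = bicubic c (m * s + s0 * t) (p * s + t0 * t) (m' * u + u0 * v) (p' * u + v0 * v)"
    "\<And>s t u v. deriv1 c1 s t u v = (t0 * m - p * s0) * deriv1 c (m * s + s0 * t) (p * s + t0 * t) (m' * u + u0 * v) (p' * u + v0 * v)"
    and l1: "\<And>s t u v. bilin l1 s t u v = bilin l (m * s + s0 * t) (p * s + t0 * t) (m' * u + u0 * v) (p' * u + v0 * v)"
    and r1: "\<And>s t u v. bilin r1 s t u v = (v0 * m' - p' * u0) * ((t0 * m - p * s0)
      * bilin r (m * s + s0 * t) (p * s + t0 * t) (m' * u + u0 * v) (p' * u + v0 * v))"
    by (rule change_coordinates[OF char3 hw smooth nz]) (rule that; assumption)
  have lnz: "\<exists>s t u v. bilin l1 s t u v \<noteq> 0"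
    using l subst1_surj[OF D, of ls lt] subst1_surj[OF D', of lu lv] unfolding l1 by metis
  have rnz: "\<exists>s t u v. bilin r1 s t u v \<noteq> 0"
    using r D D' subst1_surj[OF D, of rs rt] subst1_surj[OF D', of ru rv] unfolding r1 by (metis mult_eq_0_iff)
  have c00: "c1 0 0 = 0" using c1(1)[of 0 1 0 1] P(1) unfolding bicubic_defs by simp
  have c10: "c1 1 0 = 0" using c1(2)[of 0 1 0 1] P(3) unfolding bicubic_defs by simp
  have l00: "l1 0 0 = 0" using l1[of 0 1 0 1] P(2) unfolding bilin_def by simp
  have c01: "c1 0 1 \<noteq> 0"
    using smooth1[unfolded smooth_bicubic_def, rule_format, of 0 1 0 1] c00 c10 unfolding bicubic_defs by auto
  \<comment> \<open>The shear v -> v + x u turns \<open>c1 0 2\<close> into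
    \<open>c1 0 2 + 2 * c1 0 1 * x\<close>, which is 3 \<open>c1 0 2\<close> for this x and hence
    0.\<close>
  define x where "x = c1 0 2 / c1 0 1"
  define c2 where "c2 = transp (subst1 1 0 x 1 (transp c1))"
  define l2 where "l2 = transp (lsubst1 1 0 x 1 (transp l1))"
  define r2 where "r2 = transp (\<lambda>i j. 1 * lsubst1 1 0 x 1 (transp r1) i j)"
  have hw2: "hw_rank1 c2 l2 r2" unfolding c2_def l2_def r2_def
    by (rule hw_rank1_transp, rule hw_rank1_subst1[OF char3 hw_rank1_transp[OF hw1]]) simp
  have smooth2: "smooth_bicubic c2"
    unfolding c2_def by (intro smooth_transp smooth_subst1 char3 smooth1) simp
  have l2: "bilin l2 s t u v = bilin l1 s t u (x * u + v)" for s t u v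
    unfolding l2_def transp_simps bilin_lsubst1 by simp
  have r2: "bilin r2 s t u v = bilin r1 s t u (x * u + v)" for s t u v
    unfolding r2_def transp_simps bilin_scale bilin_lsubst1 by simp
  have lnz2: "\<exists>s t u v. bilin l2 s t u v \<noteq> 0" unfolding l2 using lnz by (metis diff_add_cancel add.commute)
  have rnz2: "\<exists>s t u v. bilin r2 s t u v \<noteq> 0" unfolding r2 using rnz by (metis diff_add_cancel add.commute)
  have "c1 0 2 + 2 * c1 0 1 * x = 3 * c1 0 2" using c01 by (simp add: x_def)
  then have "c2 0 2 = 0"
    unfolding c2_def transp_def subst1_def using numerals_char3(1)[OF char3] by (simp add: char3)
  then have c2: "c2 0 0 = 0" "c2 1 0 = 0" "c2 0 2 = 0" "l2 0 0 = 0" "l2 1 0 = l1 1 0" "l2 0 1 = l1 0 1" "c2 2 0 = c1 2 0"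
    unfolding c2_def l2_def transp_def subst1_def lsubst1_def using c00 c10 l00 char3 by simp_all
  have res: "l1 1 0 = 0" "l1 0 1 \<noteq> 0" "c1 2 0 = 0"
    using lnz2 rnz2 local_structure_normalized[OF char3 hw2 smooth2 _ _ c2(1-4)] c2(5-7) by auto
  obtain s' t' where st: "s = m * s' + s0 * t'" "t = p * s' + t0 * t'" by (rule subst1_surj[OF D])
  show "bilin l s t u0 v0 = 0"
    using l1[of s' t' 0 1] unfolding st by (simp add: bilin_def l00 res)
  have "bilin l s0 t0 m' p' \<noteq> 0" using l1[of 0 1 1 0] res(2) by (simp add: bilin_def)
  then show "\<exists>u v. bilin l s0 t0 u v \<noteq> 0" by blast
  show "deriv1 c s t u0 v0 = 0"
    using c1(2)[of s' t' 0 1] D unfolding st by (simp add: deriv1_def row_def c10 res)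
qed

lemma binary_form_root:
  fixes p :: "'a::alg_closed_field poly"
  assumes "Polynomial.degree p \<le> n" "n > 0"
  obtains "Polynomial.coeff p n = 0" | x where "poly p x = 0"
  using assms alg_closed_imp_poly_has_root[of p] le_degree[of p n] by (cases "Polynomial.coeff p n = 0") auto

lemma bicubic_root_second:
  fixes c :: "nat \<Rightarrow> nat \<Rightarrow> 'a::alg_closed_field"
  obtains u v where "(u, v) \<noteq> (0, 0)" "bicubic c s t u v = 0"
proof -
  let ?k = "\<lambda>j. row (transp c) j s t"
  have eq: "bicubic c s t u v = ?k 0 * v^3 + ?k 1 * v^2 * u + ?k 2 * v * u^2 + ?k 3 * u^3" for u v
    using transp_simps(1)[of c u v s t] unfolding bicubic_def by simp
  show thesis
  proof (rule binary_form_root[of "[:?k 0, ?k 1, ?k 2, ?k 3:]" 3])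
    assume "Polynomial.coeff [:?k 0, ?k 1, ?k 2, ?k 3:] 3 = 0"
    then show thesis using that[of 1 0] by (simp add: eq numeral_eq_Suc One_nat_def)
  next
    fix x assume "poly [:?k 0, ?k 1, ?k 2, ?k 3:] x = 0"
    then show thesis using that[of x 1] by (simp add: eq algebra_simps power2_eq_square power3_eq_cube)
  qed simp_all
qed

lemma bicubic_root_first:
  fixes c :: "nat \<Rightarrow> nat \<Rightarrow> 'a::alg_closed_field"
  obtains s t where "(s, t) \<noteq> (0, 0)" "bicubic c s t u v = 0"
  using bicubic_root_second[of "transp c" u v] by (auto simp: transp_simps)

text \<open>On the diagonal the form is a binary sextic. It either has a finite root or vanishes at
  infinity, where the coefficient of degree 6 is 0.\<close>

lemma bicubic_diagonal_root:
  fixes c :: "nat \<Rightarrow> nat \<Rightarrow> 'a::alg_closed_field"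
  obtains s t where "(s, t) \<noteq> (0, 0)" "bicubic c s t s t = 0"
proof -
  let ?p = "[:c 0 0, c 0 1 + c 1 0, c 0 2 + c 1 1 + c 2 0, c 0 3 + c 1 2 + c 2 1 + c 3 0,
    c 1 3 + c 2 2 + c 3 1, c 2 3 + c 3 2, c 3 3:]"
  show thesis
  proof (rule binary_form_root[of ?p 6])
    assume "Polynomial.coeff ?p 6 = 0"
    then show thesis using that[of 1 0] by (simp add: bicubic_defs numeral_eq_Suc One_nat_def)
  next
    fix x assume "poly ?p x = 0"
    then show thesis using that[of x 1]
      by (simp add: bicubic_defs algebra_simps power2_eq_square power3_eq_cube)
  qed simp_all
qed

lemma bilin_kernel:
  assumes "l 0 0 * l 1 1 = l 0 1 * (l 1 0 :: 'a::field)"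
  obtains p0 p1 where "(p0, p1) \<noteq> (0, 0)" "\<And>u v. bilin l p0 p1 u v = 0"
proof (cases "(l 0 0, l 1 0) = (0, 0)")
  case False
  then show thesis using assms
    by (intro that[of "- l 0 0" "l 1 0"]) (auto simp: bilin_def algebra_simps)
next
  case True
  show thesis
  proof (cases "(l 0 1, l 1 1) = (0, 0)")
    case False
    then show thesis using True by (intro that[of "- l 0 1" "l 1 1"]) (auto simp: bilin_def algebra_simps)
  next
    case 2: True
    then show thesis using True by (intro that[of 1 0]) (auto simp: bilin_def)
  qed
qed

lemma bilin_kernel_det:
  assumes "(p0, p1) \<noteq> (0, 0)" "\<And>u v. bilin l p0 p1 u v = (0 :: 'a::field)"
  shows "l 0 0 * l 1 1 = l 0 1 * l 1 0"
proof -
  have "l 0 0 * p1 + l 1 0 * p0 = 0" "l 0 1 * p1 + l 1 1 * p0 = 0"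
    using assms(2)[of 0 1] assms(2)[of 1 0] by (simp_all add: bilin_def)
  moreover have "p0 * (l 0 0 * l 1 1 - l 0 1 * l 1 0) = l 0 0 * (l 0 1 * p1 + l 1 1 * p0) - l 0 1 * (l 0 0 * p1 + l 1 0 * p0)"
    "p1 * (l 0 0 * l 1 1 - l 0 1 * l 1 0) = l 1 1 * (l 0 0 * p1 + l 1 0 * p0) - l 1 0 * (l 0 1 * p1 + l 1 1 * p0)"
    by (simp_all add: algebra_simps)
  ultimately show ?thesis using assms(1) by auto
qed

context
  fixes c l r :: "nat \<Rightarrow> nat \<Rightarrow> 'a::alg_closed_field"
  assumes char3: "(3::'a) = 0" and hw: "hw_rank1 c l r" and smooth: "smooth_bicubic c"
    and l: "\<exists>s t u v. bilin l s t u v \<noteq> 0" and r: "\<exists>s t u v. bilin r s t u v \<noteq> 0"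
begin

text \<open>At a point where the form and \<open>l\<close> vanish, the identity of
  \<open>hw_rank1\<close> reduces to f_1 f_2 = 0. Each factor gives one of the cases, the second by
  exchanging the rulings.\<close>

lemma point_cases:
  assumes "(s0, t0) \<noteq> (0, 0)" "(u0, v0) \<noteq> (0, 0)"
    and "bicubic c s0 t0 u0 v0 = 0" "bilin l s0 t0 u0 v0 = 0"
  obtains (first) "\<And>s t. bilin l s t u0 v0 = 0" "\<exists>u v. bilin l s0 t0 u v \<noteq> 0" "\<And>s t. deriv1 c s t u0 v0 = 0"
  | (second) "\<And>u v. bilin l s0 t0 u v = 0" "\<exists>s t. bilin l s t u0 v0 \<noteq> 0" "\<And>u v. deriv2 c s0 t0 u v = 0"
proof -
  have "deriv1 c s0 t0 u0 v0 * deriv2 c s0 t0 u0 v0 = 0"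
    using hw assms(3,4) unfolding hw_rank1_def by (metis add_0_left mult_zero_left power_zero_numeral)
  then consider "deriv1 c s0 t0 u0 v0 = 0" | "deriv2 c s0 t0 u0 v0 = 0" by auto
  then show thesis
  proof cases
    case 1
    then show thesis using first local_structure[OF char3 hw smooth _ _ assms(1-4)] l r by metis
  next
    case 2
    have "\<exists>s t u v. bilin (transp l) s t u v \<noteq> 0" "\<exists>s t u v. bilin (transp r) s t u v \<noteq> 0"
      unfolding transp_simps using l r by metis+
    then show thesis
      using second local_structure[OF char3 hw_rank1_transp[OF hw] smooth_transp[OF smooth] _ _ assms(2) assms(1), unfolded transp_simps,
          OF _ _ assms(3) assms(4) 2] unfolding transp_simps by metis
  qed
qed

text \<open>A plane that is not tangent meets the quadric in a smooth conic, the graph of an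
  isomorphism between the rulings. The curve meets this conic, and at such a point the plane would
  have to contain a line of the quadric.\<close>

lemma rank1_form_degenerate: "l 0 0 * l 1 1 = l 0 1 * l 1 0"
proof (rule ccontr)
  assume nd: "l 0 0 * l 1 1 \<noteq> l 0 1 * l 1 0"
  \<comment> \<open>The substitution sends the diagonal to the graph of the isomorphism (s:t) ->
    (u:v) that solves \<open>bilin l s t u v = 0\<close>.\<close>
  let ?c = "transp (subst1 (l 1 0) (l 0 0) (- l 1 1) (- l 0 1) (transp c))"
  obtain s t where st: "(s, t) \<noteq> (0, 0)" "bicubic ?c s t s t = 0" by (rule bicubic_diagonal_root)
  have f: "bicubic c s t (l 1 0 * s + l 0 0 * t) (- l 1 1 * s + - l 0 1 * t) = 0"
    using st(2) unfolding transp_simps subst1_simps[OF char3] .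
  have uv: "(l 1 0 * s + l 0 0 * t, - l 1 1 * s + - l 0 1 * t) \<noteq> (0, 0)"
    by (rule subst1_nonzero[OF _ st(1)]) (use nd in \<open>simp add: algebra_simps\<close>)
  have lam: "bilin l s t (l 1 0 * s + l 0 0 * t) (- l 1 1 * s + - l 0 1 * t) = 0" by (simp add: bilin_def algebra_simps)
  have "transp l 0 0 * transp l 1 1 = transp l 0 1 * transp l 1 0"
    if "\<And>s' t'. bilin l s' t' (l 1 0 * s + l 0 0 * t) (- l 1 1 * s + - l 0 1 * t) = 0"
    using bilin_kernel_det[OF uv, of "transp l"] that unfolding transp_simps by blast
  moreover have "l 0 0 * l 1 1 = l 0 1 * l 1 0" if "\<And>u v. bilin l s t u v = 0"
    using bilin_kernel_det[OF st(1), of l] that by blast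
  ultimately show False
    using point_cases[OF st(1) uv f lam] nd by (metis transp_def mult.commute)
qed

context
  fixes p0 p1 q0 q1
  assumes p: "(p0, p1) \<noteq> (0, 0)" "\<And>u v. bilin l p0 p1 u v = 0"
    and q: "(q0, q1) \<noteq> (0, 0)" "\<And>s t. bilin l s t q0 q1 = 0"
begin

text \<open>This is the point of tangency, where the plane contains both lines of the quadric; a
  curve point in the plane lies on exactly one line contained in it.\<close>

lemma kernel_point_off_curve: "bicubic c p0 p1 q0 q1 \<noteq> 0"
proof
  assume "bicubic c p0 p1 q0 q1 = 0"
  from point_cases[OF p(1) q(1) this p(2)] p(2) q(2) show False by metis
qed

text \<open>The line meets the curve, and at a meeting point the other alternative of
  \<open>point_cases\<close> is impossible because the plane contains this line.\<close>

lemma kernel_line_second: "deriv2 c p0 p1 u v = 0"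
proof -
  obtain u1 v1 where "(u1, v1) \<noteq> (0, 0)" "bicubic c p0 p1 u1 v1 = 0" by (rule bicubic_root_second)
  from point_cases[OF p(1) this p(2)] p(2) show ?thesis by metis
qed

lemma kernel_line_first: "deriv1 c s t q0 q1 = 0"
proof -
  obtain s1 t1 where "(s1, t1) \<noteq> (0, 0)" "bicubic c s1 t1 q0 q1 = 0" by (rule bicubic_root_first)
  from point_cases[OF this(1) q(1) this(2) q(2)] q(2) show ?thesis by metis
qed

text \<open>With the point of tangency moved to (0:1, 0:1) one has l = l_11 s u, and most
  coefficients of the form vanish. The reduced derivatives become u^3 \<open>tau\<close> and s^3
  \<open>sigma\<close>, and l_11^3 r = \<open>tau\<close> \<open>sigma\<close>. A point whose two
  lines both lie in the plane of \<open>r\<close> is therefore a zero of both derivatives, which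
  smoothness keeps off the curve.\<close>

lemma rank1_dual_point_off_curve:
  assumes nz: "(s0, t0) \<noteq> (0, 0)" "(u0, v0) \<noteq> (0, 0)"
    and rho: "\<And>u v. bilin r s0 t0 u v = 0" "\<And>s t. bilin r s t u0 v0 = 0"
  shows "bicubic c s0 t0 u0 v0 \<noteq> 0"
proof
  assume f0: "bicubic c s0 t0 u0 v0 = 0"
  obtain c1 l1 r1 m n m' n' where D: "p1 * m - n * p0 \<noteq> 0" and D': "q1 * m' - n' * q0 \<noteq> 0"
    and hw1: "hw_rank1 c1 l1 r1" and smooth1: "smooth_bicubic c1"
    and c1: "\<And>s t u v. bicubic c1 s t u v = bicubic c (m * s + p0 * t) (n * s + p1 * t) (m' * u + q0 * v) (n' * u + q1 * v)"
    "\<And>s t u v. deriv1 c1 s t u v = (p1 * m - n * p0) * deriv1 c (m * s + p0 * t) (n * s + p1 * t) (m' * u + q0 * v) (n' * u + q1 * v)"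
    "\<And>s t u v. deriv2 c1 s t u v = (q1 * m' - n' * q0) * deriv2 c (m * s + p0 * t) (n * s + p1 * t) (m' * u + q0 * v) (n' * u + q1 * v)"
    and l1: "\<And>s t u v. bilin l1 s t u v = bilin l (m * s + p0 * t) (n * s + p1 * t) (m' * u + q0 * v) (n' * u + q1 * v)"
    and r1: "\<And>s t u v. bilin r1 s t u v = (q1 * m' - n' * q0) * ((p1 * m - n * p0)
      * bilin r (m * s + p0 * t) (n * s + p1 * t) (m' * u + q0 * v) (n' * u + q1 * v))"
    by (rule change_coordinates[OF char3 hw smooth p(1) q(1)]) (rule that; assumption)
  obtain s t where st: "s0 = m * s + p0 * t" "t0 = n * s + p1 * t" by (rule subst1_surj[OF D])
  obtain u v where uv: "u0 = m' * u + q0 * v" "v0 = n' * u + q1 * v" by (rule subst1_surj[OF D'])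
  have nz': "(s, t) \<noteq> (0, 0)" "(u, v) \<noteq> (0, 0)" using nz by (auto simp: st uv)
  have "bicubic c1 0 1 0 1 \<noteq> 0" using c1(1)[of 0 1 0 1] kernel_point_off_curve by simp
  then have "c1 0 0 \<noteq> 0" by (simp add: bicubic_defs)
  moreover have "deriv2 c1 0 1 u v = 0" for u v using c1(3)[of 0 1 u v] kernel_line_second by simp
  from this[of 0 1] this[of 1 0] have "c1 0 1 = 0" "c1 0 2 = 0" by (simp_all add: bicubic_defs)
  moreover have "deriv1 c1 s t 0 1 = 0" for s t using c1(2)[of s t 0 1] kernel_line_first by simp
  from this[of 0 1] this[of 1 0] have "c1 1 0 = 0" "c1 2 0 = 0" by (simp_all add: bicubic_defs)
  moreover have "bilin l1 0 1 u v = 0" "bilin l1 s t 0 1 = 0" for s t u v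
    using l1[of 0 1 u v] l1[of s t 0 1] p(2) q(2) by simp_all
  from this(1)[of 0 1] this(1)[of 1 0] this(2)[of 1 0] have l0: "l1 0 0 = 0" "l1 0 1 = 0" "l1 1 0 = 0"
    by (simp_all add: bilin_def)
  moreover note E = hw_rank1_coeffs[OF char3 hw1]
  ultimately have c: "c1 0 1 = 0" "c1 0 2 = 0" "c1 1 0 = 0" "c1 2 0 = 0" "c1 1 1 = 0" "c1 1 2 = 0" "c1 2 1 = 0" "c1 2 2 = 0"
    using E(1,2,5,6) by simp_all
  have "\<exists>s t u v. bilin l1 s t u v \<noteq> 0"
    using l unfolding l1 by (metis subst1_surj[OF D] subst1_surj[OF D'])
  then have l11: "l1 1 1 \<noteq> 0" by (auto simp: bilin_def l0)
  have rnz: "\<exists>s t u v. bilin r1 s t u v \<noteq> 0"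
    using r D D' unfolding r1 by (metis subst1_surj[OF D] subst1_surj[OF D'] mult_eq_0_iff)
  define tau where "tau = (\<lambda>s t. c1 1 3 * t - c1 2 3 * s)"
  define sigma where "sigma = (\<lambda>u v. c1 3 1 * v - c1 3 2 * u)"
  have rho1: "l1 1 1 ^ 3 * bilin r1 s t u v = tau s t * sigma u v" for s t u v
  proof -
    have "l1 1 1 ^ 3 * bilin r1 s t u v = (l1 1 1 ^ 3 * r1 0 0) * t * v + (l1 1 1 ^ 3 * r1 0 1) * t * u
      + (l1 1 1 ^ 3 * r1 1 0) * s * v + (l1 1 1 ^ 3 * r1 1 1) * s * u" by (simp add: bilin_def algebra_simps)
    moreover have "l1 1 1 ^ 3 * r1 0 0 = c1 1 3 * c1 3 1" "l1 1 1 ^ 3 * r1 0 1 = - (c1 1 3 * c1 3 2)"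
      "l1 1 1 ^ 3 * r1 1 0 = - (c1 2 3 * c1 3 1)" "l1 1 1 ^ 3 * r1 1 1 = c1 2 3 * c1 3 2"
      using E(11,12,15,16) by (simp_all add: c)
    ultimately show ?thesis by (simp add: tau_def sigma_def algebra_simps)
  qed
  have f: "bicubic c1 s t u v = 0" "bilin r1 s t u' v' = 0" "bilin r1 s' t' u v = 0" for u' v' s' t'
    using f0 rho unfolding c1 r1 st uv by simp_all
  have "tau s t * sigma u' v' = 0" "tau s' t' * sigma u v = 0" for u' v' s' t'
    using rho1[of s t u' v'] rho1[of s' t' u v] f(2,3) l11 by simp_all
  moreover have "\<exists>s t u v. tau s t * sigma u v \<noteq> 0" using rnz l11 unfolding rho1[symmetric] by simp
  ultimately have "tau s t = 0" "sigma u v = 0" by (metis mult_eq_0_iff)+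
  moreover have "deriv1 c1 s t u v = u^3 * tau s t" "deriv2 c1 s t u v = s^3 * sigma u v"
    by (simp_all add: bicubic_defs c tau_def sigma_def algebra_simps)
  ultimately show False using smooth1 nz' f(1) unfolding smooth_bicubic_def by simp
qed

end

end

section \<open>The cubics of the standard forms and their Hasse-Witt matrices\<close>

lemma mon_cst_mult: "cst c * single (mon a b d e) k = single (mon a b d e) (c * k)"
  by (simp add: cst_def mult_single)

lemma mon_mult: "single (mon a b c d) k * single (mon a' b' c' d') l = single (mon (a + a') (b + b') (c + c') (d + d')) (k * l)"
  by (simp add: mult_single mon_add)

lemma mon_power: "single (mon a b c d) k ^ n = single (mon (n * a) (n * b) (n * c) (n * d)) (k ^ n)"
proof (induction n)
  case 0
  have "mon 0 0 0 0 = 0" by (rule poly_mapping_eqI) (simp add: mon_def)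
  then show ?case by simp
qed (simp add: mon_mult)

text \<open>One family, indexed from 1 to 13, for all curves on a nondegenerate quadric: q is y z
  for \<open>F1\<close> and y^2 + z^2 for \<open>F2\<close>, where -eps = 1. In the normal forms the
  linear coefficient of x is a multiple of q.\<close>

definition cubic :: "'a::field poly4 \<Rightarrow> (nat \<Rightarrow> 'a) \<Rightarrow> 'a poly4" where
  "cubic q g = cst (g 1) * vy * vx^2 + cst (g 2) * vz * vx^2 + cst (g 3) * q * vx
    + cst (g 4) * vy^3 + cst (g 5) * vz^3 + cst (g 6) * vy^2 * vz + cst (g 7) * vy * vz^2
    + cst (g 8) * vy^2 * vw + cst (g 9) * vy * vz * vw + cst (g 10) * vz^2 * vw
    + cst (g 11) * vy * vw^2 + cst (g 12) * vz * vw^2 + cst (g 13) * vw^3"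

lemma cubic1_mon: "cubic (vy * vz) g = single (mon 2 1 0 0) (g 1) + single (mon 2 0 1 0) (g 2) + single (mon 1 1 1 0) (g 3)
    + single (mon 0 3 0 0) (g 4) + single (mon 0 0 3 0) (g 5) + single (mon 0 2 1 0) (g 6) + single (mon 0 1 2 0) (g 7)
    + single (mon 0 2 0 1) (g 8) + single (mon 0 1 1 1) (g 9) + single (mon 0 0 2 1) (g 10)
    + single (mon 0 1 0 2) (g 11) + single (mon 0 0 1 2) (g 12) + single (mon 0 0 0 3) (g 13)"
  unfolding cubic_def var_mon mon_power mon_cst_mult mon_mult by (simp add: mon_mult flip: numeral_2_eq_2)

lemma cubic2_mon: "cubic (vy^2 + vz^2) g = single (mon 2 1 0 0) (g 1) + single (mon 2 0 1 0) (g 2)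
    + single (mon 1 2 0 0) (g 3) + single (mon 1 0 2 0) (g 3)
    + single (mon 0 3 0 0) (g 4) + single (mon 0 0 3 0) (g 5) + single (mon 0 2 1 0) (g 6) + single (mon 0 1 2 0) (g 7)
    + single (mon 0 2 0 1) (g 8) + single (mon 0 1 1 1) (g 9) + single (mon 0 0 2 1) (g 10)
    + single (mon 0 1 0 2) (g 11) + single (mon 0 0 1 2) (g 12) + single (mon 0 0 0 3) (g 13)"
  unfolding cubic_def var_mon mon_power mon_cst_mult mon_mult distrib_left distrib_right by (simp add: mon_mult add.assoc flip: numeral_2_eq_2)

lemma numeral_mon: "2 = (single (mon 0 0 0 0) 2 :: 'a::field poly4)"
  using cst_mon[of "2 :: 'a"] by (simp add: cst_def)

definition cubicD :: "(nat \<Rightarrow> 'a::field) \<Rightarrow> 'a poly4" where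
  "cubicD g = cst (g 0) * vx^3
    + (cst (g 1) * vy^2 + cst (g 2) * vz^2 + cst (g 3) * vw^2 + cst (g 4) * vy * vz + cst (g 5) * vz * vw) * vx
    + cst (g 6) * vy^3 + cst (g 7) * vz^3 + cst (g 8) * vw^3 + cst (g 9) * vy * vz^2
    + cst (g 10) * vz^2 * vw + cst (g 11) * vz * vw^2"

lemma cubicD_mon: "cubicD g = single (mon 3 0 0 0) (g 0) + single (mon 1 2 0 0) (g 1) + single (mon 1 0 2 0) (g 2)
    + single (mon 1 0 0 2) (g 3) + single (mon 1 1 1 0) (g 4) + single (mon 1 0 1 1) (g 5)
    + single (mon 0 3 0 0) (g 6) + single (mon 0 0 3 0) (g 7) + single (mon 0 0 0 3) (g 8)
    + single (mon 0 1 2 0) (g 9) + single (mon 0 0 2 1) (g 10) + single (mon 0 0 1 2) (g 11)"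
  unfolding cubicD_def var_mon mon_power mon_cst_mult mon_mult distrib_right by (simp add: mon_mult add.assoc flip: numeral_2_eq_2)

lemma homog_add: "homog d A \<Longrightarrow> homog d B \<Longrightarrow> homog d (A + B)"
  unfolding homog_def using keys_add[of A B] by blast

lemma homog_mon: "a + b + c + e = d \<Longrightarrow> homog d (single (mon a b c e) k)"
  by (auto simp: homog_def mdeg_def sum_UNIV_4 lookup_mon)

lemma homog_cubic1: "homog 3 (cubic (vy * vz) g)" and homog_cubic2: "homog 3 (cubic (vy^2 + vz^2) g)"
  and homog_cubicD: "homog 3 (cubicD g)"
  unfolding cubic1_mon cubic2_mon cubicD_mon by (intro homog_add homog_mon; simp)+

text \<open>The exponent of \<open>hasse_witt_coeff\<close> as four explicit numbers, in the shape
  in which the coefficients of (F G)^2 are evaluated entry by entry.\<close>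

lemma dual_mon:
  "lookup (mon (2 + (if 0 = j then 3 else 0) - (if 0 = i then 1 else 0)) (2 + (if 1 = j then 3 else 0) - (if 1 = i then 1 else 0))
    (2 + (if 2 = j then 3 else 0) - (if 2 = i then 1 else 0)) (2 + (if 3 = j then 3 else 0) - (if 3 = i then 1 else 0))) k
    = 2 + (if k = j then 3 else 0) - (if k = i then 1 else 0)"
proof -
  have "\<forall>k. lookup (mon (2 + (if 0 = j then 3 else 0) - (if 0 = i then 1 else 0)) (2 + (if 1 = j then 3 else 0) - (if 1 = i then 1 else 0))
    (2 + (if 2 = j then 3 else 0) - (if 2 = i then 1 else 0)) (2 + (if 3 = j then 3 else 0) - (if 3 = i then 1 else 0))) k
    = 2 + (if k = j then 3 else 0) - (if k = i then 1 else 0)"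
    unfolding all_4 lookup_mon by blast
  then show ?thesis by blast
qed

context
  assumes char3: "(3 :: 'a::field) = 0"
begin

lemma two_minus_one: "(2 :: 'a) = -1"
  by (rule numerals_char3[OF char3])

lemma F1_mon: "(F1 :: 'a poly4) = single (mon 1 0 0 1) (-1) + single (mon 0 1 1 0) (-1)"
  unfolding F1_def var_mon numeral_mon mon_mult by (simp add: two_minus_one)

lemma F2_mon: "(F2 :: 'a poly4) = single (mon 1 0 0 1) (-1) + single (mon 0 2 0 0) 1 + single (mon 0 0 2 0) 1"
  unfolding F2_def var_mon numeral_mon mon_power mon_mult mon_cst_mult eps_def by (simp add: two_minus_one single_uminus)

lemma Fd_mon: "(Fd :: 'a poly4) = single (mon 0 1 0 1) (-1) + single (mon 0 0 2 0) 1"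
  unfolding Fd_def var_mon numeral_mon mon_power mon_mult by (simp add: two_minus_one)

lemmas coeff_simps = power2_eq_square[of "_ :: 'a poly4"] mult.assoc distrib_right lookup_add lookup_mon_mult lookup_single when_def mon_eq_iff

lemma homog_F1: "homog 2 (F1 :: 'a poly4)" and homog_F2: "homog 2 (F2 :: 'a poly4)" and homog_Fd: "homog 2 (Fd :: 'a poly4)"
  unfolding F1_mon F2_mon Fd_mon by (intro homog_add homog_mon; simp)+

lemmas subst_simps = insertion_simps[OF ring_map_cst] insertion_at_var[OF ring_map_cst] insertion_at_cst[OF ring_map_cst]

lemma nonzero_of_lookup: "lookup A m \<noteq> 0 \<Longrightarrow> A \<noteq> 0"
  by auto

lemma single_mon_nonzero: "k \<noteq> 0 \<Longrightarrow> single (mon a b c d) k \<noteq> 0"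
  by (rule nonzero_of_lookup[of _ "mon a b c d"]) simp

lemma regular_quadric:
  fixes F G q :: "'a poly4"
  assumes "F = cst c * (var a * vw + q)" "c \<noteq> 0" "a \<noteq> 3" "q \<noteq> 0" "F \<noteq> 0"
    and "insertion cst (\<lambda>i. if i = 3 then - q else var a * var i) q = var a ^ 2 * q"
    and "insertion cst (\<lambda>i. if i = a then 0 else var i) q = q"
    and \<psi>: "insertion cst (\<lambda>i. if i = 3 then - q else var a * var i) G \<noteq> 0"
  shows "regular_pair F G"
proof (rule regular_pairI)
  show "G \<noteq> 0"
  proof
    assume "G = 0"
    then have "insertion cst (\<lambda>i. if i = 3 then - q else var a * var i) G = 0"
      by (simp only: insertion_linear[OF ring_map_cst])
    with \<psi> show False by contradiction
  qed
  show "F dvd B" if "homog d B" "F dvd G * B" for d B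
    by (rule quadric_prime[OF assms(1-4,6-8) that])
qed (rule assms)

lemma F1_nonzero: "F1 \<noteq> (0 :: 'a poly4)" and F2_nonzero: "F2 \<noteq> (0 :: 'a poly4)"
  by (rule nonzero_of_lookup[of _ "mon 1 0 0 1"], simp add: F1_mon F2_mon lookup_add lookup_single when_def mon_eq_iff)+

lemma Fd_nonzero: "Fd \<noteq> (0 :: 'a poly4)"
  by (rule nonzero_of_lookup[of _ "mon 0 1 0 1"]) (simp add: Fd_mon lookup_add lookup_single when_def mon_eq_iff)

lemma minus_one_nonzero: "(-1 :: 'a) \<noteq> 0" by simp

text \<open>The substitution w -> - y z / x, cleared of its denominator, sends y x^2 and z x^2 to
  x^5 y and x^5 z. All other monomials of the cubic receive lower powers of x, so one of these two
  terms survives.\<close>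

lemma regular_F1:
  assumes nz: "g 1 \<noteq> 0 \<or> g 2 \<noteq> 0"
  shows "regular_pair (F1 :: 'a poly4) (cubic (vy * vz) g)"
proof (rule regular_quadric)
  let ?q = "vy * vz :: 'a poly4"
  let ?\<psi> = "insertion cst (\<lambda>i. if i = 3 then - ?q else var 0 * var i)"
  show "F1 = cst (-1) * (var 0 * vw + ?q)"
    unfolding F1_mon var_mon mon_mult distrib_left mon_cst_mult by simp
  have v: "?\<psi> vx = vx * vx" "?\<psi> vy = vx * vy" "?\<psi> vz = vx * vz" "?\<psi> vw = - (vy * vz)"
    unfolding insertion_at_var[OF ring_map_cst] by simp_all
  show "?\<psi> ?q = vx ^ 2 * ?q"
    unfolding subst_simps(6) v by (simp add: power2_eq_square)
  show "insertion cst (\<lambda>i. if i = 0 then 0 else var i) ?q = ?q"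
    unfolding subst_simps(6) insertion_at_var[OF ring_map_cst] by simp
  show "?q \<noteq> 0" unfolding var_mon mon_mult by (rule single_mon_nonzero) simp
  have \<psi>: "?\<psi> (cubic ?q g) = single (mon 5 1 0 0) (g 1) + single (mon 5 0 1 0) (g 2) + single (mon 4 1 1 0) (g 3)
    + single (mon 3 3 0 0) (g 4) + single (mon 3 0 3 0) (g 5) + single (mon 3 2 1 0) (g 6) + single (mon 3 1 2 0) (g 7)
    - (single (mon 2 3 1 0) (g 8) + single (mon 2 2 2 0) (g 9) + single (mon 2 1 3 0) (g 10))
    + single (mon 1 3 2 0) (g 11) + single (mon 1 2 3 0) (g 12) - single (mon 0 3 3 0) (g 13)"
    unfolding cubic_def insertion_simps[OF ring_map_cst] insertion_at_cst[OF ring_map_cst] v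
    by (simp add: power2_eq_square power3_eq_cube) (simp add: var_mon mon_mult mon_cst_mult flip: numeral_2_eq_2)
  from nz show "?\<psi> (cubic ?q g) \<noteq> 0"
  proof
    assume "g 1 \<noteq> 0"
    then show ?thesis unfolding \<psi>
      by (intro nonzero_of_lookup[of _ "mon 5 1 0 0"]) (simp add: lookup_add lookup_minus lookup_single when_def mon_eq_iff)
  next
    assume "g 2 \<noteq> 0"
    then show ?thesis unfolding \<psi>
      by (intro nonzero_of_lookup[of _ "mon 5 0 1 0"]) (simp add: lookup_add lookup_minus lookup_single when_def mon_eq_iff)
  qed
qed (rule F1_nonzero minus_one_nonzero | simp)+

lemma regular_F2:
  assumes nz: "g 1 \<noteq> 0 \<or> g 2 \<noteq> 0"
  shows "regular_pair (F2 :: 'a poly4) (cubic (vy^2 + vz^2) g)"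
proof (rule regular_quadric)
  let ?q = "- (vy^2 + vz^2) :: 'a poly4"
  let ?\<psi> = "insertion cst (\<lambda>i. if i = 3 then - ?q else var 0 * var i)"
  show "F2 = cst (-1) * (var 0 * vw + ?q)"
    unfolding F2_mon var_mon mon_mult mon_power by (simp add: cst_uminus distrib_left single_uminus)
  have v: "?\<psi> vx = vx * vx" "?\<psi> vy = vx * vy" "?\<psi> vz = vx * vz" "?\<psi> vw = vy * vy + vz * vz"
    unfolding insertion_at_var[OF ring_map_cst] by (simp_all add: power2_eq_square)
  show "?\<psi> ?q = vx ^ 2 * ?q"
    unfolding insertion_simps[OF ring_map_cst] v by (simp add: power2_eq_square algebra_simps)
  show "insertion cst (\<lambda>i. if i = 0 then 0 else var i) ?q = ?q"
    unfolding insertion_simps[OF ring_map_cst] insertion_at_var[OF ring_map_cst] by simp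
  show "?q \<noteq> 0"
    by (rule nonzero_of_lookup[of _ "mon 0 2 0 0"]) (simp add: var_mon mon_power lookup_add lookup_minus lookup_single when_def mon_eq_iff)
  have \<psi>: "?\<psi> (cubic (vy^2 + vz^2) g) = single (mon 5 1 0 0) (g 1) + single (mon 5 0 1 0) (g 2)
    + vx * vx * vx * vx * (cst (g 3) * (vy * vy + vz * vz))
    + vx * vx * vx * (cst (g 4) * vy * vy * vy + cst (g 5) * vz * vz * vz + cst (g 6) * vy * vy * vz + cst (g 7) * vy * vz * vz)
    + vx * vx * (vy * vy + vz * vz) * (cst (g 8) * vy * vy + cst (g 9) * vy * vz + cst (g 10) * vz * vz)
    + vx * (vy * vy + vz * vz) * (vy * vy + vz * vz) * (cst (g 11) * vy + cst (g 12) * vz)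
    + (vy * vy + vz * vz) * (vy * vy + vz * vz) * (vy * vy + vz * vz) * cst (g 13)" (is "_ = ?r")
  proof -
    have "single (mon 5 1 0 0) (g 1) = cst (g 1) * vx * vx * vx * vx * vx * vy" "single (mon 5 0 1 0) (g 2) = cst (g 2) * vx * vx * vx * vx * vx * vz"
      unfolding var_mon mon_mult mon_cst_mult by simp_all
    then show ?thesis
      unfolding cubic_def insertion_simps[OF ring_map_cst] insertion_at_cst[OF ring_map_cst] v
      by (simp only: power2_eq_square power3_eq_cube) (simp add: algebra_simps)
  qed
  have "lookup ?r (mon 5 1 0 0) = g 1" "lookup ?r (mon 5 0 1 0) = g 2"
    by (simp_all add: var_mon cst_mon mult.assoc lookup_add lookup_mon_mult lookup_single mon_eq_iff distrib_right when_def)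
  then show "?\<psi> (cubic (vy^2 + vz^2) g) \<noteq> 0" unfolding \<psi> using nz nonzero_of_lookup by auto
qed (rule F2_nonzero minus_one_nonzero | simp)+

text \<open>Here w is eliminated by w -> z^2 / y; the term x^3 becomes x^3 y^3, and no other
  monomial of the cubic contains x to the third power.\<close>

lemma regular_Fd:
  assumes nz: "g 0 \<noteq> 0"
  shows "regular_pair (Fd :: 'a poly4) (cubicD g)"
proof (rule regular_quadric)
  let ?q = "- (vz^2) :: 'a poly4"
  let ?\<psi> = "insertion cst (\<lambda>i. if i = 3 then - ?q else var 1 * var i)"
  show "Fd = cst (-1) * (var 1 * vw + ?q)"
    unfolding Fd_mon var_mon mon_mult mon_power by (simp add: cst_uminus distrib_left single_uminus)
  have v: "?\<psi> vx = vy * vx" "?\<psi> vy = vy * vy" "?\<psi> vz = vy * vz" "?\<psi> vw = vz * vz"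
    unfolding insertion_at_var[OF ring_map_cst] by (simp_all add: power2_eq_square)
  show "?\<psi> ?q = vy ^ 2 * ?q"
    unfolding insertion_simps[OF ring_map_cst] v by (simp add: power2_eq_square algebra_simps)
  show "insertion cst (\<lambda>i. if i = 1 then 0 else var i) ?q = ?q"
    unfolding insertion_simps[OF ring_map_cst] insertion_at_var[OF ring_map_cst] by simp
  show "?q \<noteq> 0" unfolding var_mon mon_power neg_equal_0_iff_equal by (rule single_mon_nonzero) simp
  have \<psi>: "?\<psi> (cubicD g) = single (mon 3 3 0 0) (g 0) + single (mon 1 5 0 0) (g 1) + single (mon 1 3 2 0) (g 2)
    + single (mon 1 1 4 0) (g 3) + single (mon 1 4 1 0) (g 4) + single (mon 1 2 3 0) (g 5)
    + single (mon 0 6 0 0) (g 6) + single (mon 0 3 3 0) (g 7) + single (mon 0 0 6 0) (g 8)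
    + single (mon 0 4 2 0) (g 9) + single (mon 0 2 4 0) (g 10) + single (mon 0 1 5 0) (g 11)"
    unfolding cubicD_def insertion_simps[OF ring_map_cst] insertion_at_cst[OF ring_map_cst] v
    by (simp only: power2_eq_square power3_eq_cube distrib_right) (simp add: var_mon mon_mult mon_cst_mult flip: numeral_2_eq_2)
  show "?\<psi> (cubicD g) \<noteq> 0" unfolding \<psi> using nz
    by (intro nonzero_of_lookup[of _ "mon 3 3 0 0"]) (simp add: lookup_add lookup_single when_def mon_eq_iff)
qed (rule Fd_nonzero minus_one_nonzero | simp)+

lemma hasse_witt_split:
  fixes H :: "'a ^ 4 ^ 4"
  assumes nz: "g 1 \<noteq> 0 \<or> g 2 \<noteq> 0" and H: "is_hasse_witt_matrix F1 (cubic (vy * vz) g) H"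
  shows "H $ 0 $ 0 = g 3^2 - (g 1 * g 7) - (g 2 * g 6)"
  "H $ 0 $ 1 = g 4 * g 9 + g 6 * g 8"
  "H $ 0 $ 2 = g 7 * g 10 + g 5 * g 9"
  "H $ 0 $ 3 = g 11 * g 12 + g 9 * g 13"
  "H $ 1 $ 0 = - (g 2 * g 3)"
  "H $ 1 $ 1 = g 3 * g 8 + g 6^2 - (g 1 * g 11) - (g 4 * g 7)"
  "H $ 1 $ 2 = - (g 5 * g 7)"
  "H $ 1 $ 3 = - (g 10 * g 11) - (g 9 * g 12) - (g 7 * g 13)"
  "H $ 2 $ 0 = - (g 1 * g 3)"
  "H $ 2 $ 1 = - (g 4 * g 6)"
  "H $ 2 $ 2 = g 3 * g 10 + g 7^2 - (g 2 * g 12) - (g 5 * g 6)"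
  "H $ 2 $ 3 = - (g 9 * g 11) - (g 8 * g 12) - (g 6 * g 13)"
  "H $ 3 $ 0 = g 1 * g 2"
  "H $ 3 $ 1 = g 3 * g 4 - (g 1 * g 8)"
  "H $ 3 $ 2 = g 3 * g 5 - (g 2 * g 10)"
  "H $ 3 $ 3 = g 3 * g 13 + g 9^2 - (g 8 * g 10) - (g 7 * g 11) - (g 6 * g 12)"
proof -
  note coeff = hasse_witt_coeff[OF char3 homog_F1 homog_cubic1 regular_F1[of g, OF nz] H]
  show "H $ 0 $ 0 = g 3^2 - (g 1 * g 7) - (g 2 * g 6)"
  "H $ 0 $ 1 = g 4 * g 9 + g 6 * g 8"
  "H $ 0 $ 2 = g 7 * g 10 + g 5 * g 9"
  "H $ 0 $ 3 = g 11 * g 12 + g 9 * g 13"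
  "H $ 1 $ 0 = - (g 2 * g 3)"
  "H $ 1 $ 1 = g 3 * g 8 + g 6^2 - (g 1 * g 11) - (g 4 * g 7)"
  "H $ 1 $ 2 = - (g 5 * g 7)"
  "H $ 1 $ 3 = - (g 10 * g 11) - (g 9 * g 12) - (g 7 * g 13)"
  "H $ 2 $ 0 = - (g 1 * g 3)"
  "H $ 2 $ 1 = - (g 4 * g 6)"
  "H $ 2 $ 2 = g 3 * g 10 + g 7^2 - (g 2 * g 12) - (g 5 * g 6)"
  "H $ 2 $ 3 = - (g 9 * g 11) - (g 8 * g 12) - (g 6 * g 13)"
  "H $ 3 $ 0 = g 1 * g 2"
  "H $ 3 $ 1 = g 3 * g 4 - (g 1 * g 8)"
  "H $ 3 $ 2 = g 3 * g 5 - (g 2 * g 10)"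
  "H $ 3 $ 3 = g 3 * g 13 + g 9^2 - (g 8 * g 10) - (g 7 * g 11) - (g 6 * g 12)"
    unfolding coeff[OF dual_mon] F1_mon cubic1_mon
    by (simp_all add: coeff_simps) (simp_all add: numerals_char3[OF char3] char3 algebra_simps power2_eq_square)
qed

lemma hasse_witt_nonsplit:
  fixes H :: "'a ^ 4 ^ 4"
  assumes nz: "g 1 \<noteq> 0 \<or> g 2 \<noteq> 0" and H: "is_hasse_witt_matrix F2 (cubic (vy^2 + vz^2) g) H"
  shows "H $ 0 $ 0 = - (g 1 * g 7) - (g 2 * g 6) - (g 3^2)"
  "H $ 0 $ 1 = - (g 4 * g 10) - (g 4 * g 8) - (g 6 * g 9) - (g 7 * g 8)"
  "H $ 0 $ 2 = - (g 5 * g 10) - (g 6 * g 10) - (g 5 * g 8) - (g 7 * g 9)"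
  "H $ 0 $ 3 = g 11^2 + g 12^2 - (g 10 * g 13) - (g 8 * g 13)"
  "H $ 1 $ 0 = - (g 1 * g 3)"
  "H $ 1 $ 1 = g 1 * g 11 + g 3 * g 8 + g 6^2 - (g 3 * g 10) - (g 2 * g 12) - (g 4 * g 7)"
  "H $ 1 $ 2 = - (g 1 * g 12) - (g 2 * g 11) - (g 3 * g 9) - (g 5 * g 7)"
  "H $ 1 $ 3 = - (g 10 * g 11) - (g 9 * g 12) - (g 7 * g 13)"
  "H $ 2 $ 0 = - (g 2 * g 3)"
  "H $ 2 $ 1 = - (g 1 * g 12) - (g 2 * g 11) - (g 3 * g 9) - (g 4 * g 6)"
  "H $ 2 $ 2 = g 3 * g 10 + g 2 * g 12 + g 7^2 - (g 1 * g 11) - (g 3 * g 8) - (g 5 * g 6)"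
  "H $ 2 $ 3 = - (g 9 * g 11) - (g 8 * g 12) - (g 6 * g 13)"
  "H $ 3 $ 0 = g 1^2 + g 2^2"
  "H $ 3 $ 1 = g 1 * g 8 + g 3 * g 4 - (g 1 * g 10) - (g 2 * g 9) - (g 3 * g 7)"
  "H $ 3 $ 2 = g 2 * g 10 + g 3 * g 5 - (g 1 * g 9) - (g 2 * g 8) - (g 3 * g 6)"
  "H $ 3 $ 3 = g 3 * g 13 + g 9^2 - (g 8 * g 10) - (g 7 * g 11) - (g 6 * g 12)"
proof -
  note coeff = hasse_witt_coeff[OF char3 homog_F2 homog_cubic2 regular_F2[of g, OF nz] H]
  show "H $ 0 $ 0 = - (g 1 * g 7) - (g 2 * g 6) - (g 3^2)"
  "H $ 0 $ 1 = - (g 4 * g 10) - (g 4 * g 8) - (g 6 * g 9) - (g 7 * g 8)"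
  "H $ 0 $ 2 = - (g 5 * g 10) - (g 6 * g 10) - (g 5 * g 8) - (g 7 * g 9)"
  "H $ 0 $ 3 = g 11^2 + g 12^2 - (g 10 * g 13) - (g 8 * g 13)"
  "H $ 1 $ 0 = - (g 1 * g 3)"
  "H $ 1 $ 1 = g 1 * g 11 + g 3 * g 8 + g 6^2 - (g 3 * g 10) - (g 2 * g 12) - (g 4 * g 7)"
  "H $ 1 $ 2 = - (g 1 * g 12) - (g 2 * g 11) - (g 3 * g 9) - (g 5 * g 7)"
  "H $ 1 $ 3 = - (g 10 * g 11) - (g 9 * g 12) - (g 7 * g 13)"
  "H $ 2 $ 0 = - (g 2 * g 3)"
  "H $ 2 $ 1 = - (g 1 * g 12) - (g 2 * g 11) - (g 3 * g 9) - (g 4 * g 6)"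
  "H $ 2 $ 2 = g 3 * g 10 + g 2 * g 12 + g 7^2 - (g 1 * g 11) - (g 3 * g 8) - (g 5 * g 6)"
  "H $ 2 $ 3 = - (g 9 * g 11) - (g 8 * g 12) - (g 6 * g 13)"
  "H $ 3 $ 0 = g 1^2 + g 2^2"
  "H $ 3 $ 1 = g 1 * g 8 + g 3 * g 4 - (g 1 * g 10) - (g 2 * g 9) - (g 3 * g 7)"
  "H $ 3 $ 2 = g 2 * g 10 + g 3 * g 5 - (g 1 * g 9) - (g 2 * g 8) - (g 3 * g 6)"
  "H $ 3 $ 3 = g 3 * g 13 + g 9^2 - (g 8 * g 10) - (g 7 * g 11) - (g 6 * g 12)"
    unfolding coeff[OF dual_mon] F2_mon cubic2_mon
    by (simp_all add: coeff_simps) (simp_all add: numerals_char3[OF char3] char3 algebra_simps power2_eq_square)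
qed

text \<open>Below the top left entry the first column is zero, and the lower right block depends
  only on the coefficients \<open>g 1\<close> to \<open>g 5\<close> of x. This makes the rank one
  condition accessible through minors.\<close>

lemma hasse_witt_cone:
  fixes H :: "'a ^ 4 ^ 4"
  assumes nz: "g 0 \<noteq> 0" and H: "is_hasse_witt_matrix Fd (cubicD g) H"
  shows "H $ 0 $ 0 = - (g 0 * g 2)"
  "H $ 0 $ 1 = - (g 1 * g 9) - (g 2 * g 6)"
  "H $ 0 $ 2 = - (g 1 * g 11) - (g 2 * g 7) - (g 4 * g 10) - (g 5 * g 9)"
  "H $ 0 $ 3 = - (g 2 * g 8) - (g 3 * g 10) - (g 5 * g 11)"
  "H $ 1 $ 0 = 0"
  "H $ 1 $ 1 = g 4^2 - (g 1 * g 2)"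
  "H $ 1 $ 2 = - (g 2 * g 5) - (g 3 * g 4)"
  "H $ 1 $ 3 = g 3^2"
  "H $ 2 $ 0 = 0"
  "H $ 2 $ 1 = - (g 1 * g 4)"
  "H $ 2 $ 2 = g 2^2 - (g 1 * g 3) - (g 4 * g 5)"
  "H $ 2 $ 3 = - (g 3 * g 5)"
  "H $ 3 $ 0 = 0"
  "H $ 3 $ 1 = g 1^2"
  "H $ 3 $ 2 = - (g 1 * g 5) - (g 2 * g 4)"
  "H $ 3 $ 3 = g 5^2 - (g 2 * g 3)"
proof -
  note coeff = hasse_witt_coeff[OF char3 homog_Fd homog_cubicD regular_Fd[of g, OF nz] H]
  show "H $ 0 $ 0 = - (g 0 * g 2)"
  "H $ 0 $ 1 = - (g 1 * g 9) - (g 2 * g 6)"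
  "H $ 0 $ 2 = - (g 1 * g 11) - (g 2 * g 7) - (g 4 * g 10) - (g 5 * g 9)"
  "H $ 0 $ 3 = - (g 2 * g 8) - (g 3 * g 10) - (g 5 * g 11)"
  "H $ 1 $ 0 = 0"
  "H $ 1 $ 1 = g 4^2 - (g 1 * g 2)"
  "H $ 1 $ 2 = - (g 2 * g 5) - (g 3 * g 4)"
  "H $ 1 $ 3 = g 3^2"
  "H $ 2 $ 0 = 0"
  "H $ 2 $ 1 = - (g 1 * g 4)"
  "H $ 2 $ 2 = g 2^2 - (g 1 * g 3) - (g 4 * g 5)"
  "H $ 2 $ 3 = - (g 3 * g 5)"
  "H $ 3 $ 0 = 0"
  "H $ 3 $ 1 = g 1^2"
  "H $ 3 $ 2 = - (g 1 * g 5) - (g 2 * g 4)"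
  "H $ 3 $ 3 = g 5^2 - (g 2 * g 3)"
    unfolding coeff[OF dual_mon] Fd_mon cubicD_mon
    by (simp_all add: coeff_simps) (simp_all add: numerals_char3[OF char3] char3 algebra_simps power2_eq_square)
qed

end

section \<open>Local multiplicities\<close>

text \<open>A filtration with n one-dimensional steps. Coefficients are found one step after the
  other; they are unique because, once all earlier ones vanish, \<open>indep\<close> forces the next
  one to be 0.\<close>

lemma has_quot_dim_chain:
  fixes V :: "nat \<Rightarrow> 'v::ab_group_add set" and sc :: "'c::field \<Rightarrow> 'v \<Rightarrow> 'v"
  assumes sc: "\<And>c d v. sc (c - d) v = sc c v - sc d v"
    and V: "\<And>k v w. v \<in> V k \<Longrightarrow> w \<in> V k \<Longrightarrow> v - w \<in> V k" "\<And>k c v. v \<in> V k \<Longrightarrow> sc c v \<in> V k"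
    and dec: "\<And>k. k < n \<Longrightarrow> V (Suc k) \<subseteq> V k"
    and b: "\<And>k. k < n \<Longrightarrow> b k \<in> V k"
    and span: "\<And>k v. k < n \<Longrightarrow> v \<in> V k \<Longrightarrow> \<exists>c. v - sc c (b k) \<in> V (Suc k)"
    and indep: "\<And>k c. k < n \<Longrightarrow> sc c (b k) \<in> V (Suc k) \<Longrightarrow> c = 0"
  shows "has_quot_dim UNIV sc (V 0) (V n) n"
proof -
  have sc0: "sc 0 v = 0" for v using sc[of 0 0 v] by simp
  have zero: "0 \<in> V k" if "v \<in> V k" for v k using V(1)[OF that that] by simp
  have add: "v + w \<in> V k" if "v \<in> V k" "w \<in> V k" for v w k
    using V(1)[OF that(1) V(1)[OF zero[OF that(2)] that(2)]] by simp
  have mono: "V j \<subseteq> V k" if "k \<le> j" "j \<le> n" for j k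
    using that
  proof (induction rule: dec_induct)
    case (step m)
    then show ?case using dec[of m] by auto
  qed simp
  have sum: "(\<Sum>i\<in>A. sc (c i) (b i)) \<in> V k" if "finite A" "A \<subseteq> {k..<n}" "0 \<in> V k" for A c k
    using that
  proof (induction A)
    case (insert i A)
    then have "b i \<in> V k" using b[of i] mono[of k i] by auto
    then show ?case using insert by (simp add: add V(2))
  qed simp
  have ex: "\<exists>c. v - (\<Sum>i<k. sc (c i) (b i)) \<in> V k" if "v \<in> V 0" "k \<le> n" for v k
    using that(2)
  proof (induction k)
    case 0
    then show ?case using that by simp
  next
    case (Suc k)
    then obtain c where c: "v - (\<Sum>i<k. sc (c i) (b i)) \<in> V k" by auto
    obtain d where "v - (\<Sum>i<k. sc (c i) (b i)) - sc d (b k) \<in> V (Suc k)" using span[OF _ c] Suc by auto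
    moreover have "(\<Sum>i<k. sc ((c(k := d)) i) (b i)) = (\<Sum>i<k. sc (c i) (b i))" by (intro sum.cong) auto
    ultimately have "v - (\<Sum>i<Suc k. sc ((c(k := d)) i) (b i)) \<in> V (Suc k)" by (simp add: algebra_simps)
    then show ?case by blast
  qed
  have uniq: "c k = 0" if "(\<Sum>i<n. sc (c i) (b i)) \<in> V n" "k < n" for c k
    using that(2)
  proof (induction k rule: less_induct)
    case (less k)
    have "(\<Sum>i<n. sc (c i) (b i)) = (\<Sum>i<k. sc (c i) (b i)) + (\<Sum>i\<in>{k..<n}. sc (c i) (b i))"
      unfolding lessThan_atLeast0 by (rule sum.atLeastLessThan_concat[symmetric]) (use less.prems in auto)
    also have "(\<Sum>i\<in>{k..<n}. sc (c i) (b i)) = sc (c k) (b k) + (\<Sum>i\<in>{Suc k..<n}. sc (c i) (b i))"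
      by (rule sum.atLeast_Suc_lessThan[OF less.prems])
    also have "(\<Sum>i<k. sc (c i) (b i)) = 0"
    proof (rule sum.neutral, rule ballI)
      fix i assume "i \<in> {..<k}"
      then have "c i = 0" using less.IH[of i] less.prems by simp
      then show "sc (c i) (b i) = 0" by (simp only: sc0)
    qed
    finally have eq: "sc (c k) (b k) = (\<Sum>i<n. sc (c i) (b i)) - (\<Sum>i\<in>{Suc k..<n}. sc (c i) (b i))" by simp
    have "(\<Sum>i<n. sc (c i) (b i)) \<in> V (Suc k)" using that(1) mono[of "Suc k" n] less.prems by auto
    moreover have "(\<Sum>i\<in>{Suc k..<n}. sc (c i) (b i)) \<in> V (Suc k)" by (rule sum[OF _ _ zero[OF calculation]]) auto
    ultimately have "sc (c k) (b k) \<in> V (Suc k)" unfolding eq by (rule V(1))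
    then show ?case using indep less.prems by blast
  qed
  show ?thesis
    unfolding has_quot_dim_def
  proof (intro exI[of _ b] conjI allI impI ballI)
    fix i assume "i < n" then show "b i \<in> V 0" using b mono[of 0 i] by auto
  next
    fix v assume v: "v \<in> V 0"
    obtain c where c: "v - (\<Sum>i<n. sc (c i) (b i)) \<in> V n" using ex[OF v] by blast
    show "\<exists>!c. c \<in> {..<n} \<rightarrow>\<^sub>E UNIV \<and> v - (\<Sum>i<n. sc (c i) (b i)) \<in> V n"
    proof (intro ex1I[of _ "restrict c {..<n}"] conjI)
      show "v - (\<Sum>i<n. sc (restrict c {..<n} i) (b i)) \<in> V n" using c by simp
    next
      fix d assume d: "d \<in> {..<n} \<rightarrow>\<^sub>E UNIV \<and> v - (\<Sum>i<n. sc (d i) (b i)) \<in> V n"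
      have "(v - (\<Sum>i<n. sc (d i) (b i))) - (v - (\<Sum>i<n. sc (c i) (b i))) \<in> V n" using V(1) d c by blast
      then have "(\<Sum>i<n. sc (c i - d i) (b i)) \<in> V n" by (simp add: sc sum_subtractf)
      note u = uniq[OF this]
      show "d = restrict c {..<n}"
      proof
        fix i show "d i = restrict c {..<n} i"
          using d u[of i] by (cases "i < n") (auto simp: PiE_def extensional_def)
      qed
    qed auto
  qed
qed

subsection \<open>Homogeneous components\<close>

definition hcomp :: "nat \<Rightarrow> 'a::field poly4 \<Rightarrow> 'a poly4" where
  "hcomp d = linext (\<lambda>m c. if mdeg m = d then single m c else 0)"

lemma hcomp_linear:
  "hcomp d 0 = 0" "hcomp d (A + B) = hcomp d A + hcomp d B" "hcomp d (- A) = - hcomp d A" "hcomp d (A - B) = hcomp d A - hcomp d B"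
  unfolding hcomp_def by (rule linext_zero linext_add linext_uminus linext_diff, simp add: single_add)+

lemma hcomp_single: "hcomp d (single m c) = (if mdeg m = d then single m c else 0)"
  unfolding hcomp_def by (rule linext_single) (simp add: single_add)

lemma hcomp_homog: "homog e A \<Longrightarrow> hcomp d A = (if e = d then A else 0)"
proof -
  assume "homog e A"
  then have "hcomp d A = (\<Sum>m\<in>keys A. if e = d then single m (lookup A m) else 0)"
    unfolding hcomp_def linext_def homog_def by (intro sum.cong) auto
  then show ?thesis by (simp add: sum_single_lookup)
qed

lemma mdeg_add_nat: "mdeg (m + n) = mdeg m + (mdeg n :: nat)"
  by (simp add: mdeg_def lookup_add sum.distrib)

lemma homog_hcomp: "homog d (hcomp d A)"
  by (induction A rule: poly_mapping_add_induct)
    (auto simp: hcomp_linear hcomp_single homog_def dest!: subsetD[OF keys_add])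

lemma hcomp_mult_homog:
  assumes "homog e g"
  shows "hcomp d (g * A) = (if e \<le> d then g * hcomp (d - e) A else 0)"
proof (induction A rule: poly_mapping_add_induct)
  case (single m c)
  have "homog (e + mdeg m) (g * single m c)"
    unfolding homog_def
  proof
    fix k assume "k \<in> keys (g * single m c)"
    then obtain l where "l \<in> keys g" "k = l + m" using keys_mult[of g "single m c"] by (auto split: if_splits)
    then show "mdeg k = e + mdeg m" using assms by (simp add: homog_def mdeg_add_nat)
  qed
  then show ?case by (auto simp: hcomp_homog hcomp_single)
qed (simp_all add: hcomp_linear algebra_simps)

lemma homog_mult: "homog d A \<Longrightarrow> homog e B \<Longrightarrow> homog (d + e) (A * B)"
  unfolding homog_def using keys_mult[of A B] by (fastforce simp: mdeg_add_nat)

lemma homog_one: "homog 0 1"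
  by (simp add: homog_def mdeg_def)

lemma homog_power: "homog d A \<Longrightarrow> homog (n * d) (A ^ n)"
  by (induction n) (simp_all add: homog_one homog_mult)

lemma homog_plus: "homog d A \<Longrightarrow> homog d B \<Longrightarrow> homog d (A + B)"
  unfolding homog_def using keys_add[of A B] by blast

lemma homog_cst: "homog 0 (cst c)"
  by (auto simp: homog_def cst_def mdeg_def)

lemma homog_cst_mult: "homog d A \<Longrightarrow> homog d (cst c * A)"
  using homog_mult[OF homog_cst] by fastforce

lemma homog_uminus: "homog d A \<Longrightarrow> homog d (- A)"
  using homog_cst_mult[of d A "-1"] by (simp add: cst_uminus)

lemma homog_minus: "homog d A \<Longrightarrow> homog d B \<Longrightarrow> homog d (A - B)"
  using homog_plus[OF _ homog_uminus] by fastforce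

lemma homog_var: "homog 1 (var i)"
  by (auto simp: homog_def var_def mdeg_def lookup_single when_def)

lemma eval4_scale: "homog d A \<Longrightarrow> eval4 (c *s v) A = c ^ d * eval4 v A"
proof -
  assume A: "homog d A"
  have "vec_nth (c *s v) = (\<lambda>i. c * vec_nth v i)" by auto
  then show ?thesis unfolding eval4_insertion using insertion_homog[OF A] by metis
qed

subsection \<open>Polynomials over infinite fields\<close>

lemma digits_inject:
  fixes a b :: "4 \<Rightarrow> nat"
  assumes lt: "\<And>i. a i < N" "\<And>i. b i < N"
    and eq: "a 0 + N * (a 1 + N * (a 2 + N * a 3)) = b 0 + N * (b 1 + N * (b 2 + N * b 3))"
  shows "a i = b i"
proof -
  have step: "x = y \<and> p = q" if "x + N * p = y + N * q" "x < N" "y < N" for x y p q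
  proof -
    have "(x + N * p) mod N = (y + N * q) mod N" "(x + N * p) div N = (y + N * q) div N" using that by simp_all
    then show ?thesis using that(2,3) by simp
  qed
  have 0: "a 0 = b 0" "a 1 + N * (a 2 + N * a 3) = b 1 + N * (b 2 + N * b 3)" using step[OF eq] lt by blast+
  have 1: "a 1 = b 1" "a 2 + N * a 3 = b 2 + N * b 3" using step[OF 0(2)] lt by blast+
  have 2: "a 2 = b 2" "a 3 = b 3" using step[OF 1(2)] lt by blast+
  have "\<forall>i. a i = b i" unfolding all_4 using 0 1 2 by blast
  then show ?thesis by blast
qed

text \<open>Kronecker substitution: x, y, z, w are replaced by T, T^N, T^(N^2), T^(N^3) with N
  larger than all exponents. By uniqueness of digits in base N distinct monomials go to distinct
  powers of T, and a one-variable polynomial with infinitely many zeros is zero.\<close>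

lemma poly4_zero:
  fixes A :: "'a::field poly4"
  assumes inf: "infinite (UNIV :: 'a set)" and zero: "\<And>v. eval4 v A = 0"
  shows "A = 0"
proof (rule ccontr)
  assume "A \<noteq> 0"
  then obtain m where m: "m \<in> keys A" by (metis keys_eq_empty ex_in_conv poly_mapping_eqI in_keys_iff lookup_zero)
  define N where "N = Suc (\<Sum>m\<in>keys A. \<Sum>i\<in>UNIV. lookup m i)"
  have lt: "lookup k i < N" if "k \<in> keys A" for k i
  proof -
    have "lookup k i \<le> (\<Sum>i\<in>UNIV. lookup k i)" by (rule member_le_sum) simp_all
    also have "\<dots> \<le> (\<Sum>m\<in>keys A. \<Sum>i\<in>UNIV. lookup m i)" by (rule member_le_sum[OF that]) simp_all
    finally show ?thesis by (simp add: N_def)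
  qed
  define w where "w = (\<lambda>i :: 4. if i = 0 then 1 else if i = 1 then N else if i = 2 then N * N else N * N * N)"
  define \<phi> where "\<phi> = (\<lambda>k :: 4 \<Rightarrow>\<^sub>0 nat. \<Sum>i\<in>UNIV. w i * lookup k i)"
  have \<phi>: "\<phi> k = lookup k 0 + N * (lookup k 1 + N * (lookup k 2 + N * lookup k 3))" for k
    unfolding \<phi>_def sum_UNIV_4 w_def by (simp add: algebra_simps)
  have inj: "k = l" if "k \<in> keys A" "l \<in> keys A" "\<phi> k = \<phi> l" for k l
    by (rule poly_mapping_eqI, rule digits_inject[of "lookup k" N "lookup l"]) (use that lt \<phi> in auto)
  define p where "p = (\<Sum>k\<in>keys A. Polynomial.monom (lookup A k) (\<phi> k))"
  have "poly p x = eval4 (\<chi> i. x ^ w i) A" for x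
    unfolding p_def poly_sum eval4_def
    by (intro sum.cong refl) (simp add: poly_monom \<phi>_def power_sum power_mult)
  then have "p = 0" using zero poly_roots_finite[of p] inf by auto
  moreover have "Polynomial.coeff p (\<phi> m) = (\<Sum>k\<in>keys A. if k = m then lookup A k else 0)"
    unfolding p_def Polynomial.coeff_sum using inj m by (intro sum.cong) auto
  ultimately show False using m by (simp add: in_keys_iff)
qed

subsection \<open>Ideals with four generators\<close>

text \<open>Ideals with fewer generators are written with zeros, so that all ideals of the
  multiplicity computation share one form.\<close>

definition gen4 :: "'r::comm_ring_1 \<Rightarrow> 'r \<Rightarrow> 'r \<Rightarrow> 'r \<Rightarrow> 'r set" where
  "gen4 f g h k = {f * a + g * b + h * c + k * d | a b c d. True}"

lemma gen4_ideal: "ring_ideal (gen4 f g h k)"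
  unfolding ring_ideal_def
proof (intro conjI ballI allI)
  have "0 = f * 0 + g * 0 + h * 0 + k * 0" by simp
  then show "0 \<in> gen4 f g h k" unfolding gen4_def by blast
  fix r x assume "x \<in> gen4 f g h k"
  then obtain a b c d where x: "x = f * a + g * b + h * c + k * d" unfolding gen4_def by blast
  have "r * x = f * (r * a) + g * (r * b) + h * (r * c) + k * (r * d)" by (simp add: x algebra_simps)
  then show "r * x \<in> gen4 f g h k" unfolding gen4_def by blast
  fix y assume "y \<in> gen4 f g h k"
  then obtain a' b' c' d' where y: "y = f * a' + g * b' + h * c' + k * d'" unfolding gen4_def by blast
  have "x + y = f * (a + a') + g * (b + b') + h * (c + c') + k * (d + d')" by (simp add: x y algebra_simps)
  then show "x + y \<in> gen4 f g h k" unfolding gen4_def by blast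
qed

lemma gen4_mem: "f \<in> gen4 f g h k" "g \<in> gen4 f g h k" "h \<in> gen4 f g h k" "k \<in> gen4 f g h k"
proof -
  have *: "f * a + g * b + h * c + k * d \<in> gen4 f g h k" for a b c d
    unfolding gen4_def by (intro CollectI exI conjI TrueI) (rule refl)
  show "f \<in> gen4 f g h k" using *[of 1 0 0 0] by simp
  show "g \<in> gen4 f g h k" using *[of 0 1 0 0] by simp
  show "h \<in> gen4 f g h k" using *[of 0 0 1 0] by simp
  show "k \<in> gen4 f g h k" using *[of 0 0 0 1] by simp
qed

lemma gen4_least:
  assumes I: "ring_ideal I" and m: "f \<in> I" "g \<in> I" "h \<in> I" "k \<in> I"
  shows "gen4 f g h k \<subseteq> I"
proof
  fix x assume "x \<in> gen4 f g h k"
  then obtain a b c d where x: "x = f * a + g * b + h * c + k * d" unfolding gen4_def by blast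
  have "y * z \<in> I" if "y \<in> I" for y z
  proof -
    have "z * y \<in> I" using I that unfolding ring_ideal_def by blast
    then show ?thesis by (simp only: mult.commute)
  qed
  moreover have "y + z \<in> I" if "y \<in> I" "z \<in> I" for y z using I that unfolding ring_ideal_def by blast
  ultimately show "x \<in> I" using m unfolding x by simp
qed

lemma gen4E:
  assumes "x \<in> gen4 f g h k"
  obtains a b c d where "x = f * a + g * b + h * c + k * d"
  using assms unfolding gen4_def by auto

lemma gen4_hcomp:
  assumes "homog df f" "homog dg g" "homog dh h" "homog dk k" "x \<in> gen4 f g h k"
  shows "hcomp d x \<in> gen4 f g h k"
proof -
  obtain a b c e where x: "x = f * a + g * b + h * c + k * e" using assms(5) unfolding gen4_def by blast
  have "hcomp d (y * z) \<in> gen4 f g h k" if "homog dy y" "y \<in> gen4 f g h k" for dy y z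
    using gen4_ideal[of f g h k] that unfolding hcomp_mult_homog[OF that(1)] ring_ideal_def by (metis mult.commute)
  from this[OF assms(1) gen4_mem(1)] this[OF assms(2) gen4_mem(2)] this[OF assms(3) gen4_mem(3)] this[OF assms(4) gen4_mem(4)]
  show ?thesis unfolding x hcomp_linear using gen4_ideal[of f g h k] unfolding ring_ideal_def by blast
qed

subsection \<open>The local ring at a point in linear coordinates\<close>

lemma cst_eval4: "cst (eval4 v A) = insertion cst (\<lambda>j. cst (v $ j)) A"
proof (rule insertion_unique[OF ring_map_cst])
  show "cst (eval4 v (single 0 c)) = cst c" for c using eval4_cst[of v c] by (simp add: cst_def)
  show "cst (eval4 v (single (single i 1) 1)) = cst (v $ i)" for i using eval4_var[of v i] by (simp add: var_def)
qed (simp_all add: eval4_simps cst_add cst_mult)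

definition linform :: "('a::field ^ 4) \<Rightarrow> 'a poly4" where
  "linform M = (\<Sum>j\<in>UNIV. cst (M $ j) * var j)"

lemma homog_linform: "homog 1 (linform M)"
  unfolding linform_def sum_UNIV_4 by (intro homog_plus homog_cst_mult homog_var)

lemma insertion_linform: "ring_map h \<Longrightarrow> insertion h g (linform M) = (\<Sum>j\<in>UNIV. h (M $ j) * g j)"
  by (simp add: linform_def insertion_simps insertion_at_var insertion_at_cst)

lemma ring_map_const_poly2: "ring_map (\<lambda>c :: 'a::comm_ring_1. [:[:c:]:])"
  by (simp add: ring_map_def one_pCons)

lemma coeff_mult_0_1:
  "Polynomial.coeff (p * q) 0 = Polynomial.coeff p 0 * Polynomial.coeff q 0"
  "Polynomial.coeff (p * q) 1 = Polynomial.coeff p 0 * Polynomial.coeff q 1 + Polynomial.coeff p 1 * Polynomial.coeff q 0"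
  unfolding coeff_mult by (simp_all add: One_nat_def)

lemma deg0_fractions_iff:
  "x \<in> deg0_fractions N D \<longleftrightarrow> (\<exists>A B d. x = Fract A B \<and> homog d A \<and> homog d B \<and> A \<in> N \<and> B \<in> D)"
  unfolding deg0_fractions_def by blast

context
  fixes e M :: "4 \<Rightarrow> 'a::field ^ 4" and L :: "4 \<Rightarrow> 'a poly4" and D :: "'a poly4 set"
  assumes dual: "\<And>i k. (\<Sum>j\<in>UNIV. M i $ j * e k $ j) = (if i = k then 1 else 0)"
    and dual': "\<And>i j. (\<Sum>k\<in>UNIV. e k $ i * M k $ j) = (if i = j then 1 else 0)"
  defines "L \<equiv> \<lambda>i. linform (M i)" and "D \<equiv> {B. \<forall>v\<in>proj_point (e 3). eval4 v B \<noteq> 0}"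
begin

lemma var_expand: "var i = (\<Sum>k\<in>UNIV. cst (e k $ i) * L k)"
proof -
  have "(\<Sum>k\<in>UNIV. cst (e k $ i) * L k) = (\<Sum>k\<in>UNIV. \<Sum>j\<in>UNIV. cst (e k $ i * M k $ j) * var j)"
    unfolding L_def linform_def by (simp add: sum_distrib_left cst_mult mult.assoc)
  also have "\<dots> = (\<Sum>j\<in>UNIV. \<Sum>k\<in>UNIV. cst (e k $ i * M k $ j) * var j)" by (rule sum.swap)
  also have "\<dots> = (\<Sum>j\<in>UNIV. cst (\<Sum>k\<in>UNIV. e k $ i * M k $ j) * var j)"
    unfolding sum_UNIV_4 by (simp add: cst_add distrib_right)
  also have "\<dots> = (\<Sum>j\<in>UNIV. if i = j then var j else 0)"
    unfolding dual' by (intro sum.cong) auto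
  finally show ?thesis by simp
qed

lemma eval4_L: "eval4 (e k) (L i) = (if i = k then 1 else 0)"
  unfolding L_def linform_def eval4_simps eval4_cst eval4_var by (rule dual)

lemma homog_L: "homog 1 (L i)"
  unfolding L_def by (rule homog_linform)

lemma homog_L_power: "homog n (L i ^ n)"
  using homog_power[OF homog_L, of n i] by simp

text \<open>The forms L 0, L 1, L 2 vanish at the point \<open>e 3\<close>. Modulo them every
  variable is a constant times L 3, so a form of degree d is its value at the point times L 3 ^
  d.\<close>

lemma reduce_mod_point:
  assumes A: "homog d A" and I: "ring_ideal I" "L 0 \<in> I" "L 1 \<in> I" "L 2 \<in> I"
  shows "A - cst (eval4 (e 3) A) * L 3 ^ d \<in> I"
proof -
  have "var i - L 3 * cst (e 3 $ i) \<in> I" for i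
  proof -
    have "var i - L 3 * cst (e 3 $ i) = cst (e 0 $ i) * L 0 + cst (e 1 $ i) * L 1 + cst (e 2 $ i) * L 2"
      unfolding var_expand[of i] sum_UNIV_4 by (simp add: algebra_simps)
    then show ?thesis using I unfolding ring_ideal_def by simp
  qed
  from insertion_cong_mod[OF ring_map_cst I(1), of var "\<lambda>i. L 3 * cst (e 3 $ i)" A, OF this]
  show ?thesis unfolding insertion_cst_var insertion_homog[OF A] cst_eval4 by (simp add: mult.commute)
qed

lemma D_eval: "B \<in> D \<Longrightarrow> eval4 (e 3) B \<noteq> 0"
proof -
  have "e 3 \<in> proj_point (e 3)" unfolding proj_point_def by (intro CollectI exI[of _ 1]) simp
  then show "B \<in> D \<Longrightarrow> eval4 (e 3) B \<noteq> 0" unfolding D_def by blast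
qed

lemma D_homog: "homog d B \<Longrightarrow> eval4 (e 3) B \<noteq> 0 \<Longrightarrow> B \<in> D"
  unfolding D_def proj_point_def by (auto simp: eval4_scale)

lemma D_mult: "B \<in> D \<Longrightarrow> C \<in> D \<Longrightarrow> B * C \<in> D"
  unfolding D_def by (simp add: eval4_simps)

lemma D_L: "L 3 ^ n \<in> D"
  by (rule D_homog[OF homog_L_power]) (simp add: eval4_simps eval4_L)

lemma D_nonzero: "B \<in> D \<Longrightarrow> B \<noteq> 0"
  using D_eval[of B] by (auto simp: eval4_simps)

text \<open>A chain of homogeneous ideals, each obtained from the next by adding one form b k that
  the ideal of the point multiplies into the next one. In the local ring each step is spanned by b k
  over the residue field. The form W is a unit at the point and absorbs the difference between I and
  the last ideal.\<close>

lemma local_multiplicity: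
  fixes J :: "nat \<Rightarrow> 'a poly4 set" and b :: "nat \<Rightarrow> 'a poly4" and deg :: "nat \<Rightarrow> nat"
  assumes J: "\<And>k. k \<le> n \<Longrightarrow> ring_ideal (J k)" "\<And>k x m. k \<le> n \<Longrightarrow> x \<in> J k \<Longrightarrow> hcomp m x \<in> J k" "J 0 = UNIV"
    and dec: "\<And>k. k < n \<Longrightarrow> J (Suc k) \<subseteq> J k"
    and b: "\<And>k. k < n \<Longrightarrow> homog (deg k) (b k)" "\<And>k. k < n \<Longrightarrow> b k \<in> J k"
    and step: "\<And>k A. k < n \<Longrightarrow> A \<in> J k \<Longrightarrow> \<exists>h. A - b k * h \<in> J (Suc k)"
    and max: "\<And>k i. k < n \<Longrightarrow> i \<in> {0, 1, 2} \<Longrightarrow> b k * L i \<in> J (Suc k)"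
    and nonmem: "\<And>k B. k < n \<Longrightarrow> eval4 (e 3) B \<noteq> 0 \<Longrightarrow> b k * B \<notin> J (Suc k)"
    and I: "I \<subseteq> J n" and W: "homog m W" "eval4 (e 3) W \<noteq> 0" "\<And>A. A \<in> J n \<Longrightarrow> W * A \<in> I"
  shows "has_quot_dim UNIV (\<lambda>c f. fract_cst c * f) (deg0_fractions UNIV D) (deg0_fractions I D) n"
proof -
  \<comment> \<open>The filtration continues constantly beyond n, since
    \<open>has_quot_dim_chain\<close> wants subgroups for all indices.\<close>
  define V where "V = (\<lambda>k. deg0_fractions (J (min k n)) D)"
  have sc: "fract_cst c * Fract A B = Fract (cst c * A) B" for c A B
    by (simp add: fract_cst_def)
  have cstJ: "x * y \<in> J k" if "k \<le> n" "y \<in> J k" for x y k using J(1)[OF that(1)] that(2) unfolding ring_ideal_def by blast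
  have "has_quot_dim UNIV (\<lambda>c f. fract_cst c * f) (V 0) (V n) n"
  proof (rule has_quot_dim_chain[where b = "\<lambda>k. Fract (b k) (L 3 ^ deg k)"])
    show "fract_cst (c - d) * v = fract_cst c * v - fract_cst d * v" for c d :: 'a and v
      by (simp add: fract_cst_def cst_diff left_diff_distrib[symmetric])
    show "v - w \<in> V k" if vw: "v \<in> V k" "w \<in> V k" for v w k
    proof -
      let ?k = "min k n"
      obtain A B m where A: "v = Fract A B" "homog m A" "homog m B" "A \<in> J ?k" "B \<in> D"
        using vw(1) unfolding V_def deg0_fractions_iff by blast
      obtain A' B' m' where A': "w = Fract A' B'" "homog m' A'" "homog m' B'" "A' \<in> J ?k" "B' \<in> D"
        using vw(2) unfolding V_def deg0_fractions_iff by blast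
      have "v - w = Fract (A * B' - A' * B) (B * B')" using A A' D_nonzero by simp
      moreover have "homog (m + m') (A * B' - A' * B)"
        using homog_minus[OF homog_mult[OF A(2) A'(3)]] homog_mult[OF A'(2) A(3)] by (simp add: add.commute)
      moreover have "A * B' - A' * B \<in> J ?k"
        using ring_ideal_diff[OF J(1)] cstJ[of ?k A B'] cstJ[of ?k A' B] A A' by (simp add: mult.commute)
      ultimately show ?thesis unfolding V_def deg0_fractions_iff using homog_mult[OF A(3) A'(3)] D_mult[OF A(5) A'(5)] by blast
    qed
    show "fract_cst c * v \<in> V k" if "v \<in> V k" for c v k
      using that cstJ[of "min k n"] unfolding V_def deg0_fractions_iff by (auto simp: sc) (metis homog_cst_mult min.cobounded2)
    show "V (Suc k) \<subseteq> V k" if "k < n" for k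
      using dec[OF that] that unfolding V_def by (auto simp: deg0_fractions_iff min_def) blast
    show "Fract (b k) (L 3 ^ deg k) \<in> V k" if "k < n" for k
      using b[OF that] that homog_L_power[of "deg k" 3] D_L unfolding V_def deg0_fractions_iff by (auto simp: min_def)
    show "\<exists>c. v - fract_cst c * Fract (b k) (L 3 ^ deg k) \<in> V (Suc k)" if k: "k < n" and v: "v \<in> V k" for k v
    proof -
      let ?J = "J (Suc k)"
      have k1: "Suc k \<le> n" using k by simp
      note J1 = J(1)[OF k1]
      obtain A B d where A: "v = Fract A B" "homog d A" "homog d B" "A \<in> J k" "B \<in> D"
        using v k unfolding V_def deg0_fractions_iff by (auto simp: min_def)
      obtain h where h: "A - b k * h \<in> ?J" using step[OF k A(4)] by blast
      \<comment> \<open>The multipliers that carry b k into the next ideal. They form an ideal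
        containing L 0, L 1, L 2, so the reduction modulo the point applies to the cofactor of b
        k.\<close>
      define I' where "I' = {x. b k * x \<in> ?J}"
      have I': "ring_ideal I'" "L 0 \<in> I'" "L 1 \<in> I'" "L 2 \<in> I'"
        using J1 max[OF k] unfolding I'_def ring_ideal_def by (auto simp: distrib_left mult.left_commute)
      have red: "b k * (C - cst (eval4 (e 3) C) * L 3 ^ m) \<in> ?J" if "homog m C" for m C
        using reduce_mod_point[OF that I'] unfolding I'_def by simp
      have comp: "A - (if deg k \<le> d then b k * hcomp (d - deg k) h else 0) \<in> ?J"
        using J(2)[OF k1 h, of d] hcomp_homog[OF A(2), of d] unfolding hcomp_linear hcomp_mult_homog[OF b(1)[OF k]] by simp
      \<comment> \<open>The numerator is compared with b k after multiplication by powers of L 3.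
        This also covers the case that d is smaller than the degree of b k; then A itself lies in
        the next ideal and c = 0.\<close>
      obtain c where c: "A * L 3 ^ deg k - cst c * (b k * L 3 ^ d) \<in> ?J"
      proof (cases "deg k \<le> d")
        case True
        define c where "c = eval4 (e 3) (hcomp (d - deg k) h)"
        have "(A - b k * hcomp (d - deg k) h) + b k * (hcomp (d - deg k) h - cst c * L 3 ^ (d - deg k)) \<in> ?J"
          using comp red[OF homog_hcomp, of "d - deg k" h] True J1 unfolding ring_ideal_def c_def by simp
        then have "L 3 ^ deg k * (A - cst c * (b k * L 3 ^ (d - deg k))) \<in> ?J"
          by (intro cstJ k1) (simp add: algebra_simps)
        also have "L 3 ^ deg k * (A - cst c * (b k * L 3 ^ (d - deg k))) = A * L 3 ^ deg k - cst c * (b k * (L 3 ^ deg k * L 3 ^ (d - deg k)))"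
          by (simp add: algebra_simps)
        also have "L 3 ^ deg k * L 3 ^ (d - deg k) = L 3 ^ d" using True by (simp add: power_add[symmetric])
        finally show thesis by (rule that)
      next
        case False
        then have "L 3 ^ deg k * A \<in> ?J" using comp by (intro cstJ k1) simp
        then show thesis using that[of 0] by (simp add: mult.commute)
      qed
      define \<beta> where "\<beta> = eval4 (e 3) B"
      have \<beta>: "\<beta> \<noteq> 0" using D_eval[OF A(5)] by (simp add: \<beta>_def)
      \<comment> \<open>In front of b k the power L 3 ^ d is traded for B / \<beta>, because B is
        congruent to \<beta> L 3 ^ d.\<close>
      have "(A * L 3 ^ deg k - cst c * (b k * L 3 ^ d)) - cst (c / \<beta>) * (b k * (B - cst \<beta> * L 3 ^ d)) \<in> ?J"
        by (rule ring_ideal_diff[OF J1 c]) (rule cstJ[OF k1], unfold \<beta>_def, rule red[OF A(3)])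
      also have "(A * L 3 ^ deg k - cst c * (b k * L 3 ^ d)) - cst (c / \<beta>) * (b k * (B - cst \<beta> * L 3 ^ d))
        = A * L 3 ^ deg k - cst (c / \<beta>) * b k * B - (cst c - cst (c / \<beta>) * cst \<beta>) * (b k * L 3 ^ d)"
        by (simp add: algebra_simps)
      also have "cst c - cst (c / \<beta>) * cst \<beta> = 0" using \<beta> by (simp add: cst_mult[symmetric])
      finally have num: "A * L 3 ^ deg k - cst (c / \<beta>) * b k * B \<in> ?J" by simp
      have "v - fract_cst (c / \<beta>) * Fract (b k) (L 3 ^ deg k) = Fract (A * L 3 ^ deg k - cst (c / \<beta>) * b k * B) (B * L 3 ^ deg k)"
        unfolding A(1) sc using D_nonzero[OF A(5)] D_nonzero[OF D_L[of "deg k"]] by simp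
      moreover have "homog (d + deg k) (A * L 3 ^ deg k - cst (c / \<beta>) * b k * B)"
        using homog_minus[OF homog_mult[OF A(2) homog_L_power[of "deg k" 3]] _] homog_mult[OF homog_cst_mult[OF b(1)[OF k]] A(3), of "c / \<beta>"]
        by (simp add: add.commute)
      ultimately show ?thesis
        using num k homog_mult[OF A(3) homog_L_power[of "deg k" 3]] D_mult[OF A(5) D_L[of "deg k"]]
        unfolding V_def deg0_fractions_iff min_absorb1[OF k1] by blast
    qed
    show "c = 0" if k: "k < n" and mem: "fract_cst c * Fract (b k) (L 3 ^ deg k) \<in> V (Suc k)" for k c
    proof (rule ccontr)
      assume c: "c \<noteq> 0"
      have k1: "Suc k \<le> n" using k by simp
      obtain A B d where A: "Fract (cst c * b k) (L 3 ^ deg k) = Fract A B" "A \<in> J (Suc k)" "B \<in> D"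
        using mem unfolding V_def deg0_fractions_iff sc min_absorb1[OF k1] by blast
      then have "cst c * b k * B = A * L 3 ^ deg k"
        using D_nonzero[OF A(3)] D_nonzero[OF D_L[of "deg k"]] by (simp add: eq_fract)
      then have "cst c * (b k * B) \<in> J (Suc k)" using cstJ[OF k1 A(2), of "L 3 ^ deg k"] by (simp add: ac_simps)
      then have "cst (inverse c) * (cst c * (b k * B)) \<in> J (Suc k)" by (rule cstJ[OF k1])
      also have "cst (inverse c) * (cst c * (b k * B)) = b k * B" using c by (simp add: mult.assoc[symmetric] cst_mult[symmetric])
      finally show False using nonmem[OF k D_eval[OF A(3)]] by contradiction
    qed
  qed
  moreover have "V 0 = deg0_fractions UNIV D" by (simp add: V_def J(3))
  moreover have "V n = deg0_fractions I D"
  proof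
    show "deg0_fractions I D \<subseteq> V n" using I unfolding V_def deg0_fractions_def by auto
    show "V n \<subseteq> deg0_fractions I D"
    proof
      fix v assume "v \<in> V n"
      then obtain A B d where A: "v = Fract A B" "homog d A" "homog d B" "A \<in> J n" "B \<in> D"
        unfolding V_def deg0_fractions_iff by auto
      have W_in_D: "W \<in> D" using D_homog W by blast
      have "v = Fract (W * A) (W * B)" using A(1) D_nonzero[OF W_in_D] D_nonzero[OF A(5)] by (simp add: eq_fract)
      then show "v \<in> deg0_fractions I D" unfolding deg0_fractions_iff
        using homog_mult[OF W(1) A(2)] homog_mult[OF W(1) A(3)] W(3)[OF A(4)] D_mult[OF W_in_D A(5)] by blast
    qed
  qed
  ultimately show ?thesis by simp
qed

text \<open>Restriction to the plane L 0 = 0 in the chart L 3 = 1: the outer variable is L 1 and the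
  inner one is L 2. Non-membership in the ideals of the chains is read off from coefficients
  there.\<close>

abbreviation jet :: "'a poly4 \<Rightarrow> 'a poly poly" where
  "jet \<equiv> insertion (\<lambda>c. [:[:c:]:]) (\<lambda>j. [:[:e 3 $ j, e 2 $ j:], [:e 1 $ j:]:])"

lemmas jet_simps = insertion_simps[OF ring_map_const_poly2]

lemma jet_L: "jet (L i) = [:[:if i = 3 then 1 else 0, if i = 2 then 1 else 0:], [:if i = 1 then 1 else 0:]:]"
proof -
  have "jet (L i) = (\<Sum>j\<in>UNIV. [:[:M i $ j * e 3 $ j, M i $ j * e 2 $ j:], [:M i $ j * e 1 $ j:]:])"
    unfolding L_def insertion_linform[OF ring_map_const_poly2] by simp
  also have "\<dots> = [:[:\<Sum>j\<in>UNIV. M i $ j * e 3 $ j, \<Sum>j\<in>UNIV. M i $ j * e 2 $ j:], [:\<Sum>j\<in>UNIV. M i $ j * e 1 $ j:]:]"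
    unfolding sum_UNIV_4 by simp
  finally show ?thesis unfolding dual .
qed

lemma jet_cst: "jet (cst c) = [:[:c:]:]"
  by (rule insertion_at_cst[OF ring_map_const_poly2])

lemma jet_value: "poly (Polynomial.coeff (jet A) 0) 0 = eval4 (e 3) A"
  unfolding eval4_insertion
proof (rule insertion_unique[OF ring_map_id])
  show "poly (Polynomial.coeff (jet (single 0 c)) 0) 0 = id c" for c using jet_cst[of c] by (simp add: cst_def)
  show "poly (Polynomial.coeff (jet (single (single i 1) 1)) 0) 0 = e 3 $ i" for i
    using insertion_at_var[OF ring_map_const_poly2, of "\<lambda>j. [:[:e 3 $ j, e 2 $ j:], [:e 1 $ j:]:]" i] by (simp add: var_def)
qed (simp_all add: jet_simps coeff_mult_0_1)

lemma L_power_simps: "jet (L 0) = 0" "jet (L 1) = [:0, 1:]" "jet (L 2 ^ n) = [:Polynomial.monom 1 n:]"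
proof -
  show "jet (L 0) = 0" "jet (L 1) = [:0, 1:]" unfolding jet_L by (simp_all add: one_pCons)
  have "jet (L 2) = [:Polynomial.monom 1 1:]" unfolding jet_L by (simp add: One_nat_def monom_Suc monom_0)
  then show "jet (L 2 ^ n) = [:Polynomial.monom 1 n:]"
    unfolding jet_simps by (simp add: poly_const_pow monom_power)
qed

text \<open>As L 3 is a unit at the point, L 3 L 1 makes L 1 vanish locally, and C then makes L 2 ^
  3 vanish. The steps of the chain are represented by 1, L 2, L 2 ^ 2.\<close>

lemma multiplicity_three:
  assumes I: "ring_ideal I" "L 0 \<in> I" "L 3 * L 1 \<in> I" "C \<in> I" "C - cst \<delta> * L 2 ^ 3 \<in> gen4 (L 0) (L 1) 0 0" "\<delta> \<noteq> 0"
    and sub: "I \<subseteq> gen4 (L 0) (L 1) (L 2 ^ 3) 0"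
  shows "has_quot_dim UNIV (\<lambda>c f. fract_cst c * f) (deg0_fractions UNIV D) (deg0_fractions I D) 3"
proof (rule local_multiplicity[where J = "\<lambda>k. gen4 (L 0) (L 1) (L 2 ^ k) 0" and b = "\<lambda>k. L 2 ^ k" and deg = "\<lambda>k. k" and W = "L 3"])
  let ?J = "\<lambda>k. gen4 (L 0) (L 1) (L 2 ^ k) 0"
  show "ring_ideal (?J k)" for k by (rule gen4_ideal)
  have mult: "x * y \<in> ?J k" if "y \<in> ?J k" for x y k using gen4_ideal[of "L 0" "L 1" "L 2 ^ k" 0] that unfolding ring_ideal_def by blast
  have homog0: "homog 0 (0 :: 'a poly4)" by (simp add: homog_def)
  show "hcomp m x \<in> ?J k" if "x \<in> ?J k" for k x m
    by (rule gen4_hcomp[OF homog_L homog_L homog_L_power homog0 that])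
  show "?J 0 = UNIV" using mult[of 1 0] gen4_mem(3)[of 1 "L 0" "L 1" 0] by auto
  show "?J (Suc k) \<subseteq> ?J k" for k
    by (rule gen4_least[OF gen4_ideal]) (use mult[OF gen4_mem(3)] in \<open>simp_all add: gen4_mem\<close>)
  show "homog k (L 2 ^ k)" "L 2 ^ k \<in> ?J k" for k by (rule homog_L_power, rule gen4_mem)
  show "\<exists>h. A - L 2 ^ k * h \<in> ?J (Suc k)" if mem: "A \<in> ?J k" for k A
  proof -
    obtain a b c d where A: "A = L 0 * a + L 1 * b + L 2 ^ k * c + 0 * d" by (rule gen4E[OF mem])
    have "A - L 2 ^ k * c = L 0 * a + L 1 * b + L 2 ^ Suc k * 0 + 0 * d" unfolding A by simp
    then show ?thesis unfolding gen4_def by (intro exI CollectI conjI TrueI)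
  qed
  show "L 2 ^ k * L i \<in> ?J (Suc k)" if "i \<in> {0, 1, 2}" for k i
    using that mult[OF gen4_mem(1), of "L 2 ^ k" "Suc k"] mult[OF gen4_mem(2), of "L 2 ^ k" "Suc k"] gen4_mem(3)[of "L 2 ^ Suc k" "L 0" "L 1" 0]
    by (auto simp: mult.commute)
  show "L 2 ^ k * B \<notin> ?J (Suc k)" if B: "eval4 (e 3) B \<noteq> 0" for k B
  proof
    assume "L 2 ^ k * B \<in> ?J (Suc k)"
    then obtain a b c d where "L 2 ^ k * B = L 0 * a + L 1 * b + L 2 ^ Suc k * c + 0 * d" by (rule gen4E)
    then have "Polynomial.coeff (jet (L 2 ^ k * B)) 0 = Polynomial.coeff (jet (L 0 * a + L 1 * b + L 2 ^ Suc k * c)) 0" by simp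
    then have "Polynomial.monom 1 k * Polynomial.coeff (jet B) 0 = Polynomial.monom 1 (Suc k) * Polynomial.coeff (jet c) 0"
      unfolding jet_simps(2,6) L_power_simps coeff_add coeff_mult_0_1 by simp
    also have "\<dots> = Polynomial.monom 1 k * (Polynomial.monom 1 1 * Polynomial.coeff (jet c) 0)"
      by (simp add: mult.assoc[symmetric] mult_monom Suc_eq_plus1)
    finally have "Polynomial.coeff (jet B) 0 = Polynomial.monom 1 1 * Polynomial.coeff (jet c) 0" by simp
    then have "eval4 (e 3) B = 0" unfolding jet_value[symmetric] by (simp add: poly_monom)
    with B show False by contradiction
  qed
  show "I \<subseteq> ?J 3" by (rule sub)
  show "homog 1 (L 3)" by (rule homog_L)
  show "eval4 (e 3) (L 3) \<noteq> 0" by (simp add: eval4_L)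
  have multI: "x * y \<in> I" if "y \<in> I" for x y using I(1) that unfolding ring_ideal_def by blast
  obtain a b c d where C: "C - cst \<delta> * L 2 ^ 3 = L 0 * a + L 1 * b + 0 * c + 0 * d" by (rule gen4E[OF I(5)])
  have "cst (inverse \<delta>) * (L 3 * (C - L 0 * a)) - cst (inverse \<delta>) * b * (L 3 * L 1) \<in> I"
  proof -
    have "L 0 * a \<in> I" using multI[OF I(2), of a] by (simp only: mult.commute)
    from ring_ideal_diff[OF I(1) multI[OF multI[OF ring_ideal_diff[OF I(1) I(4) this]]] multI[OF I(3)]]
    show ?thesis .
  qed
  also have "cst (inverse \<delta>) * (L 3 * (C - L 0 * a)) - cst (inverse \<delta>) * b * (L 3 * L 1)
    = cst (inverse \<delta>) * L 3 * ((C - cst \<delta> * L 2 ^ 3) - L 0 * a - L 1 * b) + (cst (inverse \<delta>) * cst \<delta>) * (L 3 * L 2 ^ 3)"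
    by (simp add: algebra_simps)
  also have "cst (inverse \<delta>) * cst \<delta> = 1" using I(6) by (simp add: cst_mult[symmetric])
  finally have L23: "L 3 * L 2 ^ 3 \<in> I" unfolding C by simp
  show "L 3 * A \<in> I" if mem: "A \<in> ?J 3" for A
  proof -
    obtain a b c d where A: "A = L 0 * a + L 1 * b + L 2 ^ 3 * c + 0 * d" by (rule gen4E[OF mem])
    have "L 3 * A = (L 3 * a) * L 0 + b * (L 3 * L 1) + c * (L 3 * L 2 ^ 3)" unfolding A by (simp add: algebra_simps)
    then show ?thesis using multI[OF I(2)] multI[OF I(3)] multI[OF L23] I(1) unfolding ring_ideal_def by simp
  qed
qed

text \<open>The local ring modulo (L 0, L 1 ^ 2, C) has the basis 1, L 2, L 2 ^ 2, L 1, L 1 L 2, L 1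
  L 2 ^ 2: modulo L 0 and L 1 the cubic C is a multiple of L 2 ^ 3, which bounds the powers of L
  2.\<close>

lemma multiplicity_six:
  assumes I: "ring_ideal I" "L 0 \<in> I" "L 1 ^ 2 \<in> I" "C \<in> I" and C: "homog 3 C"
    "C - cst \<delta> * L 2 ^ 3 \<in> gen4 (L 0) (L 1) 0 0" and \<delta>: "\<delta> \<noteq> 0"
    and sub: "I \<subseteq> gen4 (L 0) (L 1 ^ 2) C 0"
  shows "has_quot_dim UNIV (\<lambda>c f. fract_cst c * f) (deg0_fractions UNIV D) (deg0_fractions I D) 6"
proof -
  let ?J = "\<lambda>k. gen4 (L 0) (L 1) (L 2 ^ k) 0" and ?K = "\<lambda>j. gen4 (L 0) (L 1 ^ 2) (L 1 * L 2 ^ j) C"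
  \<comment> \<open>The first half of the chain works modulo L 1, the second half inside the
    multiples of L 1. They fit together because \<open>?K 0\<close> contains L 1 and C, hence also L
    2 ^ 3.\<close>
  define J where "J = (\<lambda>k. if k < 3 then ?J k else ?K (k - 3))"
  define b where "b = (\<lambda>k. if k < 3 then L 2 ^ k else L 1 * L 2 ^ (k - 3))"
  define deg where "deg = (\<lambda>k :: nat. if k < 3 then k else k - 2)"
  note ideals = gen4_ideal
  have mult: "x * y \<in> S" "y * x \<in> S" if "ring_ideal S" "y \<in> S" for x y and S :: "'a poly4 set"
  proof -
    show "x * y \<in> S" using that unfolding ring_ideal_def by blast
    then show "y * x \<in> S" by (simp only: mult.commute)
  qed
  obtain q0 q1 q2 q3 where q: "C - cst \<delta> * L 2 ^ 3 = L 0 * q0 + L 1 * q1 + 0 * q2 + 0 * q3" by (rule gen4E[OF C(2)])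
  then have Ceq: "C = cst \<delta> * L 2 ^ 3 + (L 0 * q0 + L 1 * q1)" by (simp add: algebra_simps)
  have inv: "cst (inverse \<delta>) * cst \<delta> = 1" using \<delta> by (simp add: cst_mult[symmetric])
  \<comment> \<open>Whenever x carries L 0, L 1 and C into an ideal, it carries L 2 ^ 3 into it as
    well; \<delta> is invertible.\<close>
  have cube: "x * L 2 ^ 3 \<in> S" if S: "ring_ideal S" "x * L 0 \<in> S" "x * L 1 \<in> S" "x * C \<in> S" for x S
  proof -
    have "cst (inverse \<delta>) * (x * C - ((x * L 0) * q0 + (x * L 1) * q1)) \<in> S"
    proof (rule mult(1)[OF S(1)], rule ring_ideal_diff[OF S(1) S(4)])
      show "(x * L 0) * q0 + (x * L 1) * q1 \<in> S"
        using S(1) mult(2)[OF S(1,2), of q0] mult(2)[OF S(1,3), of q1] unfolding ring_ideal_def by blast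
    qed
    also have "cst (inverse \<delta>) * (x * C - ((x * L 0) * q0 + (x * L 1) * q1)) = (cst (inverse \<delta>) * cst \<delta>) * (x * L 2 ^ 3)"
      unfolding Ceq by (simp add: algebra_simps)
    finally show ?thesis unfolding inv by simp
  qed
  have k_cases: thesis if "k < 2 \<Longrightarrow> thesis" "k = 2 \<Longrightarrow> thesis" "\<And>j. k = 3 + j \<Longrightarrow> j < 3 \<Longrightarrow> thesis" "k < 6" for k :: nat and thesis
  proof -
    consider "k < 2" | "k = 2" | "k \<ge> 3" by linarith
    then show thesis
    proof cases
      case 3
      show thesis by (rule that(3)[of "k - 3"]) (use 3 that(4) in linarith)+
    qed (rule that(1,2), assumption)+
  qed
  have J: "k < 2 \<Longrightarrow> J k = ?J k" "k < 2 \<Longrightarrow> J (Suc k) = ?J (Suc k)" "J 2 = ?J 2" "J (Suc 2) = ?K 0" "J (3 + j) = ?K j" "J (Suc (3 + j)) = ?K (Suc j)" for k j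
    by (simp_all add: J_def)
  have b: "k < 2 \<Longrightarrow> b k = L 2 ^ k" "b 2 = L 2 ^ 2" "b (3 + j) = L 1 * L 2 ^ j" for k j
    by (simp_all add: b_def)
  have homog0: "homog 0 (0 :: 'a poly4)" by (simp add: homog_def)
  have L1K: "L 1 \<in> ?K 0" using gen4_mem(3)[of "L 1 * L 2 ^ 0" "L 0" "L 1 ^ 2" C] by simp
  have L23K: "L 2 ^ 3 \<in> ?K 0"
    using cube[OF ideals, of 1 "L 0" "L 1 ^ 2" "L 1 * L 2 ^ 0" C] L1K unfolding mult_1
    by (simp only: gen4_mem(1,4) simp_thms)
  have jetC: "Polynomial.coeff (jet C) 0 = Polynomial.smult \<delta> (Polynomial.monom 1 3)"
    unfolding Ceq jet_simps(2,6) L_power_simps jet_cst coeff_add coeff_mult_0_1 by simp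
  show ?thesis
  proof (rule local_multiplicity[where J = J and b = b and deg = deg and W = 1 and m = 0])
    fix k :: nat
    show "ring_ideal (J k)" unfolding J_def by (simp add: ideals)
    show "hcomp m x \<in> J k" if "x \<in> J k" for x m
    proof (cases "k < 3")
      case True
      then show ?thesis using that gen4_hcomp[OF homog_L homog_L homog_L_power homog0] unfolding J_def by simp
    next
      case False
      then show ?thesis
        using that gen4_hcomp[OF homog_L homog_L_power homog_mult[OF homog_L homog_L_power] C(1)] unfolding J_def by simp
    qed
    have "x * L 2 ^ 0 \<in> ?J 0" for x
      by (rule mult(1)[OF ideals gen4_mem(3)])
    then have "x \<in> ?J 0" for x
      by (simp only: power_0 mult_1_right)
    then show "J 0 = UNIV"
      by (auto simp: J_def)
    assume k: "k < 6"
    show "J (Suc k) \<subseteq> J k"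
    proof (rule k_cases[OF _ _ _ k])
      assume k2: "k < 2"
      show ?thesis unfolding J(1,2)[OF k2]
        by (rule gen4_least[OF ideals]) (use mult(1)[OF ideals gen4_mem(3)] in \<open>simp_all add: gen4_mem\<close>)
    next
      assume k2: "k = 2"
      have add: "x + y \<in> S" if "ring_ideal S" "x \<in> S" "y \<in> S" for x y and S :: "'a poly4 set"
        using that unfolding ring_ideal_def by blast
      have "cst \<delta> * L 2 * L 2 ^ 2 + (L 0 * q0 + L 1 * q1) \<in> ?J 2"
        by (intro add[OF ideals] mult(1)[OF ideals gen4_mem(3)] mult(2)[OF ideals gen4_mem(1)] mult(2)[OF ideals gen4_mem(2)])
      then have "C \<in> ?J 2"
        unfolding Ceq by (simp only: mult.assoc power2_eq_square power3_eq_cube)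
      then show ?thesis unfolding k2 J
        by (intro gen4_least[OF ideals]) (simp_all add: gen4_mem power2_eq_square mult(1)[OF ideals gen4_mem(2)])
    next
      fix j assume k2: "k = 3 + j"
      have "L 1 * L 2 ^ Suc j = L 2 * (L 1 * L 2 ^ j)" by simp
      then show ?thesis unfolding k2 J
        by (intro gen4_least[OF ideals]) (simp_all only: gen4_mem mult(1)[OF ideals gen4_mem(3)])
    qed
    show "homog (deg k) (b k)"
      using homog_L_power[of k 2] homog_mult[OF homog_L[of 1] homog_L_power[of "k - 3" 2]] unfolding deg_def b_def
      by (auto simp: numeral_eq_Suc Suc_diff_Suc One_nat_def)
    show "b k \<in> J k" unfolding b_def J_def by (simp add: gen4_mem)
    show "\<exists>h. A - b k * h \<in> J (Suc k)" if A: "A \<in> J k" for A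
    proof (rule k_cases[OF _ _ _ k])
      assume k2: "k < 2"
      obtain a1 a2 a3 a4 where "A = L 0 * a1 + L 1 * a2 + L 2 ^ k * a3 + 0 * a4" using A unfolding J(1)[OF k2] by (rule gen4E)
      then have "A - b k * a3 = L 0 * a1 + L 1 * a2 + L 2 ^ Suc k * 0 + 0 * a4" unfolding b(1)[OF k2] by simp
      then show ?thesis unfolding J(2)[OF k2] gen4_def by (intro exI CollectI conjI TrueI)
    next
      assume k2: "k = 2"
      obtain a1 a2 a3 a4 where "A = L 0 * a1 + L 1 * a2 + L 2 ^ 2 * a3 + 0 * a4" using A unfolding k2 J by (rule gen4E)
      then have "A - b k * a3 = L 0 * a1 + L 1 ^ 2 * 0 + (L 1 * L 2 ^ 0) * a2 + C * 0" unfolding k2 b by simp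
      then show ?thesis unfolding k2 J gen4_def by (intro exI CollectI conjI TrueI)
    next
      fix j assume k2: "k = 3 + j"
      obtain a1 a2 a3 a4 where "A = L 0 * a1 + L 1 ^ 2 * a2 + (L 1 * L 2 ^ j) * a3 + C * a4" using A unfolding k2 J by (rule gen4E)
      then have "A - b k * a3 = L 0 * a1 + L 1 ^ 2 * a2 + (L 1 * L 2 ^ Suc j) * 0 + C * a4" unfolding k2 b by simp
      then show ?thesis unfolding k2 J gen4_def by (intro exI CollectI conjI TrueI)
    qed
    show "b k * L i \<in> J (Suc k)" if i: "i \<in> {0, 1, 2}" for i
    proof (rule k_cases[OF _ _ _ k])
      assume k2: "k < 2"
      have "b k * L 2 = L 2 ^ Suc k" unfolding b(1)[OF k2] by simp
      then show ?thesis using i unfolding J(2)[OF k2]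
        by (auto simp: mult(1)[OF ideals gen4_mem(1)] mult(1)[OF ideals gen4_mem(2)] gen4_mem simp del: power_Suc)
    next
      assume k2: "k = 2"
      have "b k * L 2 = L 2 ^ 3" unfolding k2 b by (simp add: power2_eq_square power3_eq_cube)
      then show ?thesis using i L23K mult(1)[OF ideals L1K, of "b k"] mult(1)[OF ideals gen4_mem(1), of "b k"]
        unfolding k2 J by auto
    next
      fix j assume k2: "k = 3 + j"
      have "b k * L 2 = L 1 * L 2 ^ Suc j" "b k * L 1 = L 2 ^ j * L 1 ^ 2" unfolding k2 b by (simp_all add: power2_eq_square algebra_simps)
      then show ?thesis using i unfolding k2 J
        by (auto simp: mult(1)[OF ideals gen4_mem(1)] mult(1)[OF ideals gen4_mem(2)] gen4_mem(3) simp del: power_Suc)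
    qed
    show "b k * B \<notin> J (Suc k)" if B: "eval4 (e 3) B \<noteq> 0" for B
    proof
      assume mem: "b k * B \<in> J (Suc k)"
      have monom: "Polynomial.monom 1 i = Polynomial.monom 1 j * Polynomial.monom (1 :: 'a) (i - j)" if "j \<le> i" for i j :: nat
        using that by (simp add: mult_monom)
      have "\<exists>r. Polynomial.coeff (jet B) 0 = Polynomial.monom 1 1 * r"
      proof (rule k_cases[OF _ _ _ k])
        assume k2: "k < 2"
        obtain a1 a2 a3 a4 where "b k * B = L 0 * a1 + L 1 * a2 + L 2 ^ Suc k * a3 + 0 * a4" using mem unfolding J(2)[OF k2] by (rule gen4E)
        then have "Polynomial.coeff (jet (b k * B)) 0 = Polynomial.coeff (jet (L 0 * a1 + L 1 * a2 + L 2 ^ Suc k * a3)) 0" by simp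
        then have "Polynomial.monom 1 k * Polynomial.coeff (jet B) 0 = Polynomial.monom 1 (Suc k) * Polynomial.coeff (jet a3) 0"
          unfolding b(1)[OF k2] jet_simps(2,6) L_power_simps coeff_add coeff_mult_0_1 by simp
        then have "Polynomial.coeff (jet B) 0 = Polynomial.monom 1 1 * Polynomial.coeff (jet a3) 0"
          unfolding monom[of k "Suc k", OF le_SucI[OF order_refl]] mult.assoc by (simp add: Suc_diff_le One_nat_def)
        then show ?thesis by blast
      next
        assume k2: "k = 2"
        obtain a1 a2 a3 a4 where "b k * B = L 0 * a1 + L 1 ^ 2 * a2 + (L 1 * L 2 ^ 0) * a3 + C * a4" using mem unfolding k2 J by (rule gen4E)
        then have "Polynomial.coeff (jet (b k * B)) 0 = Polynomial.coeff (jet (L 0 * a1 + L 1 * (L 1 * a2 + a3) + C * a4)) 0"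
          by (simp add: algebra_simps power2_eq_square)
        then have "Polynomial.monom 1 2 * Polynomial.coeff (jet B) 0 = Polynomial.smult \<delta> (Polynomial.monom 1 3) * Polynomial.coeff (jet a4) 0"
          unfolding k2 b jet_simps(2,6) L_power_simps coeff_add coeff_mult_0_1 jetC by simp
        also have "\<dots> = Polynomial.monom 1 2 * (Polynomial.monom 1 1 * Polynomial.smult \<delta> (Polynomial.coeff (jet a4) 0))"
        proof -
          have "Polynomial.monom (1 :: 'a) 3 = Polynomial.monom 1 2 * Polynomial.monom 1 1" by (simp add: mult_monom)
          then show ?thesis by (simp add: mult.assoc)
        qed
        finally have "Polynomial.coeff (jet B) 0 = Polynomial.monom 1 1 * Polynomial.smult \<delta> (Polynomial.coeff (jet a4) 0)"
          by (subst (asm) mult_left_cancel) simp_all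
        then show ?thesis by blast
      next
        fix j assume k2: "k = 3 + j" and j: "j < 3"
        obtain a1 a2 a3 a4 where "b k * B = L 0 * a1 + L 1 ^ 2 * a2 + (L 1 * L 2 ^ Suc j) * a3 + C * a4" using mem unfolding k2 J by (rule gen4E)
        then have eq: "jet (b k * B) = jet (L 0 * a1 + L 1 ^ 2 * a2 + (L 1 * L 2 ^ Suc j) * a3 + C * a4)" by simp
        \<comment> \<open>Both sides are expanded in L 1. At order 0 only the multiple of C remains,
          so its cofactor vanishes to that order; the comparison at order 1 then shows that
          \<open>B\<close> vanishes at the point.\<close>
        have "Polynomial.coeff (jet C) 0 * Polynomial.coeff (jet a4) 0 = 0"
          using arg_cong[OF eq, of "\<lambda>p. Polynomial.coeff p 0"]
          unfolding k2 b jet_simps(2,6) L_power_simps coeff_add coeff_mult_0_1 power2_eq_square by simp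
        then have a4: "Polynomial.coeff (jet a4) 0 = 0" unfolding jetC using \<delta> by simp
        have "Polynomial.monom 1 j * Polynomial.coeff (jet B) 0 = Polynomial.monom 1 (Suc j) * Polynomial.coeff (jet a3) 0
          + Polynomial.smult \<delta> (Polynomial.monom 1 3) * Polynomial.coeff (jet a4) 1"
          using arg_cong[OF eq, of "\<lambda>p. Polynomial.coeff p 1"]
          unfolding k2 b jet_simps(2,6) L_power_simps coeff_add coeff_mult_0_1 power2_eq_square a4 jetC by (simp add: One_nat_def)
        also have "\<dots> = Polynomial.monom 1 j * (Polynomial.monom 1 1 * (Polynomial.coeff (jet a3) 0
          + Polynomial.smult \<delta> (Polynomial.monom 1 (2 - j)) * Polynomial.coeff (jet a4) 1))"
        proof -
          have "Polynomial.monom (1 :: 'a) (Suc j) = Polynomial.monom 1 j * Polynomial.monom 1 1" by (simp add: mult_monom Suc_eq_plus1)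
          moreover have "Polynomial.monom (1 :: 'a) 3 = Polynomial.monom 1 j * (Polynomial.monom 1 1 * Polynomial.monom 1 (2 - j))"
            using j by (simp add: mult_monom)
          ultimately show ?thesis by (simp add: algebra_simps)
        qed
        finally show ?thesis by auto
      qed
      then have "eval4 (e 3) B = 0" unfolding jet_value[symmetric] by (auto simp: poly_monom)
      with B show False by contradiction
    qed
  next
    have J6: "J 6 = ?K 3" by (simp add: J_def)
    show "I \<subseteq> J 6"
    proof -
      have "0 \<in> ?K 3" using ideals unfolding ring_ideal_def by blast
      then have "gen4 (L 0) (L 1 ^ 2) C 0 \<subseteq> ?K 3" by (intro gen4_least[OF ideals] gen4_mem)
      then show ?thesis unfolding J6 using sub by blast
    qed
    show "homog 0 1" by (rule homog_one)
    show "eval4 (e 3) 1 \<noteq> 0" by (simp add: eval4_simps)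
    have "L 1 * L 2 ^ 3 \<in> I"
      by (rule cube) (use I mult[OF I(1)] in \<open>simp_all add: power2_eq_square\<close>)
    then show "1 * A \<in> I" if "A \<in> J 6" for A
      using that gen4_least[OF I(1,2,3) _ I(4)] unfolding J6 by auto
  qed
qed

end

section \<open>Frames of the four-dimensional space and their dual linear forms\<close>

lemma dual_family:
  fixes e :: "4 \<Rightarrow> 'a::field ^ 4"
  assumes "\<And>x. (\<Sum>k\<in>UNIV. x k *s e k) = 0 \<Longrightarrow> x = (\<lambda>k. 0)"
  obtains M :: "4 \<Rightarrow> 'a ^ 4"
  where "\<And>i k. (\<Sum>j\<in>UNIV. M i $ j * e k $ j) = (if i = k then 1 else 0)"
    "\<And>i j. (\<Sum>k\<in>UNIV. e k $ i * M k $ j) = (if i = j then 1 else 0)"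
proof -
  define A where "A = (\<chi> i k. e k $ i)"
  have "\<exists>B. B ** A = mat 1"
    unfolding matrix_left_invertible_ker
  proof (intro allI impI)
    fix x assume "A *v x = 0"
    then have "(\<Sum>k\<in>UNIV. x $ k *s e k) = 0"
      by (simp add: A_def matrix_vector_mult_def vec_eq_iff mult.commute)
    then show "x = 0" using assms[of "vec_nth x"] by (simp add: vec_eq_iff fun_eq_iff)
  qed
  then obtain B where B: "B ** A = mat 1" by blast
  then have B': "A ** B = mat 1" by (simp add: matrix_left_right_inverse)
  show thesis
  proof (rule that[of "\<lambda>i. B $ i"])
    show "(\<Sum>j\<in>UNIV. B $ i $ j * e k $ j) = (if i = k then 1 else 0)" for i k
      using B by (simp add: vec_eq_iff matrix_matrix_mult_def mat_def A_def)
    show "(\<Sum>k\<in>UNIV. e k $ i * B $ k $ j) = (if i = j then 1 else 0)" for i j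
      using B' by (simp add: vec_eq_iff matrix_matrix_mult_def mat_def A_def)
  qed
qed

context
  fixes e M :: "4 \<Rightarrow> 'a::field ^ 4" and L :: "4 \<Rightarrow> 'a poly4"
  assumes dual: "\<And>i k. (\<Sum>j\<in>UNIV. M i $ j * e k $ j) = (if i = k then 1 else 0)"
    and dual': "\<And>i j. (\<Sum>k\<in>UNIV. e k $ i * M k $ j) = (if i = j then 1 else 0)"
    and inf: "infinite (UNIV :: 'a set)"
  defines "L \<equiv> \<lambda>i. linform (M i)"
begin

lemma eval4_L_combination: "eval4 (\<Sum>k\<in>UNIV. x k *s e k) (L i) = x i"
proof -
  have "eval4 (\<Sum>k\<in>UNIV. x k *s e k) (L i) = (\<Sum>j\<in>UNIV. \<Sum>k\<in>UNIV. x k * (M i $ j * e k $ j))"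
    unfolding L_def linform_def by (simp add: eval4_simps sum_distrib_left algebra_simps)
  also have "\<dots> = (\<Sum>k\<in>UNIV. x k * (\<Sum>j\<in>UNIV. M i $ j * e k $ j))"
    unfolding sum_distrib_left by (rule sum.swap)
  finally show ?thesis unfolding dual by (simp add: if_distrib cong: if_cong)
qed

lemma expand_vector: "v = (\<Sum>k\<in>UNIV. eval4 v (L k) *s e k)"
proof -
  have "v $ i = (\<Sum>k\<in>UNIV. eval4 v (L k) *s e k) $ i" for i
    using arg_cong[OF var_expand[OF dual dual', of i], of "eval4 v"]
    unfolding eval4_simps eval4_cst eval4_var by (simp add: L_def mult.commute)
  then show ?thesis by (simp add: vec_eq_iff)
qed

lemma poly4_eqI:
  assumes "\<And>x. eval4 (\<Sum>k\<in>UNIV. x k *s e k) A = eval4 (\<Sum>k\<in>UNIV. x k *s e k) B"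
  shows "A = B"
proof -
  have "A - B = 0"
    by (rule poly4_zero[OF inf]) (simp add: eval4_simps, metis expand_vector assms)
  then show ?thesis by simp
qed

text \<open>Modulo L 0 and L 1 a polynomial equals the one obtained by projecting onto the span of
  \<open>e 2\<close> and \<open>e 3\<close>. That one has only zero values, so it is zero over an
  infinite field.\<close>

lemma vanish_on_line:
  assumes "\<And>a b. eval4 (a *s e 2 + b *s e 3) A = 0"
  shows "A \<in> gen4 (L 0) (L 1) 0 0"
proof -
  let ?I = "gen4 (L 0) (L 1) 0 0"
  have I: "ring_ideal ?I" by (rule gen4_ideal)
  have "var i - (cst (e 2 $ i) * L 2 + cst (e 3 $ i) * L 3) \<in> ?I" for i
  proof -
    have "var i - (cst (e 2 $ i) * L 2 + cst (e 3 $ i) * L 3) = L 0 * cst (e 0 $ i) + L 1 * cst (e 1 $ i) + 0 * 0 + 0 * 0"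
      unfolding var_expand[OF dual dual', of i] sum_UNIV_4 by (simp add: algebra_simps L_def)
    then show ?thesis unfolding gen4_def by blast
  qed
  from insertion_cong_mod[OF ring_map_cst I, of var "\<lambda>i. cst (e 2 $ i) * L 2 + cst (e 3 $ i) * L 3" A, OF this]
  have *: "A - insertion cst (\<lambda>i. cst (e 2 $ i) * L 2 + cst (e 3 $ i) * L 3) A \<in> ?I"
    unfolding insertion_cst_var .
  have "insertion cst (\<lambda>i. cst (e 2 $ i) * L 2 + cst (e 3 $ i) * L 3) A = 0"
  proof (rule poly4_zero[OF inf])
    fix v
    let ?w = "eval4 v (L 2) *s e 2 + eval4 v (L 3) *s e 3"
    let ?g = "\<lambda>i. cst (e 2 $ i) * L 2 + cst (e 3 $ i) * L 3"
    have "eval4 v (insertion cst ?g A) = insertion id (vec_nth ?w) A"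
      by (rule insertion_unique[OF ring_map_id, where k = "\<lambda>A. eval4 v (insertion cst ?g A)"])
        (simp_all add: eval4_simps insertion_simps[OF ring_map_cst] insertion_at_cst[OF ring_map_cst] insertion_at_var[OF ring_map_cst]
          mult.commute flip: cst_def var_def)
    then show "eval4 v (insertion cst ?g A) = 0"
      using assms[of "eval4 v (L 2)" "eval4 v (L 3)"] by (simp add: eval4_insertion)
  qed
  then show ?thesis using * by simp
qed

end

lemma gen4_mem_combination:
  "f * a + g * b + h * c + k * d \<in> gen4 f g h k"
  unfolding gen4_def by blast

section \<open>Section of a nondegenerate quadric by a tangent plane\<close>

context
  fixes A B C D :: "'a::field ^ 4" and F G \<Lambda> :: "'a poly4" and \<kappa> h :: 'a
  assumes inf: "infinite (UNIV :: 'a set)"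
    and F: "\<And>a b c d. eval4 (a *s A + b *s B + c *s C + d *s D) F = \<kappa> * (a * d - b * c)" and \<kappa>: "\<kappa> \<noteq> 0"
    and \<Lambda>: "\<And>a b c d. eval4 (a *s A + b *s B + c *s C + d *s D) \<Lambda> = h * a" and h: "h \<noteq> 0"
begin

text \<open>Translation along a linear relation leaves F unchanged, so the coefficients of the
  relation lie in the radical of a d - b c, which is zero.\<close>

lemma nondegenerate_frame_independent:
  assumes "a *s A + b *s B + c *s C + d *s D = 0"
  shows "a = 0" "b = 0" "c = 0" "d = 0"
proof -
  have *: "(a + a') * (d + d') - (b + b') * (c + c') = a' * d' - b' * c'" for a' b' c' d'
  proof -
    have eq: "(a + a') *s A + (b + b') *s B + (c + c') *s C + (d + d') *s D = (a *s A + b *s B + c *s C + d *s D) + (a' *s A + b' *s B + c' *s C + d' *s D)"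
      by (simp add: vec_eq_iff algebra_simps)
    have "\<kappa> * ((a + a') * (d + d') - (b + b') * (c + c')) = \<kappa> * (a' * d' - b' * c')"
      unfolding F[symmetric] eq assms by simp
    then show ?thesis using \<kappa> by simp
  qed
  from *[of 0 0 0 0] *[of 1 0 0 0] *[of 0 1 0 0] *[of 0 0 1 0] *[of 0 0 0 1]
  show "a = 0" "b = 0" "c = 0" "d = 0" by (auto simp: algebra_simps)
qed

lemma nondegenerate_frame_span:
  obtains a b c d where "v = a *s A + b *s B + c *s C + d *s D"
proof -
  define e where "e = (\<lambda>i :: 4. if i = 0 then A else if i = 1 then B else if i = 2 then C else D)"
  have e: "(\<Sum>k\<in>UNIV. x k *s e k) = x 0 *s A + x 1 *s B + x 2 *s C + x 3 *s D" for x
    unfolding sum_UNIV_4 by (simp add: e_def distinct_4)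
  have indep: "x = (\<lambda>k. 0)" if "(\<Sum>k\<in>UNIV. x k *s e k) = 0" for x
    using nondegenerate_frame_independent[OF that[unfolded e]] by (simp add: fun_eq_iff all_4)
  obtain M :: "4 \<Rightarrow> 'a ^ 4" where M: "\<And>i k. (\<Sum>j\<in>UNIV. M i $ j * e k $ j) = (if i = k then 1 else 0)"
    "\<And>i j. (\<Sum>k\<in>UNIV. e k $ i * M k $ j) = (if i = j then 1 else 0)"
    by (rule dual_family[of e]) (rule indep, assumption, (rule that; assumption))
  show thesis using expand_vector[OF M inf, of v] that unfolding e by blast
qed

text \<open>In the plane a = 0 the quadric is b c = 0, two lines through D. On each of them G is a
  constant times the cube of a linear form and has a single zero.\<close>

lemma quadric_section_points:
  assumes G1: "\<And>b d. eval4 (b *s B + d *s D) G = \<delta> * (d - \<beta> * b) ^ 3" and G2: "\<And>c d. eval4 (c *s C + d *s D) G = \<delta> * (d - \<beta>' * c) ^ 3"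
    and \<delta>: "\<delta> \<noteq> 0"
  shows "{v. v \<noteq> 0 \<and> eval4 v F = 0 \<and> eval4 v G = 0 \<and> eval4 v \<Lambda> = 0} = proj_point (B + \<beta> *s D) \<union> proj_point (C + \<beta>' *s D)"
proof (intro Set.set_eqI iffI)
  fix v assume "v \<in> {v. v \<noteq> 0 \<and> eval4 v F = 0 \<and> eval4 v G = 0 \<and> eval4 v \<Lambda> = 0}"
  then have v: "v \<noteq> 0" "eval4 v F = 0" "eval4 v G = 0" "eval4 v \<Lambda> = 0" by auto
  obtain a b c d where eq: "v = a *s A + b *s B + c *s C + d *s D" by (rule nondegenerate_frame_span)
  have a: "a = 0" using v(4) h unfolding eq \<Lambda> by simp
  then have "b * c = 0" using v(2) \<kappa> unfolding eq F by simp
  then consider "c = 0" | "b = 0" by auto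
  then show "v \<in> proj_point (B + \<beta> *s D) \<union> proj_point (C + \<beta>' *s D)"
  proof cases
    case 1
    then have "d = \<beta> * b" using v(3) G1[of b d] \<delta> unfolding eq a by simp
    then have "v = b *s (B + \<beta> *s D)" unfolding eq a 1 by (simp add: vec_eq_iff algebra_simps)
    then show ?thesis using v(1) unfolding proj_point_def by auto
  next
    case 2
    then have "d = \<beta>' * c" using v(3) G2[of c d] \<delta> unfolding eq a by simp
    then have "v = c *s (C + \<beta>' *s D)" unfolding eq a 2 by (simp add: vec_eq_iff algebra_simps)
    then show ?thesis using v(1) unfolding proj_point_def by auto
  qed
next
  fix v assume "v \<in> proj_point (B + \<beta> *s D) \<union> proj_point (C + \<beta>' *s D)"
  then obtain x where x: "x \<noteq> 0" and "v = x *s (B + \<beta> *s D) \<or> v = x *s (C + \<beta>' *s D)"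
    unfolding proj_point_def by blast
  then consider "v = x *s B + (\<beta> * x) *s D" | "v = x *s C + (\<beta>' * x) *s D" by (auto simp: vec_eq_iff algebra_simps)
  then show "v \<in> {v. v \<noteq> 0 \<and> eval4 v F = 0 \<and> eval4 v G = 0 \<and> eval4 v \<Lambda> = 0}"
  proof cases
    case 1
    then show ?thesis
      using F[of 0 x 0 "\<beta> * x"] \<Lambda>[of 0 x 0 "\<beta> * x"] G1[of x "\<beta> * x"] x nondegenerate_frame_independent(2)[of 0 x 0 "\<beta> * x"] by auto
  next
    case 2
    then show ?thesis
      using F[of 0 0 x "\<beta>' * x"] \<Lambda>[of 0 0 x "\<beta>' * x"] G2[of x "\<beta>' * x"] x nondegenerate_frame_independent(3)[of 0 0 x "\<beta>' * x"] by auto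
  qed
qed

lemma quadric_section_points_distinct: "proj_point (B + \<beta> *s D) \<noteq> proj_point (C + \<beta>' *s D)"
proof
    assume eq: "proj_point (B + \<beta> *s D) = proj_point (C + \<beta>' *s D)"
    have "1 *s (B + \<beta> *s D) \<in> proj_point (C + \<beta>' *s D)" unfolding eq[symmetric] unfolding proj_point_def using one_neq_zero by blast
    then obtain x where "1 *s (B + \<beta> *s D) = x *s (C + \<beta>' *s D)" unfolding proj_point_def by blast
    then have "0 *s A + 1 *s B + (- x) *s C + (\<beta> - x * \<beta>') *s D = 0" by (simp add: vec_eq_iff algebra_simps)
    from nondegenerate_frame_independent(2)[OF this] show False by simp
qed

text \<open>In the frame A, C, D, B + \<beta> D the point is the last vector, \<Lambda> is a
  multiple of L 0, and F shows that L 3 L 1 lies in the ideal. G is congruent to \<delta> L 2 ^ 3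
  along the line, so the situation is that of \<open>multiplicity_three\<close>.\<close>

lemma quadric_section_multiplicity:
  assumes G: "\<And>b d. eval4 (b *s B + d *s D) G = \<delta> * (d - \<beta> * b) ^ 3" and \<delta>: "\<delta> \<noteq> 0"
  defines "S \<equiv> {H. \<forall>v\<in>proj_point (B + \<beta> *s D). eval4 v H \<noteq> 0}"
  shows "has_quot_dim UNIV (\<lambda>c f. fract_cst c * f) (deg0_fractions UNIV S) (deg0_fractions (gen4 F G \<Lambda> 0) S) 3"
proof -
  define e where "e = (\<lambda>i :: 4. if i = 0 then A else if i = 1 then C else if i = 2 then D else B + \<beta> *s D)"
  have e: "(\<Sum>k\<in>UNIV. x k *s e k) = x 0 *s A + x 3 *s B + x 1 *s C + (x 2 + \<beta> * x 3) *s D" for x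
    unfolding sum_UNIV_4 by (simp add: e_def distinct_4 vec_eq_iff algebra_simps)
  have indep: "x = (\<lambda>k. 0)" if "(\<Sum>k\<in>UNIV. x k *s e k) = 0" for x
    using nondegenerate_frame_independent[OF that[unfolded e]] by (simp add: fun_eq_iff all_4)
  obtain M :: "4 \<Rightarrow> 'a ^ 4" where M: "\<And>i k. (\<Sum>j\<in>UNIV. M i $ j * e k $ j) = (if i = k then 1 else 0)"
    "\<And>i j. (\<Sum>k\<in>UNIV. e k $ i * M k $ j) = (if i = j then 1 else 0)"
    by (rule dual_family[of e]) (rule indep, assumption, (rule that; assumption))
  let ?L = "\<lambda>i. linform (M i)" and ?I = "gen4 F G \<Lambda> 0"
  note L = eval4_L_combination[OF M inf]
  have \<Lambda>_eq: "\<Lambda> = cst h * ?L 0"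
    by (rule poly4_eqI[OF M inf]) (unfold e \<Lambda> eval4_simps eval4_cst, unfold e[symmetric] L, rule refl)
  have F_eq: "F = cst \<kappa> * (?L 0 * (?L 2 + cst \<beta> * ?L 3) - ?L 3 * ?L 1)"
    by (rule poly4_eqI[OF M inf]) (unfold e F eval4_simps eval4_cst, unfold e[symmetric] L, rule refl)
  have I: "ring_ideal ?I" by (rule gen4_ideal)
  have mult: "x * y \<in> J" if "ring_ideal J" "y \<in> J" for x y and J :: "'a poly4 set"
    using that unfolding ring_ideal_def by blast
  have "?L 0 = cst (1 / h) * \<Lambda>" unfolding \<Lambda>_eq using h by (simp add: mult.assoc[symmetric] flip: cst_mult)
  then have L0: "?L 0 \<in> ?I" using mult[OF I gen4_mem(3)] by metis
  have "?L 3 * ?L 1 = (?L 2 + cst \<beta> * ?L 3) * ?L 0 - cst (1 / \<kappa>) * F"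
  proof -
    have "cst (1 / \<kappa>) * F = cst (1 / \<kappa> * \<kappa>) * (?L 0 * (?L 2 + cst \<beta> * ?L 3) - ?L 3 * ?L 1)"
      unfolding F_eq cst_mult by (simp only: mult.assoc)
    then show ?thesis using \<kappa> by (simp add: algebra_simps)
  qed
  then have L31: "?L 3 * ?L 1 \<in> ?I"
    using ring_ideal_diff[OF I mult[OF I L0] mult[OF I gen4_mem(1)]] by metis
  have G_cong: "G - cst \<delta> * ?L 2 ^ 3 \<in> gen4 (?L 0) (?L 1) 0 0"
  proof (rule vanish_on_line[OF M inf])
    fix a b
    have eq: "a *s e 2 + b *s e 3 = b *s B + (a + \<beta> * b) *s D"
      by (simp add: e_def distinct_4 distinct_4[symmetric] vec_eq_iff algebra_simps)
    have L2: "eval4 (a *s e 2 + b *s e 3) (?L 2) = a"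
      using L[of "\<lambda>k. if k = 2 then a else if k = 3 then b else 0" 2]
      by (simp add: sum_UNIV_4 distinct_4 distinct_4[symmetric])
    show "eval4 (a *s e 2 + b *s e 3) (G - cst \<delta> * ?L 2 ^ 3) = 0"
      unfolding eval4_simps eval4_cst L2 unfolding eq G by simp
  qed
  have sub: "?I \<subseteq> gen4 (?L 0) (?L 1) (?L 2 ^ 3) 0"
  proof (rule gen4_least[OF gen4_ideal])
    let ?J = "gen4 (?L 0) (?L 1) (?L 2 ^ 3) 0"
    obtain a b c d where "G - cst \<delta> * ?L 2 ^ 3 = ?L 0 * a + ?L 1 * b + 0 * c + 0 * d" by (rule gen4E[OF G_cong])
    then have "G = ?L 0 * a + ?L 1 * b + ?L 2 ^ 3 * cst \<delta> + 0 * 0" by (simp add: algebra_simps)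
    then show "G \<in> ?J" using gen4_mem_combination by metis
    have "F = ?L 0 * (cst \<kappa> * (?L 2 + cst \<beta> * ?L 3)) + ?L 1 * (- cst \<kappa> * ?L 3) + ?L 2 ^ 3 * 0 + 0 * 0"
      unfolding F_eq by (simp add: algebra_simps)
    then show "F \<in> ?J" using gen4_mem_combination by metis
    show "\<Lambda> \<in> ?J" unfolding \<Lambda>_eq by (rule mult[OF gen4_ideal gen4_mem(1)])
    show "0 \<in> ?J" by (rule gen4_mem(4))
  qed
  have S: "S = {H. \<forall>v\<in>proj_point (e 3). eval4 v H \<noteq> 0}" unfolding S_def by (simp add: e_def distinct_4 distinct_4[symmetric])
  show ?thesis unfolding S
    by (rule multiplicity_three[OF M I L0 L31 gen4_mem(2) G_cong \<delta> sub])
qed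

end

text \<open>The coordinates of the kernel are taken from 0, 1 and the entries of \<open>l\<close> up
  to sign, so they stay in the field that contains these entries.\<close>

lemma bilin_kernel_explicit:
  assumes "l 0 0 * l 1 1 = l 0 1 * (l 1 0 :: 'a::field)"
  obtains p0 p1 where "(p0, p1) \<noteq> (0, 0)" "\<And>u v. bilin l p0 p1 u v = 0" "p0 \<in> {1, - l 0 0, - l 0 1}" "p1 \<in> {0, l 1 0, l 1 1}"
proof (cases "(l 0 0, l 1 0) = (0, 0)")
  case False
  then show thesis using assms
    by (intro that[of "- l 0 0" "l 1 0"]) (auto simp: bilin_def algebra_simps)
next
  case True
  show thesis
  proof (cases "(l 0 1, l 1 1) = (0, 0)")
    case False
    then show thesis using True by (intro that[of "- l 0 1" "l 1 1"]) (auto simp: bilin_def algebra_simps)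
  next
    case 2: True
    then show thesis using True by (intro that[of 1 0]) (auto simp: bilin_def)
  qed
qed

text \<open>Closure under cube roots is included because the intersection points are reached by
  rational operations and one cube root.\<close>

definition perfect_subfield :: "'a::field set \<Rightarrow> bool" where
  "perfect_subfield R \<longleftrightarrow> 0 \<in> R \<and> 1 \<in> R \<and> (\<forall>x\<in>R. \<forall>y\<in>R. x + y \<in> R \<and> x * y \<in> R) \<and>
     (\<forall>x\<in>R. - x \<in> R \<and> inverse x \<in> R) \<and> (\<forall>x. x ^ 3 \<in> R \<longrightarrow> x \<in> R)"

lemma
  assumes "perfect_subfield R"
  shows perfect_subfield_consts: "0 \<in> R" "1 \<in> R"
    and perfect_subfield_ops: "x \<in> R \<Longrightarrow> y \<in> R \<Longrightarrow> x + y \<in> R" "x \<in> R \<Longrightarrow> y \<in> R \<Longrightarrow> x * y \<in> R"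
      "x \<in> R \<Longrightarrow> - x \<in> R" "x \<in> R \<Longrightarrow> y \<in> R \<Longrightarrow> x / y \<in> R" "x \<in> R \<Longrightarrow> x ^ n \<in> R" "x ^ 3 \<in> R \<Longrightarrow> x \<in> R"
proof -
  show "0 \<in> R" "1 \<in> R" "x \<in> R \<Longrightarrow> y \<in> R \<Longrightarrow> x + y \<in> R" "x \<in> R \<Longrightarrow> y \<in> R \<Longrightarrow> x * y \<in> R"
    "x \<in> R \<Longrightarrow> - x \<in> R" "x \<in> R \<Longrightarrow> y \<in> R \<Longrightarrow> x / y \<in> R" "x ^ 3 \<in> R \<Longrightarrow> x \<in> R"
    using assms unfolding perfect_subfield_def divide_inverse by blast+
  show "x \<in> R \<Longrightarrow> x ^ n \<in> R"
    by (induction n) (use assms in \<open>simp_all add: perfect_subfield_def\<close>)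
qed

text \<open>The fixed points of a power of Frobenius form a field. Cube roots stay in it because
  cubing is injective and commutes with that power.\<close>

lemma perfect_subfield_frobenius_fixed:
  assumes char3: "(3::'a::field) = 0"
  shows "perfect_subfield {x :: 'a. x ^ (3 ^ k) = x}"
proof -
  have add: "(x + y) ^ (3 ^ k) = x ^ (3 ^ k) + y ^ (3 ^ k)" for x y :: 'a
  proof (induction k)
    case (Suc k)
    have "(x + y) ^ (3 ^ Suc k) = ((x + y) ^ (3 ^ k)) ^ 3" by (simp add: power_mult mult.commute flip: power_mult)
    then show ?case by (simp add: Suc add_cube_char3[OF char3] mult.commute flip: power_mult)
  qed simp
  have minus: "(- x) ^ (3 ^ k) = - (x ^ (3 ^ k))" for x :: 'a
    using add[of x "- x"] by (simp add: eq_neg_iff_add_eq_0 add.commute)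
  have cube_inj: "x = y" if "x ^ 3 = y ^ 3" for x y :: 'a
  proof -
    have "(x - y) ^ 3 = 0" using add_cube_char3[OF char3, of "x - y" y] that by simp
    then show ?thesis by simp
  qed
  have "x ^ (3 ^ k) = x" if "(x ^ 3) ^ (3 ^ k) = x ^ 3" for x :: 'a
    by (rule cube_inj) (use that in \<open>simp add: mult.commute flip: power_mult\<close>)
  then show ?thesis
    unfolding perfect_subfield_def by (auto simp: add minus power_mult_distrib power_inverse)
qed

context
  fixes c l r :: "nat \<Rightarrow> nat \<Rightarrow> 'a::alg_closed_field"
    and b0 b1 b2 b3 :: "'a ^ 4" and F G \<Lambda> :: "'a poly4" and \<kappa> :: 'a and R :: "'a set"
  assumes char3: "(3::'a) = 0" and hw: "hw_rank1 c l r" and smooth: "smooth_bicubic c"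
    and l: "\<exists>s t u v. bilin l s t u v \<noteq> 0" and r: "\<exists>s t u v. bilin r s t u v \<noteq> 0"
    and F: "\<And>a b c d. eval4 (a *s b0 + b *s b1 + c *s b2 + d *s b3) F = \<kappa> * (a * d - b * c)" and \<kappa>: "\<kappa> \<noteq> 0"
    and G: "\<And>s t u v. eval4 ((s * u) *s b0 + (s * v) *s b1 + (t * u) *s b2 + (t * v) *s b3) G = bicubic c s t u v"
    and \<Lambda>: "\<And>a b c d. eval4 (a *s b0 + b *s b1 + c *s b2 + d *s b3) \<Lambda> = l 1 1 * a + l 1 0 * b + l 0 1 * c + l 0 0 * d"
begin

abbreviation segre :: "'a \<Rightarrow> 'a \<Rightarrow> 'a \<Rightarrow> 'a \<Rightarrow> 'a ^ 4" where
  "segre s t u v \<equiv> (s * u) *s b0 + (s * v) *s b1 + (t * u) *s b2 + (t * v) *s b3"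

lemma segre_combination:
  "a *s segre s t u v + b *s segre s t u' v' + c' *s segre s' t' u v + d *s segre s' t' u' v'
   = (a * (s * u) + b * (s * u') + c' * (s' * u) + d * (s' * u')) *s b0
     + (a * (s * v) + b * (s * v') + c' * (s' * v) + d * (s' * v')) *s b1
     + (a * (t * u) + b * (t * u') + c' * (t' * u) + d * (t' * u')) *s b2
     + (a * (t * v) + b * (t * v') + c' * (t' * v) + d * (t' * v')) *s b3"
  by (simp add: vec_eq_iff algebra_simps)

lemma segre_add:
  "x *s segre s t u v + y *s segre s' t' u v = segre (x * s + y * s') (x * t + y * t') u v"
  "x *s segre s t u v + y *s segre s t u' v' = segre s t (x * u + y * u') (x * v + y * v')"
  by (simp_all add: vec_eq_iff algebra_simps)

text \<open>A zero of F has rank one coordinates and is a point of the Segre surface. By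
  \<open>r_eq\<close> the form \<open>r\<close> is the polar plane of this point, which contains
  both lines of the quadric through it, so \<open>rank1_dual_point_off_curve\<close>
  applies.\<close>

lemma cone_point_off_curve:
  assumes u: "(u0, u1, u2, u3) \<noteq> (0, 0, 0, 0)"
    and r_eq: "r 0 0 = k * u0" "r 0 1 = - k * u1" "r 1 0 = - k * u2" "r 1 1 = k * u3"
    and F0: "eval4 (u0 *s b0 + u1 *s b1 + u2 *s b2 + u3 *s b3) F = 0"
  shows "eval4 (u0 *s b0 + u1 *s b1 + u2 *s b2 + u3 *s b3) G \<noteq> 0"
proof -
  have det: "u0 * u3 = u1 * u2" using F0 \<kappa> unfolding F by simp
  obtain s t u' v where eq: "u0 = s * u'" "u1 = s * v" "u2 = t * u'" "u3 = t * v"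
  proof (cases "u0 = 0 \<and> u2 = 0")
    case True
    then show thesis by (intro that[of u1 0 1 u3]) simp_all
  next
    case False
    show thesis
    proof (cases "u0 = 0")
      case True
      then show thesis using False det by (intro that[of 0 1 "u3 / u2" u2]) auto
    next
      case False
      then show thesis using det by (intro that[of u0 1 "u1 / u0" u2]) (auto simp: field_simps)
    qed
  qed
  have nz: "(s, t) \<noteq> (0, 0)" "(u', v) \<noteq> (0, 0)" using u unfolding eq by auto
  have rho: "bilin r s t x y = 0" "bilin r x y u' v = 0" for x y
    unfolding bilin_def r_eq eq by (simp_all add: algebra_simps)
  note deg = rank1_form_degenerate[OF char3 hw smooth l r]
  obtain p0 p1 where p: "(p0, p1) \<noteq> (0, 0)" "\<And>u v. bilin l p0 p1 u v = 0" by (rule bilin_kernel[OF deg]) (rule that; assumption)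
  have "transp l 0 0 * transp l 1 1 = transp l 0 1 * transp l 1 0" using deg by (simp add: transp_def mult.commute)
  then obtain q0 q1 where q: "(q0, q1) \<noteq> (0, 0)" "\<And>s t. bilin l s t q0 q1 = 0"
    by (rule bilin_kernel[of "transp l"]) (unfold transp_simps, rule that; assumption)
  show ?thesis unfolding eq G
    by (rule rank1_dual_point_off_curve[OF char3 hw smooth l r p q nz rho])
qed

text \<open>The lines of the kernel plane are p x P^1 and P^1 x q. Completing p and q to bases
  yields a frame in which the plane is a = 0, and all choices can be made inside the field
  R.\<close>

lemma split_section:
  assumes R: "perfect_subfield R" "\<And>i j. c i j \<in> R" "\<And>i j. l i j \<in> R"
    "\<And>i. b0 $ i \<in> R" "\<And>i. b1 $ i \<in> R" "\<And>i. b2 $ i \<in> R" "\<And>i. b3 $ i \<in> R"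
  obtains P1 P2 :: "'a ^ 4" where "\<And>i. P1 $ i \<in> R" "\<And>i. P2 $ i \<in> R" "proj_point P1 \<noteq> proj_point P2"
    "{v. v \<noteq> 0 \<and> eval4 v F = 0 \<and> eval4 v G = 0 \<and> eval4 v \<Lambda> = 0} = proj_point P1 \<union> proj_point P2"
    "\<And>P. P \<in> {proj_point P1, proj_point P2} \<Longrightarrow> has_quot_dim UNIV (\<lambda>c f. fract_cst c * f)
       (deg0_fractions UNIV {H. \<forall>v\<in>P. eval4 v H \<noteq> 0}) (deg0_fractions (gen4 F G \<Lambda> 0) {H. \<forall>v\<in>P. eval4 v H \<noteq> 0}) 3"
proof -
  note deg = rank1_form_degenerate[OF char3 hw smooth l r]
  obtain p0 p1 where p: "(p0, p1) \<noteq> (0, 0)" "\<And>u v. bilin l p0 p1 u v = 0" and pR: "p0 \<in> {1, - l 0 0, - l 0 1}" "p1 \<in> {0, l 1 0, l 1 1}"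
    by (rule bilin_kernel_explicit[OF deg]) (rule that; assumption)
  have "transp l 0 0 * transp l 1 1 = transp l 0 1 * transp l 1 0" using deg by (simp add: transp_def mult.commute)
  then obtain q0 q1 where q: "(q0, q1) \<noteq> (0, 0)" "\<And>s t. bilin l s t q0 q1 = 0"
      and qR: "q0 \<in> {1, - l 0 0, - l 1 0}" "q1 \<in> {0, l 0 1, l 1 1}"
    by (rule bilin_kernel_explicit[of "transp l"]) (unfold transp_simps, unfold transp_def, rule that; assumption)
  note const = perfect_subfield_consts[OF R(1)] and ops = perfect_subfield_ops[OF R(1)]
  have pqR: "p0 \<in> R" "p1 \<in> R" "q0 \<in> R" "q1 \<in> R"
    using pR qR R(3) const ops(3) by auto
  have complement: "\<exists>m n. y * m - x * n \<noteq> 0 \<and> m \<in> R \<and> n \<in> R" if "(x, y) \<noteq> (0, 0)" for x y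
  proof (cases "y = 0")
    case True
    with that show ?thesis using const by (intro exI[of _ 0] exI[of _ 1]) simp
  next
    case False
    then show ?thesis using const by (intro exI[of _ 1] exI[of _ 0]) simp
  qed
  obtain m n where mn: "p1 * m - p0 * n \<noteq> 0" "m \<in> R" "n \<in> R" using complement[OF p(1)] by blast
  obtain m' n' where mn': "q1 * m' - q0 * n' \<noteq> 0" "m' \<in> R" "n' \<in> R" using complement[OF q(1)] by blast
  let ?A = "segre m n m' n'" and ?B = "segre m n q0 q1" and ?C = "segre p0 p1 m' n'" and ?D = "segre p0 p1 q0 q1"
  define \<delta> where "\<delta> = bicubic c p0 p1 q0 q1"
  have \<delta>: "\<delta> \<noteq> 0" unfolding \<delta>_def by (rule kernel_point_off_curve[OF char3 hw smooth l r p q])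
  have cube_root: "\<exists>\<beta>\<in>R. \<beta> ^ 3 = x" if "x \<in> R" for x
    using nth_root_exists[of 3 x] ops(6) that by auto
  have \<delta>R: "bicubic c s t u v \<in> R" if "s \<in> R" "t \<in> R" "u \<in> R" "v \<in> R" for s t u v
    unfolding bicubic_def row_def by (intro ops(1) ops(2) ops(5) R(2) that)
  \<comment> \<open>On the line through \<open>?B\<close> and \<open>?D\<close> the cubic is y^3
    f(B) + w^3 \<delta>; its zero w = \<beta> y requires this cube root.\<close>
  obtain \<beta> where \<beta>: "\<beta> \<in> R" "\<beta> ^ 3 = - (bicubic c m n q0 q1 / \<delta>)"
    using cube_root[of "- (bicubic c m n q0 q1 / \<delta>)"] ops(3,4) \<delta>R pqR mn mn' unfolding \<delta>_def by metis
  obtain \<beta>' where \<beta>': "\<beta>' \<in> R" "\<beta>' ^ 3 = - (bicubic c p0 p1 m' n' / \<delta>)"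
    using cube_root[of "- (bicubic c p0 p1 m' n' / \<delta>)"] ops(3,4) \<delta>R pqR mn mn' unfolding \<delta>_def by metis
  have F': "eval4 (x *s ?A + y *s ?B + z *s ?C + w *s ?D) F = (\<kappa> * (p1 * m - p0 * n) * (q1 * m' - q0 * n')) * (x * w - y * z)" for x y z w
    unfolding segre_combination F by (simp add: algebra_simps)
  have \<kappa>': "\<kappa> * (p1 * m - p0 * n) * (q1 * m' - q0 * n') \<noteq> 0" using \<kappa> mn mn' by simp
  have bil: "bilin l m n q0 q1 = 0" "bilin l p0 p1 m' n' = 0" "bilin l p0 p1 q0 q1 = 0" using p(2) q(2) by auto
  have "eval4 (x *s ?A + y *s ?B + z *s ?C + w *s ?D) \<Lambda>
    = bilin l m n m' n' * x + bilin l m n q0 q1 * y + bilin l p0 p1 m' n' * z + bilin l p0 p1 q0 q1 * w" for x y z w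
    unfolding segre_combination \<Lambda> bilin_def by (simp add: algebra_simps)
  then have \<Lambda>': "eval4 (x *s ?A + y *s ?B + z *s ?C + w *s ?D) \<Lambda> = bilin l m n m' n' * x" for x y z w
    unfolding bil by simp
  have h: "bilin l m n m' n' \<noteq> 0"
  proof
    assume h0: "bilin l m n m' n' = 0"
    obtain s t u v where nz: "bilin l s t u v \<noteq> 0" using l by blast
    obtain s' t' where st: "s = m * s' + p0 * t'" "t = n * s' + p1 * t'"
      by (rule subst1_surj[of p1 m n p0]) (use mn in \<open>simp add: mult.commute\<close>)
    obtain u' v' where uv: "u = m' * u' + q0 * v'" "v = n' * u' + q1 * v'"
      by (rule subst1_surj[of q1 m' n' q0]) (use mn' in \<open>simp add: mult.commute\<close>)
    have "bilin l s t u v = s' * u' * bilin l m n m' n' + s' * v' * bilin l m n q0 q1 + t' * u' * bilin l p0 p1 m' n' + t' * v' * bilin l p0 p1 q0 q1"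
      unfolding st uv bilin_def by (simp add: algebra_simps)
    then show False using nz bil h0 by simp
  qed
  have cube_diff: "\<delta> * (w - x * y) ^ 3 = y ^ 3 * g + w ^ 3 * \<delta>" if "x ^ 3 = - (g / \<delta>)" for w x y g
  proof -
    have "(w - x * y) ^ 3 = w ^ 3 + (- x * y) ^ 3" using add_cube_char3[OF char3, of w "- x * y"] by simp
    also have "\<dots> = w ^ 3 + g / \<delta> * y ^ 3" using that by (simp add: power_mult_distrib power_minus_odd)
    finally show ?thesis using \<delta> by (simp add: field_simps)
  qed
  \<comment> \<open>A linear form in s and t that vanishes identically has zero coefficients: the
    two middle coefficients of the cubic on this line disappear and only cubes remain.\<close>
  have rows1: "row c 1 q0 q1 = 0" "row c 2 q0 q1 = 0"
    using kernel_line_first[OF char3 hw smooth l r p q, of 0 1] kernel_line_first[OF char3 hw smooth l r p q, of 1 0]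
    unfolding deriv1_def by simp_all
  have line1: "bicubic c (y * m + w * p0) (y * n + w * p1) q0 q1 = y ^ 3 * bicubic c m n q0 q1 + w ^ 3 * \<delta>" for y w
    unfolding bicubic_def rows1 \<delta>_def add_cube_char3[OF char3] by (simp add: algebra_simps)
  have rows2: "row (transp c) 1 p0 p1 = 0" "row (transp c) 2 p0 p1 = 0"
    using kernel_line_second[OF char3 hw smooth l r p q, of 0 1] kernel_line_second[OF char3 hw smooth l r p q, of 1 0]
    unfolding transp_simps(2)[of c, symmetric] deriv1_def by simp_all
  have line2: "bicubic c p0 p1 (y * m' + w * q0) (y * n' + w * q1) = y ^ 3 * bicubic c p0 p1 m' n' + w ^ 3 * \<delta>" for y w
    unfolding \<delta>_def transp_simps(1)[of c, symmetric] unfolding bicubic_def rows2 add_cube_char3[OF char3] by (simp add: algebra_simps)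
  have G1: "eval4 (y *s ?B + w *s ?D) G = \<delta> * (w - \<beta> * y) ^ 3" for y w
    unfolding segre_add G line1 cube_diff[OF \<beta>(2)] ..
  have G2: "eval4 (y *s ?C + w *s ?D) G = \<delta> * (w - \<beta>' * y) ^ 3" for y w
    unfolding segre_add G line2 cube_diff[OF \<beta>'(2)] ..
  note inf = infinite_alg_closed_field[where 'a = 'a]
  have swap: "x + y + z + w = x + z + y + w" for x y z w :: "'a ^ 4" by (simp add: algebra_simps)
  \<comment> \<open>The second point is treated by exchanging \<open>?B\<close> and
    \<open>?C\<close>, under which a d - b c is symmetric.\<close>
  have F'': "eval4 (x *s ?A + y *s ?C + z *s ?B + w *s ?D) F = (\<kappa> * (p1 * m - p0 * n) * (q1 * m' - q0 * n')) * (x * w - y * z)" for x y z w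
    unfolding swap[of "x *s ?A" "y *s ?C"] F' by (simp only: mult.commute)
  have \<Lambda>'': "eval4 (x *s ?A + y *s ?C + z *s ?B + w *s ?D) \<Lambda> = bilin l m n m' n' * x" for x y z w
    unfolding swap[of "x *s ?A" "y *s ?C"] \<Lambda>' ..
  have segreR: "segre s t u v $ i \<in> R" if "s \<in> R" "t \<in> R" "u \<in> R" "v \<in> R" for s t u v i
    unfolding vector_add_component vector_smult_component by (intro ops(1) ops(2) R that)
  have combR: "(v + x *s w) $ i \<in> R" if "v $ i \<in> R" "w $ i \<in> R" "x \<in> R" for v w :: "'a ^ 4" and x i
    using ops(1,2) that by simp
  show thesis
  proof (rule that[of "?B + \<beta> *s ?D" "?C + \<beta>' *s ?D"])
    show "(?B + \<beta> *s ?D) $ i \<in> R" for i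
      by (rule combR; (rule segreR)?; fact)
    show "(?C + \<beta>' *s ?D) $ i \<in> R" for i
      by (rule combR; (rule segreR)?; fact)
    show "proj_point (?B + \<beta> *s ?D) \<noteq> proj_point (?C + \<beta>' *s ?D)"
      by (rule quadric_section_points_distinct[OF inf F' \<kappa>' \<Lambda>' h])
    show "{v. v \<noteq> 0 \<and> eval4 v F = 0 \<and> eval4 v G = 0 \<and> eval4 v \<Lambda> = 0} = proj_point (?B + \<beta> *s ?D) \<union> proj_point (?C + \<beta>' *s ?D)"
      by (rule quadric_section_points[OF inf F' \<kappa>' \<Lambda>' h G1 G2 \<delta>])
    fix P assume "P \<in> {proj_point (?B + \<beta> *s ?D), proj_point (?C + \<beta>' *s ?D)}"
    then consider "P = proj_point (?B + \<beta> *s ?D)" | "P = proj_point (?C + \<beta>' *s ?D)" by blast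
    then show "has_quot_dim UNIV (\<lambda>c f. fract_cst c * f)
       (deg0_fractions UNIV {H. \<forall>v\<in>P. eval4 v H \<noteq> 0}) (deg0_fractions (gen4 F G \<Lambda> 0) {H. \<forall>v\<in>P. eval4 v H \<noteq> 0}) 3"
    proof cases
      case 1
      show ?thesis unfolding 1 by (rule quadric_section_multiplicity[OF inf F' \<kappa>' \<Lambda>' h G1 \<delta>])
    next
      case 2
      show ?thesis unfolding 2 by (rule quadric_section_multiplicity[OF inf F'' \<kappa>' \<Lambda>'' h G2 \<delta>])
    qed
  qed
qed

end

section \<open>From the entries of H to the rank one identity\<close>

text \<open>\<open>hw0\<close>, \<open>hw1\<close>, \<open>hw3\<close>, \<open>hw4\<close> are the
  coefficients of v^4, v^3 u, v u^3, u^4 in the symmetrized product of a row with a reduced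
  derivative. The coefficient of v^2 u^2 cancels by symmetry.\<close>

definition hw0 :: "(nat \<Rightarrow> nat \<Rightarrow> 'a::field) \<Rightarrow> nat \<Rightarrow> nat \<Rightarrow> 'a" where
  "hw0 c i j = c i 0 * c j 1 + c j 0 * c i 1"

definition hw1 :: "(nat \<Rightarrow> nat \<Rightarrow> 'a::field) \<Rightarrow> nat \<Rightarrow> nat \<Rightarrow> 'a" where
  "hw1 c i j = 2 * c i 1 * c j 1 - c i 0 * c j 2 - c j 0 * c i 2"

definition hw3 :: "(nat \<Rightarrow> nat \<Rightarrow> 'a::field) \<Rightarrow> nat \<Rightarrow> nat \<Rightarrow> 'a" where
  "hw3 c i j = c i 3 * c j 1 + c j 3 * c i 1 - 2 * c i 2 * c j 2"

definition hw4 :: "(nat \<Rightarrow> nat \<Rightarrow> 'a::field) \<Rightarrow> nat \<Rightarrow> nat \<Rightarrow> 'a" where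
  "hw4 c i j = - (c i 3 * c j 2 + c j 3 * c i 2)"

lemma row_drow: "row c i u v * drow c j u v + row c j u v * drow c i u v
    = hw0 c i j * v^4 + hw1 c i j * v^3 * u + hw3 c i j * v * u^3 + hw4 c i j * u^4"
  unfolding row_def drow_def hw0_def hw1_def hw3_def hw4_def
  by (simp add: algebra_simps power2_eq_square power3_eq_cube power4_eq_xxxx)

lemma bicubic_derivatives: "bicubic c s t u v * deriv12 c s t u v + deriv1 c s t u v * deriv2 c s t u v
   = (row c 0 u v * drow c 1 u v + row c 1 u v * drow c 0 u v) * t^4
   + ((row c 1 u v * drow c 1 u v + row c 1 u v * drow c 1 u v) - (row c 0 u v * drow c 2 u v + row c 2 u v * drow c 0 u v)) * t^3 * s
   + ((row c 1 u v * drow c 3 u v + row c 3 u v * drow c 1 u v) - (row c 2 u v * drow c 2 u v + row c 2 u v * drow c 2 u v)) * t * s^3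
   - (row c 2 u v * drow c 3 u v + row c 3 u v * drow c 2 u v) * s^4"
  unfolding bicubic_def deriv1_def deriv2_def deriv12_def
  by (simp add: algebra_simps power2_eq_square power3_eq_cube power4_eq_xxxx)

lemma hw_rank1I:
  fixes c l r :: "nat \<Rightarrow> nat \<Rightarrow> 'a::field"
  assumes char3: "(3::'a) = 0"
    and "hw0 c 0 1 = l 0 0 ^ 3 * r 0 0" "hw1 c 0 1 = l 0 0 ^ 3 * r 0 1" "hw3 c 0 1 = l 0 1 ^ 3 * r 0 0" "hw4 c 0 1 = l 0 1 ^ 3 * r 0 1"
    "hw0 c 1 1 - hw0 c 0 2 = l 0 0 ^ 3 * r 1 0" "hw1 c 1 1 - hw1 c 0 2 = l 0 0 ^ 3 * r 1 1"
    "hw3 c 1 1 - hw3 c 0 2 = l 0 1 ^ 3 * r 1 0" "hw4 c 1 1 - hw4 c 0 2 = l 0 1 ^ 3 * r 1 1"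
    "hw0 c 1 3 - hw0 c 2 2 = l 1 0 ^ 3 * r 0 0" "hw1 c 1 3 - hw1 c 2 2 = l 1 0 ^ 3 * r 0 1"
    "hw3 c 1 3 - hw3 c 2 2 = l 1 1 ^ 3 * r 0 0" "hw4 c 1 3 - hw4 c 2 2 = l 1 1 ^ 3 * r 0 1"
    "- hw0 c 2 3 = l 1 0 ^ 3 * r 1 0" "- hw1 c 2 3 = l 1 0 ^ 3 * r 1 1" "- hw3 c 2 3 = l 1 1 ^ 3 * r 1 0" "- hw4 c 2 3 = l 1 1 ^ 3 * r 1 1"
  shows "hw_rank1 c l r"
  unfolding hw_rank1_def
proof (intro allI)
  fix s t u v
  have "bicubic c s t u v * deriv12 c s t u v + deriv1 c s t u v * deriv2 c s t u v
    = (hw0 c 0 1 * v^4 + hw1 c 0 1 * v^3 * u + hw3 c 0 1 * v * u^3 + hw4 c 0 1 * u^4) * t^4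
    + ((hw0 c 1 1 - hw0 c 0 2) * v^4 + (hw1 c 1 1 - hw1 c 0 2) * v^3 * u + (hw3 c 1 1 - hw3 c 0 2) * v * u^3 + (hw4 c 1 1 - hw4 c 0 2) * u^4) * t^3 * s
    + ((hw0 c 1 3 - hw0 c 2 2) * v^4 + (hw1 c 1 3 - hw1 c 2 2) * v^3 * u + (hw3 c 1 3 - hw3 c 2 2) * v * u^3 + (hw4 c 1 3 - hw4 c 2 2) * u^4) * t * s^3
    + ((- hw0 c 2 3) * v^4 + (- hw1 c 2 3) * v^3 * u + (- hw3 c 2 3) * v * u^3 + (- hw4 c 2 3) * u^4) * s^4"
    unfolding bicubic_derivatives row_drow by (simp add: algebra_simps)
  also have "\<dots> = (l 0 0 ^ 3 * (t * v) ^ 3 + l 0 1 ^ 3 * (t * u) ^ 3 + l 1 0 ^ 3 * (s * v) ^ 3 + l 1 1 ^ 3 * (s * u) ^ 3) * bilin r s t u v"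
    unfolding assms(2-) bilin_def by (simp add: algebra_simps power2_eq_square power3_eq_cube power4_eq_xxxx)
  also have "\<dots> = bilin l s t u v ^ 3 * bilin r s t u v"
    unfolding bilin_def add_cube_char3[OF char3] by (simp only: power_mult_distrib mult.assoc)
  finally show "bicubic c s t u v * deriv12 c s t u v + deriv1 c s t u v * deriv2 c s t u v = bilin l s t u v ^ 3 * bilin r s t u v" .
qed

text \<open>The cubic on the Segre surface x = s u, y = s v, z = t u, w = - t v of
  \<open>F1\<close>. The zeros at (1, 3), (3, 1) and (3, 3) belong to x z^2, x y^2 and x^3, which do
  not occur in the cubic.\<close>

definition segre_coeffs :: "(nat \<Rightarrow> 'a::field) \<Rightarrow> nat \<Rightarrow> nat \<Rightarrow> 'a" where
  "segre_coeffs g i j =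
     (if i = 0 then if j = 0 then - g 13 else if j = 1 then g 12 else if j = 2 then - g 10 else if j = 3 then g 5 else 0
      else if i = 1 then if j = 0 then g 11 else if j = 1 then - g 9 else if j = 2 then g 7 else 0
      else if i = 2 then if j = 0 then - g 8 else if j = 1 then g 6 else if j = 2 then g 3 else if j = 3 then g 2 else 0
      else if i = 3 then if j = 0 then g 4 else if j = 2 then g 1 else 0 else 0)"

text \<open>The linear form with coefficients a, b, c, d in the Segre coordinates s u, s v, t u, t
  v, read as a bilinear form.\<close>

definition split_form :: "'a \<Rightarrow> 'a \<Rightarrow> 'a \<Rightarrow> 'a \<Rightarrow> nat \<Rightarrow> nat \<Rightarrow> 'a::field" where
  "split_form a b c d i j = (if i = 1 then if j = 1 then a else if j = 0 then b else 0
     else if i = 0 then if j = 1 then c else if j = 0 then d else 0 else 0)"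

lemma eval4_cubic:
  "eval4 P (cubic q g) = g 1 * vec_nth P 1 * vec_nth P 0 ^ 2 + g 2 * vec_nth P 2 * vec_nth P 0 ^ 2 + g 3 * eval4 P q * vec_nth P 0
    + g 4 * vec_nth P 1 ^ 3 + g 5 * vec_nth P 2 ^ 3 + g 6 * vec_nth P 1 ^ 2 * vec_nth P 2 + g 7 * vec_nth P 1 * vec_nth P 2 ^ 2
    + g 8 * vec_nth P 1 ^ 2 * vec_nth P 3 + g 9 * vec_nth P 1 * vec_nth P 2 * vec_nth P 3 + g 10 * vec_nth P 2 ^ 2 * vec_nth P 3
    + g 11 * vec_nth P 1 * vec_nth P 3 ^ 2 + g 12 * vec_nth P 2 * vec_nth P 3 ^ 2 + g 13 * vec_nth P 3 ^ 3"
  unfolding cubic_def by (simp add: eval4_simps)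

definition vec4 :: "'a \<Rightarrow> 'a \<Rightarrow> 'a \<Rightarrow> 'a \<Rightarrow> 'a ^ 4" where
  "vec4 a b c d = (\<chi> i. if i = 0 then a else if i = 1 then b else if i = 2 then c else d)"

lemma vec4_nth [simp]: "vec4 a b c d $ 0 = a" "vec4 a b c d $ 1 = b" "vec4 a b c d $ 2 = c" "vec4 a b c d $ 3 = d"
  by (simp_all add: vec4_def)

lemma vec4_eq_iff: "(x :: 'a ^ 4) = y \<longleftrightarrow> x $ 0 = y $ 0 \<and> x $ 1 = y $ 1 \<and> x $ 2 = y $ 2 \<and> x $ 3 = y $ 3"
  unfolding vec_eq_iff all_4 ..

lemma cubic_segre:
  "eval4 (vec4 (s * u) (s * v) (t * u) (- (t * v))) (cubic (vy * vz) g) = bicubic (segre_coeffs g) s t u v"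
  unfolding eval4_cubic by (simp add: eval4_simps bicubic_def row_def segre_coeffs_def algebra_simps power2_eq_square power3_eq_cube)

lemma segre_coeffs_simps:
  "segre_coeffs g 0 0 = - g 13" "segre_coeffs g 0 1 = g 12" "segre_coeffs g 0 2 = - g 10" "segre_coeffs g 0 3 = g 5"
  "segre_coeffs g 1 0 = g 11" "segre_coeffs g 1 1 = - g 9" "segre_coeffs g 1 2 = g 7" "segre_coeffs g 1 3 = 0"
  "segre_coeffs g 2 0 = - g 8" "segre_coeffs g 2 1 = g 6" "segre_coeffs g 2 2 = g 3" "segre_coeffs g 2 3 = g 2"
  "segre_coeffs g 3 0 = g 4" "segre_coeffs g 3 1 = 0" "segre_coeffs g 3 2 = g 1" "segre_coeffs g 3 3 = 0"
  by (simp_all add: segre_coeffs_def)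

lemma split_form_simps:
  "split_form a b c d 1 1 = a" "split_form a b c d 1 0 = b" "split_form a b c d 0 1 = c" "split_form a b c d 0 0 = d"
  by (simp_all add: split_form_def)

context
  assumes char3: "(3 :: 'a::field) = 0"
begin

lemma eval4_quadrics:
  "eval4 P (F1 :: 'a poly4) = - (vec_nth P 0 * vec_nth P 3 + vec_nth P 1 * vec_nth P 2)"
  "eval4 P (F2 :: 'a poly4) = - (vec_nth P 0 * vec_nth P 3) + vec_nth P 1 ^ 2 + vec_nth P 2 ^ 2"
  "eval4 P (Fd :: 'a poly4) = - (vec_nth P 1 * vec_nth P 3) + vec_nth P 2 ^ 2"
  unfolding F1_def F2_def Fd_def eps_def by (simp_all add: eval4_simps numerals_char3[OF char3])

text \<open>The hypotheses say that H i j = m j ^ 3 * u i. On the Segre surface the linear form with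
  coefficients m becomes the first bilinear form, and up to sign the second one is the polar plane
  of u. The signs at m 3 and u 0 come from w = - t v.\<close>

lemma hw_rank1_split:
  fixes g :: "nat \<Rightarrow> 'a" and u m :: "4 \<Rightarrow> 'a"
  assumes H: "g 3^2 - (g 1 * g 7) - (g 2 * g 6) = m 0 ^ 3 * u 0"
  "g 4 * g 9 + g 6 * g 8 = m 1 ^ 3 * u 0"
  "g 7 * g 10 + g 5 * g 9 = m 2 ^ 3 * u 0"
  "g 11 * g 12 + g 9 * g 13 = m 3 ^ 3 * u 0"
  "- (g 2 * g 3) = m 0 ^ 3 * u 1"
  "g 3 * g 8 + g 6^2 - (g 1 * g 11) - (g 4 * g 7) = m 1 ^ 3 * u 1"
  "- (g 5 * g 7) = m 2 ^ 3 * u 1"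
  "- (g 10 * g 11) - (g 9 * g 12) - (g 7 * g 13) = m 3 ^ 3 * u 1"
  "- (g 1 * g 3) = m 0 ^ 3 * u 2"
  "- (g 4 * g 6) = m 1 ^ 3 * u 2"
  "g 3 * g 10 + g 7^2 - (g 2 * g 12) - (g 5 * g 6) = m 2 ^ 3 * u 2"
  "- (g 9 * g 11) - (g 8 * g 12) - (g 6 * g 13) = m 3 ^ 3 * u 2"
  "g 1 * g 2 = m 0 ^ 3 * u 3"
  "g 3 * g 4 - (g 1 * g 8) = m 1 ^ 3 * u 3"
  "g 3 * g 5 - (g 2 * g 10) = m 2 ^ 3 * u 3"
  "g 3 * g 13 + g 9^2 - (g 8 * g 10) - (g 7 * g 11) - (g 6 * g 12) = m 3 ^ 3 * u 3"
  shows "hw_rank1 (segre_coeffs g) (split_form (m 0) (m 1) (m 2) (- m 3)) (split_form (u 3) (u 2) (u 1) (- u 0))"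
proof -
  have sgn: "(- m 3) ^ 3 * y = - (m 3 ^ 3 * y)" "x ^ 3 * (- u 0) = - (x ^ 3 * u 0)" for x y
    by (simp_all add: power3_eq_cube)
  show ?thesis
    apply (rule hw_rank1I[OF char3]; unfold split_form_simps sgn minus_minus; unfold H[symmetric]; unfold hw0_def hw1_def hw3_def hw4_def segre_coeffs_simps)
    apply (simp_all only: numerals_char3(1)[OF char3] power2_eq_square)
    apply (simp_all add: algebra_simps char3)
    done
qed

text \<open>The coefficients after the substitution \<open>y = - (Y + Z)\<close>, \<open>z = \<iota> (Y - Z)\<close>, \<open>w = - W\<close>.\<close>

definition twist :: "'a \<Rightarrow> (nat \<Rightarrow> 'a::field) \<Rightarrow> nat \<Rightarrow> 'a" where
  "twist \<iota> g k =
    (if k = 1 then - g 1 + \<iota> * g 2 else if k = 2 then - g 1 - \<iota> * g 2 else if k = 3 then g 3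
     else if k = 4 then - g 4 - \<iota> * g 5 + \<iota> * g 6 + g 7 else if k = 5 then - g 4 + \<iota> * g 5 - \<iota> * g 6 + g 7
     else if k = 6 then \<iota> * g 6 - g 7 else if k = 7 then - \<iota> * g 6 - g 7
     else if k = 8 then - g 8 + \<iota> * g 9 + g 10 else if k = 9 then g 8 + g 10 else if k = 10 then - g 8 - \<iota> * g 9 + g 10
     else if k = 11 then - g 11 + \<iota> * g 12 else if k = 12 then - g 11 - \<iota> * g 12 else if k = 13 then - g 13 else 0)"

lemma twist_simps:
  "twist \<iota> g 1 = - g 1 + \<iota> * g 2" "twist \<iota> g 2 = - g 1 - \<iota> * g 2" "twist \<iota> g 3 = g 3"
  "twist \<iota> g 4 = - g 4 - \<iota> * g 5 + \<iota> * g 6 + g 7" "twist \<iota> g 5 = - g 4 + \<iota> * g 5 - \<iota> * g 6 + g 7"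
  "twist \<iota> g 6 = \<iota> * g 6 - g 7" "twist \<iota> g 7 = - \<iota> * g 6 - g 7"
  "twist \<iota> g 8 = - g 8 + \<iota> * g 9 + g 10" "twist \<iota> g 9 = g 8 + g 10" "twist \<iota> g 10 = - g 8 - \<iota> * g 9 + g 10"
  "twist \<iota> g 11 = - g 11 + \<iota> * g 12" "twist \<iota> g 12 = - g 11 - \<iota> * g 12" "twist \<iota> g 13 = - g 13"
  unfolding twist_def by simp_all

text \<open>With \<iota> the quadric splits, and the coefficients of the two forms occur in
  conjugate pairs. Since \<iota>^3 = - \<iota>, cubing exchanges the conjugates - m 1 + \<iota> m 2
  and - m 1 - \<iota> m 2 up to cubing m 1 and m 2; this decides the signs in the matching.\<close>

lemma hw_rank1_nonsplit:
  fixes g :: "nat \<Rightarrow> 'a" and u m :: "4 \<Rightarrow> 'a"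
  assumes i: "\<iota> * \<iota> = -1" and H: "- (g 1 * g 7) - (g 2 * g 6) - (g 3^2) = m 0 ^ 3 * u 0"
  "- (g 4 * g 10) - (g 4 * g 8) - (g 6 * g 9) - (g 7 * g 8) = m 1 ^ 3 * u 0"
  "- (g 5 * g 10) - (g 6 * g 10) - (g 5 * g 8) - (g 7 * g 9) = m 2 ^ 3 * u 0"
  "g 11^2 + g 12^2 - (g 10 * g 13) - (g 8 * g 13) = m 3 ^ 3 * u 0"
  "- (g 1 * g 3) = m 0 ^ 3 * u 1"
  "g 1 * g 11 + g 3 * g 8 + g 6^2 - (g 3 * g 10) - (g 2 * g 12) - (g 4 * g 7) = m 1 ^ 3 * u 1"
  "- (g 1 * g 12) - (g 2 * g 11) - (g 3 * g 9) - (g 5 * g 7) = m 2 ^ 3 * u 1"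
  "- (g 10 * g 11) - (g 9 * g 12) - (g 7 * g 13) = m 3 ^ 3 * u 1"
  "- (g 2 * g 3) = m 0 ^ 3 * u 2"
  "- (g 1 * g 12) - (g 2 * g 11) - (g 3 * g 9) - (g 4 * g 6) = m 1 ^ 3 * u 2"
  "g 3 * g 10 + g 2 * g 12 + g 7^2 - (g 1 * g 11) - (g 3 * g 8) - (g 5 * g 6) = m 2 ^ 3 * u 2"
  "- (g 9 * g 11) - (g 8 * g 12) - (g 6 * g 13) = m 3 ^ 3 * u 2"
  "g 1^2 + g 2^2 = m 0 ^ 3 * u 3"
  "g 1 * g 8 + g 3 * g 4 - (g 1 * g 10) - (g 2 * g 9) - (g 3 * g 7) = m 1 ^ 3 * u 3"
  "g 2 * g 10 + g 3 * g 5 - (g 1 * g 9) - (g 2 * g 8) - (g 3 * g 6) = m 2 ^ 3 * u 3"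
  "g 3 * g 13 + g 9^2 - (g 8 * g 10) - (g 7 * g 11) - (g 6 * g 12) = m 3 ^ 3 * u 3"
  shows "hw_rank1 (segre_coeffs (twist \<iota> g)) (split_form (m 0) (- m 1 + \<iota> * m 2) (- m 1 - \<iota> * m 2) (m 3))
    (split_form (u 3) (- (u 1 - \<iota> * u 2)) (- (u 1 + \<iota> * u 2)) (u 0))"
proof -
  have i': "\<iota> * (\<iota> * x) = - x" for x using i by (simp flip: mult.assoc)
  have i3: "\<iota> ^ 3 = - \<iota>" by (simp add: power3_eq_cube i)
  have cubes: "(- a + \<iota> * b) ^ 3 = - (a ^ 3) - \<iota> * b ^ 3" "(- a - \<iota> * b) ^ 3 = - (a ^ 3) + \<iota> * b ^ 3" for a b
    unfolding diff_conv_add_uminus[of "- a" "\<iota> * b"] add_cube_char3[OF char3] by (simp_all add: power_mult_distrib i3 power_minus_odd)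
  have D: "a * (- (x - \<iota> * y)) = - (a * x) + \<iota> * (a * y)" "a * (- (x + \<iota> * y)) = - (a * x) - \<iota> * (a * y)"
    "(- a - \<iota> * b) * x = - (a * x) - \<iota> * (b * x)" "(- a + \<iota> * b) * x = - (a * x) + \<iota> * (b * x)"
    "(- a - \<iota> * b) * (- (x - \<iota> * y)) = a * x - \<iota> * (a * y) + \<iota> * (b * x) + b * y"
    "(- a - \<iota> * b) * (- (x + \<iota> * y)) = a * x + \<iota> * (a * y) + \<iota> * (b * x) - b * y"
    "(- a + \<iota> * b) * (- (x - \<iota> * y)) = a * x - \<iota> * (a * y) - \<iota> * (b * x) - b * y"
    "(- a + \<iota> * b) * (- (x + \<iota> * y)) = a * x + \<iota> * (a * y) - \<iota> * (b * x) + b * y" for a b x y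
    by (simp_all add: algebra_simps i')
  let ?a = "m 1 ^ 3" and ?b = "m 2 ^ 3" and ?x = "u 1" and ?y = "u 2"
  note rhs = D(5-8)[of ?a ?b ?x ?y] D(3,4)[of ?a ?b "u 0"] D(3,4)[of ?a ?b "u 3"]
    D(1,2)[of "m 0 ^ 3" ?x ?y] D(1,2)[of "m 3 ^ 3" ?x ?y]
  show ?thesis
    apply (rule hw_rank1I[OF char3]; unfold split_form_simps cubes; (unfold rhs)?; unfold H[symmetric]; unfold hw0_def hw1_def hw3_def hw4_def segre_coeffs_simps twist_simps)
    apply (simp_all only: numerals_char3(1)[OF char3] power2_eq_square)
    apply (simp_all add: algebra_simps i i' char3)
    done
qed

text \<open>The vector parametrizes \<open>F2\<close>: with y = - (s v + t u) and z = \<iota> (s v -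
  t u) one gets y^2 + z^2 = 4 s t u v, which is x w in characteristic 3.\<close>

lemma cubic_segre_nonsplit:
  fixes g :: "nat \<Rightarrow> 'a"
  assumes i: "\<iota> * \<iota> = -1"
  shows "eval4 (vec4 (s * u) (- (s * v) - t * u) (\<iota> * (s * v) - \<iota> * (t * u)) (t * v)) (cubic (vy^2 + vz^2) g)
    = bicubic (segre_coeffs (twist \<iota> g)) s t u v"
proof -
  have i': "\<iota> * (\<iota> * x) = - x" for x using i by (simp flip: mult.assoc)
  define Y Z where "Y = s * v" and "Z = t * u"
  have mm: "(- Y - Z)^2 + (\<iota> * Y - \<iota> * Z)^2 = Y * Z" "(- Y - Z)^3 = - (Y^3) - Z^3" "(\<iota> * Y - \<iota> * Z)^3 = - (\<iota> * Y^3) + \<iota> * Z^3"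
    "(- Y - Z)^2 * (\<iota> * Y - \<iota> * Z) = \<iota> * (Y^3 + Y^2 * Z - Y * Z^2 - Z^3)"
    "(- Y - Z) * (\<iota> * Y - \<iota> * Z)^2 = Y^3 - Y^2 * Z - Y * Z^2 + Z^3"
    "(- Y - Z)^2 = Y^2 - Y * Z + Z^2" "(\<iota> * Y - \<iota> * Z)^2 = - (Y^2) - Y * Z - Z^2" "(- Y - Z) * (\<iota> * Y - \<iota> * Z) = \<iota> * (Z^2 - Y^2)"
    by (simp_all add: algebra_simps power2_eq_square power3_eq_cube i i' char3 numerals_char3(1)[OF char3])
  show ?thesis
    unfolding eval4_cubic vec4_nth eval4_simps eval4_var Y_def[symmetric] Z_def[symmetric] mult.assoc[of _ "- Y - Z"] mult.assoc[of _ "(- Y - Z)^2"] mm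
    unfolding Y_def Z_def bicubic_def row_def
    by (simp add: segre_coeffs_simps twist_simps algebra_simps power2_eq_square power3_eq_cube char3)
qed

end

section \<open>Section of the quadric cone by a plane tangent along a line\<close>

context
  fixes A B C E :: "'a::field ^ 4" and F G \<Lambda> :: "'a poly4" and \<beta> \<delta> :: 'a
  assumes inf: "infinite (UNIV :: 'a set)"
    and F: "\<And>a b c d. eval4 (a *s A + b *s B + c *s C + d *s E) F = b^2 - a * c"
    and \<Lambda>: "\<And>a b c d. eval4 (a *s A + b *s B + c *s C + d *s E) \<Lambda> = a"
    and G: "\<And>c d. eval4 (c *s C + d *s E) G = \<delta> * (d + \<beta> * c) ^ 3" and \<delta>: "\<delta> \<noteq> 0"
    and span: "\<And>v. \<exists>a b c d. v = a *s A + b *s B + c *s C + d *s E"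
begin

text \<open>\<Lambda> gives a = 0 and the radical of F gives b = c = 0. The vertex E lies in that
  radical, so the last coefficient is detected by G, which is nonzero at E.\<close>

lemma cone_frame_independent:
  assumes eq: "a *s A + b *s B + c *s C + d *s E = 0"
  shows "a = 0" "b = 0" "c = 0" "d = 0"
proof -
  have *: "(b + b')^2 - (a + a') * (c + c') = b'^2 - a' * c'" for a' b' c'
  proof -
    have e: "(a + a') *s A + (b + b') *s B + (c + c') *s C + (d + 0) *s E = (a *s A + b *s B + c *s C + d *s E) + (a' *s A + b' *s B + c' *s C + 0 *s E)"
      by (simp add: vec_eq_iff algebra_simps)
    have "eval4 (0 + (a' *s A + b' *s B + c' *s C + 0 *s E)) F = (b + b')^2 - (a + a') * (c + c')"
      using F[of "a + a'" "b + b'" "c + c'" "d + 0"] unfolding e eq .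
    then show ?thesis using F[of a' b' c' 0] unfolding add_0_left by metis
  qed
  show a: "a = 0" using \<Lambda>[of a b c d] \<Lambda>[of 0 0 0 0] unfolding eq by simp
  show b: "b = 0" using *[of 0 0 0] a by simp
  show c: "c = 0" using *[of 1 0 0] *[of 0 1 0] *[of 0 0 1] *[of 0 0 0] a b by simp
  have "\<delta> * (d + \<beta> * c) ^ 3 = \<delta> * (0 + \<beta> * 0) ^ 3"
    unfolding G[symmetric] using eq a b by simp
  then show "d = 0" using \<delta> c by simp
qed

lemma cone_section_point:
  "{v. v \<noteq> 0 \<and> eval4 v F = 0 \<and> eval4 v G = 0 \<and> eval4 v \<Lambda> = 0} = proj_point (C - \<beta> *s E)"
proof (intro Set.set_eqI iffI)
  fix v assume "v \<in> {v. v \<noteq> 0 \<and> eval4 v F = 0 \<and> eval4 v G = 0 \<and> eval4 v \<Lambda> = 0}"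
  then have v: "v \<noteq> 0" "eval4 v F = 0" "eval4 v G = 0" "eval4 v \<Lambda> = 0" by auto
  obtain a b c d where eq: "v = a *s A + b *s B + c *s C + d *s E" using span by blast
  have a: "a = 0" using v(4) unfolding eq \<Lambda> .
  then have b: "b = 0" using v(2) unfolding eq F by simp
  have "d = - \<beta> * c" using v(3) G[of c d] \<delta> unfolding eq a b by (simp add: add_eq_0_iff2)
  then have "v = c *s (C - \<beta> *s E)" unfolding eq a b by (simp add: vec_eq_iff algebra_simps)
  then show "v \<in> proj_point (C - \<beta> *s E)" using v(1) unfolding proj_point_def by auto
next
  fix v assume "v \<in> proj_point (C - \<beta> *s E)"
  then obtain x where x: "x \<noteq> 0" and "v = x *s (C - \<beta> *s E)" unfolding proj_point_def by blast
  then have v: "v = 0 *s A + 0 *s B + x *s C + (- \<beta> * x) *s E" by (simp add: vec_eq_iff algebra_simps)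
  have "v \<noteq> 0" using cone_frame_independent(3)[of 0 0 x "- \<beta> * x"] x unfolding v by blast
  moreover have "eval4 v F = 0" "eval4 v \<Lambda> = 0" unfolding v F \<Lambda> by simp_all
  moreover have "eval4 v G = 0" using G[of x "- \<beta> * x"] unfolding v by simp
  ultimately show "v \<in> {v. v \<noteq> 0 \<and> eval4 v F = 0 \<and> eval4 v G = 0 \<and> eval4 v \<Lambda> = 0}" by blast
qed

text \<open>In the frame A, B, E, C - \<beta> E one has \<Lambda> = L 0 and F = L 1 ^ 2 - L 0 L 3,
  so L 1 ^ 2 lies in the ideal. The double line and the triple zero of G on it combine to 6.\<close>

lemma cone_section_multiplicity:
  assumes G3: "homog 3 G"
  defines "S \<equiv> {H. \<forall>v\<in>proj_point (C - \<beta> *s E). eval4 v H \<noteq> 0}"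
  shows "has_quot_dim UNIV (\<lambda>c f. fract_cst c * f) (deg0_fractions UNIV S) (deg0_fractions (gen4 F G \<Lambda> 0) S) 6"
proof -
  define e where "e = (\<lambda>i :: 4. if i = 0 then A else if i = 1 then B else if i = 2 then E else C - \<beta> *s E)"
  have e: "(\<Sum>k\<in>UNIV. x k *s e k) = x 0 *s A + x 1 *s B + x 3 *s C + (x 2 - \<beta> * x 3) *s E" for x
    unfolding sum_UNIV_4 by (simp add: e_def distinct_4 distinct_4[symmetric] vec_eq_iff algebra_simps)
  have indep: "x = (\<lambda>k. 0)" if "(\<Sum>k\<in>UNIV. x k *s e k) = 0" for x
    using cone_frame_independent[OF that[unfolded e]] by (simp add: fun_eq_iff all_4)
  obtain M :: "4 \<Rightarrow> 'a ^ 4" where M: "\<And>i k. (\<Sum>j\<in>UNIV. M i $ j * e k $ j) = (if i = k then 1 else 0)"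
    "\<And>i j. (\<Sum>k\<in>UNIV. e k $ i * M k $ j) = (if i = j then 1 else 0)"
    by (rule dual_family[of e]) (rule indep, assumption, (rule that; assumption))
  let ?L = "\<lambda>i. linform (M i)" and ?I = "gen4 F G \<Lambda> 0"
  note L = eval4_L_combination[OF M inf]
  have \<Lambda>_eq: "\<Lambda> = ?L 0"
    by (rule poly4_eqI[OF M inf]) (unfold e \<Lambda>, unfold e[symmetric] L, rule refl)
  have F_eq: "F = ?L 1 ^ 2 - ?L 0 * ?L 3"
    by (rule poly4_eqI[OF M inf]) (unfold e F eval4_simps eval4_cst, unfold e[symmetric] L, rule refl)
  have I: "ring_ideal ?I" by (rule gen4_ideal)
  have mult: "x * y \<in> J" if "ring_ideal J" "y \<in> J" for x y and J :: "'a poly4 set"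
    using that unfolding ring_ideal_def by blast
  have L0: "?L 0 \<in> ?I" using gen4_mem(3)[of \<Lambda> F G 0] unfolding \<Lambda>_eq .
  have "?L 1 ^ 2 = F * 1 + G * 0 + \<Lambda> * ?L 3 + 0 * 0" unfolding F_eq \<Lambda>_eq by simp
  then have L1: "?L 1 ^ 2 \<in> ?I" using gen4_mem_combination by metis
  have G_cong: "G - cst \<delta> * ?L 2 ^ 3 \<in> gen4 (?L 0) (?L 1) 0 0"
  proof (rule vanish_on_line[OF M inf])
    fix a b
    have eq: "a *s e 2 + b *s e 3 = b *s C + (a - \<beta> * b) *s E"
      by (simp add: e_def distinct_4 distinct_4[symmetric] vec_eq_iff algebra_simps)
    have L2: "eval4 (a *s e 2 + b *s e 3) (?L 2) = a"
      using L[of "\<lambda>k. if k = 2 then a else if k = 3 then b else 0" 2]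
      by (simp add: sum_UNIV_4 distinct_4 distinct_4[symmetric])
    show "eval4 (a *s e 2 + b *s e 3) (G - cst \<delta> * ?L 2 ^ 3) = 0"
      unfolding eval4_simps eval4_cst L2 unfolding eq G by simp
  qed
  have sub: "?I \<subseteq> gen4 (?L 0) (?L 1 ^ 2) G 0"
  proof (rule gen4_least[OF gen4_ideal])
    have "F = ?L 0 * (- ?L 3) + ?L 1 ^ 2 * 1 + G * 0 + 0 * 0" unfolding F_eq by simp
    then show "F \<in> gen4 (?L 0) (?L 1 ^ 2) G 0" using gen4_mem_combination by metis
    show "\<Lambda> \<in> gen4 (?L 0) (?L 1 ^ 2) G 0" unfolding \<Lambda>_eq by (rule gen4_mem)
  qed (rule gen4_mem)+
  have S: "S = {H. \<forall>v\<in>proj_point (e 3). eval4 v H \<noteq> 0}" unfolding S_def by (simp add: e_def distinct_4 distinct_4[symmetric])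
  show ?thesis unfolding S
    by (rule multiplicity_six[OF M I L0 L1 gen4_mem(2) G3 G_cong \<delta> sub])
qed

end

section \<open>Matrices of rank one over the field with 3 elements and Cartier points\<close>

lemma rank_one_factor:
  fixes H :: "'k::field ^ 4 ^ 4"
  assumes "a_number H = 3"
  obtains u m :: "4 \<Rightarrow> 'k" where "\<And>i j. H $ i $ j = u i * m j" "\<exists>i. u i \<noteq> 0" "\<exists>j. m j \<noteq> 0"
proof -
  \<comment> \<open>The subtraction in \<open>a_number\<close> is truncated, but the positive value
    3 still forces rank 1.\<close>
  have "vec.dim (rows H) = 1" using assms unfolding a_number_def row_rank_def_gen by linarith
  have row: "Finite_Cartesian_Product.row i H = H $ i" for i
    by (simp add: Finite_Cartesian_Product.row_def vec_eq_iff)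
  obtain B where B: "B \<subseteq> rows H" "vec.independent B" "rows H \<subseteq> vec.span B" "card B = vec.dim (rows H)"
    by (rule vec.basis_exists[of "rows H"]) (rule that; assumption)
  have "card B = 1" using B(4) \<open>vec.dim (rows H) = 1\<close> by (rule trans)
  then obtain b where b: "B = {b}" by (rule card_1_singletonE)
  have ex: "\<exists>k. H $ i = k *s b" for i
  proof -
    have "H $ i \<in> rows H" unfolding rows_def by (intro CollectI exI[of _ i] conjI UNIV_I) (simp only: row)
    then have "H $ i \<in> range (\<lambda>k. k *s b)" using B(3) unfolding b vec.span_singleton by (rule subsetD[rotated])
    then show ?thesis by (elim rangeE) (rule exI)
  qed
  define u where "u = (\<lambda>i. SOME k. H $ i = k *s b)"
  have u: "H $ i = u i *s b" for i unfolding u_def by (rule someI_ex[OF ex])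
  have "b \<noteq> 0"
  proof
    assume "b = 0"
    then have "0 \<in> B" unfolding b by simp
    from vec.dependent_zero[OF this] B(2) show False by contradiction
  qed
  have "b \<in> rows H" using B(1) unfolding b by simp
  then obtain i where i: "b = H $ i" unfolding rows_def row by (elim CollectE exE conjE)
  have "u i \<noteq> 0"
  proof
    assume "u i = 0"
    then have "H $ i = 0" unfolding u[of i] by simp
    then show False using \<open>b \<noteq> 0\<close> unfolding i by contradiction
  qed
  show thesis
  proof (rule that[of u "vec_nth b"])
    show "H $ i $ j = u i * b $ j" for i j using u[of i] by simp
    show "\<exists>i. u i \<noteq> 0" using \<open>u i \<noteq> 0\<close> by blast
    show "\<exists>j. b $ j \<noteq> 0" using \<open>b \<noteq> 0\<close> by (simp add: vec_eq_iff)
  qed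
qed

lemma rank_proportional_rows:
  fixes w :: "'a::field ^ 4"
  assumes "m = k *s w" "n = k' *s w"
  shows "rank (vector [m, n] :: 'a ^ 4 ^ 2) \<noteq> 2"
proof -
  let ?A = "vector [m, n] :: 'a ^ 4 ^ 2"
  have A: "?A $ 1 = m" "?A $ 2 = n" by simp_all
  have mem: "m \<in> vec.span {w}" "n \<in> vec.span {w}"
    unfolding assms by (rule vec.span_scale[OF vec.span_base], rule singletonI)+
  have row: "Finite_Cartesian_Product.row i ?A = ?A $ i" for i
    by (simp add: Finite_Cartesian_Product.row_def vec_eq_iff)
  have "?A $ 1 \<in> vec.span {w}" "?A $ 2 \<in> vec.span {w}" using mem unfolding A by simp_all
  then have "?A $ i \<in> vec.span {w}" for i
    using exhaust_2[of i] by metis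
  then have "rows ?A \<subseteq> vec.span {w}" unfolding rows_def row by blast
  then have "vec.dim (rows (vector [m, n] :: 'a ^ 4 ^ 2)) \<le> card {w}" by (rule vec.dim_le_card) simp
  then show ?thesis unfolding row_rank_def_gen by simp
qed

lemma char3_of_card:
  assumes "CARD('k::field) = 3"
  shows "(3 :: 'k) = 0" "(x :: 'k) ^ 3 = x" "x \<in> {0, 1, -1}"
proof -
  have fin: "finite (UNIV :: 'k set)" by (rule card_ge_0_finite) (simp add: assms)
  \<comment> \<open>Translation by 1 permutes the field, so the sum of all elements is unchanged and
    the cardinality is 0 in the field.\<close>
  have "(\<Sum>x\<in>UNIV. x + (1 :: 'k)) = (\<Sum>x\<in>UNIV. x)"
    by (rule sum.reindex_bij_witness[of _ "\<lambda>x. x - 1" "\<lambda>x. x + 1"]) auto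
  then have "of_nat (CARD('k)) = (0 :: 'k)" by (simp add: sum.distrib)
  then show three: "(3 :: 'k) = 0" unfolding assms by simp
  have "(1 :: 'k) \<noteq> -1"
  proof
    assume "(1 :: 'k) = -1"
    then have "(1 :: 'k) + 1 = 0" by (metis add.right_inverse)
    moreover have "(3 :: 'k) = (1 + 1) + 1" by simp
    ultimately have "(3 :: 'k) = 1" by (metis add_0_left)
    then show False unfolding three by simp
  qed
  then have "card {0, 1, -1 :: 'k} = 3" by (simp add: card_insert_if)
  then have U: "(UNIV :: 'k set) = {0, 1, -1}" using card_subset_eq[OF fin, of "{0, 1, -1}"] assms by simp
  then show x: "x \<in> {0, 1, -1}" for x :: 'k by blast
  show "x ^ 3 = x" using x[of x] by auto
qed

lemma proj_point_scale: "c \<noteq> 0 \<Longrightarrow> proj_point (c *s v) = proj_point (v :: 'a::field ^ 4)"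
proof -
  assume c: "c \<noteq> 0"
  show ?thesis
    unfolding proj_point_def
  proof (intro Set.set_eqI iffI)
    fix x assume "x \<in> {d *s (c *s v) | d. d \<noteq> 0}"
    then obtain d where "d \<noteq> 0" "x = (d * c) *s v" by (auto simp: vector_smult_assoc)
    then show "x \<in> {d *s v | d. d \<noteq> 0}" using c by (intro CollectI exI[of _ "d * c"]) simp
  next
    fix x assume "x \<in> {d *s v | d. d \<noteq> 0}"
    then obtain d where "d \<noteq> 0" "x = d *s v" by auto
    then show "x \<in> {d *s (c *s v) | d. d \<noteq> 0}" using c by (intro CollectI exI[of _ "d / c"]) simp
  qed
qed

lemma proj_point_image:
  assumes "A = proj_point P1 \<union> proj_point (P2 :: 'a::field ^ 4)"
  shows "proj_point ` A = {proj_point P1, proj_point P2}"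
proof -
  have "proj_point ` proj_point P = {proj_point P}" for P :: "'a ^ 4"
  proof -
    have mem: "1 *s P \<in> proj_point P" unfolding proj_point_def using one_neq_zero by blast
    have eq: "proj_point v = proj_point P" if "v \<in> proj_point P" for v
    proof -
      obtain c where "c \<noteq> 0" "v = c *s P" using \<open>v \<in> proj_point P\<close> unfolding proj_point_def by blast
      show ?thesis unfolding \<open>v = c *s P\<close> by (rule proj_point_scale[OF \<open>c \<noteq> 0\<close>])
    qed
    have "proj_point ` proj_point P = (\<lambda>v. proj_point P) ` proj_point P"
      by (rule image_cong[OF refl]) (rule eq)
    also have "\<dots> = {proj_point P}" by (rule image_constant[OF mem])
    finally show ?thesis .
  qed
  then show ?thesis unfolding assms image_Un by auto
qed

context
  fixes F G :: "'k::field poly4" and H :: "'k ^ 4 ^ 4" and u m :: "4 \<Rightarrow> 'k"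
  assumes card: "CARD('k) = 3" and F: "homog 2 (base_change F)" and G: "homog 3 (base_change G)"
    and H: "\<And>i j. H $ i $ j = u i * m j" and u: "\<exists>i. u i \<noteq> 0"
begin

abbreviation line_form :: "'k alg_closure poly4" where
  "line_form \<equiv> linform (\<chi> j. to_ac (m j))"

abbreviation image_point :: "'k alg_closure ^ 4" where
  "image_point \<equiv> \<chi> i. to_ac (u i)"

lemma char3_closure: "(3 :: 'k alg_closure) = 0"
proof -
  have "(3 :: 'k alg_closure) = to_ac (3 :: 'k)" by simp
  also have "\<dots> = 0" unfolding char3_of_card(1)[OF card] by simp
  finally show ?thesis .
qed

lemma eval4_line_form: "eval4 v line_form = (\<Sum>j\<in>UNIV. to_ac (m j) * v $ j)"
  unfolding linform_def eval4_simps eval4_cst eval4_var by simp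

text \<open>The entries of m are fixed by cubing, so H applied to the cubed coordinates of v is (m .
  v)^3 u.\<close>

lemma cartier_eigen_rank1: "cartier_eigen H v c \<longleftrightarrow> eval4 v line_form ^ 3 *s image_point = c *s v"
proof -
  have fixed: "to_ac (m j) ^ 3 = to_ac (m j)" for j
    using char3_of_card(2)[OF card, of "m j"] by (metis to_ac_power)
  have "(\<Sum>j\<in>UNIV. to_ac (m j) * v $ j) ^ 3 = (\<Sum>j\<in>UNIV. to_ac (m j) * (v $ j) ^ 3)"
    unfolding sum_UNIV_4 add_cube_char3[OF char3_closure] power_mult_distrib fixed ..
  then have cube: "eval4 v line_form ^ 3 = (\<Sum>j\<in>UNIV. to_ac (m j) * (v $ j) ^ 3)"
    unfolding eval4_line_form .
  have comp: "(\<Sum>j\<in>UNIV. to_ac (H $ i $ j) * (v $ j) ^ 3) = to_ac (u i) * (\<Sum>j\<in>UNIV. to_ac (m j) * (v $ j) ^ 3)" for i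
    unfolding sum_distrib_left by (rule sum.cong) (simp_all add: H mult.assoc)
  have "(\<chi> i j. to_ac (H $ i $ j)) *v (\<chi> i. (v $ i) ^ 3) = eval4 v line_form ^ 3 *s image_point"
    unfolding cube vec_eq_iff
  proof
    fix i
    have "((\<chi> i j. to_ac (H $ i $ j)) *v (\<chi> i. (v $ i) ^ 3)) $ i = (\<Sum>j\<in>UNIV. to_ac (H $ i $ j) * (v $ j) ^ 3)"
      by (simp only: matrix_vector_mult_def vec_lambda_beta)
    also have "\<dots> = ((\<Sum>j\<in>UNIV. to_ac (m j) * (v $ j) ^ 3) *s image_point) $ i"
      unfolding comp vector_smult_component vec_lambda_beta by (rule mult.commute)
    finally show "((\<chi> i j. to_ac (H $ i $ j)) *v (\<chi> i. (v $ i) ^ 3)) $ i = ((\<Sum>j\<in>UNIV. to_ac (m j) * (v $ j) ^ 3) *s image_point) $ i" .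
  qed
  then show ?thesis unfolding cartier_eigen_def by (simp only:)
qed

text \<open>Every kernel form is u i times the same linear form, and some u i is invertible.\<close>

lemma section_ideal_rank1: "section_ideal F G H = gen4 (base_change F) (base_change G) line_form 0"
proof -
  have kf: "kernel_form H i = cst (to_ac (u i)) * line_form" for i
    unfolding kernel_form_def linform_def by (simp add: H cst_mult sum_distrib_left mult.assoc)
  obtain i where i: "u i \<noteq> 0" using u by blast
  show ?thesis
  proof (intro Set.set_eqI iffI)
    fix x assume "x \<in> section_ideal F G H"
    then obtain a b l where "x = base_change F * a + base_change G * b + (\<Sum>i\<in>UNIV. kernel_form H i * l i)"
      unfolding section_ideal_def by blast
    then have "x = base_change F * a + base_change G * b + line_form * (\<Sum>i\<in>UNIV. cst (to_ac (u i)) * l i) + 0 * 0"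
      unfolding kf by (simp add: sum_distrib_left mult.assoc mult.left_commute)
    then show "x \<in> gen4 (base_change F) (base_change G) line_form 0" unfolding gen4_def by blast
  next
    fix x assume "x \<in> gen4 (base_change F) (base_change G) line_form 0"
    then obtain a b c d where x: "x = base_change F * a + base_change G * b + line_form * c + 0 * d" by (rule gen4E)
    define l where "l = (\<lambda>j. if j = i then cst (to_ac (1 / u i)) * c else 0)"
    have one: "u i * (1 / u i) = 1" using i by simp
    have "(\<Sum>j\<in>UNIV. kernel_form H j * l j) = cst (to_ac (u i * (1 / u i))) * line_form * c"
    proof -
      have "(\<Sum>j\<in>UNIV. kernel_form H j * l j) = (\<Sum>j\<in>UNIV. if j = i then kernel_form H i * (cst (to_ac (1 / u i)) * c) else 0)"
        by (rule sum.cong) (simp_all add: l_def)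
      also have "\<dots> = kernel_form H i * (cst (to_ac (1 / u i)) * c)" by simp
      also have "\<dots> = cst (to_ac (u i * (1 / u i))) * line_form * c"
        unfolding kf to_ac_mult cst_mult by (simp only: mult.assoc mult.left_commute mult.commute)
      finally show ?thesis .
    qed
    then have "(\<Sum>j\<in>UNIV. kernel_form H j * l j) = line_form * c" unfolding one to_ac_1 cst_1 mult_1_left .
    then have "x = base_change F * a + base_change G * b + (\<Sum>j\<in>UNIV. kernel_form H j * l j)" using x by simp
    then show "x \<in> section_ideal F G H" unfolding section_ideal_def by blast
  qed
qed

text \<open>An eigenvector v outside the kernel plane satisfies c v = (m . v)^3 u with a nonzero
  factor, which puts u on the curve. As \<open>off\<close> excludes this, every Cartier point lies
  in the kernel plane and is of Type 1.\<close>

lemma cartier_points_rank1: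
  assumes off: "\<not> (eval4 image_point (base_change F) = 0 \<and> eval4 image_point (base_change G) = 0)"
  shows "type2_points F G H = {}"
    and "type1_points F G H = proj_point ` {v. v \<noteq> 0 \<and> eval4 v (base_change F) = 0 \<and> eval4 v (base_change G) = 0 \<and> eval4 v line_form = 0}"
proof -
  have v0: "eval4 v line_form = 0" if v: "v \<in> geom_locus F G" and c: "cartier_eigen H v c" for v c
  proof (rule ccontr)
    assume nz: "eval4 v line_form \<noteq> 0"
    have eq: "eval4 v line_form ^ 3 *s image_point = c *s v" using c unfolding cartier_eigen_rank1 .
    have vF: "eval4 v (base_change F) = 0" "eval4 v (base_change G) = 0"
      using v unfolding geom_locus_def zero_locus_def by auto
    have "eval4 (eval4 v line_form ^ 3 *s image_point) (base_change F) = 0" "eval4 (eval4 v line_form ^ 3 *s image_point) (base_change G) = 0"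
      unfolding eq eval4_scale[OF F] eval4_scale[OF G] vF by simp_all
    then show False using off nz unfolding eval4_scale[OF F] eval4_scale[OF G] by simp
  qed
  have eig: "cartier_eigen H v 0 \<longleftrightarrow> eval4 v line_form = 0" for v
    unfolding cartier_eigen_rank1 using u by (auto simp: vec_eq_iff)
  have cp: "cartier_points F G H = proj_point ` {v. v \<noteq> 0 \<and> eval4 v (base_change F) = 0 \<and> eval4 v (base_change G) = 0 \<and> eval4 v line_form = 0}"
    unfolding cartier_points_def
  proof (rule arg_cong[where f = "image proj_point"], intro Set.set_eqI iffI)
    fix v assume "v \<in> {v \<in> geom_locus F G. \<exists>c. cartier_eigen H v c}"
    then show "v \<in> {v. v \<noteq> 0 \<and> eval4 v (base_change F) = 0 \<and> eval4 v (base_change G) = 0 \<and> eval4 v line_form = 0}"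
      using v0 unfolding geom_locus_def zero_locus_def by auto
  next
    fix v assume "v \<in> {v. v \<noteq> 0 \<and> eval4 v (base_change F) = 0 \<and> eval4 v (base_change G) = 0 \<and> eval4 v line_form = 0}"
    then show "v \<in> {v \<in> geom_locus F G. \<exists>c. cartier_eigen H v c}"
      using eig unfolding geom_locus_def zero_locus_def by auto
  qed
  have "type1_points F G H = cartier_points F G H"
  proof -
    have "eval4 w line_form = 0" if "eval4 v line_form = 0" "w \<in> proj_point v" for v w
      using that eval4_scale[OF homog_linform, of _ v] unfolding proj_point_def by auto
    then show ?thesis unfolding type1_points_def eig cp by blast
  qed
  then show "type2_points F G H = {}"
    "type1_points F G H = proj_point ` {v. v \<noteq> 0 \<and> eval4 v (base_change F) = 0 \<and> eval4 v (base_change G) = 0 \<and> eval4 v line_form = 0}"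
    unfolding type2_points_def cp by auto
qed

lemma has_multiplicity_rank1:
  "has_multiplicity F G H P n \<longleftrightarrow> has_quot_dim UNIV (\<lambda>c f. fract_cst c * f)
       (deg0_fractions UNIV {B. \<forall>v\<in>P. eval4 v B \<noteq> 0})
       (deg0_fractions (gen4 (base_change F) (base_change G) line_form 0) {B. \<forall>v\<in>P. eval4 v B \<noteq> 0}) n"
  unfolding has_multiplicity_def section_ideal_rank1 ..

end

section \<open>Smoothness of the space curve and of its form on the rulings\<close>

lemma vanishing_combination:
  assumes "a * u + b * v = (0::'a::field)" "(u, v) \<noteq> (0, 0)"
  obtains k where "a = k * v" "b = - (k * u)"
proof (cases "v = 0")
  case True
  then show thesis using assms by (intro that[of "- b / u"]) auto
next
  case False
  have "b * v = - (a * u)" using assms(1) by (simp add: eq_neg_iff_add_eq_0 add.commute)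
  then have "b = - (a * u) / v" by (subst nonzero_eq_divide_eq[OF False])
  then show thesis using False by (intro that[of "a / v"]) simp_all
qed

text \<open>The four equations say that the covector (a, b, c, d) vanishes on both lines of the
  quadric through the point. These lines span the tangent plane, so the covector is a multiple of
  its equation.\<close>

lemma tangent_covector:
  fixes a b c d :: "'a::field"
  assumes nz: "(s, t) \<noteq> (0, 0)" "(u, v) \<noteq> (0, 0)"
    and "a * u + b * v = 0" "c * u + d * v = 0" "a * s + c * t = 0" "b * s + d * t = 0"
  obtains k where "a = k * (t * v)" "b = - (k * (t * u))" "c = - (k * (s * v))" "d = k * (s * u)"
proof -
  obtain \<alpha> where \<alpha>: "a = \<alpha> * v" "b = - (\<alpha> * u)" by (rule vanishing_combination[OF assms(3) nz(2)])
  obtain \<beta> where \<beta>: "c = \<beta> * v" "d = - (\<beta> * u)" by (rule vanishing_combination[OF assms(4) nz(2)])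
  have "v * (\<alpha> * s + \<beta> * t) = 0" "u * (\<alpha> * s + \<beta> * t) = 0"
    using assms(5,6) unfolding \<alpha> \<beta> by (simp_all add: algebra_simps eq_neg_iff_add_eq_0 neg_eq_iff_add_eq_0)
  then have "\<alpha> * s + \<beta> * t = 0" using nz(2) by auto
  from vanishing_combination[OF this nz(1)] obtain k where "\<alpha> = k * t" "\<beta> = - (k * s)" .
  then show thesis by (intro that[of k]) (simp_all add: \<alpha> \<beta> mult.assoc)
qed

context
  assumes char3: "(3 :: 'a::field) = 0"
begin

lemmas deriv_simps = partial_deriv_linear partial_deriv_mult partial_deriv_cst partial_deriv_var partial_deriv_power
  partial_deriv_numeral distinct_4 distinct_4[symmetric] eval4_simps

lemma gradient_F:
  "gradient (F1 :: 'a poly4) P = vec4 (- vec_nth P 3) (- vec_nth P 2) (- vec_nth P 1) (- vec_nth P 0)"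
  "gradient (F2 :: 'a poly4) P = vec4 (- vec_nth P 3) (- vec_nth P 1) (- vec_nth P 2) (- vec_nth P 0)"
  unfolding vec4_eq_iff gradient_def F1_def F2_def eps_def by (simp_all add: deriv_simps numerals_char3(1)[OF char3])

lemma gradient_cubic:
  fixes g :: "nat \<Rightarrow> 'a" and P :: "'a ^ 4"
  defines "x \<equiv> vec_nth P 0" and "y \<equiv> vec_nth P 1" and "z \<equiv> vec_nth P 2" and "w \<equiv> vec_nth P 3"
  shows "gradient (cubic (vy * vz) g) P = vec4 (- (g 1 * y * x) - g 2 * z * x + g 3 * y * z)
      (g 1 * x * x + g 3 * z * x - g 6 * y * z + g 7 * z * z - g 8 * y * w + g 9 * z * w + g 11 * w * w)
      (g 2 * x * x + g 3 * y * x + g 6 * y * y - g 7 * y * z + g 9 * y * w - g 10 * z * w + g 12 * w * w)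
      (g 8 * y * y + g 9 * y * z + g 10 * z * z - g 11 * y * w - g 12 * z * w)"
    and "gradient (cubic (vy^2 + vz^2) g) P = vec4 (- (g 1 * y * x) - g 2 * z * x + g 3 * (y * y + z * z))
      (g 1 * x * x - g 3 * y * x - g 6 * y * z + g 7 * z * z - g 8 * y * w + g 9 * z * w + g 11 * w * w)
      (g 2 * x * x - g 3 * z * x + g 6 * y * y - g 7 * y * z + g 9 * y * w - g 10 * z * w + g 12 * w * w)
      (g 8 * y * y + g 9 * y * z + g 10 * z * z - g 11 * y * w - g 12 * z * w)"
  unfolding vec4_eq_iff gradient_def cubic_def x_def y_def z_def w_def
  by (simp_all add: deriv_simps power2_eq_square char3 numerals_char3(1)[OF char3] algebra_simps)

text \<open>The chain rule for the Segre map: the gradient of the cubic, paired with the derivatives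
  of the map, gives the derivatives of the (3, 3) form, from which t, -s, v, -u split off as in
  \<open>drow\<close>.\<close>

lemma chain_split:
  fixes g :: "nat \<Rightarrow> 'a" and s t u v :: 'a
  defines "n \<equiv> gradient (cubic (vy * vz) g) (vec4 (s * u) (s * v) (t * u) (- (t * v)))"
  shows "vec_nth n 0 * u + vec_nth n 1 * v = t * deriv1 (segre_coeffs g) s t u v"
    "vec_nth n 2 * u + - vec_nth n 3 * v = - (s * deriv1 (segre_coeffs g) s t u v)"
    "vec_nth n 0 * s + vec_nth n 2 * t = v * deriv2 (segre_coeffs g) s t u v"
    "vec_nth n 1 * s + - vec_nth n 3 * t = - (u * deriv2 (segre_coeffs g) s t u v)"
  unfolding n_def gradient_cubic vec4_nth deriv1_def deriv2_def row_def drow_def segre_coeffs_simps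
  by (simp_all add: algebra_simps power2_eq_square power3_eq_cube char3 numerals_char3(1)[OF char3])

lemma chain_nonsplit:
  fixes g :: "nat \<Rightarrow> 'a" and s t u v :: 'a
  assumes i: "\<iota> * \<iota> = -1"
  defines "n \<equiv> gradient (cubic (vy^2 + vz^2) g) (vec4 (s * u) (- (s * v) - t * u) (\<iota> * (s * v) - \<iota> * (t * u)) (t * v))"
  shows "vec_nth n 0 * u + (- vec_nth n 1 + \<iota> * vec_nth n 2) * v = t * deriv1 (segre_coeffs (twist \<iota> g)) s t u v"
    "(- vec_nth n 1 - \<iota> * vec_nth n 2) * u + vec_nth n 3 * v = - (s * deriv1 (segre_coeffs (twist \<iota> g)) s t u v)"
    "vec_nth n 0 * s + (- vec_nth n 1 - \<iota> * vec_nth n 2) * t = v * deriv2 (segre_coeffs (twist \<iota> g)) s t u v"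
    "(- vec_nth n 1 + \<iota> * vec_nth n 2) * s + vec_nth n 3 * t = - (u * deriv2 (segre_coeffs (twist \<iota> g)) s t u v)"
proof -
  have i': "\<iota> * (\<iota> * x) = - x" for x using i by (simp flip: mult.assoc)
  show "vec_nth n 0 * u + (- vec_nth n 1 + \<iota> * vec_nth n 2) * v = t * deriv1 (segre_coeffs (twist \<iota> g)) s t u v"
    "(- vec_nth n 1 - \<iota> * vec_nth n 2) * u + vec_nth n 3 * v = - (s * deriv1 (segre_coeffs (twist \<iota> g)) s t u v)"
    "vec_nth n 0 * s + (- vec_nth n 1 - \<iota> * vec_nth n 2) * t = v * deriv2 (segre_coeffs (twist \<iota> g)) s t u v"
    "(- vec_nth n 1 + \<iota> * vec_nth n 2) * s + vec_nth n 3 * t = - (u * deriv2 (segre_coeffs (twist \<iota> g)) s t u v)"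
    unfolding n_def gradient_cubic vec4_nth deriv1_def deriv2_def row_def drow_def segre_coeffs_simps twist_simps[OF char3]
    by (simp_all add: algebra_simps power2_eq_square power3_eq_cube char3 numerals_char3(1)[OF char3] i i')
qed

text \<open>At a singular zero of the form the chain rule makes the gradient of G vanish on both
  lines through the point. It is then proportional to the gradient of F, and the Jacobian has rank
  below 2.\<close>

lemma smooth_split:
  fixes g :: "nat \<Rightarrow> 'a"
  assumes sm: "\<And>P. P \<noteq> 0 \<Longrightarrow> eval4 P F1 = 0 \<Longrightarrow> eval4 P (cubic (vy * vz) g) = 0 \<Longrightarrow>
    rank (vector [gradient F1 P, gradient (cubic (vy * vz) g) P] :: 'a ^ 4 ^ 2) = 2"
  shows "smooth_bicubic (segre_coeffs g)"
  unfolding smooth_bicubic_def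
proof (intro allI impI notI)
  fix s t u v assume nz: "(s, t) \<noteq> (0, 0)" "(u, v) \<noteq> (0, 0)"
    and z: "bicubic (segre_coeffs g) s t u v = 0 \<and> deriv1 (segre_coeffs g) s t u v = 0 \<and> deriv2 (segre_coeffs g) s t u v = 0"
  define P where "P = vec4 (s * u) (s * v) (t * u) (- (t * v))"
  define w where "w = vec4 (t * v) (- (t * u)) (- (s * v)) (- (s * u))"
  have P: "P \<noteq> 0" using nz unfolding P_def vec4_eq_iff by auto
  have "eval4 P F1 = 0" unfolding eval4_quadrics[OF char3] P_def vec4_nth by (simp add: algebra_simps)
  moreover have "eval4 P (cubic (vy * vz) g) = 0" unfolding P_def cubic_segre using z by blast
  moreover have "gradient F1 P = 1 *s w" unfolding gradient_F vec4_eq_iff P_def w_def by simp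
  moreover have "\<exists>k. gradient (cubic (vy * vz) g) P = k *s w"
  proof -
    note ch = chain_split[where g = g and s = s and t = t and u = u and v = v, folded P_def]
    have "\<exists>k. vec_nth (gradient (cubic (vy * vz) g) P) 0 = k * (t * v) \<and> vec_nth (gradient (cubic (vy * vz) g) P) 1 = - (k * (t * u))
      \<and> vec_nth (gradient (cubic (vy * vz) g) P) 2 = - (k * (s * v)) \<and> - vec_nth (gradient (cubic (vy * vz) g) P) 3 = k * (s * u)"
      by (rule tangent_covector[OF nz, of "vec_nth (gradient (cubic (vy * vz) g) P) 0" "vec_nth (gradient (cubic (vy * vz) g) P) 1"
          "vec_nth (gradient (cubic (vy * vz) g) P) 2" "- vec_nth (gradient (cubic (vy * vz) g) P) 3"])
        (unfold ch, use z in auto)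
    then show ?thesis unfolding vec4_eq_iff w_def by (auto simp: minus_equation_iff)
  qed
  ultimately show False using sm[OF P] rank_proportional_rows by metis
qed

lemma smooth_nonsplit:
  fixes g :: "nat \<Rightarrow> 'a"
  assumes i: "\<iota> * \<iota> = -1" and sm: "\<And>P. P \<noteq> 0 \<Longrightarrow> eval4 P F2 = 0 \<Longrightarrow> eval4 P (cubic (vy^2 + vz^2) g) = 0 \<Longrightarrow>
    rank (vector [gradient F2 P, gradient (cubic (vy^2 + vz^2) g) P] :: 'a ^ 4 ^ 2) = 2"
  shows "smooth_bicubic (segre_coeffs (twist \<iota> g))"
  unfolding smooth_bicubic_def
proof (intro allI impI notI)
  have i': "\<iota> * (\<iota> * x) = - x" for x using i by (simp flip: mult.assoc)
  fix s t u v assume nz: "(s, t) \<noteq> (0, 0)" "(u, v) \<noteq> (0, 0)"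
    and z: "bicubic (segre_coeffs (twist \<iota> g)) s t u v = 0 \<and> deriv1 (segre_coeffs (twist \<iota> g)) s t u v = 0 \<and> deriv2 (segre_coeffs (twist \<iota> g)) s t u v = 0"
  define P where "P = vec4 (s * u) (- (s * v) - t * u) (\<iota> * (s * v) - \<iota> * (t * u)) (t * v)"
  define w where "w = vec4 (t * v) (- (t * u) - s * v) (\<iota> * (s * v) - \<iota> * (t * u)) (s * u)"
  have P: "P \<noteq> 0"
  proof
    assume "P = 0"
    then have e: "s * u = 0" "s * v + t * u = 0" "\<iota> * (s * v - t * u) = 0" "t * v = 0"
      unfolding P_def vec4_eq_iff by (simp_all add: algebra_simps neg_eq_iff_add_eq_0)
    have "\<iota> \<noteq> 0" using i by auto
    then have "s * v = t * u" using e(3) by simp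
    then have "t * u + t * u = 0" using e(2) by simp
    then have "t * u * 2 = 0" by (simp only: mult_2_right)
    then have "t * u = 0" unfolding numerals_char3(1)[OF char3] by simp
    then show False using e \<open>s * v = t * u\<close> nz by auto
  qed
  have z1: "eval4 P F2 = 0" unfolding eval4_quadrics[OF char3] P_def vec4_nth
    by (simp add: algebra_simps power2_eq_square i i' char3 numerals_char3[OF char3])
  have z2: "eval4 P (cubic (vy^2 + vz^2) g) = 0" unfolding P_def cubic_segre_nonsplit[OF char3 i] using z by blast
  have g1: "gradient F2 P = (- 1) *s w" unfolding gradient_F vec4_eq_iff P_def w_def by simp
  have "\<exists>k. gradient (cubic (vy^2 + vz^2) g) P = k *s w"
  proof -
    define a b c d where "a = vec_nth (gradient (cubic (vy^2 + vz^2) g) P) 0" and "b = vec_nth (gradient (cubic (vy^2 + vz^2) g) P) 1"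
      and "c = vec_nth (gradient (cubic (vy^2 + vz^2) g) P) 2" and "d = vec_nth (gradient (cubic (vy^2 + vz^2) g) P) 3"
    note ch = chain_nonsplit[OF i, where g = g and s = s and t = t and u = u and v = v, folded P_def, folded a_def b_def c_def d_def]
    have "\<exists>k. a = k * (t * v) \<and> - b + \<iota> * c = - (k * (t * u)) \<and> - b - \<iota> * c = - (k * (s * v)) \<and> d = k * (s * u)"
      by (rule tangent_covector[OF nz, of a "- b + \<iota> * c" "- b - \<iota> * c" d]) (unfold ch, use z in auto)
    then obtain k where k: "a = k * (t * v)" "- b + \<iota> * c = - (k * (t * u))" "- b - \<iota> * c = - (k * (s * v))" "d = k * (s * u)" by blast
    note two = numerals_char3(1)[OF char3]
    \<comment> \<open>The components b and c are recovered from the conjugate combinations: -2 b =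
      b, and multiplying the difference by \<iota> returns 2 \<iota>^2 c = c.\<close>
    have "(- b + \<iota> * c) + (- b - \<iota> * c) = - (2 * b)" by simp
    also have "\<dots> = b" unfolding two by simp
    finally have "b = - (k * (t * u)) + - (k * (s * v))" unfolding k(2,3) by (rule sym)
    also have "\<dots> = k * (- (t * u) - s * v)" by (simp add: algebra_simps)
    finally have b: "b = k * (- (t * u) - s * v)" .
    have "\<iota> * ((- b + \<iota> * c) - (- b - \<iota> * c)) = \<iota> * (2 * (\<iota> * c))" by simp
    also have "\<dots> = c" unfolding two by (simp add: i')
    finally have "c = \<iota> * (- (k * (t * u)) - - (k * (s * v)))" unfolding k(2,3) by (rule sym)
    also have "\<dots> = k * (\<iota> * (s * v) - \<iota> * (t * u))" by (simp add: algebra_simps)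
    finally have c: "c = k * (\<iota> * (s * v) - \<iota> * (t * u))" .
    have "gradient (cubic (vy^2 + vz^2) g) P = k *s w"
      unfolding vec4_eq_iff[of "gradient (cubic (vy^2 + vz^2) g) P"] w_def vector_smult_component vec4_nth
      by (intro conjI) (rule k(1)[unfolded a_def] b[unfolded b_def] c[unfolded c_def] k(4)[unfolded d_def])+
    then show ?thesis by blast
  qed
  then obtain k where g2: "gradient (cubic (vy^2 + vz^2) g) P = k *s w" by blast
  show False using rank_proportional_rows[OF g1 g2] sm[OF P z1 z2] by contradiction
qed

end

lemma split_form_nonzero:
  assumes "(a, b, c, d) \<noteq> (0, 0, 0, 0 :: 'a::field)"
  shows "\<exists>s t u v. bilin (split_form a b c d) s t u v \<noteq> 0"
proof (rule ccontr)
  assume "\<not> ?thesis"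
  then have z: "bilin (split_form a b c d) s t u v = 0" for s t u v by blast
  from z[of 1 0 1 0] z[of 1 0 0 1] z[of 0 1 1 0] z[of 0 1 0 1] assms show False
    unfolding bilin_def split_form_simps by simp
qed

section \<open>Type 1 points on a nondegenerate quadric\<close>

context
  fixes F G :: "'k::field poly4" and H :: "'k ^ 4 ^ 4" and u m :: "4 \<Rightarrow> 'k"
    and c l r :: "nat \<Rightarrow> nat \<Rightarrow> 'k alg_closure" and b0 b1 b2 b3 :: "'k alg_closure ^ 4"
    and \<kappa> k u0 u1 u2 u3 :: "'k alg_closure" and e :: nat
  assumes card: "CARD('k) = 3" and F2: "homog 2 (base_change F)" and G3: "homog 3 (base_change G)"
    and H: "\<And>i j. H $ i $ j = u i * m j" and u: "\<exists>i. u i \<noteq> 0"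
    and hw: "hw_rank1 c l r" and smooth: "smooth_bicubic c"
    and l: "\<exists>s t u v. bilin l s t u v \<noteq> 0" and r: "\<exists>s t u v. bilin r s t u v \<noteq> 0"
    and F: "\<And>a b c d. eval4 (a *s b0 + b *s b1 + c *s b2 + d *s b3) (base_change F) = \<kappa> * (a * d - b * c)" and \<kappa>: "\<kappa> \<noteq> 0"
    and G: "\<And>s t u v. eval4 ((s * u) *s b0 + (s * v) *s b1 + (t * u) *s b2 + (t * v) *s b3) (base_change G) = bicubic c s t u v"
    and L: "\<And>a b c d. eval4 (a *s b0 + b *s b1 + c *s b2 + d *s b3) (linform (\<chi> j. to_ac (m j)))
      = l 1 1 * a + l 1 0 * b + l 0 1 * c + l 0 0 * d"
    and U: "(\<chi> i. to_ac (u i)) = u0 *s b0 + u1 *s b1 + u2 *s b2 + u3 *s b3" "(u0, u1, u2, u3) \<noteq> (0, 0, 0, 0)"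
    and r_eq: "r 0 0 = k * u0" "r 0 1 = - k * u1" "r 1 0 = - k * u2" "r 1 1 = k * u3"
    and fixed: "\<And>i j. c i j ^ (3 ^ e) = c i j" "\<And>i j. l i j ^ (3 ^ e) = l i j"
      "\<And>i. (b0 $ i) ^ (3 ^ e) = b0 $ i" "\<And>i. (b1 $ i) ^ (3 ^ e) = b1 $ i" "\<And>i. (b2 $ i) ^ (3 ^ e) = b2 $ i" "\<And>i. (b3 $ i) ^ (3 ^ e) = b3 $ i"
begin

text \<open>The argument shared by both nondegenerate quadrics. All data are fixed by x -> x^(3^e),
  with e = 1 for \<open>F1\<close> and e = 2 for \<open>F2\<close>, and \<open>split_section\<close>
  produces the points in that field.\<close>

lemma segre_type1_points:
  "type2_points F G H = {} \<and> card (type1_points F G H) = 2 \<and>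
   (\<forall>P\<in>type1_points F G H. has_multiplicity F G H P 3 \<and> defined_over (3 ^ e) P)"
proof -
  note char3 = char3_closure[OF card F2 G3 H u]
  have off: "\<not> (eval4 (\<chi> i. to_ac (u i)) (base_change F) = 0 \<and> eval4 (\<chi> i. to_ac (u i)) (base_change G) = 0)"
    using cone_point_off_curve[OF char3 hw smooth l r F \<kappa> G L U(2) r_eq] unfolding U(1) by blast
  note types = cartier_points_rank1[OF card F2 G3 H u off]
  have "perfect_subfield {x :: 'k alg_closure. x ^ (3 ^ e) = x}" by (rule perfect_subfield_frobenius_fixed[OF char3])
  then obtain P1 P2 :: "'k alg_closure ^ 4" where P: "\<And>i. P1 $ i \<in> {x. x ^ (3 ^ e) = x}" "\<And>i. P2 $ i \<in> {x. x ^ (3 ^ e) = x}"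
    and ne: "proj_point P1 \<noteq> proj_point P2"
    and locus: "{v. v \<noteq> 0 \<and> eval4 v (base_change F) = 0 \<and> eval4 v (base_change G) = 0 \<and> eval4 v (linform (\<chi> j. to_ac (m j))) = 0}
      = proj_point P1 \<union> proj_point P2"
    and mult: "\<And>P. P \<in> {proj_point P1, proj_point P2} \<Longrightarrow> has_quot_dim UNIV (\<lambda>c f. fract_cst c * f)
       (deg0_fractions UNIV {H. \<forall>v\<in>P. eval4 v H \<noteq> 0})
       (deg0_fractions (gen4 (base_change F) (base_change G) (linform (\<chi> j. to_ac (m j))) 0) {H. \<forall>v\<in>P. eval4 v H \<noteq> 0}) 3"
    by (rule split_section[OF char3 hw smooth l r F \<kappa> G L, where R = "{x :: 'k alg_closure. x ^ (3 ^ e) = x}"])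
      ((rule that; assumption) | (simp only: mem_Collect_eq fixed))+
  have t1: "type1_points F G H = {proj_point P1, proj_point P2}"
    unfolding types(2) by (rule proj_point_image[OF locus])
  have "has_multiplicity F G H P 3" if "P \<in> type1_points F G H" for P
    using mult[of P] that unfolding t1 has_multiplicity_rank1[OF card F2 G3 H u] by blast
  moreover have "defined_over (3 ^ e) (proj_point Q)" if "\<And>i. Q $ i \<in> {x. x ^ (3 ^ e) = x}" for Q :: "'k alg_closure ^ 4"
  proof -
    have "1 *s Q \<in> proj_point Q" unfolding proj_point_def using one_neq_zero by blast
    then show ?thesis using that unfolding defined_over_def by (intro bexI[of _ Q]) simp_all
  qed
  from this[OF P(1)] this[OF P(2)] have "\<forall>P\<in>type1_points F G H. defined_over (3 ^ e) P" unfolding t1 by blast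
  ultimately show ?thesis using types(1) ne unfolding t1 by simp
qed

end

lemma base_change_cubic:
  "base_change (cubic q g) = cubic (base_change q) (\<lambda>i. to_ac (g i))"
  unfolding cubic_def by (simp add: base_change_simps)

lemma base_change_quadrics: "base_change F1 = F1" "base_change F2 = F2" "base_change Fd = Fd"
  unfolding F1_def F2_def Fd_def eps_def by (simp_all add: base_change_simps)

lemma nonzero_entry: "(\<exists>j. m j \<noteq> (0::'a::zero)) \<longleftrightarrow> (m (0::4), m 1, m 2, m 3) \<noteq> (0, 0, 0, 0)"
  using all_4[of "\<lambda>j. m j = 0"] by auto

lemma frobenius_fixed_power:
  assumes "(x :: 'a::field) ^ 3 = x" shows "x ^ (3 ^ e) = x"
proof (induction e)
  case (Suc e)
  have "x ^ (3 ^ Suc e) = (x ^ (3 ^ e)) ^ 3" by (simp add: mult.commute flip: power_mult)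
  then show ?case by (simp add: Suc assms)
qed simp

context
  fixes H :: "'k::field ^ 4 ^ 4" and g :: "nat \<Rightarrow> 'k"
  assumes card: "CARD('k) = 3" and nz: "g 1 \<noteq> 0 \<or> g 2 \<noteq> 0" and a: "a_number H = 3"
begin

lemma char3_field: "(3 :: 'k) = 0" and char3_ac: "(3 :: 'k alg_closure) = 0"
proof -
  show c: "(3 :: 'k) = 0" by (rule char3_of_card[OF card])
  have "(3 :: 'k alg_closure) = to_ac (3 :: 'k)" by simp
  also have "\<dots> = 0" unfolding c by simp
  finally show "(3 :: 'k alg_closure) = 0" .
qed

lemma to_ac_cube: "to_ac (x :: 'k) ^ 3 = to_ac x"
  using char3_of_card(2)[OF card, of x] by (metis to_ac_power)

lemmas to_ac_hom = to_ac_diff to_ac_mult to_ac_power to_ac_add to_ac_minus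

lemma split_case:
  assumes sm: "smooth_curve F1 (cubic (vy * vz) g)" and hwm: "is_hasse_witt_matrix F1 (cubic (vy * vz) g) H"
  shows "type2_points F1 (cubic (vy * vz) g) H = {} \<and> card (type1_points F1 (cubic (vy * vz) g) H) = 2 \<and>
   (\<forall>P\<in>type1_points F1 (cubic (vy * vz) g) H. has_multiplicity F1 (cubic (vy * vz) g) H P 3 \<and> defined_over (3 ^ 1) P)"
proof -
  obtain u m where H: "\<And>i j. H $ i $ j = u i * m j" and u: "\<exists>i. u i \<noteq> 0" and m: "\<exists>j. m j \<noteq> 0"
    by (rule rank_one_factor[OF a]) (rule that; assumption)
  note ent = hasse_witt_split[OF char3_field nz hwm, unfolded H, THEN arg_cong[where f = to_ac], unfolded to_ac_hom]
  let ?g = "\<lambda>i. to_ac (g i)"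
  have bc: "base_change (cubic (vy * vz) g) = cubic (vy * vz) ?g" unfolding base_change_cubic by (simp add: base_change_simps)
  have hw: "hw_rank1 (segre_coeffs ?g) (split_form (to_ac (m 0)) (to_ac (m 1)) (to_ac (m 2)) (- to_ac (m 3)))
    (split_form (to_ac (u 3)) (to_ac (u 2)) (to_ac (u 1)) (- to_ac (u 0)))"
    by (rule hw_rank1_split[OF char3_ac, where u = "\<lambda>i. to_ac (u i)" and m = "\<lambda>i. to_ac (m i)"];
        unfold to_ac_cube mult.commute[of "to_ac (m _)"]; rule ent[symmetric])
  have smooth: "smooth_bicubic (segre_coeffs ?g)"
    by (rule smooth_split[OF char3_ac])
      (use sm in \<open>simp add: smooth_curve_def geom_locus_def zero_locus_def bc base_change_quadrics\<close>)
  have pts: "a *s vec4 1 0 0 0 + b *s vec4 0 1 0 0 + c *s vec4 0 0 1 0 + d *s vec4 0 0 0 (- 1) = vec4 a b c (- d)" for a b c d :: "'k alg_closure"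
    unfolding vec4_eq_iff by simp
  show ?thesis
  \<comment> \<open>With w = - d the form -(x w + y z) becomes a d - b c, hence \<kappa> = 1. The
    value k = - 1 identifies the second bilinear form with the polar plane of the image
    point.\<close>
  proof (rule segre_type1_points[OF card _ _ H u hw smooth, where \<kappa> = 1 and k = "- 1"
        and ?b0.0 = "vec4 1 0 0 0" and ?b1.0 = "vec4 0 1 0 0" and ?b2.0 = "vec4 0 0 1 0" and ?b3.0 = "vec4 0 0 0 (- 1)"
        and ?u0.0 = "to_ac (u 0)" and ?u1.0 = "to_ac (u 1)" and ?u2.0 = "to_ac (u 2)" and ?u3.0 = "- to_ac (u 3)"])
    show "homog 2 (base_change (F1 :: 'k poly4))" unfolding base_change_quadrics by (rule homog_F1[OF char3_ac])
    show "homog 3 (base_change (cubic (vy * vz) g))" unfolding bc by (rule homog_cubic1)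
    show "\<exists>s t u v. bilin (split_form (to_ac (m 0)) (to_ac (m 1)) (to_ac (m 2)) (- to_ac (m 3))) s t u v \<noteq> 0"
      by (rule split_form_nonzero) (use m in \<open>simp add: nonzero_entry\<close>)
    show "\<exists>s t ua v. bilin (split_form (to_ac (u 3)) (to_ac (u 2)) (to_ac (u 1)) (- to_ac (u 0))) s t ua v \<noteq> 0"
      by (rule split_form_nonzero) (use u in \<open>auto simp: nonzero_entry\<close>)
    show "eval4 (a *s vec4 1 0 0 0 + b *s vec4 0 1 0 0 + c *s vec4 0 0 1 0 + d *s vec4 0 0 0 (- 1)) (base_change (F1 :: 'k poly4)) = 1 * (a * d - b * c)" for a b c d
      unfolding pts base_change_quadrics eval4_quadrics[OF char3_ac] vec4_nth by (simp add: algebra_simps)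
    show "eval4 ((s * u) *s vec4 1 0 0 0 + (s * v) *s vec4 0 1 0 0 + (t * u) *s vec4 0 0 1 0 + (t * v) *s vec4 0 0 0 (- 1)) (base_change (cubic (vy * vz) g))
      = bicubic (segre_coeffs ?g) s t u v" for s t u v
      unfolding pts bc cubic_segre ..
    show "eval4 (a *s vec4 1 0 0 0 + b *s vec4 0 1 0 0 + c *s vec4 0 0 1 0 + d *s vec4 0 0 0 (- 1)) (linform (\<chi> j. to_ac (m j)))
      = split_form (to_ac (m 0)) (to_ac (m 1)) (to_ac (m 2)) (- to_ac (m 3)) 1 1 * a
      + split_form (to_ac (m 0)) (to_ac (m 1)) (to_ac (m 2)) (- to_ac (m 3)) 1 0 * b
      + split_form (to_ac (m 0)) (to_ac (m 1)) (to_ac (m 2)) (- to_ac (m 3)) 0 1 * c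
      + split_form (to_ac (m 0)) (to_ac (m 1)) (to_ac (m 2)) (- to_ac (m 3)) 0 0 * d" for a b c d
      unfolding pts split_form_simps linform_def eval4_simps eval4_cst eval4_var sum_UNIV_4 vec4_nth by simp
    show "(\<chi> i. to_ac (u i)) = to_ac (u 0) *s vec4 1 0 0 0 + to_ac (u 1) *s vec4 0 1 0 0 + to_ac (u 2) *s vec4 0 0 1 0 + - to_ac (u 3) *s vec4 0 0 0 (- 1)"
      unfolding pts vec4_eq_iff by simp
    show "(to_ac (u 0), to_ac (u 1), to_ac (u 2), - to_ac (u 3)) \<noteq> (0, 0, 0, 0)" using u by (simp add: nonzero_entry)
    have "(0 :: 'k alg_closure) ^ (3 ^ 1) = 0" by simp
    show "segre_coeffs ?g i j ^ (3 ^ 1) = segre_coeffs ?g i j" for i j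
      by (simp add: segre_coeffs_def to_ac_cube power_minus_odd)
    show "split_form (to_ac (m 0)) (to_ac (m 1)) (to_ac (m 2)) (- to_ac (m 3)) i j ^ (3 ^ 1) = split_form (to_ac (m 0)) (to_ac (m 1)) (to_ac (m 2)) (- to_ac (m 3)) i j" for i j
      by (simp add: split_form_def to_ac_cube power_minus_odd)
    show "(vec4 1 0 0 0 $ i :: 'k alg_closure) ^ (3 ^ 1) = vec4 1 0 0 0 $ i" "(vec4 0 1 0 0 $ i :: 'k alg_closure) ^ (3 ^ 1) = vec4 0 1 0 0 $ i"
      "(vec4 0 0 1 0 $ i :: 'k alg_closure) ^ (3 ^ 1) = vec4 0 0 1 0 $ i" "(vec4 0 0 0 (- 1) $ i :: 'k alg_closure) ^ (3 ^ 1) = vec4 0 0 0 (- 1) $ i" for i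
      by (simp_all add: vec4_def power_minus_odd)
  qed (simp_all add: split_form_simps)
qed

lemma nonsplit_case:
  assumes sm: "smooth_curve F2 (cubic (vy^2 + vz^2) g)" and hwm: "is_hasse_witt_matrix F2 (cubic (vy^2 + vz^2) g) H"
  shows "type2_points F2 (cubic (vy^2 + vz^2) g) H = {} \<and> card (type1_points F2 (cubic (vy^2 + vz^2) g) H) = 2 \<and>
   (\<forall>P\<in>type1_points F2 (cubic (vy^2 + vz^2) g) H. has_multiplicity F2 (cubic (vy^2 + vz^2) g) H P 3 \<and> defined_over (3 ^ 2) P)"
proof -
  obtain \<iota> :: "'k alg_closure" where "\<iota> ^ 2 = - 1" using nth_root_exists[of 2 "- 1 :: 'k alg_closure"] by auto
  then have i: "\<iota> * \<iota> = - 1" by (simp add: power2_eq_square)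
  have i': "\<iota> * (\<iota> * x) = - x" for x using i by (simp flip: mult.assoc)
  have inz: "\<iota> \<noteq> 0" using i by auto
  have two: "(2 :: 'k alg_closure) = - 1" by (rule numerals_char3[OF char3_ac])
  obtain u m where H: "\<And>i j. H $ i $ j = u i * m j" and u: "\<exists>i. u i \<noteq> 0" and m: "\<exists>j. m j \<noteq> 0"
    by (rule rank_one_factor[OF a]) (rule that; assumption)
  note ent = hasse_witt_nonsplit[OF char3_field nz hwm, unfolded H, THEN arg_cong[where f = to_ac], unfolded to_ac_hom]
  let ?g = "\<lambda>i. to_ac (g i)"
  let ?m1 = "to_ac (m 1)" and ?m2 = "to_ac (m 2)" and ?u1 = "to_ac (u 1)" and ?u2 = "to_ac (u 2)"
  let ?l = "split_form (to_ac (m 0)) (- ?m1 + \<iota> * ?m2) (- ?m1 - \<iota> * ?m2) (to_ac (m 3))"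
  let ?r = "split_form (to_ac (u 3)) (- (?u1 - \<iota> * ?u2)) (- (?u1 + \<iota> * ?u2)) (to_ac (u 0))"
  have bc: "base_change (cubic (vy^2 + vz^2) g) = cubic (vy^2 + vz^2) ?g" unfolding base_change_cubic by (simp add: base_change_simps)
  have hw: "hw_rank1 (segre_coeffs (twist \<iota> ?g)) ?l ?r"
    by (rule hw_rank1_nonsplit[OF char3_ac i, where u = "\<lambda>i. to_ac (u i)" and m = "\<lambda>i. to_ac (m i)"];
        unfold to_ac_cube mult.commute[of "to_ac (m _)"]; rule ent[symmetric])
  have smooth: "smooth_bicubic (segre_coeffs (twist \<iota> ?g))"
    by (rule smooth_nonsplit[OF char3_ac i])
      (use sm in \<open>simp add: smooth_curve_def geom_locus_def zero_locus_def bc base_change_quadrics\<close>)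
  let ?b1 = "vec4 0 (- 1) \<iota> 0" and ?b2 = "vec4 0 (- 1) (- \<iota>) 0"
  have pts: "a *s vec4 1 0 0 0 + b *s ?b1 + c *s ?b2 + d *s vec4 0 0 0 1 = vec4 a (- b - c) (\<iota> * b - \<iota> * c) d" for a b c d :: "'k alg_closure"
    unfolding vec4_eq_iff by (simp add: algebra_simps)
  have pair: "x + \<iota> * y = 0 \<and> x - \<iota> * y = 0 \<longleftrightarrow> x = 0 \<and> y = 0" for x y
  proof
    assume h: "x + \<iota> * y = 0 \<and> x - \<iota> * y = 0"
    have "2 * x = (x + \<iota> * y) + (x - \<iota> * y)" by simp
    also have "\<dots> = 0" unfolding h[THEN conjunct1] h[THEN conjunct2] by simp
    finally have x: "x = 0" unfolding two by simp
    then have "\<iota> * y = 0" using h[THEN conjunct1] by simp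
    then show "x = 0 \<and> y = 0" using x inz by simp
  qed simp
  have mneg: "- ?m1 + \<iota> * ?m2 = 0 \<and> - ?m1 - \<iota> * ?m2 = 0 \<longleftrightarrow> ?m1 = 0 \<and> ?m2 = 0"
    using pair[of "- ?m1" ?m2] unfolding neg_equal_0_iff_equal .
  have uneg: "- (?u1 - \<iota> * ?u2) = 0 \<and> - (?u1 + \<iota> * ?u2) = 0 \<longleftrightarrow> ?u1 = 0 \<and> ?u2 = 0"
    using pair[of ?u1 ?u2] unfolding neg_equal_0_iff_equal by (rule trans[OF conj_commute])
  \<comment> \<open>\<open>U1\<close> and \<open>U2\<close> invert the change of frame: the image
    point has coordinates u 1 + \<iota> u 2 and u 1 - \<iota> u 2 along the two conjugate
    vectors.\<close>
  have U1: "- (?u1 + \<iota> * ?u2) - (?u1 - \<iota> * ?u2) = ?u1"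
  proof -
    have "- (?u1 + \<iota> * ?u2) - (?u1 - \<iota> * ?u2) = - (2 * ?u1)" by simp
    then show ?thesis unfolding two by simp
  qed
  have U2: "\<iota> * (?u1 + \<iota> * ?u2) - \<iota> * (?u1 - \<iota> * ?u2) = ?u2"
  proof -
    have "\<iota> * (?u1 + \<iota> * ?u2) - \<iota> * (?u1 - \<iota> * ?u2) = 2 * ((\<iota> * \<iota>) * ?u2)" by (simp add: algebra_simps)
    then show ?thesis unfolding i two by simp
  qed
  \<comment> \<open>This puts \<iota>, and with it all twisted coefficients, into the field with 9
    elements.\<close>
  have i9: "\<iota> ^ 9 = \<iota>"
  proof -
    have "\<iota> ^ 9 = \<iota> ^ (2 * 4 + 1)" by simp
    also have "\<dots> = (\<iota> ^ 2) ^ 4 * \<iota>" unfolding power_add power_mult by simp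
    also have "\<dots> = \<iota>" unfolding power2_eq_square i by simp
    finally show ?thesis .
  qed
  have R: "perfect_subfield {x :: 'k alg_closure. x ^ (3 ^ 2) = x}" by (rule perfect_subfield_frobenius_fixed[OF char3_ac])
  note ops = perfect_subfield_ops[OF R] and const = perfect_subfield_consts[OF R]
  have fx: "to_ac x \<in> {x. x ^ (3 ^ 2) = x}" for x :: 'k unfolding mem_Collect_eq by (rule frobenius_fixed_power[OF to_ac_cube])
  have fi: "\<iota> \<in> {x. x ^ (3 ^ 2) = x}" using i9 by simp
  have sub: "x - y \<in> {x. x ^ (3 ^ 2) = x}" if "x \<in> {x. x ^ (3 ^ 2) = x}" "y \<in> {x. x ^ (3 ^ 2) = x}" for x y :: "'k alg_closure"
    using ops(1)[OF that(1) ops(3)[OF that(2)]] unfolding diff_conv_add_uminus .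
  have if_mem: "(P \<Longrightarrow> x \<in> S) \<Longrightarrow> (\<not> P \<Longrightarrow> y \<in> S) \<Longrightarrow> (if P then x else y) \<in> S" for P x y and S :: "'k alg_closure set" by simp
  have tw: "twist \<iota> ?g i \<in> {x. x ^ (3 ^ 2) = x}" for i
    unfolding twist_def[OF char3_ac] by (intro if_mem ops(1,2,3) sub fx fi const)
  have cR: "segre_coeffs (twist \<iota> ?g) i j \<in> {x. x ^ (3 ^ 2) = x}" for i j
    unfolding segre_coeffs_def by (intro if_mem ops(3) tw const)
  have lR: "?l i j \<in> {x. x ^ (3 ^ 2) = x}" for i j
    unfolding split_form_def by (intro if_mem ops(1,2,3) sub fx fi const)
  show ?thesis
  \<comment> \<open>For y = - b - c and z = \<iota> (b - c) one has y^2 + z^2 = 4 b c = b c, so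
    \<open>F2\<close> becomes -(a d - b c) and \<kappa> = - 1.\<close>
  proof (rule segre_type1_points[OF card _ _ H u hw smooth, where \<kappa> = "- 1" and k = 1
        and ?b0.0 = "vec4 1 0 0 0" and ?b1.0 = ?b1 and ?b2.0 = ?b2 and ?b3.0 = "vec4 0 0 0 1"
        and ?u0.0 = "to_ac (u 0)" and ?u1.0 = "?u1 + \<iota> * ?u2" and ?u2.0 = "?u1 - \<iota> * ?u2" and ?u3.0 = "to_ac (u 3)"])
    show "homog 2 (base_change (F2 :: 'k poly4))" unfolding base_change_quadrics by (rule homog_F2[OF char3_ac])
    show "homog 3 (base_change (cubic (vy^2 + vz^2) g))" unfolding bc by (rule homog_cubic2)
    show "\<exists>s t u v. bilin ?l s t u v \<noteq> 0"
    proof (rule split_form_nonzero, rule notI)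
      assume "(to_ac (m 0), - ?m1 + \<iota> * ?m2, - ?m1 - \<iota> * ?m2, to_ac (m 3)) = (0, 0, 0, 0)"
      then have z: "to_ac (m 0) = 0" "- ?m1 + \<iota> * ?m2 = 0 \<and> - ?m1 - \<iota> * ?m2 = 0" "to_ac (m 3) = 0"
        unfolding prod.inject by blast+
      show False using m z(1,3) z(2)[unfolded mneg] unfolding nonzero_entry by simp
    qed
    show "\<exists>s t ua v. bilin ?r s t ua v \<noteq> 0"
    proof (rule split_form_nonzero, rule notI)
      assume "(to_ac (u 3), - (?u1 - \<iota> * ?u2), - (?u1 + \<iota> * ?u2), to_ac (u 0)) = (0, 0, 0, 0)"
      then have z: "to_ac (u 3) = 0" "- (?u1 - \<iota> * ?u2) = 0 \<and> - (?u1 + \<iota> * ?u2) = 0" "to_ac (u 0) = 0"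
        unfolding prod.inject by blast+
      show False using u z(1,3) z(2)[unfolded uneg] unfolding nonzero_entry by simp
    qed
    show "eval4 (a *s vec4 1 0 0 0 + b *s ?b1 + c *s ?b2 + d *s vec4 0 0 0 1) (base_change (F2 :: 'k poly4)) = - 1 * (a * d - b * c)" for a b c d
      unfolding pts base_change_quadrics eval4_quadrics[OF char3_ac] vec4_nth
      by (simp add: algebra_simps power2_eq_square i i' char3_ac numerals_char3[OF char3_ac])
    show "eval4 ((s * u) *s vec4 1 0 0 0 + (s * v) *s ?b1 + (t * u) *s ?b2 + (t * v) *s vec4 0 0 0 1) (base_change (cubic (vy^2 + vz^2) g))
      = bicubic (segre_coeffs (twist \<iota> ?g)) s t u v" for s t u v
      unfolding pts bc cubic_segre_nonsplit[OF char3_ac i] ..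
    show "eval4 (a *s vec4 1 0 0 0 + b *s ?b1 + c *s ?b2 + d *s vec4 0 0 0 1) (linform (\<chi> j. to_ac (m j)))
      = ?l 1 1 * a + ?l 1 0 * b + ?l 0 1 * c + ?l 0 0 * d" for a b c d
      unfolding pts split_form_simps linform_def eval4_simps eval4_cst eval4_var sum_UNIV_4 vec4_nth by (simp add: algebra_simps)
    show "(\<chi> i. to_ac (u i)) = to_ac (u 0) *s vec4 1 0 0 0 + (?u1 + \<iota> * ?u2) *s ?b1 + (?u1 - \<iota> * ?u2) *s ?b2 + to_ac (u 3) *s vec4 0 0 0 1"
      unfolding pts vec4_eq_iff by (simp only: vec4_nth vec_lambda_beta U1 U2 simp_thms)
    show "(to_ac (u 0), ?u1 + \<iota> * ?u2, ?u1 - \<iota> * ?u2, to_ac (u 3)) \<noteq> (0, 0, 0, 0)"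
    proof
      assume "(to_ac (u 0), ?u1 + \<iota> * ?u2, ?u1 - \<iota> * ?u2, to_ac (u 3)) = (0, 0, 0, 0)"
      then have z: "to_ac (u 0) = 0" "?u1 + \<iota> * ?u2 = 0 \<and> ?u1 - \<iota> * ?u2 = 0" "to_ac (u 3) = 0"
        unfolding prod.inject by blast+
      show False using u z(1,3) z(2)[unfolded pair] unfolding nonzero_entry by simp
    qed
    show "segre_coeffs (twist \<iota> ?g) i j ^ (3 ^ 2) = segre_coeffs (twist \<iota> ?g) i j" "?l i j ^ (3 ^ 2) = ?l i j" for i j
      by (rule cR[unfolded mem_Collect_eq], rule lR[unfolded mem_Collect_eq])
    show "(vec4 1 0 0 0 $ i :: 'k alg_closure) ^ (3 ^ 2) = vec4 1 0 0 0 $ i" "(?b1 $ i) ^ (3 ^ 2) = ?b1 $ i"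
      "(?b2 $ i) ^ (3 ^ 2) = ?b2 $ i" "(vec4 0 0 0 1 $ i :: 'k alg_closure) ^ (3 ^ 2) = vec4 0 0 0 1 $ i" for i
      using i9 by (simp_all add: vec4_def power_minus_odd)
  qed (simp_all add: split_form_simps)
qed

end

section \<open>The quadric cone\<close>

lemma base_change_cubicD: "base_change (cubicD g) = cubicD (\<lambda>i. to_ac (g i))"
  unfolding cubicD_def by (simp add: base_change_simps)

lemma eval4_cubicD:
  "eval4 P (cubicD g) = g 0 * vec_nth P 0 ^ 3
    + (g 1 * vec_nth P 1 ^ 2 + g 2 * vec_nth P 2 ^ 2 + g 3 * vec_nth P 3 ^ 2 + g 4 * vec_nth P 1 * vec_nth P 2 + g 5 * vec_nth P 2 * vec_nth P 3) * vec_nth P 0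
    + g 6 * vec_nth P 1 ^ 3 + g 7 * vec_nth P 2 ^ 3 + g 8 * vec_nth P 3 ^ 3 + g 9 * vec_nth P 1 * vec_nth P 2 ^ 2
    + g 10 * vec_nth P 2 ^ 2 * vec_nth P 3 + g 11 * vec_nth P 2 * vec_nth P 3 ^ 2"
  unfolding cubicD_def by (simp add: eval4_simps)

context
  assumes char3: "(3 :: 'a::field) = 0"
begin

lemma gradient_cubicD:
  fixes g :: "nat \<Rightarrow> 'a"
  assumes g2: "g 2 = 0"
  shows "gradient (cubicD g) (vec4 x y z w) = vec4 (g 1 * y * y + g 3 * w * w + g 4 * y * z + g 5 * z * w)
    (- (g 1 * y * x) + g 4 * z * x + g 9 * z * z)
    (g 4 * y * x + g 5 * w * x - g 9 * y * z - g 10 * z * w + g 11 * w * w)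
    (- (g 3 * w * x) + g 5 * z * x + g 10 * z * z - g 11 * z * w)"
  unfolding vec4_eq_iff gradient_def cubicD_def
  by (simp_all add: deriv_simps[OF char3] g2 power2_eq_square char3 numerals_char3(1)[OF char3] algebra_simps)

text \<open>The vector projects to the point (Y : W) = (r : -p) of the conic y = Y^2, z = Y W, w =
  W^2, the zero of p Y + r W. The derivative by x is a quartic with this factor; the relations for c
  make the other derivatives vanish.\<close>

lemma gradient_cubicD_zero:
  fixes g :: "nat \<Rightarrow> 'a"
  assumes g: "g 2 = 0" "g 1 = p * m" "g 4 = r * m" "g 5 = p * n" "g 3 = r * n"
    and m: "m = 1 \<or> m = 0 \<and> n = 1"
    and c: "c * m * m = - (g 1 * g 9)" "- (c * m * n) = - (g 1 * g 11) - (g 4 * g 10) - (g 5 * g 9)" "c * n * n = - (g 3 * g 10) - (g 5 * g 11)"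
  shows "gradient (cubicD g) (vec4 c (r * r) (- (p * r)) (p * p)) = 0"
  using m
proof
  assume m1: "m = 1"
  have c1: "c = - (p * g 9)" using c(1) unfolding g m1 by simp
  \<comment> \<open>The second relation for c, after inserting c = - p g 9; the two expressions
    differ by a multiple of 3.\<close>
  have rg: "r * g 10 = n * p * g 9 - p * g 11"
  proof -
    have "r * g 10 = c * n - p * g 11 - p * n * g 9" using c(2) unfolding g m1 by (simp add: algebra_simps)
    also have "\<dots> = n * p * g 9 - p * g 11 - 3 * (n * p * g 9)" unfolding c1 by (simp add: algebra_simps)
    finally show ?thesis unfolding char3 by simp
  qed
  have rg': "r * (g 10 * x) = (n * p * g 9 - p * g 11) * x" for x unfolding mult.assoc[symmetric] rg ..
  show ?thesis unfolding gradient_cubicD[where g = g, OF g(1)] vec4_eq_iff vec4_nth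
    by (simp add: g m1 c1 rg rg' algebra_simps char3 numerals_char3(1)[OF char3])
next
  assume "m = 0 \<and> n = 1"
  then have mn: "m = 0" "n = 1" by simp_all
  have c3: "r * g 10 + p * g 11 = - c" using c(3) unfolding g mn by simp
  have pg: "p * g 9 = 0" using c(2) unfolding g mn by simp
  have "g 9 * - (p * r) * - (p * r) = (p * g 9) * (p * r * r)" by (simp add: algebra_simps)
  then have comp1: "g 9 * - (p * r) * - (p * r) = 0" unfolding pg by simp
  have "p * (p * p) * c - g 9 * (r * r) * - (p * r) - g 10 * - (p * r) * (p * p) + g 11 * (p * p) * (p * p)
    = (p * g 9) * (r * r * r) + p * p * p * (c + (r * g 10 + p * g 11))" by (simp add: algebra_simps)
  then have comp2: "p * (p * p) * c - g 9 * (r * r) * - (p * r) - g 10 * - (p * r) * (p * p) + g 11 * (p * p) * (p * p) = 0"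
    unfolding pg c3 by simp
  have "- (r * (p * p) * c) + p * - (p * r) * c + g 10 * - (p * r) * - (p * r) - g 11 * - (p * r) * (p * p)
    = p * p * r * (r * g 10 + p * g 11) - 2 * (p * p * r * c)" by (simp add: algebra_simps)
  also have "\<dots> = - (3 * (p * p * r * c))" unfolding c3 by simp
  also have "\<dots> = 0" unfolding char3 by simp
  finally have comp3: "- (r * (p * p) * c) + p * - (p * r) * c + g 10 * - (p * r) * - (p * r) - g 11 * - (p * r) * (p * p) = 0" .
  have comp0: "r * (p * p) * (p * p) + p * - (p * r) * (p * p) = 0" by (simp add: algebra_simps)
  show ?thesis unfolding gradient_cubicD[where g = g, OF g(1)] vec4_eq_iff vec4_nth
    unfolding g mn mult_zero_left mult_zero_right mult_1_right add_0_left minus_zero zero_index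
    using comp0 comp1 comp2 comp3 by simp
qed

text \<open>On the conic the coefficient of x is g_1 Y^4 + g_4 Y^3 W + g_2 Y^2 W^2 + g_5 Y W^3 + g_3
  W^4. Rank one forces g_2 = 0 and the factorization (p Y + r W)(m Y^3 + n W^3), the analogue of a
  cube times a linear form; c is the remaining coordinate of the image vector.\<close>

lemma cone_rank1_parameters:
  fixes g :: "nat \<Rightarrow> 'a" and u w :: "4 \<Rightarrow> 'a"
  assumes g0: "g 0 \<noteq> 0" and u: "\<exists>i. u i \<noteq> 0" and w: "\<exists>j. w j \<noteq> 0"
    and H: "u 0 * w 0 = - (g 0 * g 2)"
  "u 0 * w 1 = - (g 1 * g 9) - (g 2 * g 6)"
  "u 0 * w 2 = - (g 1 * g 11) - (g 2 * g 7) - (g 4 * g 10) - (g 5 * g 9)"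
  "u 0 * w 3 = - (g 2 * g 8) - (g 3 * g 10) - (g 5 * g 11)"
  "u 1 * w 0 = 0"
  "u 1 * w 1 = g 4^2 - (g 1 * g 2)"
  "u 1 * w 2 = - (g 2 * g 5) - (g 3 * g 4)"
  "u 1 * w 3 = g 3^2"
  "u 2 * w 0 = 0"
  "u 2 * w 1 = - (g 1 * g 4)"
  "u 2 * w 2 = g 2^2 - (g 1 * g 3) - (g 4 * g 5)"
  "u 2 * w 3 = - (g 3 * g 5)"
  "u 3 * w 0 = 0"
  "u 3 * w 1 = g 1^2"
  "u 3 * w 2 = - (g 1 * g 5) - (g 2 * g 4)"
  "u 3 * w 3 = g 5^2 - (g 2 * g 3)"
  obtains p r m n c where "g 2 = 0" "g 1 = p * m" "g 4 = r * m" "g 5 = p * n" "g 3 = r * n"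
    "m = 1 \<or> m = 0 \<and> n = 1" "(p, r) \<noteq> (0, 0)"
    "c * m * m = - (g 1 * g 9)" "- (c * m * n) = - (g 1 * g 11) - (g 4 * g 10) - (g 5 * g 9)" "c * n * n = - (g 3 * g 10) - (g 5 * g 11)"
proof -
  have minor: "(u i * w j) * (u k * w l) = (u i * w l) * (u k * w j)" for i j k l by (simp add: algebra_simps)
  \<comment> \<open>If \<open>g 2\<close> were nonzero, the top left entry would be too, so rank one
    and the zeros below it would annihilate the other rows; the diagonal entry of row 2 would then
    give g_2^2 = 0.\<close>
  have g2: "g 2 = 0"
  proof (rule ccontr)
    assume g2: "g 2 \<noteq> 0"
    then have "w 0 \<noteq> 0" using H(1) g0 by auto
    then have z: "u 1 = 0" "u 2 = 0" "u 3 = 0" using H(5,9,13) by simp_all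
    have "g 3 = 0" "g 1 = 0" using H(8,14) unfolding z by simp_all
    moreover from this have "g 4 = 0" using H(6) unfolding z by simp
    ultimately show False using H(11) g2 unfolding z by simp
  qed
  note H' = H[unfolded g2 power2_eq_square mult_zero_left mult_zero_right diff_zero minus_zero add_0_left diff_0]
  have m3: "g 3 * g 3 * (g 1 * g 3 - g 4 * g 5) = 0"
  proof -
    have "g 3 * g 3 * (g 1 * g 3 - g 4 * g 5) = - (g 3 * g 3 * (- (g 1 * g 3) - (g 4 * g 5))) + - (g 3 * g 4) * - (g 3 * g 5) - 3 * (g 3 * g 3 * (g 4 * g 5))"
      by (simp add: algebra_simps)
    also have "\<dots> = 0" using minor[of 1 3 2 2] unfolding H' char3 by (simp only: mult_zero_left diff_zero left_minus)
    finally show ?thesis .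
  qed
  have m1: "g 1 * g 1 * (g 1 * g 3 - g 4 * g 5) = 0"
  proof -
    have "g 1 * g 1 * (g 1 * g 3 - g 4 * g 5) = - (g 1 * g 1 * (- (g 1 * g 3) - (g 4 * g 5))) + - (g 1 * g 5) * - (g 1 * g 4) - 3 * (g 1 * g 1 * (g 4 * g 5))"
      by (simp add: algebra_simps)
    also have "\<dots> = 0" using minor[of 3 1 2 2] unfolding H' char3 by (simp only: mult_zero_left diff_zero left_minus)
    finally show ?thesis .
  qed
  \<comment> \<open>The condition for the quartic to factor. The minors give it multiplied by g_1^2
    or g_3^2; if both vanish, the corner minor gives g_4 g_5 = 0.\<close>
  have prod: "g 1 * g 3 = g 4 * g 5"
  proof (cases "g 1 = 0 \<and> g 3 = 0")
    case True
    then have "g 4 * g 4 * (g 5 * g 5) = 0" using minor[of 1 1 3 3] unfolding H' by simp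
    then show ?thesis using True by auto
  next
    case False
    then show ?thesis using m1 m3 by auto
  qed
  define E2 E3 where "E2 = - (g 1 * g 11) - (g 4 * g 10) - (g 5 * g 9)" and "E3 = - (g 3 * g 10) - (g 5 * g 11)"
  have r1: "- (g 1 * g 9) * - (g 3 * g 4) = E2 * (g 4 * g 4)" using minor[of 0 1 1 2] unfolding H' E2_def .
  have r2: "- (g 1 * g 9) * - (g 1 * g 5) = E2 * (g 1 * g 1)" using minor[of 0 1 3 2] unfolding H' E2_def .
  have r3: "- (g 1 * g 9) * (g 3 * g 3) = E3 * (g 4 * g 4)" using minor[of 0 1 1 3] unfolding H' E3_def .
  have r4: "- (g 1 * g 9) * (g 5 * g 5) = E3 * (g 1 * g 1)" using minor[of 0 1 3 3] unfolding H' E3_def .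
  have r5: "E2 * (g 5 * g 5) = E3 * - (g 1 * g 5)" using minor[of 0 2 3 3] unfolding H' E2_def E3_def .
  show thesis
  proof (cases "g 1 = 0 \<and> g 4 = 0")
    case True
    then have z: "g 1 = 0" "g 4 = 0" by simp_all
    have pr: "(g 5, g 3) \<noteq> (0, 0)"
    proof
      assume "(g 5, g 3) = (0, 0)"
      then have z': "g 5 = 0" "g 3 = 0" by simp_all
      have "\<forall>i j. u i * w j = 0" unfolding all_4 H' z z' by simp
      moreover obtain i j where "u i \<noteq> 0" "w j \<noteq> 0" using u w by blast
      ultimately show False by (metis mult_eq_0_iff)
    qed
    have e2: "E2 = 0"
    proof (cases "g 5 = 0")
      case True
      then show ?thesis unfolding E2_def z by simp
    next
      case False
      have "E2 * (g 5 * g 5) = 0" unfolding r5 z by simp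
      then show ?thesis using False by simp
    qed
    show thesis
    proof (rule that[of "g 5" 0 "g 3" 1 E3])
      show "- (E3 * 0 * 1) = - (g 1 * g 11) - (g 4 * g 10) - (g 5 * g 9)" unfolding E2_def[symmetric] e2 by simp
      show "E3 * 1 * 1 = - (g 3 * g 10) - (g 5 * g 11)" unfolding E3_def by simp
      show "(g 5, g 3) \<noteq> (0, 0)" by (rule pr)
    qed (simp_all add: z g2)
  next
    case False
    \<comment> \<open>With m normalized to 1, n is the ratio of the coefficients of Y W^3 and Y^4,
      or of W^4 and Y^3 W when the former denominator is 0.\<close>
    define n where "n = (if g 1 = 0 then g 3 / g 4 else g 5 / g 1)"
    have g5: "g 5 = g 1 * n"
    proof (cases "g 1 = 0")
      case True
      then have "g 4 * g 5 = 0" "g 4 \<noteq> 0" using prod False by simp_all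
      then show ?thesis using True by simp
    next
      case g1: False
      then show ?thesis unfolding n_def by simp
    qed
    have g3: "g 3 = g 4 * n"
    proof (cases "g 1 = 0")
      case True
      then show ?thesis using False unfolding n_def by simp
    next
      case g1: False
      then show ?thesis using prod unfolding n_def by (simp add: nonzero_eq_divide_eq mult.commute)
    qed
    have e2: "g 1 * g 9 * n = E2"
    proof (cases "g 4 = 0")
      case True
      then have g1: "g 1 * g 1 \<noteq> 0" using False by simp
      have "(g 1 * g 9 * n) * (g 1 * g 1) = E2 * (g 1 * g 1)"
        using r2 unfolding g5 by (simp only: minus_mult_minus mult_ac)
      then show ?thesis unfolding mult_right_cancel[OF g1] .
    next
      case g4: False
      then have g4: "g 4 * g 4 \<noteq> 0" by simp
      have "(g 1 * g 9 * n) * (g 4 * g 4) = E2 * (g 4 * g 4)"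
        using r1 unfolding g3 by (simp only: minus_mult_minus mult_ac)
      then show ?thesis unfolding mult_right_cancel[OF g4] .
    qed
    have e3: "- (g 1 * g 9) * n * n = E3"
    proof (cases "g 4 = 0")
      case True
      then have g1: "g 1 * g 1 \<noteq> 0" using False by simp
      have "(- (g 1 * g 9) * n * n) * (g 1 * g 1) = E3 * (g 1 * g 1)"
        using r4 unfolding g5 by (simp only: mult_minus_left mult_ac)
      then show ?thesis unfolding mult_right_cancel[OF g1] .
    next
      case g4: False
      then have g4: "g 4 * g 4 \<noteq> 0" by simp
      have "(- (g 1 * g 9) * n * n) * (g 4 * g 4) = E3 * (g 4 * g 4)"
        using r3 unfolding g3 by (simp only: mult_minus_left mult_ac)
      then show ?thesis unfolding mult_right_cancel[OF g4] .
    qed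
    show thesis
    proof (rule that[of "g 1" 1 "g 4" n "- (g 1 * g 9)"])
      show "- (- (g 1 * g 9) * 1 * n) = - (g 1 * g 11) - (g 4 * g 10) - (g 5 * g 9)"
        unfolding E2_def[symmetric] e2[symmetric] by simp
      show "- (g 1 * g 9) * n * n = - (g 3 * g 10) - (g 5 * g 11)" unfolding E3_def[symmetric] by (rule e3)
      show "g 5 = g 1 * n" "g 3 = g 4 * n" by (rule g5, rule g3)
      show "(g 1, g 4) \<noteq> (0, 0)" using False by simp
    qed (simp_all add: g2)
  qed
qed

end

lemma cone_case:
  fixes H :: "'k::field ^ 4 ^ 4" and g :: "nat \<Rightarrow> 'k"
  assumes card: "CARD('k) = 3" and g0: "g 0 \<noteq> 0" and a: "a_number H = 3"
    and sm: "smooth_curve Fd (cubicD g)" and hwm: "is_hasse_witt_matrix Fd (cubicD g) H"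
  shows "type2_points Fd (cubicD g) H = {} \<and> card (type1_points Fd (cubicD g) H) = 1 \<and>
   (\<forall>P\<in>type1_points Fd (cubicD g) H. has_multiplicity Fd (cubicD g) H P 6)"
proof -
  have char3: "(3 :: 'k) = 0" and char3': "(3 :: 'k alg_closure) = 0"
proof -
  show c: "(3 :: 'k) = 0" by (rule char3_of_card[OF card])
  have "(3 :: 'k alg_closure) = to_ac (3 :: 'k)" by simp
  also have "\<dots> = 0" unfolding c by simp
  finally show "(3 :: 'k alg_closure) = 0" .
qed
  have two: "(2 :: 'k alg_closure) = - 1" by (rule numerals_char3[OF char3'])
  obtain u0 w0 where H0: "\<And>i j. H $ i $ j = u0 i * w0 j" and u0: "\<exists>i. u0 i \<noteq> 0" and w0: "\<exists>j. w0 j \<noteq> 0"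
    by (rule rank_one_factor[OF a]) (rule that; assumption)
  note ent = hasse_witt_cone[OF char3 g0 hwm]
  obtain p r m n c where par: "g 2 = 0" "g 1 = p * m" "g 4 = r * m" "g 5 = p * n" "g 3 = r * n"
    "m = 1 \<or> m = 0 \<and> n = 1" "(p, r) \<noteq> (0, 0)"
    and cc: "c * m * m = - (g 1 * g 9)" "- (c * m * n) = - (g 1 * g 11) - (g 4 * g 10) - (g 5 * g 9)" "c * n * n = - (g 3 * g 10) - (g 5 * g 11)"
    by (rule cone_rank1_parameters[OF char3 g0 u0 w0 ent[unfolded H0]]) (rule that; assumption)
  \<comment> \<open>The image vector lies over the zero of p Y + r W. The covector w restricts to
    the conic as (m Y + n W)^2 because -1 = 2, so its plane touches the cone along the line m Y + n
    W = 0.\<close>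
  define u where "u = vec_nth (vec4 c (r * r) (- (p * r)) (p * p))"
  define w where "w = vec_nth (vec4 0 (m * m) (- (m * n)) (n * n))"
  have "\<forall>i j. H $ i $ j = u i * w j"
    unfolding all_4 ent u_def w_def vec4_nth using cc
    by (simp add: par(1-5) power2_eq_square algebra_simps char3 numerals_char3(1)[OF char3])
  then have H: "\<And>i j. H $ i $ j = u i * w j" by blast
  have u: "\<exists>i. u i \<noteq> 0" unfolding nonzero_entry u_def vec4_nth using par(7) by auto
  let ?g = "\<lambda>i. to_ac (g i)" and ?L = "linform (\<chi> j. to_ac (w j))" and ?n = "to_ac n"
  have bc: "base_change (cubicD g) = cubicD ?g" by (rule base_change_cubicD)
  have F2: "homog 2 (base_change (Fd :: 'k poly4))" unfolding base_change_quadrics by (rule homog_Fd[OF char3'])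
  have G3: "homog 3 (base_change (cubicD g))" unfolding bc by (rule homog_cubicD)
  have image: "(\<chi> i. to_ac (u i)) = vec4 (to_ac c) (to_ac r * to_ac r) (- (to_ac p * to_ac r)) (to_ac p * to_ac p)"
    unfolding vec4_eq_iff u_def by simp
  have parK: "?g 2 = 0" "?g 1 = to_ac p * to_ac m" "?g 4 = to_ac r * to_ac m" "?g 5 = to_ac p * to_ac n" "?g 3 = to_ac r * to_ac n"
    "to_ac m = 1 \<or> to_ac m = 0 \<and> to_ac n = 1"
    using par by auto
  note ccK = cc[THEN arg_cong[where f = to_ac], unfolded to_ac_diff to_ac_mult to_ac_minus]
  \<comment> \<open>The gradient of G vanishes at the image vector, so lying on the curve would make
    it a singular point.\<close>
  have off: "\<not> (eval4 (\<chi> i. to_ac (u i)) (base_change Fd) = 0 \<and> eval4 (\<chi> i. to_ac (u i)) (base_change (cubicD g)) = 0)"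
  proof
    assume z: "eval4 (\<chi> i. to_ac (u i)) (base_change Fd) = 0 \<and> eval4 (\<chi> i. to_ac (u i)) (base_change (cubicD g)) = 0"
    have "(\<chi> i. to_ac (u i)) \<noteq> 0" using u by (simp add: vec_eq_iff)
    then have "(\<chi> i. to_ac (u i)) \<in> geom_locus Fd (cubicD g)" using z unfolding geom_locus_def zero_locus_def by simp
    then have rk: "rank (vector [gradient (base_change Fd) (\<chi> i. to_ac (u i)), gradient (base_change (cubicD g)) (\<chi> i. to_ac (u i))]
       :: 'k alg_closure ^ 4 ^ 2) = 2" using sm unfolding smooth_curve_def by blast
    have "gradient (base_change (cubicD g)) (\<chi> i. to_ac (u i)) = 0"
      unfolding image bc by (rule gradient_cubicD_zero[OF char3' parK ccK])
    then have "gradient (base_change (cubicD g)) (\<chi> i. to_ac (u i)) = 0 *s gradient (base_change Fd) (\<chi> i. to_ac (u i))" by simp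
    moreover have "gradient (base_change Fd) (\<chi> i. to_ac (u i)) = 1 *s gradient (base_change Fd) (\<chi> i. to_ac (u i))" by simp
    ultimately show False using rank_proportional_rows rk by blast
  qed
  note types = cartier_points_rank1[OF card F2 G3 H u off]
  \<comment> \<open>E is the vertex and C lies over the zero (-n : 1), or (1 : 0) if m = 0, of m Y +
    n W. A and B complete them to a frame with F = b^2 - a c.\<close>
  define A where "A = (if m = 0 then vec4 0 0 0 1 else vec4 0 1 0 0 :: 'k alg_closure ^ 4)"
  define B where "B = (if m = 0 then vec4 0 0 1 0 else vec4 0 ?n 1 0)"
  define C where "C = (if m = 0 then vec4 0 1 0 0 else vec4 0 (?n * ?n) (- ?n) 1)"
  define E where "E = (vec4 1 0 0 0 :: 'k alg_closure ^ 4)"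
  have comb: "a *s A + b *s B + c *s C + d *s E
    = (if m = 0 then vec4 d c b a else vec4 d (a + b * ?n + c * (?n * ?n)) (b - c * ?n) c)" for a b c d
    unfolding A_def B_def C_def E_def vec4_eq_iff by simp
  have F: "eval4 (a *s A + b *s B + c *s C + d *s E) (base_change (Fd :: 'k poly4)) = b^2 - a * c" for a b c d
    unfolding comb base_change_quadrics eval4_quadrics[OF char3']
    by (simp add: power2_eq_square algebra_simps char3' numerals_char3(1)[OF char3'])
  have L: "eval4 (a *s A + b *s B + c *s C + d *s E) ?L = a" for a b c d
  proof -
    have ev: "eval4 v ?L = to_ac m * to_ac m * vec_nth v 1 - to_ac m * ?n * vec_nth v 2 + ?n * ?n * vec_nth v 3" for v
      unfolding linform_def eval4_simps eval4_cst eval4_var sum_UNIV_4 w_def by simp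
    show ?thesis
    proof (cases "m = 0")
      case True
      then have "?n = 1" using parK(6) by auto
      then show ?thesis unfolding comb ev using True by simp
    next
      case False
      then have m1: "to_ac m = 1" using parK(6) by auto
      show ?thesis unfolding comb ev using False
        by (simp add: m1 algebra_simps char3' numerals_char3(1)[OF char3'])
    qed
  qed
  \<comment> \<open>Since n lies in the field with 3 elements, the factor m Y^3 + n W^3 also
    vanishes at (-n : 1). This removes the terms linear in x from G on the line of tangency, leaving
    a sum of two cubes.\<close>
  have n3: "?n * (?n * ?n) = ?n"
  proof -
    have "?n * (?n * ?n) = to_ac (n ^ 3)" by (simp add: power3_eq_cube mult.assoc)
    then show ?thesis unfolding char3_of_card(2)[OF card] .
  qed
  have n3': "?n * (?n * (?n * x)) = ?n * x" for x
  proof -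
    have "?n * (?n * (?n * x)) = (?n * (?n * ?n)) * x" by (simp only: mult.assoc)
    then show ?thesis unfolding n3 .
  qed
  define e where "e = eval4 C (base_change (cubicD g))"
  have line: "eval4 (c *s C + d *s E) (base_change (cubicD g)) = ?g 0 * d ^ 3 + e * c ^ 3" for c d
  proof -
    have v: "c *s C + d *s E = (if m = 0 then vec4 d c 0 0 else vec4 d (c * (?n * ?n)) (- (c * ?n)) c)"
      unfolding C_def E_def vec4_eq_iff by simp
    have C: "C = (if m = 0 then vec4 0 1 0 0 else vec4 0 (?n * ?n) (- ?n) 1)" by (rule C_def)
    show ?thesis
    proof (cases "m = 0")
      case True
      then have "?g 1 = 0" using parK(2) by simp
      then show ?thesis using True unfolding v unfolding e_def bc C by (simp add: eval4_cubicD)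
    next
      case False
      then have m1: "to_ac m = 1" using parK(6) by auto
      show ?thesis using False unfolding v unfolding e_def bc C
        by (simp add: eval4_cubicD parK(1-5) m1 algebra_simps power2_eq_square power3_eq_cube n3 n3')
    qed
  qed
  have g0': "?g 0 \<noteq> 0" using g0 by simp
  obtain \<beta> where \<beta>: "\<beta> ^ 3 = e / ?g 0" using nth_root_exists[of 3 "e / ?g 0"] by auto
  have G: "eval4 (c *s C + d *s E) (base_change (cubicD g)) = ?g 0 * (d + \<beta> * c) ^ 3" for c d
    unfolding line add_cube_char3[OF char3'] power_mult_distrib \<beta> using g0' by (simp add: distrib_left)
  have span: "\<exists>a b c d. v = a *s A + b *s B + c *s C + d *s E" for v
  proof (cases "m = 0")
    case True
    then show ?thesis unfolding comb vec4_eq_iff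
      by (intro exI[of _ "vec_nth v 3"] exI[of _ "vec_nth v 2"] exI[of _ "vec_nth v 1"] exI[of _ "vec_nth v 0"]) simp
  next
    case False
    then show ?thesis unfolding comb vec4_eq_iff
      by (intro exI[of _ "vec_nth v 1 - (vec_nth v 2 + vec_nth v 3 * ?n) * ?n - vec_nth v 3 * (?n * ?n)"]
          exI[of _ "vec_nth v 2 + vec_nth v 3 * ?n"] exI[of _ "vec_nth v 3"] exI[of _ "vec_nth v 0"]) simp
  qed
  note inf = infinite_alg_closed_field[where 'a = "'k alg_closure"]
  have t1: "type1_points Fd (cubicD g) H = {proj_point (C - \<beta> *s E)}"
  proof -
    have "{v. v \<noteq> 0 \<and> eval4 v (base_change Fd) = 0 \<and> eval4 v (base_change (cubicD g)) = 0 \<and> eval4 v ?L = 0}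
      = proj_point (C - \<beta> *s E) \<union> proj_point (C - \<beta> *s E)"
      unfolding Un_absorb by (rule cone_section_point[OF inf F L G g0' span])
    from proj_point_image[OF this] show ?thesis unfolding types(2) by (simp only: insert_absorb2)
  qed
  have "has_multiplicity Fd (cubicD g) H (proj_point (C - \<beta> *s E)) 6"
    unfolding has_multiplicity_rank1[OF card F2 G3 H u] by (rule cone_section_multiplicity[OF inf F L G g0' span G3])
  then show ?thesis using types(1) unfolding t1 by simp
qed

section \<open>Reduction of the standard forms to the three families\<close>

lemma quadrics_distinct:
  assumes char3: "(3 :: 'a::field) = 0"
  shows "(F1 :: 'a poly4) \<noteq> F2" "(F1 :: 'a poly4) \<noteq> Fd" "(F2 :: 'a poly4) \<noteq> Fd"
proof -
  let ?P = "vec4 0 1 0 0 :: 'a ^ 4" and ?Q = "vec4 1 0 0 1 :: 'a ^ 4"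
  have "eval4 ?P (F1 :: 'a poly4) \<noteq> eval4 ?P F2" "eval4 ?Q (F1 :: 'a poly4) \<noteq> eval4 ?Q Fd" "eval4 ?P (F2 :: 'a poly4) \<noteq> eval4 ?P Fd"
    unfolding eval4_quadrics[OF char3] vec4_nth by simp_all
  then show "(F1 :: 'a poly4) \<noteq> F2" "(F1 :: 'a poly4) \<noteq> Fd" "(F2 :: 'a poly4) \<noteq> Fd" by metis+
qed

lemma case_D_cubicD:
  assumes "case_D F G"
  obtains g where "F = Fd" "G = cubicD g" "g 0 \<noteq> 0"
proof -
  obtain a0 a1 a2 a3 a4 a5 a6 a7 a8 a9 b1 b2 r where F: "F = Fd" and a0: "a0 \<noteq> 0"
    and r: "r = cst a1 * vy^2 + cst a2 * vz^2 + cst a3 * vw^2 + cst a4 * vy * vz + cst a5 * vz * vw"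
    and G: "G = cst a0 * vx^3 + r * vx
          + cst a6 * vy^3 + cst a7 * vz^3 + cst a8 * vw^3 + cst a9 * vy * vz^2
          + cst b1 * vz^2 * vw + cst b2 * vz * vw^2"
    using assms unfolding case_D_def by (elim conjE exE) (rule that; assumption)
  define g where "g = (\<lambda>i::nat. if i = 0 then a0 else if i = 1 then a1 else if i = 2 then a2 else if i = 3 then a3 else if i = 4 then a4
    else if i = 5 then a5 else if i = 6 then a6 else if i = 7 then a7 else if i = 8 then a8 else if i = 9 then a9 else if i = 10 then b1 else b2)"
  show thesis
    by (rule that[OF F, of g]) (simp_all add: G r cubicD_def g_def a0)
qed

definition coeff13 :: "'a \<Rightarrow> 'a \<Rightarrow> 'a \<Rightarrow> 'a \<Rightarrow> 'a \<Rightarrow> 'a \<Rightarrow> 'a \<Rightarrow> 'a \<Rightarrow> 'a \<Rightarrow> 'a \<Rightarrow> 'a \<Rightarrow> 'a \<Rightarrow> 'a \<Rightarrow> nat \<Rightarrow> 'a" where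
  "coeff13 a1 a2 a3 a4 a5 a6 a7 a8 a9 a10 a11 a12 a13 i = (if i = 1 then a1 else if i = 2 then a2 else if i = 3 then a3 else if i = 4 then a4
    else if i = 5 then a5 else if i = 6 then a6 else if i = 7 then a7 else if i = 8 then a8 else if i = 9 then a9 else if i = 10 then a10
    else if i = 11 then a11 else if i = 12 then a12 else a13)"

lemma case_N1i_cubic:
  assumes "case_N1i F G"
  obtains g where "F = F1" "G = cubic (vy * vz) g" "g 1 \<noteq> 0 \<or> g 2 \<noteq> 0"
proof -
  obtain a1 a2 a3 a4 a5 a6 a7 a8 a9 a10 b1 b2 where F: "F = F1" and a1: "a1 \<noteq> 0"
    and G: "G = (cst a1 * vy + cst a2 * vz) * vx^2 + cst a3 * vy * vz * vx
          + vy^3 + cst a4 * vz^3 + cst b1 * vy^2 * vz + cst a5 * vy * vz^2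
          + (cst a6 * vy^2 + cst a7 * vy * vz + cst b2 * vz^2) * vw
          + (cst a8 * vy + cst a9 * vz) * vw^2 + cst a10 * vw^3"
    using assms unfolding case_N1i_def by (elim conjE exE) (rule that; assumption)
  show thesis
    by (rule that[OF F, of "coeff13 a1 a2 a3 1 a4 b1 a5 a6 a7 b2 a8 a9 a10"])
      (simp_all add: G cubic_def coeff13_def a1 algebra_simps)
qed

lemma case_N1ii_cubic:
  assumes "case_N1ii F G"
  obtains g where "F = F1" "G = cubic (vy * vz) g" "g 1 \<noteq> 0 \<or> g 2 \<noteq> 0"
proof -
  obtain a1 a2 a3 a4 a5 a6 a7 a8 b1 b2 b3 where F: "F = F1" and a1: "a1 * a2 \<noteq> 0"
    and G: "G = (cst a1 * vy + cst a2 * vz) * vx^2 + cst a3 * vy * vz * vx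
          + cst b1 * vy^2 * vz + cst b2 * vy * vz^2
          + (cst a4 * vy^2 + cst a5 * vy * vz + cst b3 * vz^2) * vw
          + (cst a6 * vy + cst a7 * vz) * vw^2 + cst a8 * vw^3"
    using assms unfolding case_N1ii_def by (elim conjE exE) (rule that; assumption)
  show thesis
    by (rule that[OF F, of "coeff13 a1 a2 a3 0 0 b1 b2 a4 a5 b3 a6 a7 a8"])
      (use a1 in \<open>simp_all add: G cubic_def coeff13_def algebra_simps\<close>)
qed

text \<open>With 3 = 0 and eps = -1 the three binary cubics in y and z of the normal form become y^3
  + y z^2, y^3 and - z^3, which explains the coefficients b1 + a4, - a5, 0, b1.\<close>

lemma case_N2_cubic:
  fixes F G :: "'a::field poly4"
  assumes char3: "(3 :: 'a) = 0" and "case_N2 F G"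
  obtains g where "F = F2" "G = cubic (vy^2 + vz^2) g" "g 1 \<noteq> 0 \<or> g 2 \<noteq> 0"
proof -
  obtain a1 a2 a3 a4 a5 a6 a7 a8 a9 a10 b1 b2 where F: "F = F2" and a1: "(a1, a2) \<noteq> (0, 0)"
    and G: "G = (cst a1 * vy + cst a2 * vz) * vx^2 + cst a3 * (vy^2 - cst eps * vz^2) * vx
          + cst b1 * vy * (vy^2 - cst eps * vz^2)
          + cst a4 * vy * (vy^2 + 3 * cst eps * vz^2)
          + cst a5 * vz * (3 * vy^2 + cst eps * vz^2)
          + (cst a6 * vy^2 + cst a7 * vy * vz + cst b2 * vz^2) * vw
          + (cst a8 * vy + cst a9 * vz) * vw^2 + cst a10 * vw^3"
    using assms(2) unfolding case_N2_def by (elim conjE exE) (rule that; assumption)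
  have eps: "cst (eps :: 'a) = - 1"
    unfolding eps_def numerals_char3(1)[OF char3] cst_uminus by simp
  have "(3 :: 'a poly4) = 1 + 1 + 1" by simp
  also have "\<dots> = cst (1 + 1 + 1)" unfolding cst_add by simp
  also have "\<dots> = 0" using char3 by simp
  finally have three: "(3 :: 'a poly4) = 0" .
  have eq: "G = cubic (vy^2 + vz^2) (coeff13 a1 a2 a3 (b1 + a4) (- a5) 0 b1 a6 a7 b2 a8 a9 a10)"
    unfolding G eps three
    by (simp add: cubic_def coeff13_def cst_add cst_uminus algebra_simps power2_eq_square power3_eq_cube)
  show thesis
    by (rule that[OF F eq]) (use a1 in \<open>simp add: coeff13_def\<close>)
qed

theorem lemma7p1:
  fixes F G :: "'k::field poly4" and H :: "'k ^ 4 ^ 4"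
  assumes "CARD('k) = 3"
    and "standard_form F G"
    and "is_hasse_witt_matrix F G H"
    and "a_number H = 3"
  shows "type2_points F G H = {} \<and>
    (F = Fd \<longrightarrow> card (type1_points F G H) = 1 \<and>
       (\<forall>P\<in>type1_points F G H. has_multiplicity F G H P 6)) \<and>
    (F = F1 \<longrightarrow> card (type1_points F G H) = 2 \<and>
       (\<forall>P\<in>type1_points F G H. has_multiplicity F G H P 3 \<and> defined_over 3 P)) \<and>
    (F = F2 \<longrightarrow> card (type1_points F G H) = 2 \<and>
       (\<forall>P\<in>type1_points F G H. has_multiplicity F G H P 3 \<and> defined_over 9 P))"
proof -
  have char3: "(3 :: 'k) = 0" by (rule char3_of_card[OF assms(1)])
  note ne = quadrics_distinct[OF char3]
  have sm: "smooth_curve F G" and "case_D F G \<or> case_N1i F G \<or> case_N1ii F G \<or> case_N2 F G"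
    using assms(2) unfolding standard_form_def by blast+
  then consider (D) g where "F = Fd" "G = cubicD g" "g 0 \<noteq> 0"
    | (N1) g where "F = F1" "G = cubic (vy * vz) g" "g 1 \<noteq> 0 \<or> g 2 \<noteq> 0"
    | (N2) g where "F = F2" "G = cubic (vy^2 + vz^2) g" "g 1 \<noteq> 0 \<or> g 2 \<noteq> 0"
    by (elim disjE) (erule case_D_cubicD case_N1i_cubic case_N1ii_cubic case_N2_cubic[OF char3], blast)+
  then show ?thesis
  proof cases
    case D
    show ?thesis
      using cone_case[where g = g and H = H, OF assms(1) D(3) assms(4), folded D(1,2), OF sm assms(3)] ne D(1) by metis
  next
    case N1
    show ?thesis
      using split_case[where g = g and H = H, OF assms(1) N1(3) assms(4), folded N1(1,2), OF sm assms(3)] ne N1(1) unfolding power_one_right by metis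
  next
    case N2
    have "(3 :: nat) ^ 2 = 9" by simp
    then show ?thesis
      using nonsplit_case[where g = g and H = H, OF assms(1) N2(3) assms(4), folded N2(1,2), OF sm assms(3)] ne N2(1) by metis
  qed
qed

end
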